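(* Let $(X,(R_i))$ be one of the following association schemes, with the parameters $n$, $b$, $c$ indicated: (1) the bilinear forms scheme $\mathrm{Bil}_q(n,m)$ ($m\ge n\ge1$), with $(b,c)=(q,q^{m-n})$; (2) the Hermitian forms scheme $\mathrm{Her}_q(n)$ ($n\ge1$), with $(b,c)=(-q,-1)$; (3) the alternating bilinear forms scheme $\mathrm{Alt}_q(m)$ ($m\ge2$) with $n=\lfloor m/2\rfloor$, with $(b,c)=(q^2,1/q)$ if $m$ is even and $(b,c)=(q^2,q)$ if $m$ is odd. Then for every integer $d$ with $1\le d\le n$, where $d$ is additionally required to be odd in case (2), the optimum of the linear program for $d$-codes is \[ \mathrm{LP}(d)=(cb^n)^{n-d+1}. \] Moreover, in case (2), for every even $d$ with $2\le d\le n$, \[ \mathrm{LP}(d)=(cb^n)^{n-d+1}\,\frac{(b^{n-d+2}-1)+b^n(b^{n-d+1}-1)}{b^{n-d+2}-b^{n-d+1}}. \] Furthermore, both formulas also hold for every association scheme having the same $P$- and $Q$-numbers as $\mathrm{Bil}_q(n,m)$, $\mathrm{Her}_q(n)$, or $\mathrm{Alt}_q(m)$, respectively.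
   Context: $q$ is a prime power. An association scheme with $n$ classes is a finite set $X$ with relations $R_0,\dots,R_n$ partitioning $X\times X$, $R_0$ the identity relation, each $R_i$ symmetric, such that for $(x,y)\in R_k$ the number of $z$ with $(x,z)\in R_i$, $(z,y)\in R_j$ depends only on $i,j,k$. With $D_i$ the adjacency matrix of $R_i$, the span of $D_0,\dots,D_n$ has a unique basis of primitive idempotents $E_0=|X|^{-1}J,E_1,\dots,E_n$; the $Q$-numbers $Q_k(i)$ are defined by $E_k=|X|^{-1}\sum_i Q_k(i)D_i$, the $P$-numbers by $D_i=\sum_kP_i(k)E_k$. For $1\le d\le n$, the linear program for $d$-codes is: maximize $\sum_{i=0}^n x_i$ over $x\in\mathbb{R}^{n+1}$ subject to $x_0=1$, $x_1=\dots=x_{d-1}=0$, $x_i\ge0$ for $d\le i\le n$, and $\sum_{i}Q_k(i)x_i\ge0$ for $k=1,\dots,n$; its optimal value is $\mathrm{LP}(d)$. The schemes: $\mathrm{Bil}_q(n,m)$: $X$ is the set of $m\times n$ matrices over $\mathbb{F}_q$, $R_i=\{(A,B):\operatorname{rk}(A-B)=i\}$, $i=0,\dots,n$. $\mathrm{Her}_q(n)$: $X$ is the set of $n\times n$ matrices $A$ over $\mathbb{F}_{q^2}$ with $A^*=A$, where $A^*$ is obtained by applying $x\mapsto x^q$ entrywise and transposing; $R_i=\{(A,B):\operatorname{rk}(A-B)=i\}$, $i=0,\dots,n$. $\mathrm{Alt}_q(m)$: $X$ is the set of alternating $m\times m$ matrices over $\mathbb{F}_q$ (skew-symmetric with zero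 diagonal), $R_i=\{(A,B):\operatorname{rk}(A-B)=2i\}$, $i=0,\dots,n$ with $n=\lfloor m/2\rfloor$. *)

theory Defs
  imports "Jordan_Normal_Form.DL_Rank" "HOL-Library.Cardinality"
begin

section \<open>Symmetric association schemes\<close>

definition association_scheme :: "'x set \<Rightarrow> (nat \<Rightarrow> ('x \<times> 'x) set) \<Rightarrow> nat \<Rightarrow> bool" where
  "association_scheme X R n \<longleftrightarrow>
     finite X \<and>
     (\<Union>i\<le>n. R i) = X \<times> X \<and>
     (\<forall>i\<le>n. R i \<noteq> {}) \<and>
     (\<forall>i\<le>n. \<forall>j\<le>n. i \<noteq> j \<longrightarrow> R i \<inter> R j = {}) \<and>
     R 0 = Id_on X \<and>
     (\<forall>i\<le>n. sym (R i)) \<and>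
     (\<exists>p :: nat \<Rightarrow> nat \<Rightarrow> nat \<Rightarrow> nat. \<forall>i\<le>n. \<forall>j\<le>n. \<forall>k\<le>n. \<forall>(x, y)\<in>R k.
        card {z \<in> X. (x, z) \<in> R i \<and> (z, y) \<in> R j} = p i j k)"

text \<open>Real matrices with rows and columns indexed by \<open>X\<close> are functions \<open>'x \<Rightarrow> 'x \<Rightarrow> real\<close>
  vanishing outside \<open>X \<times> X\<close>.\<close>

definition adj :: "(nat \<Rightarrow> ('x \<times> 'x) set) \<Rightarrow> nat \<Rightarrow> 'x \<Rightarrow> 'x \<Rightarrow> real" where
  "adj R i = (\<lambda>x y. if (x, y) \<in> R i then 1 else 0)"

definition mprod :: "'x set \<Rightarrow> ('x \<Rightarrow> 'x \<Rightarrow> real) \<Rightarrow> ('x \<Rightarrow> 'x \<Rightarrow> real) \<Rightarrow> 'x \<Rightarrow> 'x \<Rightarrow> real" where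
  "mprod X A B = (\<lambda>x y. \<Sum>z\<in>X. A x z * B z y)"

definition adj_span :: "(nat \<Rightarrow> ('x \<times> 'x) set) \<Rightarrow> nat \<Rightarrow> ('x \<Rightarrow> 'x \<Rightarrow> real) set" where
  "adj_span R n = {M. \<exists>a :: nat \<Rightarrow> real. M = (\<lambda>x y. \<Sum>i\<le>n. a i * adj R i x y)}"

definition nonzero_idempotent ::
  "'x set \<Rightarrow> (nat \<Rightarrow> ('x \<times> 'x) set) \<Rightarrow> nat \<Rightarrow> ('x \<Rightarrow> 'x \<Rightarrow> real) \<Rightarrow> bool" where
  "nonzero_idempotent X R n E \<longleftrightarrow>
     E \<in> adj_span R n \<and> E \<noteq> (\<lambda>x y. 0) \<and> mprod X E E = E"

definition primitive_idempotent ::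
  "'x set \<Rightarrow> (nat \<Rightarrow> ('x \<times> 'x) set) \<Rightarrow> nat \<Rightarrow> ('x \<Rightarrow> 'x \<Rightarrow> real) \<Rightarrow> bool" where
  "primitive_idempotent X R n E \<longleftrightarrow>
     nonzero_idempotent X R n E \<and>
     \<not> (\<exists>F G. nonzero_idempotent X R n F \<and> nonzero_idempotent X R n G \<and>
          mprod X F G = (\<lambda>x y. 0) \<and> mprod X G F = (\<lambda>x y. 0) \<and>
          E = (\<lambda>x y. F x y + G x y))"

definition idempotent_basis ::
  "'x set \<Rightarrow> (nat \<Rightarrow> ('x \<times> 'x) set) \<Rightarrow> nat \<Rightarrow> (nat \<Rightarrow> 'x \<Rightarrow> 'x \<Rightarrow> real) \<Rightarrow> bool" where
  "idempotent_basis X R n E \<longleftrightarrow>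
     E 0 = (\<lambda>x y. if x \<in> X \<and> y \<in> X then 1 / real (card X) else 0) \<and>
     (\<forall>k\<le>n. primitive_idempotent X R n (E k)) \<and>
     (\<forall>M\<in>adj_span R n. \<exists>!a :: nat \<Rightarrow> real.
        (\<forall>k>n. a k = 0) \<and> M = (\<lambda>x y. \<Sum>k\<le>n. a k * E k x y))"

text \<open>The basis of primitive idempotents is unique only up to the order of \<open>E 1, \<dots>, E n\<close>.
  Hence \<open>P\<close> and \<open>Q\<close> are the \<open>P\<close>- and \<open>Q\<close>-numbers of the scheme with respect to \<^emph>\<open>some\<close>
  (common) order. We write \<open>P i k\<close> for $P_i(k)$ and \<open>Q k i\<close> for $Q_k(i)$;
  values at indices above \<open>n\<close> are irrelevant.\<close>

definition PQ_numbers ::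
  "'x set \<Rightarrow> (nat \<Rightarrow> ('x \<times> 'x) set) \<Rightarrow> nat \<Rightarrow> (nat \<Rightarrow> nat \<Rightarrow> real) \<Rightarrow> (nat \<Rightarrow> nat \<Rightarrow> real) \<Rightarrow> bool" where
  "PQ_numbers X R n P Q \<longleftrightarrow>
     (\<exists>E. idempotent_basis X R n E \<and>
        (\<forall>i\<le>n. adj R i = (\<lambda>x y. \<Sum>k\<le>n. P i k * E k x y)) \<and>
        (\<forall>k\<le>n. E k = (\<lambda>x y. 1 / real (card X) * (\<Sum>i\<le>n. Q k i * adj R i x y))))"

definition same_PQ_numbers ::
  "'x set \<Rightarrow> (nat \<Rightarrow> ('x \<times> 'x) set) \<Rightarrow> 'y set \<Rightarrow> (nat \<Rightarrow> ('y \<times> 'y) set) \<Rightarrow> nat \<Rightarrow> bool" where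
  "same_PQ_numbers X R Y S n \<longleftrightarrow> (\<exists>P Q. PQ_numbers X R n P Q \<and> PQ_numbers Y S n P Q)"

section \<open>The linear program for \<open>d\<close>-codes\<close>

definition lp_feasible :: "nat \<Rightarrow> (nat \<Rightarrow> nat \<Rightarrow> real) \<Rightarrow> nat \<Rightarrow> (nat \<Rightarrow> real) \<Rightarrow> bool" where
  "lp_feasible n Q d x \<longleftrightarrow>
     x 0 = 1 \<and>
     (\<forall>i\<in>{1..<d}. x i = 0) \<and>
     (\<forall>i\<in>{d..n}. x i \<ge> 0) \<and>
     (\<forall>k\<in>{1..n}. (\<Sum>i\<le>n. Q k i * x i) \<ge> 0)"

definition lp_optimum :: "nat \<Rightarrow> (nat \<Rightarrow> nat \<Rightarrow> real) \<Rightarrow> nat \<Rightarrow> real \<Rightarrow> bool" where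
  "lp_optimum n Q d v \<longleftrightarrow>
     (\<exists>x. lp_feasible n Q d x \<and> (\<Sum>i\<le>n. x i) = v) \<and>
     (\<forall>x. lp_feasible n Q d x \<longrightarrow> (\<Sum>i\<le>n. x i) \<le> v)"

text \<open>\<open>LP_equals X R n d v\<close> says $\mathrm{LP}(d) = v$. The program depends on the order of the
  idempotents only through a permutation of its constraints, so every order is admitted;
  the first conjunct prevents the second from holding vacuously.\<close>

definition LP_equals :: "'x set \<Rightarrow> (nat \<Rightarrow> ('x \<times> 'x) set) \<Rightarrow> nat \<Rightarrow> nat \<Rightarrow> real \<Rightarrow> bool" where
  "LP_equals X R n d v \<longleftrightarrow>
     (\<exists>P Q. PQ_numbers X R n P Q) \<and>
     (\<forall>P Q. PQ_numbers X R n P Q \<longrightarrow> lp_optimum n Q d v)"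

section \<open>The schemes\<close>

text \<open>\<open>vec_space.rank m A\<close> is the rank of a matrix \<open>A\<close> with \<open>m\<close> rows.\<close>

definition Bil :: "nat \<Rightarrow> nat \<Rightarrow> 'f::{field,finite} mat set" where
  "Bil n m = carrier_mat m n"

definition Bil_rel :: "nat \<Rightarrow> nat \<Rightarrow> nat \<Rightarrow> ('f::{field,finite} mat \<times> 'f mat) set" where
  "Bil_rel n m i = {(A, B). A \<in> Bil n m \<and> B \<in> Bil n m \<and> vec_space.rank m (A - B) = i}"

text \<open>For the Hermitian scheme the field has \<open>q\<^sup>2\<close> elements.\<close>

definition conj_transpose :: "nat \<Rightarrow> 'h::{field,finite} mat \<Rightarrow> 'h mat" where
  "conj_transpose q A = transpose_mat (map_mat (\<lambda>x. x ^ q) A)"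

definition Her :: "nat \<Rightarrow> nat \<Rightarrow> 'h::{field,finite} mat set" where
  "Her q n = {A \<in> carrier_mat n n. conj_transpose q A = A}"

definition Her_rel :: "nat \<Rightarrow> nat \<Rightarrow> nat \<Rightarrow> ('h::{field,finite} mat \<times> 'h mat) set" where
  "Her_rel q n i = {(A, B). A \<in> Her q n \<and> B \<in> Her q n \<and> vec_space.rank n (A - B) = i}"

definition Alt :: "nat \<Rightarrow> 'f::{field,finite} mat set" where
  "Alt m = {A \<in> carrier_mat m m. transpose_mat A = - A \<and> (\<forall>i<m. A $$ (i, i) = 0)}"

definition Alt_rel :: "nat \<Rightarrow> nat \<Rightarrow> ('f::{field,finite} mat \<times> 'f mat) set" where
  "Alt_rel m i = {(A, B). A \<in> Alt m \<and> B \<in> Alt m \<and> vec_space.rank m (A - B) = 2 * i}"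

section \<open>The claimed optima\<close>

definition lp_val :: "real \<Rightarrow> real \<Rightarrow> nat \<Rightarrow> nat \<Rightarrow> real" where
  "lp_val b c n d = (c * b ^ n) ^ (n - d + 1)"

definition lp_val_even :: "real \<Rightarrow> real \<Rightarrow> nat \<Rightarrow> nat \<Rightarrow> real" where
  "lp_val_even b c n d =
     (c * b ^ n) ^ (n - d + 1) *
     (((b ^ (n - d + 2) - 1) + b ^ n * (b ^ (n - d + 1) - 1)) / (b ^ (n - d + 2) - b ^ (n - d + 1)))"

end

theory Submission
  imports Defs "HOL-Number_Theory.Cong" "HOL-Computational_Algebra.Polynomial" "HOL-Combinatorics.Permutations"
    "Jordan_Normal_Form.Gauss_Jordan_Elimination"
begin

text \<open>With Gaussian binomials \<open>gbin b n k\<close> to the base \<open>b\<close>, the $Q$-numbers of each of the schemes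
  satisfy the moment identities
  \<open>(\<Sum>k\<le>j. gbin b (n - k) (n - j) * Q k i) = gbin b (n - i) j * (c * b ^ n) ^ j\<close>.
  They solve the linear program: if \<open>x\<close> is feasible and \<open>a\<close> denotes the vector of the constraint
  sums \<open>a k = (\<Sum>i\<le>n. Q k i * x i)\<close>, then the moments of \<open>a\<close> with \<open>j > n - d\<close> involve only
  \<open>x 0 = 1\<close>, and \<open>j = n - d + 1\<close> bounds \<open>a 0\<close>, the objective; for even \<open>d\<close> and negative \<open>b\<close> one
  combines \<open>j = n - d + 1\<close> and \<open>j = n - d + 2\<close>. Equality prescribes \<open>x\<close> and \<open>a\<close> through triangular
  systems, and their solutions are nonnegative because alternating sums of Gaussian binomials are.

  The identities follow by induction on \<open>n\<close>. The group of forms is self-dual, so \<open>Q k i\<close> is the sum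
  of a character at a form of rank \<open>i\<close> over the forms of rank \<open>k\<close>. The form can be brought to block
  diagonal shape with a nonzero last block. Writing the forms of rank \<open>k\<close> as bordered Schur
  complements and summing over the border yields a Gauss sum, and a recursion for \<open>Q k i\<close>
  in \<open>n\<close> and \<open>i\<close>.\<close>

section \<open>Gaussian binomial coefficients\<close>

text \<open>The recursion obtained by bordering determines the eigenvalues only relative to their
  values at the zero form, that is, relative to the numbers of forms of each rank. These numbers are
  not counted separately: symmetry of the pairing relates those of rank \<open>k\<close> to those of
  rank 1, which makes them proportional to \<open>rank_count\<close>, and the known total fixes the
  factor. Bordered forms whose corner vanishes have no Schur complement. They drop out because only
  the difference of two character sums is evaluated: at a form with nonzero last block and at the
  same form with that block deleted. For base \<open>- q\<close> the terms of the Gaussian sums need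
  not alternate in sign, so nonnegativity comes from domination by the first term. The margins are
  narrow for \<open>q = 2\<close> and small \<open>n\<close>, whence the explicit constants. For
  even \<open>d\<close> and base \<open>- q\<close> a single moment has coefficients of both signs.
  Making two moments tight needs a second free parameter in the optimal solution, the dual
  coordinate \<open>a 1\<close>; it is exactly the coordinate whose coefficient vanishes in the
  combined bound.\<close>

definition gfac :: "real \<Rightarrow> nat \<Rightarrow> real" where
  "gfac b n = (\<Prod>i=1..n. b ^ i - 1)"

text \<open>A quotient of reals, so that negative bases are allowed. The cutoff is explicit because
  truncated subtraction would give the quotient a nonzero value for \<open>k > n\<close>.\<close>

definition gbin :: "real \<Rightarrow> nat \<Rightarrow> nat \<Rightarrow> real" where
  "gbin b n k = (if k \<le> n then gfac b n / (gfac b k * gfac b (n - k)) else 0)"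

lemma gfac_0 [simp]: "gfac b 0 = 1"
  by (simp add: gfac_def)

lemma gfac_Suc [simp]: "gfac b (Suc n) = (b ^ Suc n - 1) * gfac b n"
  by (simp add: gfac_def)

lemma gbin_eq_0 [simp]: "n < k \<Longrightarrow> gbin b n k = 0"
  by (simp add: gbin_def)

text \<open>Exactly what keeps every \<open>gfac b n\<close> nonzero; it covers the bases
  \<open>q\<close>, \<open>q ^ 2\<close> and \<open>- q\<close> alike.\<close>

locale gauss_base =
  fixes b :: real
  assumes pow_ne_1: "0 < i \<Longrightarrow> b ^ i \<noteq> 1"
begin

lemma Suc_pow_ne_1 [simp]: "b * b ^ i \<noteq> 1"
  using pow_ne_1[of "Suc i"] by simp

lemma gfac_ne_0 [simp]: "gfac b n \<noteq> 0"
  by (induction n) auto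

lemma gbin_0 [simp]: "gbin b n 0 = 1"
  by (simp add: gbin_def)

lemma gbin_self [simp]: "gbin b n n = 1"
  by (simp add: gbin_def)

lemma gbin_sym: "k \<le> n \<Longrightarrow> gbin b n (n - k) = gbin b n k"
  by (simp add: gbin_def mult.commute)

lemma gbin_ne_0: "k \<le> n \<Longrightarrow> gbin b n k \<noteq> 0"
  by (simp add: gbin_def)

lemma gbin_absorb: "(b ^ Suc k - 1) * gbin b (Suc n) (Suc k) = (b ^ Suc n - 1) * gbin b n k"
  using Suc_pow_ne_1[of k] by (auto simp: gbin_def field_simps)

lemma gbin_absorb': "k \<le> n \<Longrightarrow> (b ^ Suc k - 1) * gbin b n (Suc k) = (b ^ (n - k) - 1) * gbin b n k"
proof (cases "k = n")
  case False
  assume "k \<le> n"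
  with False have "n - k = Suc (n - Suc k)" by simp
  then show ?thesis
    using False \<open>k \<le> n\<close> Suc_pow_ne_1[of k] Suc_pow_ne_1[of "n - Suc k"]
    by (auto simp: gbin_def field_simps)
qed simp

lemma gbin_Suc_Suc: "gbin b (Suc n) (Suc k) = gbin b n k + b ^ Suc k * gbin b n (Suc k)"
proof (cases "k \<le> n")
  case True
  have "(b ^ Suc k - 1) * gbin b (Suc n) (Suc k) =
      (b ^ Suc k - 1) * (gbin b n k + b ^ Suc k * gbin b n (Suc k))"
  proof -
    have "(b ^ Suc k - 1) * (gbin b n k + b ^ Suc k * gbin b n (Suc k)) =
       (b ^ Suc k - 1) * gbin b n k + b ^ Suc k * ((b ^ Suc k - 1) * gbin b n (Suc k))"
      by (simp add: algebra_simps)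
    also have "\<dots> = ((b ^ Suc k - 1) + b ^ Suc k * (b ^ (n - k) - 1)) * gbin b n k"
      unfolding gbin_absorb'[OF True] by (simp add: algebra_simps)
    also have "(b ^ Suc k - 1) + b ^ Suc k * (b ^ (n - k) - 1) = b ^ Suc n - 1"
      using True by (simp add: algebra_simps flip: power_add)
    finally show ?thesis unfolding gbin_absorb by simp
  qed
  then show ?thesis using pow_ne_1[of "Suc k"] by simp
qed simp

text \<open>The partial sums telescope by the Pascal rule \<open>gbin_Suc_Suc\<close>. The complete
  alternating sum is the case \<open>R = Suc N\<close>, where \<open>gbin b N R\<close>
  vanishes.\<close>

lemma gbin_partial_alternating_sum:
  "(\<Sum>r\<le>R. (- 1) ^ r * b ^ (r choose 2) * gbin b (Suc N) r) =
     (- 1) ^ R * b ^ (Suc R choose 2) * gbin b N R"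
proof (induction R)
  case 0
  show ?case by (simp add: binomial_eq_0)
next
  case (Suc R)
  have "Suc (Suc R) choose 2 = Suc R + (Suc R choose 2)"
    by (simp add: numeral_2_eq_2)
  with Suc show ?case unfolding sum.atMost_Suc gbin_Suc_Suc
    by (simp add: algebra_simps power_add)
qed

lemma gbin_alternating_sum:
  "(\<Sum>r\<le>N. (- 1) ^ r * b ^ (r choose 2) * gbin b N r) = (if N = 0 then 1 else 0)"
proof (cases N)
  case (Suc M)
  show ?thesis using gbin_partial_alternating_sum[of M "Suc M"] Suc by simp
qed (simp add: binomial_eq_0)

text \<open>For a prime power \<open>b\<close> and \<open>x = b ^ m\<close> this sorts the
  \<open>m\<close> by \<open>j\<close> matrices by rank. The choice \<open>x = c * b ^ n\<close>
  yields both the total number of forms (\<open>sum_rank_count\<close>) and the moments at rank 0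
  (\<open>eig_moments\<close>).\<close>

lemma gbin_vandermonde:
  "(\<Sum>k\<le>j. gbin b j k * (\<Prod>s<k. x - b ^ s)) = x ^ j"
proof (induction j)
  case (Suc j)
  let ?p = "\<lambda>k. \<Prod>s<k. x - b ^ s"
  have "(\<Sum>k\<le>Suc j. gbin b (Suc j) k * ?p k) =
     1 + (\<Sum>k\<le>j. gbin b (Suc j) (Suc k) * ?p (Suc k))"
    by (subst sum.atMost_Suc_shift) simp
  also have "(\<Sum>k\<le>j. gbin b (Suc j) (Suc k) * ?p (Suc k)) =
     (\<Sum>k\<le>j. gbin b j k * ?p k * (x - b ^ k)) + (\<Sum>k\<le>j. b ^ Suc k * gbin b j (Suc k) * ?p (Suc k))"
    unfolding gbin_Suc_Suc sum.distrib[symmetric] by (rule sum.cong) (auto simp: algebra_simps)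
  also have "1 + (\<dots>) = (\<Sum>k\<le>j. gbin b j k * ?p k * (x - b ^ k)) + (\<Sum>k\<le>Suc j. b ^ k * gbin b j k * ?p k)"
    unfolding sum.atMost_Suc_shift[of "\<lambda>k. b ^ k * gbin b j k * ?p k" j] by simp
  also have "\<dots> = (\<Sum>k\<le>j. gbin b j k * ?p k * (x - b ^ k)) + (\<Sum>k\<le>j. b ^ k * gbin b j k * ?p k)"
    by simp
  also have "\<dots> = x * (\<Sum>k\<le>j. gbin b j k * ?p k)"
    unfolding sum.distrib[symmetric] sum_distrib_left by (rule sum.cong) (auto simp: algebra_simps)
  finally show ?case using Suc by simp
qed simp

lemma gbin_inversion:
  assumes j: "d \<le> j" "j \<le> n"
  shows "(\<Sum>i=d..j. gbin b (n - i) (n - j) *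
      (gbin b n i * (\<Sum>r\<le>i - d. (- 1) ^ r * b ^ (r choose 2) * gbin b i r * \<psi> (i - r)))) =
    gbin b n j * \<psi> j"
proof -
  let ?c = "\<lambda>r. (- 1) ^ r * b ^ (r choose 2)"
  have inner: "(\<Sum>r\<le>i - d. ?c r * gbin b i r * \<psi> (i - r)) =
      (\<Sum>t=d..i. ?c (i - t) * gbin b i t * \<psi> t)" if "d \<le> i" for i
  proof (rule sum.reindex_bij_witness[where i = "\<lambda>t. i - t" and j = "\<lambda>r. i - r"])
    fix r assume "r \<in> {..i - d}"
    then show "?c (i - (i - r)) * gbin b i (i - r) * \<psi> (i - r) = ?c r * gbin b i r * \<psi> (i - r)"
      using gbin_sym[of r i] by simp
  qed (use that in auto)
  \<comment> \<open>Trinomial revision: both sides are the Gaussian multinomial with parts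
    \<open>n - j\<close>, \<open>j - i\<close>, \<open>i - t\<close> and \<open>t\<close>.\<close>
  have rev: "gbin b (n - i) (n - j) * (gbin b n i * gbin b i t) =
       gbin b n t * gbin b (n - t) (j - t) * gbin b (j - t) (i - t)"
    if "t \<le> i" "i \<le> j" for i t
  proof -
    have "i - t \<le> j - t" "j - t \<le> n - t" "n - j \<le> n - i" "j - i = j - t - (i - t)"
      "n - i - (n - j) = j - i" "n - t - (j - t) = n - j"
      using that j by auto
    then show ?thesis using that j by (simp add: gbin_def field_simps)
  qed
  have "(\<Sum>i=d..j. gbin b (n - i) (n - j) *
      (gbin b n i * (\<Sum>r\<le>i - d. ?c r * gbin b i r * \<psi> (i - r)))) =
      (\<Sum>i=d..j. \<Sum>t=d..i. ?c (i - t) * (gbin b (n - i) (n - j) * (gbin b n i * gbin b i t)) * \<psi> t)"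
  proof (rule sum.cong)
    fix i assume "i \<in> {d..j}"
    then have "d \<le> i" by simp
    show "gbin b (n - i) (n - j) * (gbin b n i * (\<Sum>r\<le>i - d. ?c r * gbin b i r * \<psi> (i - r))) =
      (\<Sum>t=d..i. ?c (i - t) * (gbin b (n - i) (n - j) * (gbin b n i * gbin b i t)) * \<psi> t)"
      unfolding inner[OF \<open>d \<le> i\<close>] sum_distrib_left by (simp add: mult.assoc mult.left_commute)
  qed simp
  also have "\<dots> = (\<Sum>i=d..j. \<Sum>t=d..i. gbin b n t * gbin b (n - t) (j - t) * \<psi> t *
       (?c (i - t) * gbin b (j - t) (i - t)))"
  proof (intro sum.cong refl)
    fix i t assume "i \<in> {d..j}" "t \<in> {d..i}"
    then show "?c (i - t) * (gbin b (n - i) (n - j) * (gbin b n i * gbin b i t)) * \<psi> t =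
      gbin b n t * gbin b (n - t) (j - t) * \<psi> t * (?c (i - t) * gbin b (j - t) (i - t))"
      by (subst rev) auto
  qed
  \<comment> \<open>With \<open>t\<close> outermost, the sum over \<open>i\<close> becomes a
    complete alternating sum over \<open>r = i - t\<close>, which vanishes unless
    \<open>t = j\<close>.\<close>
  also have "\<dots> = (\<Sum>t=d..j. \<Sum>i=t..j. gbin b n t * gbin b (n - t) (j - t) * \<psi> t *
       (?c (i - t) * gbin b (j - t) (i - t)))"
    unfolding sum.Sigma[OF finite_atLeastAtMost ballI[OF finite_atLeastAtMost]]
    by (rule sum.reindex_bij_witness[where i = "\<lambda>(a, b). (b, a)" and j = "\<lambda>(a, b). (b, a)"]) auto
  also have "\<dots> = (\<Sum>t=d..j. gbin b n t * gbin b (n - t) (j - t) * \<psi> t *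
       (\<Sum>r\<le>j - t. ?c r * gbin b (j - t) r))"
  proof (rule sum.cong)
    fix t assume t: "t \<in> {d..j}"
    have "(\<Sum>i=t..j. ?c (i - t) * gbin b (j - t) (i - t)) = (\<Sum>r\<le>j - t. ?c r * gbin b (j - t) r)"
      by (rule sum.reindex_bij_witness[where i = "\<lambda>r. r + t" and j = "\<lambda>i. i - t"]) (use t in auto)
    then show "(\<Sum>i=t..j. gbin b n t * gbin b (n - t) (j - t) * \<psi> t *
       (?c (i - t) * gbin b (j - t) (i - t))) = gbin b n t * gbin b (n - t) (j - t) * \<psi> t *
       (\<Sum>r\<le>j - t. ?c r * gbin b (j - t) r)"
      by (simp flip: sum_distrib_left)
  qed simp
  also have "\<dots> = (\<Sum>t=d..j. if t = j then gbin b n j * \<psi> j else 0)"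
    unfolding gbin_alternating_sum by (rule sum.cong) auto
  also have "\<dots> = gbin b n j * \<psi> j" using j by simp
  finally show ?thesis .
qed

text \<open>Equation \<open>j\<close> has coefficient 1 at \<open>x j\<close> and otherwise involves
  smaller indices only.\<close>

lemma gbin_triangular_unique:
  assumes low: "\<And>i. i < d \<Longrightarrow> x i = y i"
    and eq: "\<And>j. d \<le> j \<Longrightarrow> j \<le> n \<Longrightarrow>
      (\<Sum>i\<le>j. gbin b (n - i) (n - j) * x i) = (\<Sum>i\<le>j. gbin b (n - i) (n - j) * y i)"
  shows "i \<le> n \<Longrightarrow> x i = y i"
proof (induction i rule: less_induct)
  case (less i)
  show ?case
  proof (cases "i < d")
    case False
    have "(\<Sum>k<i. gbin b (n - k) (n - i) * x k) = (\<Sum>k<i. gbin b (n - k) (n - i) * y k)"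
      using less by (intro sum.cong) auto
    then show ?thesis using eq[of i] False less.prems by (simp flip: lessThan_Suc_atMost)
  qed (use low in auto)
qed

end

section \<open>The linear program in dual coordinates\<close>

text \<open>By Gaussian inversion, \<open>x i = inv_sol b n d \<psi> i\<close> solves the triangular system
  \<open>\<Sum>i=d..j. gbin b (n - i) (n - j) * x i = gbin b n j * \<psi> j\<close> for \<open>d \<le> j \<le> n\<close>.\<close>

definition inv_sol :: "real \<Rightarrow> nat \<Rightarrow> nat \<Rightarrow> (nat \<Rightarrow> real) \<Rightarrow> nat \<Rightarrow> real" where
  "inv_sol b n d \<psi> i =
     gbin b n i * (\<Sum>r\<le>i - d. (- 1) ^ r * b ^ (r choose 2) * gbin b i r * \<psi> (i - r))"

lemma inv_sol_cong:
  assumes "d \<le> i" "\<And>l. d \<le> l \<Longrightarrow> l \<le> i \<Longrightarrow> \<psi> l = \<phi> l"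
  shows "inv_sol b n d \<psi> i = inv_sol b n d \<phi> i"
  unfolding inv_sol_def using assms by (intro arg_cong2[where f = "(*)"] sum.cong) auto

lemma inv_sol_scale: "inv_sol b n d (\<lambda>l. a * \<psi> l) i = a * inv_sol b n d \<psi> i"
  unfolding inv_sol_def by (simp add: sum_distrib_left mult.assoc mult.left_commute)

text \<open>The program sees a scheme only through the moment identities, so the families differ
  here only in \<open>b\<close> and \<open>c\<close>. Division by powers of \<open>v\<close> in
  \<open>lp_attained\<close> rests on \<open>cb_ne_0\<close>.\<close>

locale code_lp = gauss_base b for b :: real +
  fixes c :: real and n :: nat and Q :: "nat \<Rightarrow> nat \<Rightarrow> real"
  assumes n_pos: "1 \<le> n"
    and cb_ne_0: "c * b ^ n \<noteq> 0"
    and Q_moments: "\<And>i j. i \<le> n \<Longrightarrow> j \<le> n \<Longrightarrow>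
      (\<Sum>k\<le>j. gbin b (n - k) (n - j) * Q k i) = gbin b (n - i) j * (c * b ^ n) ^ j"
begin

abbreviation "v \<equiv> c * b ^ n"

abbreviation dual :: "(nat \<Rightarrow> real) \<Rightarrow> nat \<Rightarrow> real" where
  "dual x k \<equiv> (\<Sum>i\<le>n. Q k i * x i)"

lemma Q_0: "i \<le> n \<Longrightarrow> Q 0 i = 1"
  using Q_moments[of i 0] by simp

lemma dual_0: "dual x 0 = (\<Sum>i\<le>n. x i)"
  by (simp add: Q_0)

text \<open>A MacWilliams-type identity: the right-hand sum is moment \<open>n - j\<close> of
  \<open>x\<close>.\<close>

lemma dual_moments:
  assumes "j \<le> n"
  shows "(\<Sum>k\<le>j. gbin b (n - k) (n - j) * dual x k) = v ^ j * (\<Sum>i\<le>n. gbin b (n - i) j * x i)"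
proof -
  have "(\<Sum>k\<le>j. gbin b (n - k) (n - j) * dual x k) =
     (\<Sum>i\<le>n. (\<Sum>k\<le>j. gbin b (n - k) (n - j) * Q k i) * x i)"
    unfolding sum_distrib_left sum_distrib_right
    by (subst sum.swap) (simp add: mult.assoc)
  then show ?thesis using assms
    by (simp add: Q_moments sum_distrib_left mult.assoc mult.left_commute)
qed

text \<open>Feasibility annihilates \<open>x i\<close> for \<open>1 \<le> i < d\<close>, and
  \<open>n < j + d\<close> annihilates \<open>gbin b (n - i) j\<close> for
  \<open>d \<le> i\<close>.\<close>

lemma feasible_moments:
  assumes "lp_feasible n Q d x" "d \<le> n" "n < j + d" "j \<le> n"
  shows "(\<Sum>k\<le>j. gbin b (n - k) (n - j) * dual x k) = v ^ j * gbin b n j"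
proof -
  have "(\<Sum>i\<le>n. gbin b (n - i) j * x i) = (\<Sum>i\<le>n. if i = 0 then gbin b n j else 0)"
  proof (rule sum.cong)
    fix i assume "i \<in> {..n}"
    show "gbin b (n - i) j * x i = (if i = 0 then gbin b n j else 0)"
    proof (cases "i = 0 \<or> d \<le> i")
      case True
      then show ?thesis using assms by (auto simp: lp_feasible_def)
    next
      case False
      then have "i \<in> {1..<d}" by auto
      then show ?thesis using assms(1) by (auto simp: lp_feasible_def)
    qed
  qed simp
  then show ?thesis by (simp add: dual_moments[OF assms(4)])
qed

text \<open>Hypothesis \<open>pos\<close> is where parity enters: for \<open>b = - q\<close> the
  sign of a nonzero coefficient is governed by \<open>(d - 1) * (n - k - (d - 1))\<close>, which is
  even for odd \<open>d\<close>.\<close>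

lemma lp_bound:
  assumes x: "lp_feasible n Q d x" and d: "1 \<le> d" "d \<le> n"
    and pos: "\<And>k. k \<le> n - d + 1 \<Longrightarrow> 0 \<le> gbin b (n - k) (d - 1)"
  shows "(\<Sum>i\<le>n. x i) \<le> v ^ (n - d + 1)"
proof -
  let ?j = "n - d + 1"
  have nj: "n - ?j = d - 1" using d by simp
  have "(\<Sum>k\<le>?j. gbin b (n - k) (d - 1) * dual x k) = v ^ ?j * gbin b n ?j"
    using feasible_moments[OF x, of ?j] d unfolding nj by simp
  also have "gbin b n ?j = gbin b n (d - 1)"
    using gbin_sym[of "d - 1" n] d by (simp add: Suc_diff_le)
  finally have eq: "(\<Sum>k\<le>?j. gbin b (n - k) (d - 1) * dual x k) = v ^ ?j * gbin b n (d - 1)" .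
  have "gbin b (n - 0) (d - 1) * dual x 0 \<le> (\<Sum>k\<le>?j. gbin b (n - k) (d - 1) * dual x k)"
  proof (rule member_le_sum)
    fix k assume k: "k \<in> {..?j} - {0}"
    then have "k \<in> {1..n}" using d by auto
    then show "0 \<le> gbin b (n - k) (d - 1) * dual x k"
      using pos[of k] k x by (auto simp: lp_feasible_def)
  qed auto
  moreover have "0 < gbin b n (d - 1)"
    using pos[of 0] gbin_ne_0[of "d - 1" n] le_trans[OF diff_le_self d(2)]
    by (simp add: less_le)
  ultimately show ?thesis unfolding eq dual_0 by (simp add: mult.commute)
qed

text \<open>Intended for \<open>b = - q\<close> and even \<open>d\<close>, where the moment used in
  \<open>lp_bound\<close> has coefficients of both signs. The moments \<open>s\<close> and
  \<open>s - 1\<close> are combined with weights that make the coefficient of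
  \<open>dual x 1\<close> vanish, since \<open>b ^ (s - 1) - b ^ (s - k)\<close> is zero at
  \<open>k = 1\<close>; the others then share the sign \<open>(- 1) ^ (s - 1)\<close>.\<close>

lemma lp_bound_even:
  assumes x: "lp_feasible n Q d x" and d: "2 \<le> d" "d \<le> n"
    and s: "s = n - d + 2"
    and pos: "\<And>k. k \<le> s \<Longrightarrow> 0 \<le> (- 1) ^ (s - 1) * gbin b (n - k) (d - 2) * (b ^ (s - 1) - b ^ (s - k)) \<or> k = 1"
    and b: "b \<noteq> 0"
  shows "(\<Sum>i\<le>n. x i) \<le> v ^ (s - 1) * (((b ^ s - 1) - v * (b ^ (s - 1) - 1)) / (b ^ s - b ^ (s - 1)))"
proof -
  let ?g = "\<lambda>k. gbin b (n - k) (d - 2) * (b ^ (s - 1) - b ^ (s - k))"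
  have s1: "s = Suc (s - 1)" "s \<le> n" "n - s = d - 2" "n - (s - 1) = d - 1" "d - 1 = Suc (d - 2)" using d s by auto
  have m1: "(\<Sum>k\<le>s. gbin b (n - k) (d - 2) * dual x k) = v ^ s * gbin b n (d - 2)"
  proof -
    have "n - (d - 2) = s" using d s by simp
    then have "gbin b n s = gbin b n (d - 2)" using gbin_sym[of "d - 2" n] d by simp
    then show ?thesis using feasible_moments[OF x d(2), of s] s1(2) d s unfolding s1(3) by simp
  qed
  have gn: "gbin b n (n - (d - 1)) = gbin b n (s - 1)" using s1 s d by (intro arg_cong[where f = "gbin b n"]) simp
  have "(\<Sum>k\<le>s - 1. gbin b (n - k) (d - 1) * dual x k) = v ^ (s - 1) * gbin b n (d - 1)"
    using feasible_moments[OF x, of "s - 1"] d s s1(4) gbin_sym[of "d - 1" n] gn by simp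
  moreover have "gbin b (n - s) (d - 1) = 0" using s1 d by simp
  ultimately have m2: "(\<Sum>k\<le>s. gbin b (n - k) (d - 1) * dual x k) = v ^ (s - 1) * gbin b n (d - 1)"
    using sum.atMost_Suc[of "\<lambda>k. gbin b (n - k) (d - 1) * dual x k" "s - 1"] s1(1,3) by simp
  \<comment> \<open>Absorption expresses \<open>gbin b (n - k) (d - 1)\<close> through
    \<open>gbin b (n - k) (d - 2)\<close>, so that the two moments get a common factor.\<close>
  have coef: "(b ^ (s - 1) - 1) * gbin b (n - k) (d - 2) - (b ^ (d - 1) - 1) * gbin b (n - k) (d - 1) = ?g k"
    if "k \<le> s" for k
  proof -
    have "(b ^ Suc (d - 2) - 1) * gbin b (n - k) (Suc (d - 2)) = (b ^ (n - k - (d - 2)) - 1) * gbin b (n - k) (d - 2)"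
      by (rule gbin_absorb') (use that d s in auto)
    moreover have "n - k - (d - 2) = s - k" using that d s by auto
    ultimately show ?thesis unfolding s1(5) by (simp add: algebra_simps)
  qed
  have "(\<Sum>k\<le>s. ?g k * dual x k) =
     (\<Sum>k\<le>s. (b ^ (s - 1) - 1) * (gbin b (n - k) (d - 2) * dual x k) -
        (b ^ (d - 1) - 1) * (gbin b (n - k) (d - 1) * dual x k))"
  proof (rule sum.cong)
    fix k assume "k \<in> {..s}"
    then have "k \<le> s" by simp
    show "?g k * dual x k = (b ^ (s - 1) - 1) * (gbin b (n - k) (d - 2) * dual x k) -
        (b ^ (d - 1) - 1) * (gbin b (n - k) (d - 1) * dual x k)"
      unfolding coef[OF \<open>k \<le> s\<close>, symmetric] by (simp only: left_diff_distrib mult.assoc)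
  qed simp
  also have "\<dots> = (b ^ (s - 1) - 1) * (v ^ s * gbin b n (d - 2)) - v ^ (s - 1) * ((b ^ (d - 1) - 1) * gbin b n (d - 1))"
    unfolding sum_subtractf sum_distrib_left[symmetric] m1 m2 by simp
  also have "(b ^ (d - 1) - 1) * gbin b n (d - 1) = (b ^ s - 1) * gbin b n (d - 2)"
    using coef[of 0] by (simp add: algebra_simps)
  also have "(b ^ (s - 1) - 1) * (v ^ s * gbin b n (d - 2)) - v ^ (s - 1) * ((b ^ s - 1) * gbin b n (d - 2)) =
     gbin b n (d - 2) * (v ^ (s - 1) * (v * (b ^ (s - 1) - 1) - (b ^ s - 1)))"
  proof -
    have "v ^ s = v * v ^ (s - 1)" using power_Suc[of v "s - 1"] s1(1) by simp
    moreover have "(B - 1) * (V * P * g) - P * ((B' - 1) * g) = g * (P * (V * (B - 1) - (B' - 1)))"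
      for B B' V P g :: real by (simp add: algebra_simps)
    ultimately show ?thesis by simp
  qed
  finally have eq: "(\<Sum>k\<le>s. ?g k * dual x k) =
     gbin b n (d - 2) * (v ^ (s - 1) * (v * (b ^ (s - 1) - 1) - (b ^ s - 1)))" .
  let ?e = "(- 1) ^ (s - 1) :: real"
  have "?e * (?g 0 * dual x 0) \<le> (\<Sum>k\<le>s. ?e * (?g k * dual x k))"
  proof (rule member_le_sum)
    fix k assume k: "k \<in> {..s} - {0}"
    then have "k \<in> {1..n}" using s1 by auto
    then have "0 \<le> dual x k" using x by (auto simp: lp_feasible_def)
    moreover have "0 \<le> ?e * ?g k" using pos[of k] k by auto
    ultimately have "0 \<le> (?e * ?g k) * dual x k" by (rule mult_nonneg_nonneg[rotated])
    then show "0 \<le> ?e * (?g k * dual x k)" by (simp add: mult.assoc)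
  qed auto
  also have "\<dots> = ?e * gbin b n (d - 2) * (v ^ (s - 1) * (v * (b ^ (s - 1) - 1) - (b ^ s - 1)))"
    unfolding sum_distrib_left[symmetric] eq by simp
  finally have ineq: "?e * gbin b n (d - 2) * (b ^ (s - 1) - b ^ s) * dual x 0 \<le>
     ?e * gbin b n (d - 2) * (v ^ (s - 1) * (v * (b ^ (s - 1) - 1) - (b ^ s - 1)))"
    by (simp add: mult.assoc)
  have "b ^ s - b ^ (s - 1) = b ^ (s - 1) * (b - 1)"
    using power_Suc[of b "s - 1"] s1(1) by (simp add: algebra_simps)
  then have ne: "b ^ s - b ^ (s - 1) \<noteq> 0" using b pow_ne_1[of 1] by simp
  have P: "0 < ?e * gbin b n (d - 2) * (b ^ (s - 1) - b ^ s)"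
    using pos[of 0] ne gbin_ne_0[of "d - 2" n] d by (simp add: less_le mult.assoc)
  have "dual x 0 \<le> v ^ (s - 1) * (v * (b ^ (s - 1) - 1) - (b ^ s - 1)) / (b ^ (s - 1) - b ^ s)"
  proof -
    have "A \<le> R / D" if "0 < E * D" "E * D * A \<le> E * R" for A R D E :: real
    proof -
      have "D \<noteq> 0" using that by auto
      then have "E * D * A \<le> E * D * (R / D)" using that by simp
      then show ?thesis using that(1) by (simp only: mult_le_cancel_left_pos)
    qed
    from this[OF P ineq] show ?thesis .
  qed
  also have "\<dots> = v ^ (s - 1) * (((b ^ s - 1) - v * (b ^ (s - 1) - 1)) / (b ^ s - b ^ (s - 1)))"
  proof -
    have "p * (x - y) / (w - u) = p * ((y - x) / (u - w))" for p x y u w :: real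
      by (metis minus_diff_eq minus_divide_divide times_divide_eq_right)
    then show ?thesis .
  qed
  finally show ?thesis unfolding dual_0 .
qed

text \<open>The factor \<open>b ^ n - 1\<close> at index 1 is chosen so that absorption turns
  \<open>(b ^ n - 1) * gbin b (n - 1) (j - 1)\<close> into \<open>(b ^ j - 1) * gbin b n j\<close>.
  The two leading entries then contribute a multiple of \<open>gbin b n j\<close>, just as the tail
  does.\<close>

lemma shaped_moments:
  assumes "j \<le> n"
  shows "(\<Sum>i\<le>j. gbin b (n - i) (n - j) *
      ((if i = 0 then N else if i = 1 then (b ^ n - 1) * M else 0) + (if d \<le> i then inv_sol b n d \<psi> i else 0))) =
    gbin b n j * (N + (b ^ j - 1) * M + (if d \<le> j then \<psi> j else 0))"
proof -
  have head: "(\<Sum>i\<le>j. gbin b (n - i) (n - j) * (if i = 0 then N else if i = 1 then (b ^ n - 1) * M else 0)) =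
      gbin b n j * (N + (b ^ j - 1) * M)"
  proof (cases j)
    case (Suc m)
    have "(\<Sum>i\<le>Suc m. gbin b (n - i) (n - j) * (if i = 0 then N else if i = 1 then (b ^ n - 1) * M else 0)) =
       gbin b n (n - j) * N + (\<Sum>i\<le>m. gbin b (n - Suc i) (n - j) * (if i = 0 then (b ^ n - 1) * M else 0))"
      by (subst sum.atMost_Suc_shift) (simp cong: if_cong)
    also have "(\<Sum>i\<le>m. gbin b (n - Suc i) (n - j) * (if i = 0 then (b ^ n - 1) * M else 0)) =
       (\<Sum>i\<le>m. if i = 0 then gbin b (n - 1) (n - j) * ((b ^ n - 1) * M) else 0)"
      by (rule sum.cong) auto
    also have "\<dots> = (b ^ n - 1) * gbin b (n - 1) (n - j) * M" by simp
    also have "gbin b (n - 1) (n - j) = gbin b (n - 1) (j - 1)"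
      using gbin_sym[of "j - 1" "n - 1"] Suc assms by simp
    also have "(b ^ n - 1) * gbin b (n - 1) (j - 1) = (b ^ j - 1) * gbin b n j"
      using gbin_absorb[of "j - 1" "n - 1"] Suc assms n_pos by simp
    also have "gbin b n (n - j) = gbin b n j" using gbin_sym assms by simp
    finally show ?thesis using Suc by (simp add: algebra_simps)
  qed simp
  have tail: "(\<Sum>i\<le>j. gbin b (n - i) (n - j) * (if d \<le> i then inv_sol b n d \<psi> i else 0)) =
     gbin b n j * (if d \<le> j then \<psi> j else 0)"
  proof (cases "d \<le> j")
    case True
    have "(\<Sum>i\<le>j. gbin b (n - i) (n - j) * (if d \<le> i then inv_sol b n d \<psi> i else 0)) =
       (\<Sum>i=d..j. gbin b (n - i) (n - j) * inv_sol b n d \<psi> i)"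
      by (rule sum.mono_neutral_cong_right) auto
    also have "\<dots> = gbin b n j * \<psi> j"
      unfolding inv_sol_def by (rule gbin_inversion) (use True assms in auto)
    finally show ?thesis using True by simp
  qed (auto intro: sum.neutral)
  show ?thesis
    unfolding distrib_left[of _ "if _ = 0 then _ else _"] sum.distrib head tail by (simp add: algebra_simps)
qed

text \<open>The optimal solution has dual coordinates \<open>a 0 = N\<close>, \<open>a 1 = (b ^ n - 1) * M\<close> and
  \<open>a k = 0\<close> for \<open>2 \<le> k < e\<close>; the remaining ones then solve the same kind of triangular system
  as the solution itself, whence both are given by \<^const>\<open>inv_sol\<close>.\<close>

lemma lp_attained:
  fixes N M :: real
  defines "F \<equiv> \<lambda>j. N + (b ^ j - 1) * M"
  assumes d: "1 \<le> d" "d \<le> n" and e: "2 \<le> e" "n < d + e"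
    and tight: "\<And>j. n < d + j \<Longrightarrow> j < e \<Longrightarrow> j \<le> n \<Longrightarrow> F j = v ^ j"
    and posx: "\<And>i. d \<le> i \<Longrightarrow> i \<le> n \<Longrightarrow> 0 \<le> inv_sol b n d (\<lambda>l. F (n - l) / v ^ (n - l) - 1) i"
    and posa: "\<And>k. e \<le> k \<Longrightarrow> k \<le> n \<Longrightarrow> 0 \<le> inv_sol b n e (\<lambda>j. v ^ j - F j) k"
    and posM: "0 \<le> (b ^ n - 1) * M"
  shows "\<exists>x. lp_feasible n Q d x \<and> (\<Sum>i\<le>n. x i) = N"
proof -
  define \<psi> where "\<psi> = (\<lambda>l. F (n - l) / v ^ (n - l) - 1)"
  define \<phi> where "\<phi> = (\<lambda>j. v ^ j - F j)"
  \<comment> \<open>The solution has the shape of \<open>shaped_moments\<close> with leading entries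
    1 and 0; the zero is written as a product to match that lemma.\<close>
  define x where "x = (\<lambda>i. (if i = 0 then 1 else if i = 1 then (b ^ n - 1) * 0 else 0) +
     (if d \<le> i then inv_sol b n d \<psi> i else 0))"
  define a where "a = (\<lambda>i. (if i = 0 then N else if i = 1 then (b ^ n - 1) * M else 0) +
     (if e \<le> i then inv_sol b n e \<phi> i else 0))"
  have "dual x k = a k" if "k \<le> n" for k
  proof (rule gbin_triangular_unique[where d = 0, OF _ _ that])
    fix j assume j: "j \<le> n"
    have "(\<Sum>i\<le>n. gbin b (n - i) j * x i) = (\<Sum>i\<le>n - j. gbin b (n - i) (n - (n - j)) * x i)"
      using j by (intro sum.mono_neutral_cong_right) auto
    also have "\<dots> = gbin b n (n - j) * (1 + (if d \<le> n - j then \<psi> (n - j) else 0))"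
      unfolding x_def by (subst shaped_moments) simp_all
    finally have "(\<Sum>k\<le>j. gbin b (n - k) (n - j) * dual x k) =
        gbin b n j * (v ^ j * (1 + (if d \<le> n - j then \<psi> (n - j) else 0)))"
      unfolding dual_moments[OF j] using gbin_sym[OF j] by simp
    also have "v ^ j * (1 + (if d \<le> n - j then \<psi> (n - j) else 0)) = F j + (if e \<le> j then \<phi> j else 0)"
    \<comment> \<open>If \<open>d \<le> n - j\<close>, then \<open>j < e\<close>, and the choice of
      \<open>\<psi>\<close> gives the equation. Otherwise it is one of the \<open>tight\<close>
      equations when \<open>j < e\<close>, and the choice of \<open>\<phi>\<close> gives it when
      \<open>e \<le> j\<close>.\<close>
    proof (cases "d \<le> n - j")
      case True
      then have "j < e" using d e by auto
      then show ?thesis using True j cb_ne_0 by (simp add: \<psi>_def del: mult_eq_0_iff)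
    next
      case False
      then show ?thesis using tight[of j] j by (auto simp: \<phi>_def)
    qed
    also have "gbin b n j * (F j + (if e \<le> j then \<phi> j else 0)) = (\<Sum>k\<le>j. gbin b (n - k) (n - j) * a k)"
      unfolding a_def shaped_moments[OF j] F_def by simp
    finally show "(\<Sum>k\<le>j. gbin b (n - k) (n - j) * dual x k) = (\<Sum>k\<le>j. gbin b (n - k) (n - j) * a k)" .
  qed simp
  moreover have "0 \<le> a k" if "1 \<le> k" "k \<le> n" for k
    using that posM posa[of k] e unfolding a_def \<phi>_def by auto
  moreover have "a 0 = N" using e by (simp add: a_def)
  moreover have "0 \<le> x i" if "d \<le> i" "i \<le> n" for i
    using that d posx[of i] unfolding x_def \<psi>_def by auto
  ultimately have "lp_feasible n Q d x" "dual x 0 = N"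
    using d by (auto simp: lp_feasible_def x_def)
  then show ?thesis unfolding dual_0 by blast
qed

end

section \<open>Sign criteria for sums and for Gaussian binomials\<close>

lemma alternating_sum_nonneg:
  fixes f :: "nat \<Rightarrow> real"
  assumes "\<And>r. r \<le> J \<Longrightarrow> 0 \<le> f r" "\<And>r. r < J \<Longrightarrow> f (Suc r) \<le> f r"
  shows "0 \<le> (\<Sum>r\<le>J. (- 1) ^ r * f r) \<and> (\<Sum>r\<le>J. (- 1) ^ r * f r) \<le> f 0"
  using assms
proof (induction J arbitrary: f)
  case (Suc J)
  have "(\<Sum>r\<le>Suc J. (- 1) ^ r * f r) = f 0 - (\<Sum>r\<le>J. (- 1) ^ r * f (Suc r))"
    by (subst sum.atMost_Suc_shift) (simp add: sum_negf)
  with Suc.IH[of "\<lambda>r. f (Suc r)"] Suc.prems show ?case by force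
qed auto

text \<open>Relative to the first term the bound is a geometric sum with ratio 1/2 whose last term
  is repeated, and this equals 2 exactly. Hence a last ratio of 1 is affordable.\<close>

lemma sum_abs_le_twice_first:
  fixes T :: "nat \<Rightarrow> real"
  assumes "\<And>r. Suc r < J \<Longrightarrow> 2 * \<bar>T (Suc r)\<bar> \<le> \<bar>T r\<bar>" "\<And>r. Suc r = J \<Longrightarrow> \<bar>T (Suc r)\<bar> \<le> \<bar>T r\<bar>"
  shows "(\<Sum>r\<le>J. \<bar>T r\<bar>) \<le> 2 * \<bar>T 0\<bar>"
  using assms
proof (induction J arbitrary: T)
  case (Suc J)
  show ?case
  proof (cases J)
    case 0
    then show ?thesis using Suc.prems(2)[of 0] by simp
  next
    case (Suc J')
    have "(\<Sum>r\<le>J. \<bar>T (Suc r)\<bar>) \<le> 2 * \<bar>T (Suc 0)\<bar>"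
      using Suc.IH[of "\<lambda>r. T (Suc r)"] Suc.prems by simp
    then show ?thesis using Suc.prems(1)[of 0] Suc by (subst sum.atMost_Suc_shift) simp
  qed
qed simp

text \<open>The later terms together are at most \<open>\<bar>T 0\<bar>\<close> in absolute value.
  The factor \<open>g\<close> admits either sign of \<open>T 0\<close>.\<close>

lemma sum_sign_of_first:
  fixes T :: "nat \<Rightarrow> real"
  assumes "\<And>r. Suc r < J \<Longrightarrow> 2 * \<bar>T (Suc r)\<bar> \<le> \<bar>T r\<bar>" "\<And>r. Suc r = J \<Longrightarrow> \<bar>T (Suc r)\<bar> \<le> \<bar>T r\<bar>"
    and "0 \<le> g * T 0"
  shows "0 \<le> g * (\<Sum>r\<le>J. T r)"
proof -
  have "\<bar>(\<Sum>r\<le>J. T r) - T 0\<bar> = \<bar>\<Sum>r\<in>{..J} - {0}. T r\<bar>"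
    by (subst sum.remove[of _ 0]) auto
  also have "\<dots> \<le> (\<Sum>r\<in>{..J} - {0}. \<bar>T r\<bar>)" by (rule sum_abs)
  also have "\<dots> = (\<Sum>r\<le>J. \<bar>T r\<bar>) - \<bar>T 0\<bar>"
    by (subst (2) sum.remove[of _ 0]) auto
  also have "\<dots> \<le> \<bar>T 0\<bar>" using sum_abs_le_twice_first[of J T] assms by simp
  finally have "\<bar>(\<Sum>r\<le>J. T r) - T 0\<bar> \<le> \<bar>T 0\<bar>" .
  with assms(3) show ?thesis
    by (cases "T 0" "0::real" rule: linorder_cases; cases g "0::real" rule: linorder_cases)
      (auto simp: mult_nonneg_nonneg mult_nonpos_nonpos zero_le_mult_iff)
qed

lemma gauss_base_gt_1: "1 < b \<Longrightarrow> gauss_base b"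
  by unfold_locales (metis less_irrefl one_less_power)

lemma gauss_base_neg:
  assumes "2 \<le> q" shows "gauss_base (- q)"
proof
  fix i :: nat assume "0 < i"
  then have "1 < q ^ i" using assms by (intro one_less_power) auto
  moreover have "\<bar>(- q) ^ i\<bar> = q ^ i" using assms by (simp add: power_abs)
  ultimately show "(- q) ^ i \<noteq> 1" by (metis abs_one less_irrefl)
qed

lemma gbin_nonneg:
  assumes "1 < b" shows "0 \<le> gbin b n k"
proof -
  have "0 \<le> gfac b m" for m
    unfolding gfac_def using assms by (intro prod_nonneg) (auto intro: one_le_power)
  then show ?thesis by (simp add: gbin_def)
qed

text \<open>As a polynomial in the base the binomial has degree \<open>k * (n - k)\<close>, and the
  sign is that of its leading term. The induction uses absorption, where
  \<open>(- q) ^ i - 1\<close> has sign \<open>(- 1) ^ i\<close>.\<close>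

lemma gbin_sign:
  assumes q: "2 \<le> q" and k: "k \<le> n"
  shows "0 < (- 1) ^ (k * (n - k)) * gbin (- q) n k"
  using k
proof (induction k arbitrary: n)
  case 0
  interpret gauss_base "- q" by (rule gauss_base_neg[OF q])
  show ?case by simp
next
  case (Suc k)
  interpret gauss_base "- q" by (rule gauss_base_neg[OF q])
  from Suc obtain m where n: "n = Suc m" "k \<le> m" by (cases n) auto
  have p: "0 < (- 1) ^ i * ((- q) ^ i - 1)" if "0 < i" for i :: nat
  proof -
    have "1 < q ^ i" using q that by (intro one_less_power) auto
    then show ?thesis by (cases "even i") (auto simp: add_pos_nonneg)
  qed
  have par: "(- 1) ^ (Suc k * (m - k)) = (- 1) ^ (k * (m - k)) * (- 1) ^ Suc k * (- 1 :: real) ^ Suc m"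
  proof -
    have "(- 1 :: real) ^ (k + m) = (- 1) ^ (m - k)"
      using n by (simp add: uminus_power_if)
    then show ?thesis by (simp add: power_add)
  qed
  have "0 < ((- 1) ^ (k * (m - k)) * gbin (- q) m k) * ((- 1) ^ Suc m * ((- q) ^ Suc m - 1)) *
      ((- 1) ^ Suc k * ((- q) ^ Suc k - 1))"
    by (intro mult_pos_pos Suc.IH[OF n(2)] p) simp_all
  also have "\<dots> = ((- 1) ^ (k * (m - k)) * (- 1) ^ Suc k * (- 1) ^ Suc m) * ((- q) ^ Suc k - 1) *
      (((- q) ^ Suc m - 1) * gbin (- q) m k)"
    by (simp only: mult_ac)
  also have "\<dots> = ((- q) ^ Suc k - 1) ^ 2 * ((- 1) ^ (Suc k * (m - k)) * gbin (- q) (Suc m) (Suc k))"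
    unfolding gbin_absorb[symmetric] par[symmetric] by (simp only: power2_eq_square mult_ac)
  finally show ?case unfolding n by (simp add: zero_less_mult_iff)
qed

context gauss_base
begin

text \<open>These are Delsarte's weights of a code meeting the bound. The terms decrease because
  \<open>b ^ i - b ^ r \<le> (b ^ Suc r - 1) * v\<close>, which the hypothesis on \<open>c\<close>
  supplies in the form \<open>b ^ n \<le> (b - 1) * v\<close>. That hypothesis holds with equality
  for \<open>b = 2\<close>, \<open>c = 1\<close>, the square binary matrices.\<close>

lemma alternating_weights_nonneg:
  assumes b: "1 < b" and c: "1 \<le> (b - 1) * c" and d: "1 \<le> d" "d \<le> i" "i \<le> n"
  defines "v \<equiv> c * b ^ n"
  shows "0 \<le> inv_sol b n d (\<lambda>l. v ^ Suc (l - d) - 1) i"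
proof -
  define f where "f = (\<lambda>r. b ^ (r choose 2) * gbin b i r * (v ^ Suc (i - r - d) - 1))"
  have bv: "b ^ n \<le> (b - 1) * v" using mult_right_mono[OF c, of "b ^ n"] b by (simp add: v_def mult.assoc)
  have "(b - 1) * 1 \<le> b ^ n"
    using self_le_power[of b n] b d by auto
  then have "(b - 1) * 1 \<le> (b - 1) * v" using bv by linarith
  then have v1: "1 \<le> v" using b by simp
  have dec: "f (Suc r) \<le> f r" if "r < i - d" for r
  proof -
    have "i - r - d \<noteq> 0" using that by linarith
    then obtain e where e: "i - r - d = Suc e" using not0_implies_Suc by blast
    have e': "i - Suc r - d = e" using e by simp
    have "b ^ r * (b ^ (i - r) - 1) = b ^ i - b ^ r"
      using that by (simp add: algebra_simps flip: power_add)
    also have "\<dots> \<le> b ^ n - 1" using b power_increasing[OF d(3), of b] one_le_power[of b r] by linarith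
    also have "\<dots> \<le> (b - 1) * v" using bv by simp
    also have "\<dots> \<le> (b ^ Suc r - 1) * v" using b v1 self_le_power[of b "Suc r"] by (intro mult_right_mono) auto
    finally have 1: "b ^ r * (b ^ (i - r) - 1) \<le> (b ^ Suc r - 1) * v" .
    have "0 \<le> v ^ Suc e - 1" using one_le_power[OF v1, of "Suc e"] by simp
    with 1 have "b ^ r * (b ^ (i - r) - 1) * (v ^ Suc e - 1) \<le> (b ^ Suc r - 1) * v * (v ^ Suc e - 1)"
      by (rule mult_right_mono)
    also have "\<dots> \<le> (b ^ Suc r - 1) * (v ^ Suc (Suc e) - 1)"
    proof -
      have "0 \<le> b ^ Suc r - 1" using b one_le_power[of b "Suc r"] by simp
      moreover have "v * (v ^ Suc e - 1) \<le> v ^ Suc (Suc e) - 1" using v1 by (simp add: algebra_simps)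
      ultimately show ?thesis unfolding mult.assoc by (rule mult_left_mono[rotated])
    qed
    finally have 2: "b ^ r * (b ^ (i - r) - 1) * (v ^ Suc e - 1) \<le> (b ^ Suc r - 1) * (v ^ Suc (Suc e) - 1)" .
    have "(b ^ Suc r - 1) * f (Suc r) = b ^ (r choose 2) * gbin b i r * (b ^ r * (b ^ (i - r) - 1) * (v ^ Suc e - 1))"
    proof -
      have "Suc r choose 2 = r + (r choose 2)" by (simp add: numeral_2_eq_2)
      then have "(b ^ Suc r - 1) * f (Suc r) = b ^ r * b ^ (r choose 2) * ((b ^ Suc r - 1) * gbin b i (Suc r)) * (v ^ Suc e - 1)"
        unfolding f_def e' by (simp only: power_add mult_ac)
      also have "(b ^ Suc r - 1) * gbin b i (Suc r) = (b ^ (i - r) - 1) * gbin b i r"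
        by (rule gbin_absorb') (use that in simp)
      finally show ?thesis by (simp only: mult_ac)
    qed
    also have "\<dots> \<le> b ^ (r choose 2) * gbin b i r * ((b ^ Suc r - 1) * (v ^ Suc (Suc e) - 1))"
      by (rule mult_left_mono[OF 2]) (use b gbin_nonneg[OF b] in auto)
    also have "\<dots> = (b ^ Suc r - 1) * f r" unfolding f_def e by (simp only: mult_ac)
    finally show ?thesis using b one_less_power[of b "Suc r"] by simp
  qed
  have "0 \<le> f r" for r
    unfolding f_def using b gbin_nonneg[OF b] one_le_power[OF v1, of "Suc (i - r - d)"]
    by (intro mult_nonneg_nonneg) (auto simp del: power_Suc)
  then have "0 \<le> (\<Sum>r\<le>i - d. (- 1) ^ r * f r)"
    using alternating_sum_nonneg[of "i - d" f] dec by auto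
  then show ?thesis unfolding inv_sol_def f_def
    using gbin_nonneg[OF b] by (simp add: mult.assoc)
qed

end

text \<open>The quotient of consecutive weights in \<open>inv_sol\<close> is at most
  \<open>(1 + 1 / 2 ^ t) / 3 * q ^ n\<close>, here cleared of fractions: its numerator is at most
  \<open>q ^ i + q ^ r\<close> with \<open>2 ^ t * q ^ r \<le> q ^ n\<close>, and its denominator is
  at least 3, attained for \<open>q = 2\<close> at \<open>r = 0\<close> and
  \<open>r = 1\<close>.\<close>

lemma weight_ratio:
  fixes q :: real
  assumes q: "2 \<le> q" and r: "r + t \<le> i" "i \<le> n" "r < i"
  shows "3 * 2 ^ t * (q ^ r * \<bar>(- q) ^ (i - r) - 1\<bar>) \<le> \<bar>(- q) ^ Suc r - 1\<bar> * ((2 ^ t + 1) * q ^ n)"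
proof -
  have "\<bar>(- q) ^ (i - r) - 1\<bar> \<le> q ^ (i - r) + 1"
    using abs_triangle_ineq4[of "(- q) ^ (i - r)" 1] q by (simp add: power_abs)
  then have "q ^ r * \<bar>(- q) ^ (i - r) - 1\<bar> \<le> q ^ r * (q ^ (i - r) + 1)"
    using q by (intro mult_left_mono) auto
  also have "\<dots> = q ^ i + q ^ r" using r by (simp add: algebra_simps flip: power_add)
  finally have 1: "q ^ r * \<bar>(- q) ^ (i - r) - 1\<bar> \<le> q ^ i + q ^ r" .
  have "2 ^ t * q ^ r \<le> q ^ t * q ^ r" using q by (intro mult_right_mono power_mono) auto
  also have "\<dots> \<le> q ^ n" unfolding power_add[symmetric] using q r by (intro power_increasing) auto
  finally have 2: "2 ^ t * q ^ r \<le> q ^ n" .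
  have 3: "q ^ i \<le> q ^ n" using q r by (intro power_increasing) auto
  have 4: "3 \<le> \<bar>(- q) ^ Suc r - 1\<bar>"
  proof (cases r)
    case (Suc m)
    have "2 * 2 \<le> q * q" using q by (intro mult_mono) auto
    also have "q * q \<le> q ^ Suc r" using power_increasing[of 2 "Suc r" q] q Suc by (simp add: power2_eq_square)
    finally have "4 \<le> \<bar>(- q) ^ Suc r\<bar>" using q unfolding power_abs by simp
    then show ?thesis by linarith
  qed (use q in simp)
  have "3 * 2 ^ t * (q ^ r * \<bar>(- q) ^ (i - r) - 1\<bar>) \<le> 3 * (2 ^ t * (q ^ i + q ^ r))"
    using 1 by (simp add: mult.assoc)
  also have "\<dots> \<le> 3 * ((2 ^ t + 1) * q ^ n)"
  proof -
    have "2 ^ t * q ^ i \<le> 2 ^ t * q ^ n" by (intro mult_left_mono 3) simp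
    with 2 show ?thesis unfolding distrib_left distrib_right by linarith
  qed
  also have "\<dots> \<le> \<bar>(- q) ^ Suc r - 1\<bar> * ((2 ^ t + 1) * q ^ n)"
    using 4 q by (intro mult_right_mono) auto
  finally show ?thesis .
qed

text \<open>For negative base the terms need not alternate in sign, so the first one is shown to
  dominate by \<open>sum_sign_of_first\<close>. Term \<open>r\<close> carries
  \<open>\<psi> l\<close> with \<open>l = i - r\<close>; the hypothesis \<open>last\<close> concerns
  the final step, where ratio 1 is enough. The exponents are admissible values of \<open>t\<close>
  in \<open>weight_ratio\<close>, because \<open>t \<le> l\<close>; capped at 3 and 4 they give the
  constants \<open>9 : 24\<close> and \<open>34 : 48\<close>.\<close>

lemma inv_sol_neg_nonneg:
  fixes q :: real
  assumes q: "2 \<le> q" and d: "1 \<le> d" "d \<le> i" "i \<le> n"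
    and last: "\<And>l. l = Suc d \<Longrightarrow> l \<le> i \<Longrightarrow>
       (2 ^ min 3 (Suc d) + 1) * q ^ n * \<bar>\<psi> (l - 1)\<bar> \<le> 3 * 2 ^ min 3 (Suc d) * \<bar>\<psi> l\<bar>"
    and other: "\<And>l. Suc (Suc d) \<le> l \<Longrightarrow> l \<le> i \<Longrightarrow>
       2 * ((2 ^ min 4 (Suc (Suc d)) + 1) * q ^ n * \<bar>\<psi> (l - 1)\<bar>) \<le> 3 * 2 ^ min 4 (Suc (Suc d)) * \<bar>\<psi> l\<bar>"
    and sign: "0 \<le> (- 1) ^ (i * (n - i)) * \<psi> i"
  shows "0 \<le> inv_sol (- q) n d \<psi> i"
  unfolding inv_sol_def
proof (rule sum_sign_of_first)
  interpret gauss_base "- q" by (rule gauss_base_neg[OF q])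
  let ?T = "\<lambda>r. (- 1) ^ r * (- q) ^ (r choose 2) * gbin (- q) i r * \<psi> (i - r)"
  have key: "k * \<bar>?T (Suc r)\<bar> \<le> \<bar>?T r\<bar>"
    if r: "r + t \<le> i" "r < i" and k: "0 \<le> k" "k * ((2 ^ t + 1) * q ^ n * \<bar>\<psi> (i - Suc r)\<bar>) \<le> 3 * 2 ^ t * \<bar>\<psi> (i - r)\<bar>"
    for k :: real and r t
  proof -
    let ?D = "\<bar>(- q) ^ Suc r - 1\<bar>"
    let ?g = "q ^ (r choose 2) * \<bar>gbin (- q) i r\<bar>"
    have "Suc r choose 2 = r + (r choose 2)" by (simp add: numeral_2_eq_2)
    then have "?D * \<bar>?T (Suc r)\<bar> = q ^ r * q ^ (r choose 2) * \<bar>((- q) ^ Suc r - 1) * gbin (- q) i (Suc r)\<bar> * \<bar>\<psi> (i - Suc r)\<bar>"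
      using q by (simp only: abs_mult power_abs abs_minus_cancel abs_one power_one power_add) (simp add: mult_ac)
    also have "((- q) ^ Suc r - 1) * gbin (- q) i (Suc r) = ((- q) ^ (i - r) - 1) * gbin (- q) i r"
      by (rule gbin_absorb') (use r in simp)
    finally have 1: "?D * \<bar>?T (Suc r)\<bar> = (q ^ r * \<bar>(- q) ^ (i - r) - 1\<bar>) * (?g * \<bar>\<psi> (i - Suc r)\<bar>)"
      by (simp only: abs_mult mult_ac)
    have g: "0 \<le> ?g" using q by simp
    have "3 * 2 ^ t * (?D * (k * \<bar>?T (Suc r)\<bar>)) =
        (3 * 2 ^ t * (q ^ r * \<bar>(- q) ^ (i - r) - 1\<bar>)) * (k * (?g * \<bar>\<psi> (i - Suc r)\<bar>))"
      using 1 by (simp add: mult_ac)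
    also have "\<dots> \<le> (?D * ((2 ^ t + 1) * q ^ n)) * (k * (?g * \<bar>\<psi> (i - Suc r)\<bar>))"
      by (rule mult_right_mono[OF weight_ratio[OF q r(1) d(3) r(2)]]) (use k g in simp)
    also have "\<dots> = ?D * ?g * (k * ((2 ^ t + 1) * q ^ n * \<bar>\<psi> (i - Suc r)\<bar>))"
      by (simp only: mult_ac)
    also have "\<dots> \<le> ?D * ?g * (3 * 2 ^ t * \<bar>\<psi> (i - r)\<bar>)"
      by (rule mult_left_mono[OF k(2)]) (use g in simp)
    also have "\<dots> = 3 * 2 ^ t * (?D * \<bar>?T r\<bar>)"
      using q by (simp add: abs_mult power_abs)
    finally have "3 * 2 ^ t * (?D * (k * \<bar>?T (Suc r)\<bar>)) \<le> 3 * 2 ^ t * (?D * \<bar>?T r\<bar>)" .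
    moreover have "0 < ?D" using pow_ne_1[of "Suc r"] by (simp only: zero_less_abs_iff) simp
    ultimately show ?thesis by simp
  qed
  {
    fix r assume r: "Suc r < i - d"
    then have l: "Suc (Suc d) \<le> i - r" "r + min 4 (Suc (Suc d)) \<le> i" by auto
    show "2 * \<bar>?T (Suc r)\<bar> \<le> \<bar>?T r\<bar>"
      by (rule key[of r "min 4 (Suc (Suc d))" 2])
        (use r l other[of "i - r"] in auto)
  next
    fix r assume r: "Suc r = i - d"
    then have l: "i - r = Suc d" "r + min 3 (Suc d) \<le> i" by auto
    have "1 * \<bar>?T (Suc r)\<bar> \<le> \<bar>?T r\<bar>"
      by (rule key[of r "min 3 (Suc d)" 1])
        (use r l(2) last[OF l(1)] in \<open>auto simp: l(1)\<close>)
    then show "\<bar>?T (Suc r)\<bar> \<le> \<bar>?T r\<bar>" by simp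
  next
    have "0 \<le> ((- 1) ^ (i * (n - i)) * gbin (- q) n i) * ((- 1) ^ (i * (n - i)) * \<psi> i)"
      by (rule mult_nonneg_nonneg[OF less_imp_le[OF gbin_sign[OF q d(3)]] sign])
    also have "\<dots> = ((- 1) ^ (i * (n - i)) * (- 1) ^ (i * (n - i))) * (gbin (- q) n i * \<psi> i)"
      by (simp only: mult_ac)
    also have "((- 1 :: real) ^ (i * (n - i)) * (- 1) ^ (i * (n - i))) = 1"
      by (simp flip: power_add)
    finally show "0 \<le> gbin (- q) n i * ?T 0" by (simp add: binomial_eq_0)
  }
qed

section \<open>Nonnegativity estimates for the Hermitian forms\<close>

lemma abs_pow_minus_1_ratio:
  fixes wn :: real
  assumes "2 \<le> \<bar>wn\<bar>"
  shows "(\<bar>wn\<bar> - 1) * \<bar>wn ^ Suc m - 1\<bar> \<le> \<bar>wn ^ Suc (Suc m) - 1\<bar>"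
proof -
  let ?X = "\<bar>wn\<bar>"
  have "\<bar>wn ^ Suc m - 1\<bar> \<le> ?X ^ Suc m + 1"
    using abs_triangle_ineq4[of "wn ^ Suc m" 1] by (simp add: power_abs abs_mult)
  then have "(?X - 1) * \<bar>wn ^ Suc m - 1\<bar> \<le> (?X - 1) * (?X ^ Suc m + 1)"
    using assms by (intro mult_left_mono) auto
  also have "\<dots> = ?X ^ Suc (Suc m) + (?X - ?X ^ Suc m) - 1" by (simp add: algebra_simps)
  also have "\<dots> \<le> ?X ^ Suc (Suc m) - 1"
    using assms self_le_power[of ?X "Suc m"] by simp
  also have "\<dots> \<le> \<bar>wn ^ Suc (Suc m) - 1\<bar>"
    using abs_triangle_ineq2[of "wn ^ Suc (Suc m)" 1] unfolding power_abs by simp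
  finally show ?thesis .
qed

lemma neg_power_sign:
  assumes "0 \<le> (q::real)" shows "- ((- q) ^ n) = (- 1) ^ Suc n * q ^ n"
  using power_mult_distrib[of "- 1" q n] by simp

lemma abs_neg_power:
  assumes "0 \<le> (q::real)" shows "\<bar>- ((- q) ^ n)\<bar> = q ^ n"
  using assms by (simp add: power_abs)

context
  fixes q :: real and n :: nat
  assumes q: "2 \<le> q"
begin

text \<open>The value \<open>c * b ^ n\<close> for the Hermitian parameters \<open>c = - 1\<close>
  and \<open>b = - q\<close>; its sign is \<open>(- 1) ^ Suc n\<close>.\<close>

abbreviation (input) "wn \<equiv> - ((- q) ^ n)"

lemma two_power_le: "2 ^ k \<le> q ^ k"
  using q by (intro power_mono) auto

lemma two_power_le': "m \<le> k \<Longrightarrow> 2 ^ m \<le> q ^ k"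
  using two_power_le[of k] power_increasing[of m k "2::real"] by linarith

text \<open>The parity condition survives replacing an odd \<open>d\<close> by
  \<open>n - d + 2\<close>, since that number is odd when \<open>n\<close> is even. So one lemma
  serves the primal and the dual coordinates in \<open>lp_optimum_hermitian_odd\<close>.\<close>

lemma hermitian_weights_nonneg:
  assumes d: "1 \<le> d" "d \<le> i" "i \<le> n" and par: "odd d \<or> odd n"
  shows "0 \<le> inv_sol (- q) n d (\<lambda>l. wn ^ Suc (l - d) - 1) i"
proof (rule inv_sol_neg_nonneg[OF q d])
  have X: "\<bar>wn\<bar> = q ^ n" using q by (intro abs_neg_power) simp
  have ratio: "(q ^ n - 1) * \<bar>wn ^ Suc m - 1\<bar> \<le> \<bar>wn ^ Suc (Suc m) - 1\<bar>" for m
    using abs_pow_minus_1_ratio[of wn m] two_power_le'[of 1 n] d unfolding X by simp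
  fix l
  {
    assume l: "l = Suc d" "l \<le> i"
    define p :: real where "p = 2 ^ min 3 (Suc d)"
    have p: "4 \<le> p" using power_increasing[of 2 "min 3 (Suc d)" "2::real"] d by (simp add: p_def)
    have X4: "4 \<le> q ^ n" using two_power_le'[of 2 n] l d by simp
    have c: "(p + 1) * q ^ n \<le> 3 * p * (q ^ n - 1)"
    proof -
      have "4 * p \<le> p * q ^ n" "q ^ n \<le> p * q ^ n" using p X4 by (simp_all add: mult.commute[of 4])
      then have "q ^ n + 3 * p \<le> 2 * (p * q ^ n)" using p by linarith
      then show ?thesis by (simp add: algebra_simps)
    qed
    have "(p + 1) * q ^ n * \<bar>wn ^ Suc 0 - 1\<bar> \<le> 3 * p * (q ^ n - 1) * \<bar>wn ^ Suc 0 - 1\<bar>"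
      by (rule mult_right_mono[OF c]) simp
    also have "\<dots> \<le> 3 * p * \<bar>wn ^ Suc (Suc 0) - 1\<bar>"
      unfolding mult.assoc[of "3 * p"] by (rule mult_left_mono[OF ratio]) (use p in simp)
    finally show "(2 ^ min 3 (Suc d) + 1) * q ^ n * \<bar>wn ^ Suc (l - 1 - d) - 1\<bar> \<le>
        3 * 2 ^ min 3 (Suc d) * \<bar>wn ^ Suc (l - d) - 1\<bar>"
      unfolding l p_def[symmetric] by simp
  next
    assume l: "Suc (Suc d) \<le> l" "l \<le> i"
    define p :: real where "p = 2 ^ min 4 (Suc (Suc d))"
    have p: "8 \<le> p" using power_increasing[of 3 "min 4 (Suc (Suc d))" "2::real"] d by (simp add: p_def)
    have X8: "8 \<le> q ^ n" using two_power_le'[of 3 n] l d by simp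
    have c: "2 * ((p + 1) * q ^ n) \<le> 3 * p * (q ^ n - 1)"
    proof -
      have "8 * p \<le> p * q ^ n" "8 * q ^ n \<le> p * q ^ n" using p X8 by (simp_all add: mult.commute[of 8])
      then have "3 * p + 2 * q ^ n \<le> p * q ^ n" using p by linarith
      then show ?thesis by (simp add: algebra_simps)
    qed
    obtain m where m: "l - d = Suc m" "l - 1 - d = m" using l by (cases "l - d") auto
    have "2 * ((p + 1) * q ^ n) * \<bar>wn ^ Suc m - 1\<bar> \<le> 3 * p * (q ^ n - 1) * \<bar>wn ^ Suc m - 1\<bar>"
      by (rule mult_right_mono[OF c]) simp
    also have "\<dots> \<le> 3 * p * \<bar>wn ^ Suc (Suc m) - 1\<bar>"
      unfolding mult.assoc[of "3 * p"] by (rule mult_left_mono[OF ratio]) (use p in simp)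
    finally show "2 * ((2 ^ min 4 (Suc (Suc d)) + 1) * q ^ n * \<bar>wn ^ Suc (l - 1 - d) - 1\<bar>) \<le>
        3 * 2 ^ min 4 (Suc (Suc d)) * \<bar>wn ^ Suc (l - d) - 1\<bar>"
      unfolding m p_def[symmetric] by (simp add: mult.assoc)
  }
  have q1: "1 \<le> (q ^ n) ^ m" for m using q by (intro one_le_power) auto
  \<comment> \<open>For odd \<open>n\<close> both factors are nonnegative. For even \<open>n\<close>
    the number \<open>wn\<close> is negative and \<open>Suc (i - d)\<close> has the parity of
    \<open>i\<close>, because \<open>d\<close> is odd; so the two signs agree.\<close>
  show "0 \<le> (- 1) ^ (i * (n - i)) * (wn ^ Suc (i - d) - 1)"
  proof (cases "odd n")
    case True
    then have "even (i * (n - i))" using d by auto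
    moreover have "wn = q ^ n" using True by simp
    ultimately show ?thesis using q1[of "Suc (i - d)"] by simp
  next
    case False
    then have "odd d" "even (i * (n - i)) \<longleftrightarrow> even i" "odd (Suc (i - d)) \<longleftrightarrow> odd i" using par d by auto
    moreover have "wn = - (q ^ n)" using False by simp
    ultimately show ?thesis using q1[of "Suc (i - d)"] 
      by (cases "even i") (auto simp del: power_Suc)
  qed
qed

text \<open>\<open>Y\<close> is a main term with an oscillating correction. The bound
  \<open>17 / 14\<close> on \<open>Z / Y\<close> is attained at \<open>q = 2\<close>,
  \<open>n = 4\<close> in \<open>even_main_bounds\<close>. The conclusions combine the ratios
  \<open>9 : 24\<close> and \<open>17 : 24\<close> of \<open>inv_sol_neg_nonneg\<close> with error
  factors \<open>21 / 20\<close> and \<open>19 / 20\<close>: \<open>189 = 21 * 9\<close>,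
  \<open>357 = 21 * 17\<close>, \<open>456 = 19 * 24\<close>.\<close>

lemma perturbed_ratio:
  fixes X Y Z :: real
  defines "U \<equiv> \<lambda>e::nat. Y - Z / (- q) ^ e"
  assumes Z: "0 \<le> Z" "14 * Z \<le> 17 * Y" and Y: "0 < Y" and X: "2 \<le> X" "20 * (q + 1) \<le> X * Y"
  shows "1 \<le> e \<Longrightarrow> 20 * (q + 1) \<le> X ^ e * U e"
    and "189 * U 1 \<le> 456 * U 2" and "3 \<le> e \<Longrightarrow> 357 * U (e - 1) \<le> 456 * U e"
proof -
  have Zq: "0 \<le> Z / q ^ e" "14 * (Z / q ^ e) \<le> 17 * Y / 2 ^ e" for e
  proof -
    show "0 \<le> Z / q ^ e" using Z q by simp
    have "14 * Z / q ^ e \<le> 14 * Z / 2 ^ e"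
      using Z q two_power_le[of e] by (intro divide_left_mono) auto
    also have "\<dots> \<le> 17 * Y / 2 ^ e" using Z by (intro divide_right_mono) auto
    finally show "14 * (Z / q ^ e) \<le> 17 * Y / 2 ^ e" by simp
  qed
  have Uodd: "odd e \<Longrightarrow> U e = Y + Z / q ^ e" and Uev: "even e \<Longrightarrow> U e = Y - Z / q ^ e" for e
    by (auto simp: U_def)
  have pe: "17 * Y / 2 ^ e \<le> 17 * Y / 2 ^ m" if "m \<le> e" for e m
    using Y that power_increasing[of m e "2::real"] by (intro divide_left_mono) auto
  show "20 * (q + 1) \<le> X ^ e * U e" if e: "1 \<le> e"
  proof (cases "odd e")
    case True
    have "20 * (q + 1) \<le> X * Y" by (rule X)
    also have "\<dots> \<le> X ^ e * U e"
      using True Zq(1)[of e] e X Y self_le_power[of X e] by (intro mult_mono) (auto simp: Uodd)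
    finally show ?thesis .
  next
    case False
    then have e2: "2 \<le> e" using e by (cases "e = 1") auto
    have "14 * (Z / q ^ e) \<le> 17 * Y / 4" using Zq(2)[of e] pe[OF e2] by simp
    then have "Y / 2 \<le> U e" using False Y by (simp add: Uev)
    moreover have "2 * X \<le> X ^ e"
    proof -
      have "2 * X \<le> X ^ 2" using X by (simp add: power2_eq_square)
      also have "\<dots> \<le> X ^ e" using e2 X by (intro power_increasing) auto
      finally show ?thesis .
    qed
    ultimately have "2 * X * (Y / 2) \<le> X ^ e * U e" using X Y by (intro mult_mono) auto
    then show ?thesis using X by simp
  qed
  show "189 * U 1 \<le> 456 * U 2"
    using Zq(2)[of 1] Zq(2)[of 2] Y by (simp add: U_def)
  show "357 * U (e - 1) \<le> 456 * U e" if e: "3 \<le> e"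
  proof (cases "odd e")
    case True
    then have "even (e - 1)" by simp
    then have "U (e - 1) \<le> Y" "Y \<le> U e" using True Zq(1) by (auto simp: Uodd Uev)
    then show ?thesis using Y by simp
  next
    case False
    then have "odd (e - 1)" "4 \<le> e" using e by (simp, presburger)
    then have "14 * (Z / q ^ (e - 1)) \<le> 17 * Y / 2 ^ 3" "14 * (Z / q ^ e) \<le> 17 * Y / 2 ^ 4"
      using Zq(2)[of "e - 1"] Zq(2)[of e] pe[of 3 "e - 1"] pe[of 4 e] by linarith+
    then have "14 * U (e - 1) \<le> 14 * Y + 17 * Y / 8" "14 * Y - 17 * Y / 16 \<le> 14 * U e"
      using False \<open>odd (e - 1)\<close> by (simp_all add: Uodd Uev)
    then show ?thesis using Y by linarith
  qed
qed

text \<open>Numerator over \<open>q + 1\<close> of the weight in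
  \<open>hermitian_even_weights_nonneg\<close>, with \<open>e = Suc (l - d)\<close>; see
  \<open>even_num_eq\<close>.\<close>

definition even_num :: "nat \<Rightarrow> real" where
  "even_num e = wn ^ e * ((1 - 1 / (- q) ^ e) * wn + q + 1 / (- q) ^ e) - (q + 1)"

lemma even_num_eq:
  "wn ^ e * (1 + (1 / (- q) ^ e - 1) * ((wn - 1) / (- q - 1))) - 1 = even_num e / (q + 1)"
proof -
  define \<beta> where "\<beta> = 1 / (- q) ^ e"
  define W where "W = wn"
  have "- q - 1 = - (q + 1)" by simp
  then have "(W - 1) / (- q - 1) = - ((W - 1) / (q + 1))" by (simp only: divide_minus_right)
  then have "1 + (\<beta> - 1) * ((W - 1) / (- q - 1)) = ((1 - \<beta>) * W + q + \<beta>) / (q + 1)"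
    using q by (simp add: field_simps)
  then have "W ^ e * (1 + (\<beta> - 1) * ((W - 1) / (- q - 1))) - 1 =
      (W ^ e * ((1 - \<beta>) * W + q + \<beta>) - (q + 1)) / (q + 1)"
    using q by (simp add: diff_divide_distrib)
  then show ?thesis unfolding even_num_def \<beta>_def W_def .
qed

text \<open>What remains of \<open>even_num\<close> after splitting off the sign, the power
  \<open>(q ^ n) ^ e\<close> and the constant \<open>q + 1\<close>. It has the form
  \<open>Y - Z / (- q) ^ e\<close> of \<open>perturbed_ratio\<close>.\<close>

definition even_main :: "nat \<Rightarrow> real" where
  "even_main e = (if odd n then q ^ n + q else q ^ n - q) - (if odd n then q ^ n - 1 else q ^ n + 1) / (- q) ^ e"

lemma even_num_main:
  "even_num e = (if odd n then 1 else (- 1) ^ Suc e) * ((q ^ n) ^ e * even_main e) - (q + 1)"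
proof -
  define \<beta> where "\<beta> = 1 / (- q) ^ e"
  have \<beta>: "x / (- q) ^ e = x * \<beta>" for x by (simp add: \<beta>_def)
  show ?thesis
  proof (cases "odd n")
    case True
    then have "wn = q ^ n" by simp
    then show ?thesis using True unfolding even_num_def even_main_def \<open>wn = q ^ n\<close> \<beta>
      by (simp add: algebra_simps)
  next
    case False
    then have wn: "wn = - (q ^ n)" by simp
    have "(- (q ^ n)) ^ e = (- 1) ^ e * (q ^ n) ^ e" using power_mult_distrib[of "-1" "q ^ n" e] by simp
    then show ?thesis using False unfolding even_num_def even_main_def wn \<beta>
      by (simp add: algebra_simps)
  qed
qed

text \<open>The case \<open>n = 2\<close> is out of reach of \<open>perturbed_ratio\<close>: with
  \<open>q = 2\<close> it has \<open>Y = 2\<close> and \<open>Z = 5\<close>, far above the ratio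
  \<open>17 / 14\<close>.\<close>

lemma even_main_bounds:
  assumes "3 \<le> n"
  shows "1 \<le> e \<Longrightarrow> 20 * (q + 1) \<le> (q ^ n) ^ e * even_main e"
    and "189 * even_main 1 \<le> 456 * even_main 2" and "3 \<le> e \<Longrightarrow> 357 * even_main (e - 1) \<le> 456 * even_main e"
proof -
  let ?Y = "if odd n then q ^ n + q else q ^ n - q"
  let ?Z = "if odd n then q ^ n - 1 else q ^ n + 1"
  have "2 * q \<le> q * q" using q by simp
  then have qq: "q + 1 \<le> q * q" using q by linarith
  have X0: "0 < q ^ n" using q by simp
  have q3: "q ^ 3 \<le> q ^ n" using assms q by (intro power_increasing) auto
  have c3: "4 * q \<le> q ^ 3" using mult_mono[of "2 * 2" "q * q" q q] q mult_mono[of 2 q 2 q]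
    by (simp add: power3_eq_cube)
  \<comment> \<open>For even \<open>n\<close> the main term \<open>?Y\<close> is smaller than
    \<open>?Z\<close>, so the stronger growth coming from \<open>n \<ge> 4\<close> is
    needed.\<close>
  have c4: "8 * q \<le> q ^ n" if "even n"
  proof -
    have "8 * q \<le> q ^ 3 * q" using c3 q mult_right_mono[of 8 "q ^ 3" q] by simp
    also have "\<dots> = q ^ 4" by (simp add: eval_nat_numeral)
    also have "\<dots> \<le> q ^ n" using assms that q by (intro power_increasing) (presburger, simp)
    finally show ?thesis .
  qed
  have "14 * (x - 1) \<le> 17 * (x + q)" if "0 < x" for x :: real using q that by (smt (verit))
  note odd_case = this[OF X0]
  have Z: "14 * ?Z \<le> 17 * ?Y"
  proof (cases "odd n")
    case True
    show ?thesis using odd_case unfolding if_P[OF True] .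
  next
    case False
    then show ?thesis using c4 q by simp
  qed
  have Z0: "0 \<le> ?Z" and Y: "0 < ?Y" and X: "2 \<le> q ^ n"
    using q c3 c4 q3 X0 by (auto intro!: add_pos_pos order.trans[OF _ q3])
  have XY: "20 * (q + 1) \<le> q ^ n * ?Y"
  proof (cases "odd n")
    case True
    have "20 * (q + 1) \<le> 20 * (q * q)" using mult_left_mono[OF qq, of 20] by simp
    also have "\<dots> = 4 * q * (5 * q)" by simp
    also have "\<dots> \<le> q ^ n * ?Y" using True q order.trans[OF c3 q3] by (intro mult_mono) auto
    finally show ?thesis .
  next
    case False
    have "20 * (q + 1) \<le> 56 * (q * q)" using mult_mono[OF _ qq, of 20 56] q by simp
    also have "\<dots> = 8 * q * (7 * q)" by simp
    also have "\<dots> \<le> q ^ n * ?Y" using False q c4 by (intro mult_mono) auto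
    finally show ?thesis .
  qed
  note * = perturbed_ratio[OF Z0 Z Y X XY, folded even_main_def]
  show "1 \<le> e \<Longrightarrow> 20 * (q + 1) \<le> (q ^ n) ^ e * even_main e" by (rule *(1))
  show "189 * even_main 1 \<le> 456 * even_main 2" by (rule *(2))
  show "3 \<le> e \<Longrightarrow> 357 * even_main (e - 1) \<le> 456 * even_main e" by (rule *(3))
qed

text \<open>The constant \<open>q + 1\<close> is at most one twentieth of the main term, which
  therefore fixes the size up to that error and also the sign.\<close>

lemma even_num_abs:
  assumes "3 \<le> n" "1 \<le> e"
  shows "20 * \<bar>even_num e\<bar> \<le> 21 * ((q ^ n) ^ e * even_main e)"
    and "19 * ((q ^ n) ^ e * even_main e) \<le> 20 * \<bar>even_num e\<bar>"
    and "0 \<le> (if odd n then 1 else (- 1) ^ Suc e) * even_num e"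
proof -
  define P where "P = (q ^ n) ^ e * even_main e"
  define \<sigma> :: real where "\<sigma> = (if odd n then 1 else (- 1) ^ Suc e)"
  have P: "20 * (q + 1) \<le> P" unfolding P_def by (rule even_main_bounds(1)[OF assms])
  have "\<sigma> = 1 \<or> \<sigma> = - 1" by (simp add: \<sigma>_def uminus_power_if)
  then have "(20 * \<bar>\<sigma> * P - (q + 1)\<bar> \<le> 21 * P) \<and> 19 * P \<le> 20 * \<bar>\<sigma> * P - (q + 1)\<bar> \<and> 0 \<le> \<sigma> * (\<sigma> * P - (q + 1))"
    using P q by auto
  then show "20 * \<bar>even_num e\<bar> \<le> 21 * ((q ^ n) ^ e * even_main e)"
    "19 * ((q ^ n) ^ e * even_main e) \<le> 20 * \<bar>even_num e\<bar>"
    "0 \<le> (if odd n then 1 else (- 1) ^ Suc e) * even_num e"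
    unfolding even_num_main P_def[symmetric] \<sigma>_def[symmetric] by auto
qed

lemma hermitian_even_weights_nonneg:
  assumes d: "2 \<le> d" "even d" "d \<le> i" "i \<le> n"
  shows "0 \<le> inv_sol (- q) n d
    (\<lambda>l. wn ^ Suc (l - d) * (1 + (1 / (- q) ^ Suc (l - d) - 1) * ((wn - 1) / (- q - 1))) - 1) i"
  unfolding even_num_eq
proof (rule inv_sol_neg_nonneg[OF q])
  show "1 \<le> d" "d \<le> i" "i \<le> n" using d by auto
  have X: "0 < q ^ n" using q by simp
  \<comment> \<open>Errors of one twentieth on both sides turn a ratio \<open>a : c\<close> into the
    comparison of \<open>21 * a\<close> with \<open>19 * c\<close>.\<close>
  have scale: "a * q ^ n * \<bar>even_num e / (q + 1)\<bar> \<le> c * \<bar>even_num (Suc e) / (q + 1)\<bar>"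
    if "3 \<le> n" "1 \<le> e" "0 \<le> a" "0 \<le> c" "21 * a * even_main e \<le> 19 * c * even_main (Suc e)" for a c e
  proof -
    have "20 * (a * q ^ n * \<bar>even_num e\<bar>) \<le> a * q ^ n * (21 * ((q ^ n) ^ e * even_main e))"
      using even_num_abs(1)[OF that(1,2)] mult_left_mono[of _ _ "a * q ^ n"] that(3) X by (simp add: mult.left_commute)
    also have "\<dots> = (q ^ n) ^ Suc e * (21 * a * even_main e)" by simp
    also have "\<dots> \<le> (q ^ n) ^ Suc e * (19 * c * even_main (Suc e))"
      by (rule mult_left_mono[OF that(5)]) (use X in simp)
    also have "\<dots> = c * (19 * ((q ^ n) ^ Suc e * even_main (Suc e)))" by simp
    also have "\<dots> \<le> c * (20 * \<bar>even_num (Suc e)\<bar>)"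
      by (rule mult_left_mono[OF even_num_abs(2)]) (use that in auto)
    finally have "a * q ^ n * \<bar>even_num e\<bar> \<le> c * \<bar>even_num (Suc e)\<bar>" by simp
    then have "a * q ^ n * \<bar>even_num e\<bar> / (q + 1) \<le> c * \<bar>even_num (Suc e)\<bar> / (q + 1)"
      using q by (intro divide_right_mono) auto
    then show ?thesis using q by simp
  qed
  fix l
  {
    assume l: "l = Suc d" "l \<le> i"
    have "min 3 (Suc d) = 3" using d by simp
    then show "(2 ^ min 3 (Suc d) + 1) * q ^ n * \<bar>even_num (Suc (l - 1 - d)) / (q + 1)\<bar> \<le>
        3 * 2 ^ min 3 (Suc d) * \<bar>even_num (Suc (l - d)) / (q + 1)\<bar>"
      \<comment> \<open>Here \<open>9 = 2 ^ 3 + 1\<close> and \<open>24 = 3 * 2 ^ 3\<close>; in the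
        other case \<open>34 = 2 * (2 ^ 4 + 1)\<close> and \<open>48 = 3 * 2 ^ 4\<close>.\<close>
      using scale[of 1 9 24] even_main_bounds(2) l d by (simp add: numeral_2_eq_2)
  next
    assume l: "Suc (Suc d) \<le> l" "l \<le> i"
    have "min 4 (Suc (Suc d)) = 4" using d by simp
    moreover obtain m where "l = Suc (Suc d) + m" using l le_Suc_ex by blast
    then have m: "l - d = Suc (Suc m)" "l - 1 - d = Suc m" by auto
    ultimately show "2 * ((2 ^ min 4 (Suc (Suc d)) + 1) * q ^ n * \<bar>even_num (Suc (l - 1 - d)) / (q + 1)\<bar>) \<le>
        3 * 2 ^ min 4 (Suc (Suc d)) * \<bar>even_num (Suc (l - d)) / (q + 1)\<bar>"
      using scale[of "Suc (Suc m)" 34 48] even_main_bounds(3)[of "Suc (Suc (Suc m))"] l d by simp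
  }
  show "0 \<le> (- 1) ^ (i * (n - i)) * (even_num (Suc (i - d)) / (q + 1))"
  \<comment> \<open>The sign estimate needs \<open>3 \<le> n\<close>. For \<open>n = 2\<close> only
    \<open>i = d = 2\<close> is possible, and the numerator is \<open>q ^ 4 - 1\<close>.\<close>
  proof (cases "n = 2")
    case True
    then have "i = d" "d = 2" using d by auto
    then have "even_num (Suc 0) = q ^ 4 - 1"
      using q unfolding even_num_def unfolding True by (simp add: field_simps eval_nat_numeral)
    then show ?thesis using True \<open>i = d\<close> \<open>d = 2\<close> q one_le_power[of q 4] by simp
  next
    case False
    then have n: "3 \<le> n" using d by simp
    have "even (Suc (Suc (i - d))) \<longleftrightarrow> even i" using d by auto
    moreover have "odd n \<Longrightarrow> even (i * (n - i))" "even n \<Longrightarrow> even (i * (n - i)) \<longleftrightarrow> even i" using d by auto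
    ultimately have "(if odd n then 1 else (- 1) ^ Suc (Suc (i - d))) = ((- 1) ^ (i * (n - i)) :: real)"
      by (auto simp: uminus_power_if simp del: power_Suc)
    then show ?thesis using even_num_abs(3)[OF n, of "Suc (i - d)"] q by (simp only: times_divide_eq_right zero_le_divide_iff) simp
  qed
qed

end

context
  fixes q :: real and n :: nat
  assumes q: "2 \<le> q"
begin

text \<open>Numerator over \<open>q + 1\<close> of the dual weights for even \<open>d\<close>, up to
  a power of \<open>c * b ^ n\<close>. It is used with \<open>f = Suc (j - s)\<close> and
  \<open>Suc s \<le> j\<close>, hence \<open>2 \<le> f\<close>.\<close>

definition dual_num :: "nat \<Rightarrow> real" where
  "dual_num f = (q + 1) * (- ((- q) ^ n)) ^ f + (- q) ^ f * (- ((- q) ^ n) - 1) - (- ((- q) ^ n)) - q"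

lemma dual_num_eq:
  "(- ((- q) ^ n)) ^ f - 1 - ((- q) ^ f - 1) * ((- ((- q) ^ n) - 1) / (- q - 1)) = dual_num f / (q + 1)"
proof -
  define W where "W = - ((- q) ^ n)"
  have "- q - 1 = - (q + 1)" by simp
  then have "(W - 1) / (- q - 1) = - ((W - 1) / (q + 1))" by (simp only: divide_minus_right)
  then have "W ^ f - 1 - ((- q) ^ f - 1) * ((W - 1) / (- q - 1)) =
      ((q + 1) * W ^ f + (- q) ^ f * (W - 1) - W - q) / (q + 1)"
    using q by (simp add: field_simps)
  then show ?thesis unfolding dual_num_def W_def .
qed

text \<open>For \<open>n \<ge> 4\<close> the power \<open>q ^ n\<close> is at least 16 and at least
  \<open>8 * q\<close>, so the leading power dominates. A relative error of 1/8 is good enough,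
  because \<open>9 * 34 \<le> 7 * 48\<close> in the ratio test.\<close>

lemma dual_num_approx:
  assumes n: "4 \<le> n" and f: "2 \<le> f"
  shows "8 * \<bar>dual_num f - (q + 1) * (- ((- q) ^ n)) ^ f\<bar> \<le> (q + 1) * (q ^ n) ^ f"
proof -
  define X where "X = q ^ n"
  define W where "W = - ((- q) ^ n)"
  have W: "\<bar>W\<bar> = X" unfolding W_def X_def using q by (intro abs_neg_power) simp
  have q4: "q ^ 4 \<le> X" unfolding X_def using n q by (intro power_increasing) auto
  have "(2::real) ^ 4 \<le> q ^ 4" using q by (intro power_mono) auto
  with q4 have X16: "16 \<le> X" by simp
  have "2 ^ 3 \<le> q ^ 3" using q by (intro power_mono) auto
  then have "q * 8 \<le> q * q ^ 3" using q by (intro mult_left_mono) auto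
  also have "\<dots> = q ^ 4" by (simp add: eval_nat_numeral)
  finally have q8: "8 * q \<le> X" using q4 by simp
  obtain g where g: "f = Suc (Suc g)" using f by (metis One_nat_def Suc_1 Suc_le_D Suc_le_mono)
  have "q ^ f * q ^ 2 \<le> (q ^ 4) ^ Suc g"
    unfolding power_add[symmetric] power_mult[symmetric] using q g by (intro power_increasing) auto
  also have "\<dots> \<le> X ^ Suc g" using q4 q by (intro power_mono) auto
  finally have "q ^ f * q ^ 2 \<le> X ^ Suc g" .
  moreover have "q ^ f * 4 \<le> q ^ f * q ^ 2"
    using q mult_mono[of 2 q 2 q] by (intro mult_left_mono) (auto simp: power2_eq_square)
  ultimately have "4 * q ^ f \<le> X ^ Suc g" by simp
  then have "4 * q ^ f * (X + 1) \<le> X ^ Suc g * (17 / 16 * X)"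
    using X16 q by (intro mult_mono) auto
  moreover have "X ^ Suc g * (17 / 16 * X) = 17 / 16 * X ^ f" unfolding g by simp
  ultimately have "4 * q ^ f * (X + 1) \<le> 17 / 16 * X ^ f" by (simp only:)
  then have 1: "64 * (q ^ f * (X + 1)) \<le> 17 * X ^ f" unfolding mult.assoc by linarith
  have "16 \<le> X ^ Suc g" using X16 self_le_power[of X "Suc g"] by linarith
  then have "X * 16 \<le> X * X ^ Suc g" using X16 by (intro mult_left_mono) auto
  then have 2: "16 * X \<le> X ^ f" unfolding g by simp
  have "\<bar>(- q) ^ f * (W - 1) - W - q\<bar> \<le> \<bar>(- q) ^ f * (W - 1)\<bar> + \<bar>W\<bar> + q"
    using q by linarith
  also have "\<bar>(- q) ^ f * (W - 1)\<bar> = q ^ f * \<bar>W - 1\<bar>" using q by (simp add: abs_mult power_abs)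
  also have "q ^ f * \<bar>W - 1\<bar> \<le> q ^ f * (X + 1)"
    using q W by (intro mult_left_mono) auto
  finally have "\<bar>(- q) ^ f * (W - 1) - W - q\<bar> \<le> q ^ f * (X + 1) + X + q" using W by simp
  then have "64 * \<bar>(- q) ^ f * (W - 1) - W - q\<bar> \<le> 17 * X ^ f + 64 * X + 64 * q"
  proof -
    have "64 * L \<le> Y + 64 * X + 64 * q" if "L \<le> T + X + q" "64 * T \<le> Y" for L T Y :: real
      using that by linarith
    then show ?thesis using 1 \<open>\<bar>(- q) ^ f * (W - 1) - W - q\<bar> \<le> q ^ f * (X + 1) + X + q\<close> by blast
  qed
  also have "\<dots> \<le> 17 * X ^ f + 72 * X" using q8 by linarith
  also have "\<dots> \<le> 24 * X ^ f" using 2 X16 by linarith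
  also have "\<dots> \<le> 8 * ((q + 1) * X ^ f)"
    using q X16 mult_right_mono[of 3 "q + 1" "X ^ f"] by simp
  finally have "8 * \<bar>(- q) ^ f * (W - 1) - W - q\<bar> \<le> (q + 1) * X ^ f" by simp
  moreover have "dual_num f - (q + 1) * W ^ f = (- q) ^ f * (W - 1) - W - q"
    by (simp add: dual_num_def W_def)
  ultimately show ?thesis unfolding X_def W_def by simp
qed

lemma dual_num_abs:
  assumes n: "4 \<le> n" and f: "2 \<le> f"
  shows "8 * \<bar>dual_num f\<bar> \<le> 9 * ((q + 1) * (q ^ n) ^ f)"
    and "7 * ((q + 1) * (q ^ n) ^ f) \<le> 8 * \<bar>dual_num f\<bar>"
    and "0 \<le> (- 1) ^ (f * Suc n) * dual_num f"
proof -
  define P where "P = (q + 1) * (q ^ n) ^ f"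
  define \<sigma> :: real where "\<sigma> = (- 1) ^ (f * Suc n)"
  have \<sigma>: "\<sigma> = 1 \<or> \<sigma> = - 1" by (simp add: \<sigma>_def uminus_power_if)
  have P: "0 \<le> P" using q by (simp add: P_def)
  have "(- ((- q) ^ n)) ^ f = ((- 1) ^ Suc n * q ^ n) ^ f"
    using q by (simp only: neg_power_sign)
  also have "\<dots> = \<sigma> * (q ^ n) ^ f" unfolding power_mult_distrib \<sigma>_def by (simp only: power_mult[symmetric] mult.commute[of f])
  finally have eq: "(q + 1) * (- ((- q) ^ n)) ^ f = \<sigma> * P" by (simp add: P_def)
  have "8 * \<bar>dual_num f - \<sigma> * P\<bar> \<le> P"
    using dual_num_approx[OF n f] unfolding eq P_def[symmetric] .
  then have "8 * \<bar>dual_num f\<bar> \<le> 9 * P \<and> 7 * P \<le> 8 * \<bar>dual_num f\<bar> \<and> 0 \<le> \<sigma> * dual_num f"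
    using \<sigma> P by (elim disjE) (simp_all, (smt (verit))+)
  then show "8 * \<bar>dual_num f\<bar> \<le> 9 * ((q + 1) * (q ^ n) ^ f)"
    "7 * ((q + 1) * (q ^ n) ^ f) \<le> 8 * \<bar>dual_num f\<bar>" "0 \<le> (- 1) ^ (f * Suc n) * dual_num f"
    unfolding P_def \<sigma>_def by auto
qed

lemma hermitian_even_dual_nonneg:
  assumes d: "2 \<le> d" "even d" "d \<le> n" and s: "s = n - d + 2" and k: "Suc s \<le> k" "k \<le> n"
  shows "0 \<le> inv_sol (- q) n (Suc s)
    (\<lambda>j. (- ((- q) ^ n)) ^ (s - 1) * ((- ((- q) ^ n)) ^ Suc (j - s) - 1 -
       ((- q) ^ Suc (j - s) - 1) * ((- ((- q) ^ n) - 1) / (- q - 1)))) k"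
  unfolding dual_num_eq
proof (rule inv_sol_neg_nonneg[OF q _ k])
  show "1 \<le> Suc s" by simp
  \<comment> \<open>An index \<open>k\<close> with \<open>Suc s \<le> k\<close> and
    \<open>k \<le> n\<close> forces \<open>d \<ge> 3\<close>, hence \<open>d \<ge> 4\<close> by
    parity; this supplies \<open>n \<ge> 4\<close>.\<close>
  have "d \<noteq> 3" using d by auto
  then have n4: "4 \<le> n" "2 \<le> s" using d s k by auto
  let ?K = "(- ((- q) ^ n)) ^ (s - 1) / (q + 1)"
  have scale: "a * q ^ n * \<bar>?K * dual_num f\<bar> \<le> c * \<bar>?K * dual_num (Suc f)\<bar>"
    if "2 \<le> f" "0 \<le> a" "0 \<le> c" "9 * a \<le> 7 * c" for a c f
  proof -
    have "a * q ^ n * (8 * \<bar>dual_num f\<bar>) \<le> a * q ^ n * (9 * ((q + 1) * (q ^ n) ^ f))"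
      by (rule mult_left_mono[OF dual_num_abs(1)[OF n4(1) that(1)]]) (use that(2) q in simp)
    also have "\<dots> = ((q + 1) * (q ^ n) ^ Suc f) * (9 * a)" by simp
    also have "\<dots> \<le> ((q + 1) * (q ^ n) ^ Suc f) * (7 * c)"
      by (rule mult_left_mono[OF that(4)]) (use q in simp)
    also have "\<dots> = c * (7 * ((q + 1) * (q ^ n) ^ Suc f))" by simp
    also have "\<dots> \<le> c * (8 * \<bar>dual_num (Suc f)\<bar>)"
      by (rule mult_left_mono[OF dual_num_abs(2)]) (use that n4 in auto)
    finally have "a * q ^ n * \<bar>dual_num f\<bar> \<le> c * \<bar>dual_num (Suc f)\<bar>" by simp
    then have "\<bar>?K\<bar> * (a * q ^ n * \<bar>dual_num f\<bar>) \<le> \<bar>?K\<bar> * (c * \<bar>dual_num (Suc f)\<bar>)"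
      by (rule mult_left_mono) simp
    then show ?thesis by (simp only: abs_mult mult_ac)
  qed
  have K: "(- ((- q) ^ n)) ^ (s - 1) * (x / (q + 1)) = ?K * x" for x by simp
  fix l
  {
    assume l: "l = Suc (Suc s)" "l \<le> k"
    have "min 3 (Suc (Suc s)) = 3" using n4 by simp
    then show "(2 ^ min 3 (Suc (Suc s)) + 1) * q ^ n * \<bar>(- ((- q) ^ n)) ^ (s - 1) * (dual_num (Suc (l - 1 - s)) / (q + 1))\<bar> \<le>
        3 * 2 ^ min 3 (Suc (Suc s)) * \<bar>(- ((- q) ^ n)) ^ (s - 1) * (dual_num (Suc (l - s)) / (q + 1))\<bar>"
      unfolding K using scale[of 2 9 24] l by (simp add: numeral_2_eq_2)
  next
    assume l: "Suc (Suc (Suc s)) \<le> l" "l \<le> k"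
    have "min 4 (Suc (Suc (Suc s))) = 4" using n4 by simp
    moreover obtain m where "l = Suc (Suc (Suc s)) + m" using l le_Suc_ex by blast
    then have m: "l - s = Suc (Suc (Suc m))" "l - 1 - s = Suc (Suc m)" by auto
    ultimately show "2 * ((2 ^ min 4 (Suc (Suc (Suc s))) + 1) * q ^ n * \<bar>(- ((- q) ^ n)) ^ (s - 1) * (dual_num (Suc (l - 1 - s)) / (q + 1))\<bar>) \<le>
        3 * 2 ^ min 4 (Suc (Suc (Suc s))) * \<bar>(- ((- q) ^ n)) ^ (s - 1) * (dual_num (Suc (l - s)) / (q + 1))\<bar>"
      unfolding K m using scale[of "Suc (Suc (Suc m))" 34 48] by simp
  }
  have "(- ((- q) ^ n)) ^ (s - 1) = ((- 1) ^ Suc n * q ^ n) ^ (s - 1)"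
    using q by (simp only: neg_power_sign)
  also have "\<dots> = (- 1) ^ (Suc n * (s - 1)) * (q ^ n) ^ (s - 1)" unfolding power_mult_distrib by (simp only: power_mult)
  finally have w: "(- ((- q) ^ n)) ^ (s - 1) = (- 1) ^ (Suc n * (s - 1)) * (q ^ n) ^ (s - 1)" .
  \<comment> \<open>For odd \<open>n\<close> all exponents are even. For even \<open>n\<close> the
    number \<open>s\<close> is even as well, and both sides have the parity of
    \<open>Suc k\<close>.\<close>
  have par: "(- 1) ^ (k * (n - k)) * (- 1) ^ (Suc n * (s - 1)) = ((- 1) ^ (Suc (k - s) * Suc n) :: real)"
  proof -
    have "even (k * (n - k) + Suc n * (s - 1)) \<longleftrightarrow> even (Suc (k - s) * Suc n)"
    proof (cases "even n")
      case True
      then have "even s" using s d by simp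
      then have "odd (s - 1)" using n4 by (cases s) auto
      then show ?thesis using True \<open>even s\<close> k by simp
    next
      case False
      then have "even (k * (n - k))" using k by auto
      then show ?thesis using False by simp
    qed
    then show ?thesis unfolding power_add[symmetric] by (simp only: uminus_power_if power_one)
  qed
  have "(- 1) ^ (k * (n - k)) * ((- ((- q) ^ n)) ^ (s - 1) * (dual_num (Suc (k - s)) / (q + 1))) =
      ((- 1) ^ (k * (n - k)) * (- 1) ^ (Suc n * (s - 1))) * dual_num (Suc (k - s)) * ((q ^ n) ^ (s - 1) / (q + 1))"
    unfolding w by simp
  also have "0 \<le> \<dots>"
    unfolding par by (rule mult_nonneg_nonneg[OF dual_num_abs(3)[OF n4(1)]]) (use k q in auto)
  finally show "0 \<le> (- 1) ^ (k * (n - k)) * ((- ((- q) ^ n)) ^ (s - 1) * (dual_num (Suc (k - s)) / (q + 1)))" .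
qed

end

section \<open>Optimal values of the linear program\<close>

lemma power_quotient: "x \<noteq> 0 \<Longrightarrow> k = l + m \<Longrightarrow> x ^ k / x ^ m = x ^ l" for x :: real
  by (simp add: power_add)

text \<open>The choice \<open>M = 0\<close>, \<open>e = n - d + 2\<close> leaves the single tight
  moment \<open>j = n - d + 1\<close>, met by \<open>N = v ^ (n - d + 1)\<close>. The dual
  coordinates then have the form of the primal ones with \<open>n - d + 2\<close> in place of
  \<open>d\<close>, scaled by \<open>N\<close>, as for a code and its dual.\<close>

lemma lp_optimum_pos_base:
  assumes lp: "code_lp b c n Q" and b: "1 < b" "1 \<le> (b - 1) * c" and d: "1 \<le> d" "d \<le> n"
  shows "lp_optimum n Q d (lp_val b c n d)"
proof -
  interpret code_lp b c n Q by (rule lp)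
  let ?N = "v ^ (n - d + 1)"
  have "0 < c" using b by (smt (verit) mult_nonneg_nonpos)
  then have v0: "0 < v" using b by simp
  then have v: "v \<noteq> 0" by (metis less_irrefl)
  have "\<exists>x. lp_feasible n Q d x \<and> (\<Sum>i\<le>n. x i) = ?N"
  proof (rule lp_attained[OF d, where M = 0 and e = "n - d + 2"])
    fix i assume i: "d \<le> i" "i \<le> n"
    have "inv_sol b n d (\<lambda>l. (?N + (b ^ (n - l) - 1) * 0) / v ^ (n - l) - 1) i =
        inv_sol b n d (\<lambda>l. v ^ Suc (l - d) - 1) i"
    proof (rule inv_sol_cong[OF i(1)])
      fix l assume "d \<le> l" "l \<le> i"
      then have "n - d + 1 = Suc (l - d) + (n - l)" using i by simp
      from power_quotient[OF v this]
      show "(?N + (b ^ (n - l) - 1) * 0) / v ^ (n - l) - 1 = v ^ Suc (l - d) - 1"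
        by (simp only: mult_zero_right add_0_right)
    qed
    then show "0 \<le> inv_sol b n d (\<lambda>l. (?N + (b ^ (n - l) - 1) * 0) / v ^ (n - l) - 1) i"
      using alternating_weights_nonneg[OF b d(1) i] by simp
  next
    fix k assume k: "n - d + 2 \<le> k" "k \<le> n"
    have "inv_sol b n (n - d + 2) (\<lambda>j. v ^ j - (?N + (b ^ j - 1) * 0)) k =
        inv_sol b n (n - d + 2) (\<lambda>j. ?N * (v ^ Suc (j - (n - d + 2)) - 1)) k"
    proof (rule inv_sol_cong[OF k(1)])
      fix j assume "n - d + 2 \<le> j" "j \<le> k"
      then have "j = n - d + 1 + Suc (j - (n - d + 2))" by simp
      then have "v ^ j = ?N * v ^ Suc (j - (n - d + 2))" by (metis power_add)
      then show "v ^ j - (?N + (b ^ j - 1) * 0) = ?N * (v ^ Suc (j - (n - d + 2)) - 1)"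
        by (simp only: right_diff_distrib mult_zero_right mult_1_right add_0_right)
    qed
    then show "0 \<le> inv_sol b n (n - d + 2) (\<lambda>j. v ^ j - (?N + (b ^ j - 1) * 0)) k"
      using alternating_weights_nonneg[OF b _ k] v0 unfolding inv_sol_scale by simp
  next
    fix j assume "n < d + j" "j < n - d + 2" "j \<le> n"
    then have "j = n - d + 1" using d by simp
    then show "?N + (b ^ j - 1) * 0 = v ^ j" by simp
  qed (use d in auto)
  then show ?thesis
    using lp_bound[OF _ d] gbin_nonneg[OF b(1)] unfolding lp_optimum_def lp_val_def by blast
qed

lemma lp_optimum_hermitian_odd:
  assumes q: "2 \<le> q" and lp: "code_lp (- q) (- 1) n Q" and d: "1 \<le> d" "d \<le> n" "odd d"
  shows "lp_optimum n Q d (lp_val (- q) (- 1) n d)"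
proof -
  interpret code_lp "- q" "- 1" n Q by (rule lp)
  let ?N = "v ^ (n - d + 1)"
  have veq: "v = - ((- q) ^ n)" by simp
  have v: "v \<noteq> 0" using q by simp
  \<comment> \<open>The dual coordinates are \<open>?N\<close> times weights of the primal type, so
    the sign matters: \<open>v\<close> is negative for even \<open>n\<close>, but then the exponent
    \<open>n - d + 1\<close> is even because \<open>d\<close> is odd.\<close>
  have N: "0 \<le> ?N"
  proof (cases "odd n")
    case True
    then show ?thesis using q by simp
  next
    case False
    then have "even (n - d + 1)" using d by simp
    then show ?thesis by (rule zero_le_even_power)
  qed
  have "\<exists>x. lp_feasible n Q d x \<and> (\<Sum>i\<le>n. x i) = ?N"
  proof (rule lp_attained[OF d(1,2), where M = 0 and e = "n - d + 2"])
    fix i assume i: "d \<le> i" "i \<le> n"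
    have "inv_sol (- q) n d (\<lambda>l. (?N + ((- q) ^ (n - l) - 1) * 0) / v ^ (n - l) - 1) i =
        inv_sol (- q) n d (\<lambda>l. v ^ Suc (l - d) - 1) i"
    proof (rule inv_sol_cong[OF i(1)])
      fix l assume "d \<le> l" "l \<le> i"
      then have "n - d + 1 = Suc (l - d) + (n - l)" using i by simp
      from power_quotient[OF v this]
      show "(?N + ((- q) ^ (n - l) - 1) * 0) / v ^ (n - l) - 1 = v ^ Suc (l - d) - 1"
        by (simp only: mult_zero_right add_0_right)
    qed
    then show "0 \<le> inv_sol (- q) n d (\<lambda>l. (?N + ((- q) ^ (n - l) - 1) * 0) / v ^ (n - l) - 1) i"
      using hermitian_weights_nonneg[OF q d(1) i] d unfolding veq by simp
  next
    fix k assume k: "n - d + 2 \<le> k" "k \<le> n"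
    have "inv_sol (- q) n (n - d + 2) (\<lambda>j. v ^ j - (?N + ((- q) ^ j - 1) * 0)) k =
        inv_sol (- q) n (n - d + 2) (\<lambda>j. ?N * (v ^ Suc (j - (n - d + 2)) - 1)) k"
    proof (rule inv_sol_cong[OF k(1)])
      fix j assume "n - d + 2 \<le> j" "j \<le> k"
      then have "j = n - d + 1 + Suc (j - (n - d + 2))" by simp
      then have "v ^ j = ?N * v ^ Suc (j - (n - d + 2))" by (metis power_add)
      then show "v ^ j - (?N + ((- q) ^ j - 1) * 0) = ?N * (v ^ Suc (j - (n - d + 2)) - 1)"
        by (simp only: right_diff_distrib mult_zero_right mult_1_right add_0_right)
    qed
    moreover have "0 \<le> inv_sol (- q) n (n - d + 2) (\<lambda>l. v ^ Suc (l - (n - d + 2)) - 1) k"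
      unfolding veq by (rule hermitian_weights_nonneg[OF q _ k]) (use d in auto)
    ultimately show "0 \<le> inv_sol (- q) n (n - d + 2) (\<lambda>j. v ^ j - (?N + ((- q) ^ j - 1) * 0)) k"
      using N unfolding inv_sol_scale by (simp only: mult_nonneg_nonneg)
  next
    fix j assume "n < d + j" "j < n - d + 2" "j \<le> n"
    then have "j = n - d + 1" using d by simp
    then show "?N + ((- q) ^ j - 1) * 0 = v ^ j" by simp
  qed (use d in auto)
  moreover have "0 \<le> gbin (- q) (n - k) (d - 1)" for k
  proof (cases "d - 1 \<le> n - k")
    case True
    have "even ((d - 1) * (n - k - (d - 1)))" using d by simp
    then show ?thesis using gbin_sign[OF q True] by simp
  qed simp
  ultimately show ?thesis
    using lp_bound[OF _ d(1,2)] unfolding lp_optimum_def lp_val_def by blast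
qed

text \<open>With \<open>e = Suc s\<close> two moments are tight, \<open>j = s - 1\<close> and
  \<open>j = s\<close>. The two equations \<open>N + (b ^ j - 1) * M = V ^ j\<close> determine
  \<open>M\<close> by subtraction, and then \<open>N\<close>.\<close>

lemma lp_optimum_hermitian_even:
  assumes q: "2 \<le> q" and lp: "code_lp (- q) (- 1) n Q" and d: "2 \<le> d" "d \<le> n" "even d"
  shows "lp_optimum n Q d (lp_val_even (- q) (- 1) n d)"
proof -
  interpret code_lp "- q" "- 1" n Q by (rule lp)
  define b where "b = - q"
  define V where "V = - ((- q) ^ n)"
  define s where "s = n - d + 2"
  have veq: "v = V" by (simp add: V_def)
  have V0: "V \<noteq> 0" using q by (simp add: V_def)
  have b0: "b \<noteq> 0" "b - 1 \<noteq> 0" using q by (auto simp: b_def)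
  have s1: "s = Suc (s - 1)" "s \<le> n" "1 \<le> s - 1" "n - d + 1 = s - 1" using d by (auto simp: s_def)
  \<comment> \<open>Subtracting the tight equations gives
    \<open>(b ^ s - b ^ (s - 1)) * M = V ^ s - V ^ (s - 1)\<close>; \<open>\<theta>\<close> is what
    is left of \<open>M\<close> once the powers with exponent \<open>s - 1\<close> are taken
    out.\<close>
  define \<theta> where "\<theta> = (V - 1) / (b - 1)"
  define M where "M = V ^ (s - 1) / b ^ (s - 1) * \<theta>"
  define N where "N = V ^ (s - 1) - (b ^ (s - 1) - 1) * M"
  have F: "N + (b ^ j - 1) * M = V ^ (s - 1) * (1 + (b ^ j / b ^ (s - 1) - 1) * \<theta>)" for j
    using b0 by (simp add: N_def M_def field_simps)
  have bs: "b ^ s = b * b ^ (s - 1)" using power_Suc[of b "s - 1"] s1(1) by simp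
  have Nval: "N = V ^ (s - 1) * (((b ^ s - 1) - V * (b ^ (s - 1) - 1)) / (b ^ s - b ^ (s - 1)))"
  proof -
    have "V ^ (s - 1) - (B - 1) * (V ^ (s - 1) / B * ((V - 1) / (b - 1))) =
        V ^ (s - 1) * (((b * B - 1) - V * (B - 1)) / (b * B - B))" if "B \<noteq> 0" for B
    proof -
      have "b * B - B \<noteq> 0" using that b0 by (simp add: algebra_simps)
      then show ?thesis using that b0 by (simp add: divide_simps) (simp add: algebra_simps)
    qed
    from this[of "b ^ (s - 1)"] show ?thesis using b0 by (simp add: N_def M_def \<theta>_def bs)
  qed
  have pw: "0 < q ^ k" "1 \<le> q ^ k" for k using q one_le_power[of q k] by auto
  have "\<exists>x. lp_feasible n Q d x \<and> (\<Sum>i\<le>n. x i) = N"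
  proof (rule lp_attained[where M = M and e = "Suc s"], unfold veq, unfold b_def[symmetric])
    \<comment> \<open>As \<open>d\<close> is even, \<open>s - 1\<close> is even for odd
      \<open>n\<close>, and the two nonpositive factors \<open>\<theta>\<close> and
      \<open>b ^ n - 1\<close> compensate. For even \<open>n\<close> all factors are
      nonnegative.\<close>
    show "0 \<le> (b ^ n - 1) * M"
    proof -
      have q1: "q + 1 > 0" using q by simp
      have \<theta>: "\<theta> = - (V - 1) / (q + 1)"
        unfolding \<theta>_def b_def using q by (simp add: field_simps)
      have VB: "V ^ (s - 1) / b ^ (s - 1) = (V / b) ^ (s - 1)" by (simp add: power_divide)
      obtain m where m: "n = Suc m" using n_pos by (cases n) auto
      show ?thesis
      proof (cases "odd n")
        case True
        then have "even (s - 1)" using d by (auto simp: s_def)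
        then have "0 \<le> (V / b) ^ (s - 1)" by (rule zero_le_even_power)
        moreover have "V = q ^ n" "b ^ n = - (q ^ n)" using True by (auto simp: V_def b_def)
        then have "\<theta> \<le> 0" "b ^ n - 1 \<le> 0" using pw[of n] q1 by (auto simp: \<theta> divide_nonpos_pos)
        ultimately show ?thesis unfolding M_def VB by (intro mult_nonpos_nonpos mult_nonneg_nonpos)
      next
        case False
        then have "V = - (q ^ n)" "b ^ n = q ^ n" by (auto simp: V_def b_def)
        moreover from this have "V / b = q ^ n / q" using q by (simp add: b_def)
        moreover have "0 \<le> \<theta>" using calculation pw[of n] q1 by (auto simp: \<theta>)
        ultimately show ?thesis unfolding M_def VB using pw[of n] q by (intro mult_nonneg_nonneg) auto
      qed
    qed
  next
    fix i assume i: "d \<le> i" "i \<le> n"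
    have "inv_sol b n d (\<lambda>l. (N + (b ^ (n - l) - 1) * M) / V ^ (n - l) - 1) i =
        inv_sol b n d (\<lambda>l. V ^ Suc (l - d) * (1 + (1 / b ^ Suc (l - d) - 1) * \<theta>) - 1) i"
    proof (rule inv_sol_cong[OF i(1)])
      fix l assume "d \<le> l" "l \<le> i"
      then have e: "s - 1 = Suc (l - d) + (n - l)" using i by (simp add: s_def)
      have "b ^ (n - l) / b ^ (s - 1) = 1 / b ^ Suc (l - d)" "V ^ (s - 1) / V ^ (n - l) = V ^ Suc (l - d)"
        unfolding e power_add using b0 V0 by simp_all
      then show "(N + (b ^ (n - l) - 1) * M) / V ^ (n - l) - 1 = V ^ Suc (l - d) * (1 + (1 / b ^ Suc (l - d) - 1) * \<theta>) - 1"
        unfolding F by (metis times_divide_eq_left)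
    qed
    then show "0 \<le> inv_sol b n d (\<lambda>l. (N + (b ^ (n - l) - 1) * M) / V ^ (n - l) - 1) i"
      using hermitian_even_weights_nonneg[OF q d(1,3) i] unfolding \<theta>_def V_def b_def by simp
  next
    fix k assume k: "Suc s \<le> k" "k \<le> n"
    have "inv_sol b n (Suc s) (\<lambda>j. V ^ j - (N + (b ^ j - 1) * M)) k =
        inv_sol b n (Suc s) (\<lambda>j. V ^ (s - 1) * (V ^ Suc (j - s) - 1 - (b ^ Suc (j - s) - 1) * \<theta>)) k"
    proof (rule inv_sol_cong[OF k(1)])
      fix j assume "Suc s \<le> j" "j \<le> k"
      then have e: "j = s - 1 + Suc (j - s)" using s1 by simp
      have "b ^ j / b ^ (s - 1) = b ^ Suc (j - s)"
        by (subst e) (simp add: power_add b0)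
      moreover have "V ^ j = V ^ (s - 1) * V ^ Suc (j - s)"
        by (subst e) (rule power_add)
      ultimately show "V ^ j - (N + (b ^ j - 1) * M) = V ^ (s - 1) * (V ^ Suc (j - s) - 1 - (b ^ Suc (j - s) - 1) * \<theta>)"
        unfolding F by (simp only: right_diff_distrib distrib_left mult_1_right)
    qed
    then show "0 \<le> inv_sol b n (Suc s) (\<lambda>j. V ^ j - (N + (b ^ j - 1) * M)) k"
      using hermitian_even_dual_nonneg[OF q d(1,3,2) s_def k] unfolding \<theta>_def V_def b_def by simp
  next
    fix j assume j: "n < d + j" "j < Suc s" "j \<le> n"
    then have "j = s - 1 \<or> j = s" using d by (auto simp: s_def)
    then consider "j = s - 1" | "j = s" by blast
    then show "N + (b ^ j - 1) * M = V ^ j"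
    proof cases
      case 1
      then show ?thesis unfolding F using b0 by simp
    next
      case 2
      have "b ^ s / b ^ (s - 1) = b" using b0 bs by simp
      moreover have "(b - 1) * \<theta> = V - 1" using b0 by (simp add: \<theta>_def)
      moreover have "V ^ s = V ^ (s - 1) * V" using power_Suc2[of V "s - 1"] s1(1) by simp
      ultimately show ?thesis unfolding F 2 by simp
    qed
  qed (use d in \<open>auto simp: s_def\<close>)
  moreover have "(\<Sum>i\<le>n. x i) \<le> N" if x: "lp_feasible n Q d x" for x
  proof -
    have "(\<Sum>i\<le>n. x i) \<le> v ^ (s - 1) * ((((- q) ^ s - 1) - v * ((- q) ^ (s - 1) - 1)) / ((- q) ^ s - (- q) ^ (s - 1)))"
    proof (rule lp_bound_even[OF x d(1,2) s_def])
      fix k assume k: "k \<le> s"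
      have g: "0 \<le> gbin (- q) (n - k) (d - 2)"
      proof (cases "d - 2 \<le> n - k")
        case True
        have "even ((d - 2) * (n - k - (d - 2)))" using d by simp
        then show ?thesis using gbin_sign[OF q True] by simp
      qed simp
      \<comment> \<open>At \<open>k = 0\<close> the power \<open>(- q) ^ s\<close> has the opposite
        sign, so the difference adds absolute values. For \<open>k \<ge> 1\<close> the power
        \<open>(- q) ^ (s - 1)\<close> is largest in absolute value and decides the sign.\<close>
      have "0 \<le> (- 1) ^ (s - 1) * ((- q) ^ (s - 1) - (- q) ^ (s - k)) \<or> k = 1"
      proof (cases "k = 0")
        case True
        have "(- 1) ^ (s - 1) * ((- q) ^ (s - 1) - (- q) ^ s) = ((- 1) ^ (s - 1) * (- q) ^ (s - 1)) * (1 + q)"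
          using bs unfolding b_def by (simp add: algebra_simps)
        also have "(- 1) ^ (s - 1) * (- q) ^ (s - 1) = q ^ (s - 1)"
          by (simp flip: power_mult_distrib)
        finally show ?thesis using q True by simp
      next
        case False
        then have "s - k \<le> s - 1" by simp
        then have abs: "\<bar>(- q) ^ (s - k)\<bar> \<le> q ^ (s - 1)"
          using q by (auto simp: power_abs intro: power_increasing)
        have unit: "(- 1 :: real) ^ (s - 1) = 1 \<or> (- 1 :: real) ^ (s - 1) = - 1" by (simp add: uminus_power_if)
        have "e * x \<le> y" if "\<bar>x\<bar> \<le> y" "e = 1 \<or> e = - 1" for e x y :: real
          using that by auto
        from this[OF abs unit] have "0 \<le> q ^ (s - 1) - (- 1) ^ (s - 1) * (- q) ^ (s - k)" by simp
        also have "\<dots> = (- 1) ^ (s - 1) * ((- q) ^ (s - 1) - (- q) ^ (s - k))"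
          by (simp add: right_diff_distrib flip: power_mult_distrib)
        finally show ?thesis by simp
      qed
      then show "0 \<le> (- 1) ^ (s - 1) * gbin (- q) (n - k) (d - 2) * ((- q) ^ (s - 1) - (- q) ^ (s - k)) \<or> k = 1"
      proof (elim disjE)
        assume "0 \<le> (- 1) ^ (s - 1) * ((- q) ^ (s - 1) - (- q) ^ (s - k))"
        from mult_nonneg_nonneg[OF g this] show ?thesis by (simp only: mult_ac) simp
      qed simp
    qed (use q in auto)
    then show ?thesis unfolding Nval veq b_def .
  qed
  moreover have "N = lp_val_even (- q) (- 1) n d"
    unfolding Nval lp_val_even_def s1(4) s_def[symmetric] b_def[symmetric] by (simp add: V_def b_def)
  ultimately show ?thesis unfolding lp_optimum_def by auto
qed

section \<open>Association schemes\<close>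

lemma mprod_assoc:
  "mprod X (mprod X A B) C = mprod X A (mprod X B C)"
proof (intro ext)
  fix x y
  have "mprod X (mprod X A B) C x y = (\<Sum>z\<in>X. \<Sum>w\<in>X. A x w * B w z * C z y)"
    by (simp add: mprod_def sum_distrib_right)
  also have "\<dots> = (\<Sum>w\<in>X. \<Sum>z\<in>X. A x w * B w z * C z y)" by (rule sum.swap)
  also have "\<dots> = mprod X A (mprod X B C) x y" by (simp add: mprod_def sum_distrib_left mult.assoc)
  finally show "mprod X (mprod X A B) C x y = mprod X A (mprod X B C) x y" .
qed

lemma mprod_diff_right: "mprod X A (\<lambda>x y. B x y - C x y) = (\<lambda>x y. mprod X A B x y - mprod X A C x y)"
  by (simp add: mprod_def right_diff_distrib sum_subtractf)

lemma mprod_diff_left: "mprod X (\<lambda>x y. B x y - C x y) A = (\<lambda>x y. mprod X B A x y - mprod X C A x y)"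
  by (simp add: mprod_def left_diff_distrib sum_subtractf)

lemma mprod_sum_left: "mprod X (\<lambda>x y. \<Sum>i\<in>I. a i * B i x y) A = (\<lambda>x y. \<Sum>i\<in>I. a i * mprod X (B i) A x y)"
proof (intro ext)
  fix x y
  show "mprod X (\<lambda>x y. \<Sum>i\<in>I. a i * B i x y) A x y = (\<Sum>i\<in>I. a i * mprod X (B i) A x y)"
    unfolding mprod_def sum_distrib_left sum_distrib_right
    by (subst sum.swap) (simp add: mult.assoc)
qed

lemma mprod_sum_right: "mprod X A (\<lambda>x y. \<Sum>i\<in>I. a i * B i x y) = (\<lambda>x y. \<Sum>i\<in>I. a i * mprod X A (B i) x y)"
proof (intro ext)
  fix x y
  show "mprod X A (\<lambda>x y. \<Sum>i\<in>I. a i * B i x y) x y = (\<Sum>i\<in>I. a i * mprod X A (B i) x y)"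
    unfolding mprod_def sum_distrib_left
    by (subst sum.swap) (simp add: mult.left_commute)
qed

lemma mprod_zero_right [simp]: "mprod X A (\<lambda>x y. 0) = (\<lambda>x y. 0)"
  by (simp add: mprod_def)

lemma adj_span_diff:
  assumes "A \<in> adj_span R n" "B \<in> adj_span R n"
  shows "(\<lambda>x y. A x y - B x y) \<in> adj_span R n"
proof -
  from assms obtain a b where "A = (\<lambda>x y. \<Sum>i\<le>n. a i * adj R i x y)" "B = (\<lambda>x y. \<Sum>i\<le>n. b i * adj R i x y)"
    by (auto simp: adj_span_def)
  then have "(\<lambda>x y. A x y - B x y) = (\<lambda>x y. \<Sum>i\<le>n. (a i - b i) * adj R i x y)"
    by (simp add: left_diff_distrib sum_subtractf)
  then show ?thesis by (auto simp: adj_span_def)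
qed

lemma adj_span_sum:
  fixes a :: "'i \<Rightarrow> real"
  assumes "\<And>i. i \<in> I \<Longrightarrow> B i \<in> adj_span R n"
  shows "(\<lambda>x y. \<Sum>i\<in>I. a i * B i x y) \<in> adj_span R n"
proof -
  have "\<forall>i\<in>I. \<exists>c. B i = (\<lambda>x y. \<Sum>j\<le>n. c j * adj R j x y)"
    using assms by (auto simp: adj_span_def)
  then obtain c where c: "\<And>i. i \<in> I \<Longrightarrow> B i = (\<lambda>x y. \<Sum>j\<le>n. c i j * adj R j x y)" by metis
  have "(\<lambda>x y. \<Sum>i\<in>I. a i * B i x y) = (\<lambda>x y. \<Sum>j\<le>n. (\<Sum>i\<in>I. a i * c i j) * adj R j x y)"
  proof (intro ext)
    fix x y
    have "(\<Sum>i\<in>I. a i * B i x y) = (\<Sum>i\<in>I. \<Sum>j\<le>n. a i * c i j * adj R j x y)"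
      by (rule sum.cong) (simp_all add: c sum_distrib_left mult.assoc)
    also have "\<dots> = (\<Sum>j\<le>n. \<Sum>i\<in>I. a i * c i j * adj R j x y)" by (rule sum.swap)
    finally show "(\<Sum>i\<in>I. a i * B i x y) = (\<Sum>j\<le>n. (\<Sum>i\<in>I. a i * c i j) * adj R j x y)"
      by (simp add: sum_distrib_right)
  qed
  then show ?thesis by (auto simp: adj_span_def)
qed

locale scheme =
  fixes X :: "'x set" and R :: "nat \<Rightarrow> ('x \<times> 'x) set" and n :: nat
  assumes scheme: "association_scheme X R n"
begin

lemma finite_X: "finite X" and R_nonempty: "i \<le> n \<Longrightarrow> R i \<noteq> {}"
  and R_sym: "i \<le> n \<Longrightarrow> sym (R i)" and R_cover: "(\<Union>i\<le>n. R i) = X \<times> X"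
  using scheme by (auto simp: association_scheme_def)

lemma R_disjoint: "i \<le> n \<Longrightarrow> j \<le> n \<Longrightarrow> e \<in> R i \<Longrightarrow> e \<in> R j \<Longrightarrow> i = j"
proof -
  have "\<forall>i\<le>n. \<forall>j\<le>n. i \<noteq> j \<longrightarrow> R i \<inter> R j = {}"
    using scheme by (simp add: association_scheme_def)
  then show "i \<le> n \<Longrightarrow> j \<le> n \<Longrightarrow> e \<in> R i \<Longrightarrow> e \<in> R j \<Longrightarrow> i = j" by blast
qed

lemma span_eval:
  assumes "(x, y) \<in> R k" "k \<le> n"
  shows "(\<Sum>i\<le>n. a i * adj R i x y) = a k"
proof -
  have "(\<Sum>i\<le>n. a i * adj R i x y) = (\<Sum>i\<le>n. if i = k then a k else 0)"
    using assms R_disjoint by (intro sum.cong) (auto simp: adj_def)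
  then show ?thesis using assms by simp
qed

lemma span_sym:
  assumes "A \<in> adj_span R n" shows "A x y = A y x"
proof -
  have "adj R i x y = adj R i y x" if "i \<le> n" for i
    using R_sym[OF that] by (auto simp: adj_def sym_def)
  then show ?thesis using assms by (auto simp: adj_span_def intro!: sum.cong)
qed

lemma adj_mprod_span:
  assumes "i \<le> n" "j \<le> n"
  shows "mprod X (adj R i) (adj R j) \<in> adj_span R n"
proof -
  have "\<exists>p :: nat \<Rightarrow> nat \<Rightarrow> nat \<Rightarrow> nat. \<forall>i\<le>n. \<forall>j\<le>n. \<forall>k\<le>n. \<forall>(x, y)\<in>R k.
        card {z \<in> X. (x, z) \<in> R i \<and> (z, y) \<in> R j} = p i j k"
    using scheme unfolding association_scheme_def by (elim conjE)
  then obtain p :: "nat \<Rightarrow> nat \<Rightarrow> nat \<Rightarrow> nat" where "\<forall>i\<le>n. \<forall>j\<le>n. \<forall>k\<le>n. \<forall>(x, y)\<in>R k.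
        card {z \<in> X. (x, z) \<in> R i \<and> (z, y) \<in> R j} = p i j k" ..
  with assms have p: "\<And>k x y. k \<le> n \<Longrightarrow> (x, y) \<in> R k \<Longrightarrow> card {z \<in> X. (x, z) \<in> R i \<and> (z, y) \<in> R j} = p i j k"
    by blast
  have "mprod X (adj R i) (adj R j) x y = (\<Sum>k\<le>n. real (p i j k) * adj R k x y)" for x y
  proof -
    have eq: "mprod X (adj R i) (adj R j) x y = real (card {z \<in> X. (x, z) \<in> R i \<and> (z, y) \<in> R j})"
    proof -
      have "mprod X (adj R i) (adj R j) x y = (\<Sum>z\<in>X. if (x, z) \<in> R i \<and> (z, y) \<in> R j then 1 else 0)"
        unfolding mprod_def adj_def by (rule sum.cong) auto
      then show ?thesis using finite_X by (simp flip: sum.inter_filter)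
    qed
    show ?thesis
    proof (cases "\<exists>k\<le>n. (x, y) \<in> R k")
      case True
      then obtain k where k: "k \<le> n" "(x, y) \<in> R k" by blast
      then show ?thesis unfolding eq span_eval[OF k(2,1)] by (simp add: p)
    next
      case False
      then have "x \<notin> X \<or> y \<notin> X" using R_cover by auto
      then have empty: "{z \<in> X. (x, z) \<in> R i \<and> (z, y) \<in> R j} = {}" using R_cover assms by blast
      show ?thesis unfolding eq empty using False by (auto simp: adj_def intro!: sum.neutral[symmetric])
    qed
  qed
  then have "mprod X (adj R i) (adj R j) = (\<lambda>x y. \<Sum>k\<le>n. real (p i j k) * adj R k x y)"
    by (intro ext)
  then show ?thesis unfolding adj_span_def by (intro CollectI exI)
qed

lemma span_mprod:
  assumes "A \<in> adj_span R n" "B \<in> adj_span R n"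
  shows "mprod X A B \<in> adj_span R n"
proof -
  from assms obtain a b where "A = (\<lambda>x y. \<Sum>i\<le>n. a i * adj R i x y)" "B = (\<lambda>x y. \<Sum>i\<le>n. b i * adj R i x y)"
    by (auto simp: adj_span_def)
  then show ?thesis
    by (auto simp: mprod_sum_left mprod_sum_right intro!: adj_span_sum adj_mprod_span)
qed

text \<open>Symmetric matrices whose product is symmetric commute.\<close>

lemma span_commute:
  assumes "A \<in> adj_span R n" "B \<in> adj_span R n"
  shows "mprod X A B = mprod X B A"
proof (intro ext)
  fix x y
  have "mprod X A B x y = mprod X A B y x" by (rule span_sym[OF span_mprod[OF assms]])
  also have "\<dots> = mprod X B A x y"
    unfolding mprod_def by (rule sum.cong) (simp_all add: span_sym[OF assms(1), of y] span_sym[OF assms(2), of _ x])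
  finally show "mprod X A B x y = mprod X B A x y" .
qed

text \<open>Otherwise \<open>mprod X E F\<close> and its complement in \<open>E\<close> would split
  \<open>E\<close> into two orthogonal nonzero idempotents.\<close>

lemma primitive_mprod:
  assumes E: "primitive_idempotent X R n E" and F: "nonzero_idempotent X R n F"
  shows "mprod X E F = (\<lambda>x y. 0) \<or> mprod X E F = E"
proof (rule ccontr)
  let ?G = "mprod X E F" and ?H = "\<lambda>x y. E x y - mprod X E F x y"
  assume neg: "\<not> ?thesis"
  have span: "E \<in> adj_span R n" "F \<in> adj_span R n"
    and idem: "mprod X E E = E" "mprod X F F = F"
    using E F by (auto simp: primitive_idempotent_def nonzero_idempotent_def)
  have G: "?G \<in> adj_span R n" by (rule span_mprod[OF span])
  have H: "?H \<in> adj_span R n" by (rule adj_span_diff[OF span(1) G])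
  have EG: "mprod X E ?G = ?G" using idem by (simp flip: mprod_assoc)
  have GG: "mprod X ?G ?G = ?G"
  proof -
    have "mprod X F ?G = mprod X (mprod X F F) E"
      unfolding mprod_assoc by (simp only: span_commute[OF span])
    then have "mprod X F ?G = ?G" by (simp only: idem span_commute[OF span])
    then show ?thesis by (simp only: mprod_assoc EG)
  qed
  have GE: "mprod X ?G E = ?G" using EG span_commute[OF G span(1)] by simp
  have GH: "mprod X ?G ?H = (\<lambda>x y. 0)" by (simp add: mprod_diff_right GE GG)
  then have HG: "mprod X ?H ?G = (\<lambda>x y. 0)" using span_commute[OF G H] by simp
  have HH: "mprod X ?H ?H = ?H" by (simp add: mprod_diff_right mprod_diff_left idem EG GE GG)
  have "?H \<noteq> (\<lambda>x y. 0)"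
  proof
    assume "?H = (\<lambda>x y. 0)"
    then have "E x y - ?G x y = 0" for x y by (rule fun_cong[THEN fun_cong])
    then have "?G = E" by (intro ext) simp
    with neg show False by blast
  qed
  then have "nonzero_idempotent X R n ?H" "nonzero_idempotent X R n ?G"
    using G H GG HH neg by (auto simp: nonzero_idempotent_def)
  moreover have "E = (\<lambda>x y. ?G x y + ?H x y)" by simp
  ultimately show False using E GH HG unfolding primitive_idempotent_def by blast
qed

lemma primitive_eq:
  assumes "primitive_idempotent X R n E" "primitive_idempotent X R n F"
    and "mprod X E F \<noteq> (\<lambda>x y. 0)"
  shows "E = F"
proof -
  have "E \<in> adj_span R n" "F \<in> adj_span R n" "nonzero_idempotent X R n E" "nonzero_idempotent X R n F"
    using assms by (auto simp: primitive_idempotent_def nonzero_idempotent_def)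
  then show ?thesis
    using primitive_mprod[OF assms(1), of F] primitive_mprod[OF assms(2), of E] assms(3) span_commute[of E F] by simp
qed

text \<open>If all products of \<open>F\<close> with basis members vanished, expanding one factor of
  \<open>mprod X F F = F\<close> in the basis would give \<open>F = 0\<close>.\<close>

lemma primitive_in_basis:
  assumes E: "idempotent_basis X R n E" and F: "primitive_idempotent X R n F"
  obtains k where "k \<le> n" "F = E k"
proof -
  have F': "F \<in> adj_span R n" "mprod X F F = F" "F \<noteq> (\<lambda>x y. 0)"
    using F by (auto simp: primitive_idempotent_def nonzero_idempotent_def)
  then obtain a where a: "F = (\<lambda>x y. \<Sum>k\<le>n. a k * E k x y)"
    using E unfolding idempotent_basis_def by blast
  have "\<exists>k\<le>n. mprod X F (E k) \<noteq> (\<lambda>x y. 0)"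
  proof (rule ccontr)
    assume "\<not> ?thesis"
    then have "mprod X F (\<lambda>x y. \<Sum>k\<le>n. a k * E k x y) = (\<lambda>x y. 0)"
      unfolding mprod_sum_right by simp
    with F' show False unfolding a[symmetric] by simp
  qed
  then obtain k where "k \<le> n" "mprod X F (E k) \<noteq> (\<lambda>x y. 0)" by blast
  moreover from this have "primitive_idempotent X R n (E k)" using E by (auto simp: idempotent_basis_def)
  ultimately show ?thesis using primitive_eq[OF F] that by blast
qed

text \<open>Two equal members at different indices would give two different unit coefficient vectors
  for one matrix.\<close>

lemma basis_inj:
  assumes E: "idempotent_basis X R n E"
  shows "inj_on E {..n}"
proof (rule inj_onI)
  fix k l assume kl: "k \<in> {..n}" "l \<in> {..n}" "E k = E l"
  then have "E k \<in> adj_span R n"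
    using E by (auto simp: idempotent_basis_def primitive_idempotent_def nonzero_idempotent_def)
  then have ex1: "\<exists>!a. (\<forall>k>n. a k = 0) \<and> E k = (\<lambda>x y. \<Sum>k\<le>n. a k * E k x y)"
    using E by (auto simp: idempotent_basis_def)
  have rep: "(\<forall>j>n. (if j = m then 1 else 0 :: real) = 0) \<and>
      E m = (\<lambda>x y. \<Sum>j\<le>n. (if j = m then 1 else 0) * E j x y)" if "m \<le> n" for m
    using that by (auto simp: if_distrib[of "\<lambda>c. c * _"] cong: if_cong)
  have unique: "\<exists>!a. P a \<Longrightarrow> P f \<Longrightarrow> P g \<Longrightarrow> f = g" for P :: "(nat \<Rightarrow> real) \<Rightarrow> bool" and f g
    unfolding ex1_iff_ex_Uniq by (elim conjE) (rule Uniq_D)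
  have "(\<lambda>j. if j = k then 1 else 0 :: real) = (\<lambda>j. if j = l then 1 else 0)"
  proof (rule unique[OF ex1])
    show "(\<forall>j>n. (if j = k then 1 else 0 :: real) = 0) \<and>
        E k = (\<lambda>x y. \<Sum>j\<le>n. (if j = k then 1 else 0) * E j x y)" by (rule rep) (use kl in simp)
    show "(\<forall>j>n. (if j = l then 1 else 0 :: real) = 0) \<and>
        E k = (\<lambda>x y. \<Sum>j\<le>n. (if j = l then 1 else 0) * E j x y)" unfolding kl(3) by (rule rep) (use kl in simp)
  qed
  then show "k = l" by (metis zero_neq_one)
qed

lemma basis_permutation:
  assumes E: "idempotent_basis X R n E" and E': "idempotent_basis X R n E'"
  obtains \<sigma> where "bij_betw \<sigma> {1..n} {1..n}" "\<And>k. k \<le> n \<Longrightarrow> E' k = E (\<sigma> k)"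
proof -
  have "\<exists>j. j \<le> n \<and> E' k = E j" if "k \<le> n" for k
  proof -
    have "primitive_idempotent X R n (E' k)" using E' that by (simp add: idempotent_basis_def)
    then obtain j where "j \<le> n" "E' k = E j" by (rule primitive_in_basis[OF E])
    then show ?thesis by blast
  qed
  then obtain \<sigma> where \<sigma>: "\<And>k. k \<le> n \<Longrightarrow> \<sigma> k \<le> n" "\<And>k. k \<le> n \<Longrightarrow> E' k = E (\<sigma> k)" by metis
  have inj: "inj_on \<sigma> {..n}"
    using basis_inj[OF E'] \<sigma> by (auto simp: inj_on_def)
  \<comment> \<open>Index 0 is fixed because \<open>idempotent_basis\<close> prescribes
    \<open>E 0\<close>; hence the permutation acts on \<open>1..n\<close>, the indices of the
    constraints.\<close>
  have "E 0 = E' 0" using E E' by (simp add: idempotent_basis_def)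
  then have "E (\<sigma> 0) = E 0" using \<sigma>(2)[of 0] by simp
  then have "\<sigma> 0 = 0" using basis_inj[OF E] \<sigma>(1)[of 0] by (auto dest: inj_onD)
  have "\<sigma> k \<in> {1..n}" if "k \<in> {1..n}" for k
  proof -
    have "\<sigma> k \<noteq> \<sigma> 0" using inj that by (auto dest: inj_onD)
    then show ?thesis using \<sigma>(1)[of k] that \<open>\<sigma> 0 = 0\<close> by simp
  qed
  then have "\<sigma> ` {1..n} \<subseteq> {1..n}" by blast
  moreover have "inj_on \<sigma> {1..n}" using inj by (rule inj_on_subset) auto
  ultimately have "bij_betw \<sigma> {1..n} {1..n}"
    by (simp add: bij_betw_def endo_inj_surj)
  then show ?thesis using that \<sigma>(2) by blast
qed

lemma Q_numbers_permutation:
  assumes "PQ_numbers X R n P Q" "PQ_numbers X R n P' Q'"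
  obtains \<sigma> where "bij_betw \<sigma> {1..n} {1..n}" "\<And>k i. 1 \<le> k \<Longrightarrow> k \<le> n \<Longrightarrow> i \<le> n \<Longrightarrow> Q' k i = Q (\<sigma> k) i"
proof -
  obtain E E' where E: "idempotent_basis X R n E" "\<And>k. k \<le> n \<Longrightarrow> E k = (\<lambda>x y. 1 / real (card X) * (\<Sum>i\<le>n. Q k i * adj R i x y))"
    and E': "idempotent_basis X R n E'" "\<And>k. k \<le> n \<Longrightarrow> E' k = (\<lambda>x y. 1 / real (card X) * (\<Sum>i\<le>n. Q' k i * adj R i x y))"
    using assms unfolding PQ_numbers_def by blast
  obtain \<sigma> where \<sigma>: "bij_betw \<sigma> {1..n} {1..n}" "\<And>k. k \<le> n \<Longrightarrow> E' k = E (\<sigma> k)"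
    using basis_permutation[OF E(1) E'(1)] by blast
  have "Q' k i = Q (\<sigma> k) i" if k: "1 \<le> k" "k \<le> n" and i: "i \<le> n" for k i
  proof -
    obtain x y where xy: "(x, y) \<in> R i" using R_nonempty[OF i] by auto
    then have "x \<in> X" using R_cover i by blast
    then have "card X \<noteq> 0" using finite_X by auto
    moreover have "\<sigma> k \<le> n" using bij_betwE[OF \<sigma>(1)] k by auto
    then have "E' k x y = E (\<sigma> k) x y" "E (\<sigma> k) x y = 1 / real (card X) * Q (\<sigma> k) i"
      using \<sigma>(2)[OF k(2)] E(2) span_eval[OF xy i] by auto
    moreover have "E' k x y = 1 / real (card X) * Q' k i"
      using E'(2)[OF k(2)] span_eval[OF xy i] by simp
    ultimately show ?thesis by simp
  qed
  with \<sigma>(1) show ?thesis using that by blast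
qed

lemma lp_optimum_order_irrelevant:
  assumes "PQ_numbers X R n P Q" "PQ_numbers X R n P' Q'" "lp_optimum n Q d v"
  shows "lp_optimum n Q' d v"
proof -
  obtain \<sigma> where \<sigma>: "bij_betw \<sigma> {1..n} {1..n}"
    and Q: "\<And>k i. 1 \<le> k \<Longrightarrow> k \<le> n \<Longrightarrow> i \<le> n \<Longrightarrow> Q' k i = Q (\<sigma> k) i"
    using Q_numbers_permutation[OF assms(1,2)] by blast
  have "lp_feasible n Q' d x \<longleftrightarrow> lp_feasible n Q d x" for x
  proof -
    have "(\<forall>k\<in>{1..n}. (\<Sum>i\<le>n. Q' k i * x i) \<ge> 0) \<longleftrightarrow> (\<forall>k\<in>{1..n}. (\<Sum>i\<le>n. Q (\<sigma> k) i * x i) \<ge> 0)"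
      by (intro ball_cong refl) (simp add: Q)
    also have "\<dots> \<longleftrightarrow> (\<forall>k\<in>\<sigma> ` {1..n}. (\<Sum>i\<le>n. Q k i * x i) \<ge> 0)" by simp
    also have "\<sigma> ` {1..n} = {1..n}" using \<sigma> by (simp add: bij_betw_def)
    finally show ?thesis unfolding lp_feasible_def by simp
  qed
  then show ?thesis using assms(3) unfolding lp_optimum_def by simp
qed

lemma LP_equals_iff:
  assumes "PQ_numbers X R n P Q"
  shows "LP_equals X R n d v \<longleftrightarrow> lp_optimum n Q d v"
  using assms lp_optimum_order_irrelevant unfolding LP_equals_def by blast

end

text \<open>The schemes share one array \<open>Q\<close>, and for each of them
  \<open>LP_equals_iff\<close> lets the value be tested on any admissible order of the
  idempotents.\<close>

lemma LP_equals_same_PQ: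
  assumes X: "association_scheme X R n" and Y: "association_scheme Y S n"
    and PQ: "same_PQ_numbers X R Y S n" and LP: "LP_equals X R n d v"
  shows "LP_equals Y S n d v"
proof -
  interpret X: scheme X R n by unfold_locales (rule X)
  interpret Y: scheme Y S n by unfold_locales (rule Y)
  from PQ obtain P Q where "PQ_numbers X R n P Q" "PQ_numbers Y S n P Q"
    by (auto simp: same_PQ_numbers_def)
  then show ?thesis using LP X.LP_equals_iff Y.LP_equals_iff by blast
qed

section \<open>Translation schemes\<close>

text \<open>The laws are relative to the carrier because matrices of all sizes share one type. The
  symmetric nondegenerate pairing \<open>pr\<close> identifies the group with its character
  group.\<close>

locale self_dual_group =
  fixes X :: "'m::{plus,minus} set" and z :: 'm and pr :: "'m \<Rightarrow> 'm \<Rightarrow> complex"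
  assumes finite_X: "finite X" and zero_in: "z \<in> X"
    and add_in: "A \<in> X \<Longrightarrow> B \<in> X \<Longrightarrow> A + B \<in> X"
    and minus_in: "A \<in> X \<Longrightarrow> B \<in> X \<Longrightarrow> A - B \<in> X"
    and minus_add: "A \<in> X \<Longrightarrow> B \<in> X \<Longrightarrow> A - B + B = A"
    and add_minus: "A \<in> X \<Longrightarrow> B \<in> X \<Longrightarrow> A + B - B = A"
    and minus_eq_zero: "A \<in> X \<Longrightarrow> B \<in> X \<Longrightarrow> A - B = z \<longleftrightarrow> A = B"
    and minus_zero: "A \<in> X \<Longrightarrow> A - z = A"
    and pr_sym: "A \<in> X \<Longrightarrow> B \<in> X \<Longrightarrow> pr A B = pr B A"
    and pr_ne_0: "A \<in> X \<Longrightarrow> B \<in> X \<Longrightarrow> pr A B \<noteq> 0"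
    and pr_add: "A \<in> X \<Longrightarrow> B \<in> X \<Longrightarrow> C \<in> X \<Longrightarrow> pr (A + B) C = pr A C * pr B C"
    and pr_nondegenerate: "A \<in> X \<Longrightarrow> A \<noteq> z \<Longrightarrow> \<exists>B\<in>X. pr A B \<noteq> 1"
begin

lemma pr_minus: "A \<in> X \<Longrightarrow> B \<in> X \<Longrightarrow> C \<in> X \<Longrightarrow> pr (A - B) C = pr A C / pr B C"
  using pr_add[of "A - B" B C] minus_in[of A B] minus_add[of A B] pr_ne_0[of B C] by (simp add: field_simps)

lemma pr_zero: "B \<in> X \<Longrightarrow> pr z B = 1"
  using pr_minus[of z z B] minus_zero zero_in pr_ne_0[of z B] by simp

lemma sum_shift:
  assumes "B \<in> X" shows "(\<Sum>A\<in>X. f (A + B)) = (\<Sum>A\<in>X. f A)"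
  by (rule sum.reindex_bij_witness[where i = "\<lambda>A. A - B" and j = "\<lambda>A. A + B"])
    (use assms add_in minus_in minus_add add_minus in auto)

lemma sum_pr:
  assumes A: "A \<in> X"
  shows "(\<Sum>B\<in>X. pr A B) = (if A = z then of_nat (card X) else 0)"
proof (cases "A = z")
  case False
  then obtain B where B: "B \<in> X" "pr A B \<noteq> 1" using pr_nondegenerate A by blast
  have "(\<Sum>C\<in>X. pr A C) = (\<Sum>C\<in>X. pr A (C + B))" by (rule sum_shift[OF B(1), symmetric])
  also have "\<dots> = (\<Sum>C\<in>X. pr A C * pr A B)"
    by (rule sum.cong) (use A B pr_add add_in in \<open>auto simp: pr_sym[of A]\<close>)
  also have "\<dots> = (\<Sum>C\<in>X. pr A C) * pr A B" by (rule sum_distrib_right[symmetric])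
  finally show ?thesis using B False by simp
qed (simp add: pr_zero)

lemma sum_pr_quotient:
  assumes "A \<in> X" "B \<in> X"
  shows "(\<Sum>C\<in>X. pr A C / pr B C) = (if A = B then of_nat (card X) else 0)"
proof -
  have "(\<Sum>C\<in>X. pr A C / pr B C) = (\<Sum>C\<in>X. pr (A - B) C)"
    by (rule sum.cong) (use assms pr_minus in auto)
  then show ?thesis using sum_pr[OF minus_in[OF assms]] minus_eq_zero[OF assms] by simp
qed

end

text \<open>By \<open>eigenvalue\<close> the sum of a character over a rank class depends only on
  the rank of the label of the character. Ranks therefore index the relations as well as the
  eigenspaces, and one array serves for both the \<open>P\<close>- and the \<open>Q\<close>-numbers
  (see \<open>PQ\<close>).\<close>

locale rank_scheme = self_dual_group X z pr
  for X :: "'m::{plus,minus} set" and z and pr +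
  fixes rk :: "'m \<Rightarrow> nat" and n :: nat and Q :: "nat \<Rightarrow> nat \<Rightarrow> real"
  assumes rk_le: "A \<in> X \<Longrightarrow> rk A \<le> n"
    and rk_zero: "A \<in> X \<Longrightarrow> rk A = 0 \<longleftrightarrow> A = z"
    and rk_minus: "A \<in> X \<Longrightarrow> B \<in> X \<Longrightarrow> rk (A - B) = rk (B - A)"
    and eigenvalue: "k \<le> n \<Longrightarrow> A \<in> X \<Longrightarrow> (\<Sum>B\<in>{B \<in> X. rk B = k}. pr A B) = of_real (Q k (rk A))"
    and valency: "k \<le> n \<Longrightarrow> Q k 0 \<noteq> 0"
begin

definition Rel :: "nat \<Rightarrow> ('m \<times> 'm) set" where
  "Rel i = {(A, B). A \<in> X \<and> B \<in> X \<and> rk (A - B) = i}"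

text \<open>The projection onto the span of the characters labelled by elements of rank
  \<open>k\<close>. Its kernel is the normalised sum of \<open>pr (A - B) M\<close> over such
  \<open>M\<close>, which \<open>eigenvalue\<close> evaluates to this expression.\<close>

definition E :: "nat \<Rightarrow> 'm \<Rightarrow> 'm \<Rightarrow> real" where
  "E k A B = (if A \<in> X \<and> B \<in> X then Q k (rk (A - B)) / card X else 0)"

lemma card_X: "card X \<noteq> 0"
  using finite_X zero_in by auto

lemma rk_z: "rk z = 0"
  using rk_zero zero_in by blast

lemma sum_by_rank:
  fixes f :: "'m \<Rightarrow> complex"
  shows "(\<Sum>k\<le>n. \<Sum>B\<in>{B \<in> X. rk B = k}. f B) = (\<Sum>B\<in>X. f B)"
  by (rule sum.group) (use finite_X rk_le in auto)

lemma E_mprod: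
  assumes k: "k \<le> n" and l: "l \<le> n"
  shows "mprod X (E k) (E l) = (if k = l then E k else (\<lambda>A B. 0))"
proof (intro ext)
  fix A B
  let ?L = "\<lambda>k. {M \<in> X. rk M = k}"
  show "mprod X (E k) (E l) A B = (if k = l then E k else (\<lambda>A B. 0)) A B"
  proof (cases "A \<in> X \<and> B \<in> X")
    case False
    then show ?thesis by (auto simp: mprod_def E_def)
  next
    case True
    have "complex_of_real (\<Sum>C\<in>X. Q k (rk (A - C)) * Q l (rk (C - B))) =
        (\<Sum>C\<in>X. (\<Sum>M\<in>?L k. pr (A - C) M) * (\<Sum>N\<in>?L l. pr (C - B) N))"
      using True k l by (simp add: eigenvalue minus_in)
    also have "\<dots> = (\<Sum>C\<in>X. \<Sum>M\<in>?L k. \<Sum>N\<in>?L l. pr A M / pr B N * (pr N C / pr M C))"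
      unfolding sum_product
      by (intro sum.cong refl) (use True in \<open>auto simp: pr_minus pr_sym[of _ "_ :: 'm"] field_simps\<close>)
    also have "\<dots> = (\<Sum>M\<in>?L k. \<Sum>N\<in>?L l. \<Sum>C\<in>X. pr A M / pr B N * (pr N C / pr M C))"
      by (subst sum.swap, rule sum.cong[OF refl], rule sum.swap)
    also have "\<dots> = (\<Sum>M\<in>?L k. \<Sum>N\<in>?L l. if N = M then pr A M / pr B M * of_nat (card X) else 0)"
      unfolding sum_distrib_left[symmetric] by (intro sum.cong refl) (auto simp: sum_pr_quotient)
    also have "\<dots> = (\<Sum>M\<in>?L k. if l = k then pr A M / pr B M * of_nat (card X) else 0)"
      using finite_X by (intro sum.cong refl) auto
    also have "\<dots> = (if l = k then of_nat (card X) * (\<Sum>M\<in>?L k. pr (A - B) M) else 0)"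
      using True by (auto simp: pr_minus sum_distrib_left mult.commute intro!: sum.cong)
    also have "\<dots> = complex_of_real (if l = k then card X * Q k (rk (A - B)) else 0)"
      using True k by (simp add: eigenvalue minus_in)
    finally have "(\<Sum>C\<in>X. Q k (rk (A - C)) * Q l (rk (C - B))) = (if l = k then card X * Q k (rk (A - B)) else 0)"
      by (simp only: of_real_eq_iff)
    moreover have "mprod X (E k) (E l) A B = (\<Sum>C\<in>X. Q k (rk (A - C)) * Q l (rk (C - B))) / (card X * card X)"
      using True by (simp add: mprod_def E_def sum_divide_distrib)
    ultimately show ?thesis using True card_X by (simp add: E_def)
  qed
qed

lemma adj_eq:
  assumes i: "i \<le> n"
  shows "adj Rel i = (\<lambda>A B. \<Sum>k\<le>n. Q i k * E k A B)"
proof (intro ext)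
  fix A B
  let ?L = "\<lambda>k. {M \<in> X. rk M = k}"
  show "adj Rel i A B = (\<Sum>k\<le>n. Q i k * E k A B)"
  proof (cases "A \<in> X \<and> B \<in> X")
    case False
    then show ?thesis by (auto simp: adj_def Rel_def E_def)
  next
    case True
    define D where "D = A - B"
    \<comment> \<open>Passing from \<open>D\<close> to \<open>z - D\<close> inverts the characters
      without changing the rank; this produces the quotients to which orthogonality applies.\<close>
    have D: "D \<in> X" "rk (z - D) = rk D"
      using True zero_in minus_in rk_minus[of z D] minus_zero by (auto simp: D_def)
    have "complex_of_real (\<Sum>k\<le>n. Q i k * Q k (rk D)) = (\<Sum>k\<le>n. of_real (Q i k) * (\<Sum>M\<in>?L k. pr (z - D) M))"
      using D zero_in minus_in by (simp add: eigenvalue)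
    also have "\<dots> = (\<Sum>k\<le>n. \<Sum>M\<in>?L k. of_real (Q i (rk M)) * (1 / pr D M))"
      unfolding sum_distrib_left
      by (intro sum.cong refl) (use D zero_in in \<open>auto simp: pr_minus pr_zero\<close>)
    also have "\<dots> = (\<Sum>M\<in>X. of_real (Q i (rk M)) * (1 / pr D M))" by (rule sum_by_rank)
    also have "\<dots> = (\<Sum>M\<in>X. \<Sum>N\<in>?L i. pr N M / pr D M)"
      by (rule sum.cong) (use i in \<open>auto simp: eigenvalue[symmetric] sum_distrib_right sum_divide_distrib pr_sym intro!: sum.cong\<close>)
    also have "\<dots> = (\<Sum>N\<in>?L i. \<Sum>M\<in>X. pr N M / pr D M)" by (rule sum.swap)
    also have "\<dots> = (\<Sum>N\<in>?L i. if N = D then of_nat (card X) else 0)"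
      by (intro sum.cong refl) (use D in \<open>auto simp: sum_pr_quotient\<close>)
    also have "\<dots> = complex_of_real (if rk D = i then card X else 0)"
      using finite_X D by auto
    finally have "(\<Sum>k\<le>n. Q i k * Q k (rk D)) = (if rk D = i then card X else 0)"
      by (simp only: of_real_eq_iff)
    moreover have "(\<Sum>k\<le>n. Q i k * E k A B) = (\<Sum>k\<le>n. Q i k * Q k (rk D)) / card X"
      using True by (simp add: E_def D_def sum_divide_distrib)
    ultimately show ?thesis using True card_X by (simp add: adj_def Rel_def D_def)
  qed
qed

lemma Rel_eval:
  "(\<Sum>i\<le>n. a i * adj Rel i A B) = (if A \<in> X \<and> B \<in> X then a (rk (A - B)) else 0)"
proof (cases "A \<in> X \<and> B \<in> X")
  case True
  then have "(\<Sum>i\<le>n. a i * adj Rel i A B) = (\<Sum>i\<le>n. if i = rk (A - B) then a i else 0)"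
    by (intro sum.cong) (auto simp: adj_def Rel_def)
  then show ?thesis using True rk_le minus_in by simp
next
  case False
  then have "adj Rel i A B = 0" for i by (auto simp: adj_def Rel_def)
  then show ?thesis using False by auto
qed

lemma E_eq: "k \<le> n \<Longrightarrow> E k = (\<lambda>A B. 1 / real (card X) * (\<Sum>i\<le>n. Q k i * adj Rel i A B))"
  unfolding Rel_eval by (auto simp: E_def fun_eq_iff)

lemma E_diag: "A \<in> X \<Longrightarrow> E k A A = Q k 0 / card X"
  using minus_eq_zero[of A A] rk_z by (simp add: E_def)

lemma sum_E_mprod:
  assumes "l \<le> n"
  shows "mprod X (\<lambda>A B. \<Sum>k\<le>n. a k * E k A B) (E l) = (\<lambda>A B. a l * E l A B)"
proof (intro ext)
  fix A B
  have "mprod X (\<lambda>A B. \<Sum>k\<le>n. a k * E k A B) (E l) A B = (\<Sum>k\<le>n. if k = l then a l * E l A B else 0)"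
    unfolding mprod_sum_left by (rule sum.cong) (auto simp: E_mprod assms)
  then show "mprod X (\<lambda>A B. \<Sum>k\<le>n. a k * E k A B) (E l) A B = a l * E l A B" using assms by simp
qed

lemma E_coeff_unique:
  assumes "(\<lambda>A B. \<Sum>k\<le>n. a k * E k A B) = (\<lambda>A B. \<Sum>k\<le>n. c k * E k A B)" "l \<le> n"
  shows "a l = c l"
proof -
  have "(\<lambda>A B. a l * E l A B) = (\<lambda>A B. c l * E l A B)"
    using assms sum_E_mprod[OF assms(2), of a] sum_E_mprod[OF assms(2), of c] by simp
  then have "a l * E l z z = c l * E l z z" by (rule fun_cong[THEN fun_cong])
  then show ?thesis using E_diag[OF zero_in] valency[OF assms(2)] card_X by simp
qed

lemma sum_E_mprod_sum:
  "mprod X (\<lambda>A B. \<Sum>k\<le>n. a k * E k A B) (\<lambda>A B. \<Sum>k\<le>n. c k * E k A B) =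
   (\<lambda>A B. \<Sum>k\<le>n. (a k * c k) * E k A B)"
proof (intro ext)
  fix A B
  show "mprod X (\<lambda>A B. \<Sum>k\<le>n. a k * E k A B) (\<lambda>A B. \<Sum>k\<le>n. c k * E k A B) A B =
      (\<Sum>k\<le>n. (a k * c k) * E k A B)"
    unfolding mprod_sum_right by (rule sum.cong) (auto simp: sum_E_mprod mult_ac)
qed

lemma span_E:
  assumes "M \<in> adj_span Rel n"
  obtains a where "M = (\<lambda>A B. \<Sum>k\<le>n. a k * E k A B)"
proof -
  from assms obtain m where M: "M = (\<lambda>A B. \<Sum>i\<le>n. m i * adj Rel i A B)" by (auto simp: adj_span_def)
  have "M A B = (\<Sum>k\<le>n. (\<Sum>i\<le>n. m i * Q i k) * E k A B)" for A B
  proof -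
    have "M A B = (\<Sum>i\<le>n. \<Sum>k\<le>n. m i * Q i k * E k A B)"
      unfolding M by (rule sum.cong) (auto simp: adj_eq sum_distrib_left mult.assoc)
    also have "\<dots> = (\<Sum>k\<le>n. \<Sum>i\<le>n. m i * Q i k * E k A B)" by (rule sum.swap)
    finally show ?thesis by (simp add: sum_distrib_right)
  qed
  then have "M = (\<lambda>A B. \<Sum>k\<le>n. (\<Sum>i\<le>n. m i * Q i k) * E k A B)" by (intro ext)
  then show ?thesis by (rule that)
qed

lemma E_in_span: "k \<le> n \<Longrightarrow> E k \<in> adj_span Rel n"
proof -
  assume "k \<le> n"
  have "E k = (\<lambda>A B. \<Sum>i\<le>n. (Q k i / real (card X)) * adj Rel i A B)"
    unfolding E_eq[OF \<open>k \<le> n\<close>] by (simp add: sum_divide_distrib)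
  then show ?thesis unfolding adj_span_def by (intro CollectI exI)
qed

lemma E_unit: "m \<le> n \<Longrightarrow> E m = (\<lambda>A B. \<Sum>k\<le>n. (if k = m then 1 else 0) * E k A B)"
  by (auto simp: if_distrib[of "\<lambda>c. c * _"] cong: if_cong)

text \<open>In the coordinates given by \<open>E\<close> idempotents have entries 0 and 1.
  Orthogonal idempotents with sum \<open>E k\<close> are supported on the index \<open>k\<close>
  alone, and one of them vanishes there.\<close>

lemma E_primitive:
  assumes k: "k \<le> n"
  shows "primitive_idempotent X Rel n (E k)"
proof -
  have "E k z z \<noteq> 0" using E_diag[OF zero_in] valency[OF k] card_X by simp
  then have "E k \<noteq> (\<lambda>A B. 0)" by metis
  then have "nonzero_idempotent X Rel n (E k)"
    using E_in_span[OF k] E_mprod[OF k k] by (simp add: nonzero_idempotent_def)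
  moreover have False
    if F: "nonzero_idempotent X Rel n F" and G: "nonzero_idempotent X Rel n G"
      and FG: "mprod X F G = (\<lambda>A B. 0)" and sum: "E k = (\<lambda>A B. F A B + G A B)" for F G
  proof -
    obtain a where a: "F = (\<lambda>A B. \<Sum>l\<le>n. a l * E l A B)" using F span_E by (auto simp: nonzero_idempotent_def)
    obtain c where c: "G = (\<lambda>A B. \<Sum>l\<le>n. c l * E l A B)" using G span_E by (auto simp: nonzero_idempotent_def)
    have aa: "a l * a l = a l" and cc: "c l * c l = c l" and ac: "a l * c l = 0" if "l \<le> n" for l
    proof -
      have "mprod X F F = F" using F by (simp add: nonzero_idempotent_def)
      then show "a l * a l = a l" unfolding a sum_E_mprod_sum by (rule E_coeff_unique[OF _ that])
      have "mprod X G G = G" using G by (simp add: nonzero_idempotent_def)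
      then show "c l * c l = c l" unfolding c sum_E_mprod_sum by (rule E_coeff_unique[OF _ that])
      show "a l * c l = 0"
        by (rule E_coeff_unique[where c = "\<lambda>_. 0", OF _ that]) (use FG in \<open>simp add: a c sum_E_mprod_sum\<close>)
    qed
    have sum': "a l + c l = (if l = k then 1 else 0)" if "l \<le> n" for l
    proof (rule E_coeff_unique[OF _ that])
      show "(\<lambda>A B. \<Sum>l\<le>n. (a l + c l) * E l A B) = (\<lambda>A B. \<Sum>l\<le>n. (if l = k then 1 else 0) * E l A B)"
        unfolding E_unit[OF k, symmetric] sum by (simp add: a c distrib_right sum.distrib)
    qed
    have zero: "a l = 0 \<and> c l = 0" if "l \<le> n" "l \<noteq> k" for l
      using aa[OF that(1)] cc[OF that(1)] ac[OF that(1)] sum'[OF that(1)] that(2) by auto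
    have "a k = 0 \<or> c k = 0" using ac[OF k] by auto
    then show False
    proof
      assume "a k = 0"
      then have "a l = 0" if "l \<le> n" for l using zero that by blast
      then have "F = (\<lambda>A B. 0)" by (simp add: a)
      then show False using F by (simp add: nonzero_idempotent_def)
    next
      assume "c k = 0"
      then have "c l = 0" if "l \<le> n" for l using zero that by blast
      then have "G = (\<lambda>A B. 0)" by (simp add: c)
      then show False using G by (simp add: nonzero_idempotent_def)
    qed
  qed
  ultimately show ?thesis unfolding primitive_idempotent_def by blast
qed

lemma E_0: "E 0 = (\<lambda>A B. if A \<in> X \<and> B \<in> X then 1 / real (card X) else 0)"
proof -
  have "Q 0 (rk A) = 1" if "A \<in> X" for A
  proof -
    have "{B \<in> X. rk B = 0} = {z}" using rk_zero zero_in by auto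
    then have "complex_of_real (Q 0 (rk A)) = of_real 1"
      using eigenvalue[of 0 A] that pr_zero pr_sym[of A z] zero_in by simp
    then show ?thesis by (simp only: of_real_eq_iff)
  qed
  then show ?thesis by (auto simp: E_def minus_in fun_eq_iff)
qed

lemma PQ: "PQ_numbers X Rel n Q Q"
proof -
  have "\<exists>!a. (\<forall>k>n. a k = 0) \<and> M = (\<lambda>A B. \<Sum>k\<le>n. a k * E k A B)" if M: "M \<in> adj_span Rel n" for M
  proof -
    obtain a where a: "M = (\<lambda>A B. \<Sum>k\<le>n. a k * E k A B)" by (rule span_E[OF M])
    show ?thesis
    proof (rule ex1I)
      show "(\<forall>k>n. (if k \<le> n then a k else 0) = 0) \<and>
          M = (\<lambda>A B. \<Sum>k\<le>n. (if k \<le> n then a k else 0) * E k A B)" by (simp add: a)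
      fix c :: "nat \<Rightarrow> real"
      assume c: "(\<forall>k>n. c k = 0) \<and> M = (\<lambda>A B. \<Sum>k\<le>n. c k * E k A B)"
      have "c k = (if k \<le> n then a k else 0)" for k
        using c E_coeff_unique[of c a k] a by (cases "k \<le> n") auto
      then show "c = (\<lambda>k. if k \<le> n then a k else 0)" by (intro ext)
    qed
  qed
  then have "idempotent_basis X Rel n E"
    using E_0 E_primitive by (simp add: idempotent_basis_def)
  then show ?thesis unfolding PQ_numbers_def using adj_eq E_eq by blast
qed

lemma association_scheme: "association_scheme X Rel n"
proof -
  have "(\<Union>i\<le>n. Rel i) = X \<times> X" using rk_le minus_in by (auto simp: Rel_def)
  moreover have "Rel i \<noteq> {}" if "i \<le> n" for i
  proof -
    have "complex_of_real (Q i 0) \<noteq> 0" using valency[OF that] by simp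
    then have "{B \<in> X. rk B = i} \<noteq> {}"
      using eigenvalue[OF that zero_in] rk_z by (metis (no_types) sum.empty)
    then obtain B where "B \<in> X" "rk B = i" by blast
    then have "(B, z) \<in> Rel i" using zero_in minus_zero by (simp add: Rel_def)
    then show ?thesis by blast
  qed
  moreover have "Rel 0 = Id_on X" using rk_zero minus_in minus_eq_zero by (auto simp: Rel_def)
  moreover have "sym (Rel i)" for i using rk_minus by (auto simp: Rel_def sym_def)
  \<comment> \<open>Expanding the product of two adjacency matrices in the idempotents gives an
    expression in \<open>i\<close>, \<open>j\<close>, \<open>k\<close> only. The floor converts this
    real number, known to be a cardinality, into a natural number.\<close>
  moreover have "card {C \<in> X. (A, C) \<in> Rel i \<and> (C, B) \<in> Rel j} =
      nat \<lfloor>\<Sum>l\<le>n. Q i l * Q j l * (Q l k / card X)\<rfloor>"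
    if ij: "i \<le> n" "j \<le> n" and k: "(A, B) \<in> Rel k" for i j k A B
  proof -
    have "real (card {C \<in> X. (A, C) \<in> Rel i \<and> (C, B) \<in> Rel j}) = mprod X (adj Rel i) (adj Rel j) A B"
    proof -
      have "mprod X (adj Rel i) (adj Rel j) A B = (\<Sum>C\<in>X. if (A, C) \<in> Rel i \<and> (C, B) \<in> Rel j then 1 else 0)"
        unfolding mprod_def adj_def by (rule sum.cong) auto
      then show ?thesis using finite_X by (simp flip: sum.inter_filter)
    qed
    also have "\<dots> = (\<Sum>l\<le>n. Q i l * Q j l * E l A B)"
      unfolding adj_eq[OF ij(1)] adj_eq[OF ij(2)] sum_E_mprod_sum ..
    also have "\<dots> = (\<Sum>l\<le>n. Q i l * Q j l * (Q l k / card X))"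
      using k by (auto simp: Rel_def E_def)
    finally have "(\<Sum>l\<le>n. Q i l * Q j l * (Q l k / card X)) =
        real (card {C \<in> X. (A, C) \<in> Rel i \<and> (C, B) \<in> Rel j})" by simp
    then show ?thesis by (simp only: floor_of_nat nat_int)
  qed
  then have "\<exists>p :: nat \<Rightarrow> nat \<Rightarrow> nat \<Rightarrow> nat. \<forall>i\<le>n. \<forall>j\<le>n. \<forall>k\<le>n. \<forall>(A, B)\<in>Rel k.
      card {C \<in> X. (A, C) \<in> Rel i \<and> (C, B) \<in> Rel j} = p i j k"
    by (intro exI[where x = "\<lambda>i j k. nat \<lfloor>\<Sum>l\<le>n. Q i l * Q j l * (Q l k / card X)\<rfloor>"]) auto
  ultimately show ?thesis
    unfolding association_scheme_def using finite_X by (auto simp: Rel_def)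
qed

end

section \<open>Families of forms closed under bordering\<close>

definition rank_count :: "real \<Rightarrow> real \<Rightarrow> nat \<Rightarrow> nat \<Rightarrow> real" where
  "rank_count b c n k = gbin b n k * (\<Prod>s<k. c * b ^ n - b ^ s)"

text \<open>\<open>rank_count b c n k\<close> is the number of forms of rank \<open>k\<close>, and \<open>eig b c n k i\<close> is the
  character sum over these forms at a form of rank \<open>i\<close>, that is $Q_k(i)$. In the recursion,
  \<open>c * b ^ (2 * n + 1 - i)\<close> is the Gauss sum over the borders of a form of rank \<open>i\<close>.\<close>

fun eig :: "real \<Rightarrow> real \<Rightarrow> nat \<Rightarrow> nat \<Rightarrow> nat \<Rightarrow> real" where
  "eig b c n k 0 = rank_count b c n k"
| "eig b c n 0 (Suc i) = 1"
| "eig b c 0 (Suc k) (Suc i) = 0"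
| "eig b c (Suc n) (Suc k) (Suc i) = eig b c (Suc n) (Suc k) i - c * b ^ (2 * n + 1 - i) * eig b c n k i"

context gauss_base
begin

lemma rank_count_0 [simp]: "rank_count b c n 0 = 1"
  by (simp add: rank_count_def)

lemma eig_0 [simp]: "eig b c n 0 i = 1"
  by (cases i) simp_all

lemma sum_rank_count: "(\<Sum>k\<le>n. rank_count b c n k) = (c * b ^ n) ^ n"
  unfolding rank_count_def by (rule gbin_vandermonde)

lemma gbin_Suc_Suc':
  assumes "k \<le> n"
  shows "gbin b (Suc n) (Suc k) = b ^ (n - k) * gbin b n k + gbin b n (Suc k)"
proof (cases "k = n")
  case False
  with assms have k: "Suc k \<le> n" by simp
  have *: "Suc (n - Suc k) = n - k" using k by simp
  have "gbin b (Suc n) (Suc k) = gbin b (Suc n) (n - k)"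
    using gbin_sym[of "Suc k" "Suc n"] assms by simp
  also have "\<dots> = gbin b n (n - Suc k) + b ^ (n - k) * gbin b n (n - k)"
    using gbin_Suc_Suc[of n "n - Suc k"] unfolding * .
  finally show ?thesis using gbin_sym[of "Suc k" n] gbin_sym[of k n] k by simp
qed simp

text \<open>Rank 0 is \<open>gbin_vandermonde\<close>. When \<open>i\<close> grows by one, the
  recursion subtracts a moment for \<open>n - 1\<close> and \<open>j - 1\<close>, and this cancels
  the first summand of the Pascal rule \<open>gbin_Suc_Suc'\<close> for
  \<open>gbin b (n - i) j\<close>.\<close>

lemma eig_moments:
  assumes "i \<le> n" "j \<le> n"
  shows "(\<Sum>k\<le>j. gbin b (n - k) (n - j) * eig b c n k i) = gbin b (n - i) j * (c * b ^ n) ^ j"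
  using assms
proof (induction i arbitrary: n j)
  case 0
  have "gbin b (n - k) (n - j) * eig b c n k 0 = gbin b n j * (gbin b j k * (\<Prod>s<k. c * b ^ n - b ^ s))"
    if "k \<le> j" for k
  proof -
    have "n - k - (n - j) = j - k" "n - j \<le> n - k" using that 0 by auto
    then have "gbin b (n - k) (n - j) * gbin b n k = gbin b n j * gbin b j k"
      using that 0 by (simp add: gbin_def field_simps)
    then show ?thesis by (simp add: rank_count_def)
  qed
  then have "(\<Sum>k\<le>j. gbin b (n - k) (n - j) * eig b c n k 0) =
      gbin b n j * (\<Sum>k\<le>j. gbin b j k * (\<Prod>s<k. c * b ^ n - b ^ s))"
    unfolding sum_distrib_left by (intro sum.cong) auto
  then show ?case unfolding gbin_vandermonde by simp
next
  case (Suc i)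
  then obtain m where m: "n = Suc m" by (cases n) auto
  show ?case
  proof (cases j)
    case (Suc l)
    have i: "i \<le> m" "l \<le> m" using Suc.prems m Suc by auto
    let ?g = "c * b ^ (2 * m + 1 - i)"
    have "(\<Sum>k\<le>j. gbin b (n - k) (n - j) * eig b c n k (Suc i)) =
        (\<Sum>k\<le>j. gbin b (n - k) (n - j) * eig b c n k i) - ?g * (\<Sum>k\<le>l. gbin b (m - k) (m - l) * eig b c m k i)"
      unfolding Suc m sum.atMost_Suc_shift
      by (simp add: right_diff_distrib sum_subtractf sum_distrib_left mult.left_commute)
    also have "\<dots> = gbin b (n - i) j * (c * b ^ n) ^ j - ?g * (gbin b (m - i) l * (c * b ^ m) ^ l)"
      using Suc.IH[of n j] Suc.IH[of m l] Suc.prems i m by simp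
    also have "\<dots> = gbin b (m - i) (Suc l) * (c * b ^ n) ^ Suc l"
    proof (cases "l \<le> m - i")
      case True
      have "n - i = Suc (m - i)" using m i by simp
      then have p: "gbin b (n - i) j = b ^ (m - i - l) * gbin b (m - i) l + gbin b (m - i) (Suc l)"
        using gbin_Suc_Suc'[OF True] Suc by simp
      \<comment> \<open>The cancellation balances the powers of \<open>b\<close> precisely because
        the Gauss sum has the exponent \<open>2 * m + 1 - i\<close>.\<close>
      have "m - i - l + (Suc m + Suc m * l) = 2 * m + 1 - i + m * l" using True i by (simp add: algebra_simps)
      then have "b ^ (m - i - l + (Suc m + Suc m * l)) = b ^ (2 * m + 1 - i + m * l)" by (simp only:)
      then have "b ^ (m - i - l) * (b ^ Suc m * (b ^ Suc m) ^ l) = b ^ (2 * m + 1 - i) * (b ^ m) ^ l"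
        by (simp only: power_add power_mult)
      then have "c ^ Suc l * (b ^ (m - i - l) * (b ^ Suc m) ^ Suc l) = c ^ Suc l * (b ^ (2 * m + 1 - i) * (b ^ m) ^ l)"
        by (simp only: power_Suc)
      then have e: "b ^ (m - i - l) * (c * b ^ n) ^ Suc l = ?g * (c * b ^ m) ^ l"
        unfolding m power_mult_distrib by (simp only: power_Suc mult_ac)
      have "b ^ (m - i - l) * gbin b (m - i) l * (c * b ^ n) ^ Suc l = ?g * (gbin b (m - i) l * (c * b ^ m) ^ l)"
        using arg_cong[OF e, of "\<lambda>x. gbin b (m - i) l * x"] by (simp only: mult_ac)
      then show ?thesis unfolding Suc p[unfolded Suc] by (simp only: distrib_right add_diff_cancel_left')
    next
      case False
      then show ?thesis using Suc m i by simp
    qed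
    finally show ?thesis using Suc m by simp
  qed simp
qed

lemma code_lp_eig:
  assumes "1 \<le> n" "c * b ^ n \<noteq> 0"
  shows "code_lp b c n (eig b c n)"
  by unfold_locales (use assms eig_moments in auto)

lemma rank_count_Suc:
  "(b ^ Suc k - 1) * rank_count b c (Suc n) (Suc k) =
     (b ^ Suc n - 1) * (c * b ^ Suc n - 1) * b ^ k * rank_count b c n k"
proof -
  have "(\<Prod>s<Suc k. c * b ^ Suc n - b ^ s) = (c * b ^ Suc n - 1) * (\<Prod>s<k. b * (c * b ^ n - b ^ s))"
    unfolding prod.lessThan_Suc_shift by (simp add: algebra_simps)
  also have "(\<Prod>s<k. b * (c * b ^ n - b ^ s)) = b ^ k * (\<Prod>s<k. c * b ^ n - b ^ s)"
    by (simp add: prod.distrib)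
  finally have p: "(\<Prod>s<Suc k. c * b ^ Suc n - b ^ s) = (c * b ^ Suc n - 1) * (b ^ k * (\<Prod>s<k. c * b ^ n - b ^ s))" .
  show ?thesis
    unfolding rank_count_def p mult.assoc[symmetric, of "b ^ Suc k - 1"] gbin_absorb by (simp only: mult_ac)
qed

text \<open>Each step in the rank subtracts one Gauss sum, and these add up to a geometric series.
  For nonzero \<open>b\<close> and \<open>c\<close> the result is nonzero, which lets
  \<open>S_eig\<close> divide by the difference.\<close>

lemma eig_first_minus:
  assumes "k \<le> n"
  shows "(b - 1) * (eig b c (Suc n) 1 (Suc k) - rank_count b c (Suc n) 1) =
    - (c * b ^ (2 * n + 1 - k) * (b ^ Suc k - 1))"
  using assms
proof (induction k)
  case 0
  show ?case by (simp add: algebra_simps)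
next
  case (Suc k)
  have e: "2 * n + 1 - k = Suc (2 * n + 1 - Suc k)" using Suc.prems by simp
  have "eig b c (Suc n) 1 (Suc (Suc k)) = eig b c (Suc n) 1 (Suc k) - c * b ^ (2 * n + 1 - Suc k)"
    by (simp del: eig.simps(1) add: One_nat_def)
  then have "(b - 1) * (eig b c (Suc n) 1 (Suc (Suc k)) - rank_count b c (Suc n) 1) =
     (b - 1) * (eig b c (Suc n) 1 (Suc k) - rank_count b c (Suc n) 1) - (b - 1) * (c * b ^ (2 * n + 1 - Suc k))"
    by (simp only: right_diff_distrib)
  also have "(b - 1) * (eig b c (Suc n) 1 (Suc k) - rank_count b c (Suc n) 1) =
      - (c * b ^ (2 * n + 1 - k) * (b ^ Suc k - 1))" using Suc by simp
  also have "- (c * b ^ (2 * n + 1 - k) * (b ^ Suc k - 1)) - (b - 1) * (c * b ^ (2 * n + 1 - Suc k)) =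
     - (c * b ^ (2 * n + 1 - Suc k) * (b ^ Suc (Suc k) - 1))"
    unfolding e by (simp add: algebra_simps)
  finally show ?case .
qed

text \<open>The candidates \<open>rank_count\<close> satisfy the relation between ranks 1 and
  \<open>Suc k\<close> that \<open>S_symmetry\<close> forces on the true numbers of forms. Comparing
  the two makes the true numbers proportional to the candidates.\<close>

lemma rank_count_ratio:
  assumes k: "k \<le> n"
  shows "rank_count b c (Suc n) 1 * (eig b c (Suc n) (Suc k) 1 - rank_count b c (Suc n) (Suc k)) =
    rank_count b c (Suc n) (Suc k) * (eig b c (Suc n) 1 (Suc k) - rank_count b c (Suc n) 1)"
proof -
  let ?w = "rank_count b c"
  have b1: "b - 1 \<noteq> 0" using pow_ne_1[of 1] by simp
  have e: "2 * n + 1 = k + (2 * n + 1 - k)" using k by simp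
  have w1: "(b - 1) * ?w (Suc n) 1 = (b ^ Suc n - 1) * (c * b ^ Suc n - 1)"
    using rank_count_Suc[of 0 c n] by simp
  have "(b - 1) * (?w (Suc n) 1 * (eig b c (Suc n) (Suc k) 1 - ?w (Suc n) (Suc k))) =
      - ((b - 1) * ?w (Suc n) 1) * (c * b ^ (2 * n + 1) * ?w n k)" by simp
  also have "\<dots> = - (c * b ^ (2 * n + 1 - k)) * ((b ^ Suc n - 1) * (c * b ^ Suc n - 1) * b ^ k * ?w n k)"
    unfolding w1 by (subst e) (simp only: power_add mult_ac mult_minus_left mult_minus_right)
  also have "\<dots> = - (c * b ^ (2 * n + 1 - k)) * ((b ^ Suc k - 1) * ?w (Suc n) (Suc k))"
    unfolding rank_count_Suc ..
  also have "\<dots> = ?w (Suc n) (Suc k) * ((b - 1) * (eig b c (Suc n) 1 (Suc k) - ?w (Suc n) 1))"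
    unfolding eig_first_minus[OF k] by (simp only: mult_ac mult_minus_left mult_minus_right)
  finally have "(b - 1) * (?w (Suc n) 1 * (eig b c (Suc n) (Suc k) 1 - ?w (Suc n) (Suc k))) =
      (b - 1) * (?w (Suc n) (Suc k) * (eig b c (Suc n) 1 (Suc k) - ?w (Suc n) 1))"
    by (simp only: mult.left_commute)
  from iffD1[OF mult_left_cancel[OF b1] this] show ?thesis .
qed

end

text \<open>The members \<open>X n\<close> of a family of forms are built by bordering: an element of \<open>X (Suc n)\<close>
  consists of a corner \<open>d\<close>, a border \<open>v\<close> and a remaining block, whose Schur complement
  with respect to \<open>d\<close> is obtained by subtracting \<open>T n v d\<close>.\<close>

locale form_family = gauss_base b for b :: real +
  fixes c :: real and X :: "nat \<Rightarrow> 'm::{plus,minus} set" and z :: "nat \<Rightarrow> 'm"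
    and pr :: "nat \<Rightarrow> 'm \<Rightarrow> 'm \<Rightarrow> complex" and rk :: "nat \<Rightarrow> 'm \<Rightarrow> nat"
    and V :: "nat \<Rightarrow> 'v set" and v0 :: "nat \<Rightarrow> 'v" and D :: "'d set" and d0 :: 'd
    and blk :: "nat \<Rightarrow> 'm \<Rightarrow> 'v \<Rightarrow> 'd \<Rightarrow> 'm" and T :: "nat \<Rightarrow> 'v \<Rightarrow> 'd \<Rightarrow> 'm"
    and \<psi> :: "'d \<Rightarrow> 'd \<Rightarrow> complex"
  assumes group: "self_dual_group (X n) (z n) (pr n)"
    and base: "X 0 = {z 0}"
    and rk_le: "A \<in> X n \<Longrightarrow> rk n A \<le> n"
    and rk_zero: "A \<in> X n \<Longrightarrow> rk n A = 0 \<longleftrightarrow> A = z n"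
    and rk_minus: "A \<in> X n \<Longrightarrow> B \<in> X n \<Longrightarrow> rk n (A - B) = rk n (B - A)"
    and blk_bij: "bij_betw (\<lambda>(C, v, d). blk n C v d) (X n \<times> V n \<times> D) (X (Suc n))"
    and finite_V: "finite (V n)" and finite_D: "finite D"
    and v0_in: "v0 n \<in> V n" and d0_in: "d0 \<in> D" and D_nontrivial: "\<exists>d\<in>D. d \<noteq> d0"
    and T_in: "v \<in> V n \<Longrightarrow> d \<in> D \<Longrightarrow> d \<noteq> d0 \<Longrightarrow> T n v d \<in> X n"
    and rk_blk: "C \<in> X n \<Longrightarrow> v \<in> V n \<Longrightarrow> d \<in> D \<Longrightarrow> d \<noteq> d0 \<Longrightarrow>
      rk (Suc n) (blk n (C + T n v d) v d) = Suc (rk n C)"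
    and rk_blk_0: "C \<in> X n \<Longrightarrow> rk (Suc n) (blk n C (v0 n) d0) = rk n C"
    and pr_blk: "A \<in> X n \<Longrightarrow> C \<in> X n \<Longrightarrow> v \<in> V n \<Longrightarrow> a \<in> D \<Longrightarrow> d \<in> D \<Longrightarrow>
      pr (Suc n) (blk n A (v0 n) a) (blk n C v d) = pr n A C * \<psi> a d"
    and \<psi>_d0: "d \<in> D \<Longrightarrow> \<psi> d0 d = 1" "d \<in> D \<Longrightarrow> \<psi> d d0 = 1"
    and sum_\<psi>: "a \<in> D \<Longrightarrow> a \<noteq> d0 \<Longrightarrow> (\<Sum>d\<in>D. \<psi> a d) = 0"
    and reduction: "A \<in> X (Suc n) \<Longrightarrow> A \<noteq> z (Suc n) \<Longrightarrow>
      \<exists>A'\<in>X n. \<exists>a\<in>D - {d0}. Suc (rk n A') = rk (Suc n) A \<and>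
        (\<forall>k. (\<Sum>B\<in>{B \<in> X (Suc n). rk (Suc n) B = k}. pr (Suc n) A B) =
             (\<Sum>B\<in>{B \<in> X (Suc n). rk (Suc n) B = k}. pr (Suc n) (blk n A' (v0 n) a) B))"
    and gauss_sum: "A \<in> X n \<Longrightarrow> d \<in> D \<Longrightarrow> d \<noteq> d0 \<Longrightarrow>
      of_nat (card D) * (\<Sum>v\<in>V n. pr n A (T n v d)) = of_real (c * b ^ (2 * n + 1 - rk n A))"
    and card_step: "real (card (V n)) * real (card D) * (c * b ^ n) ^ n = (c * b ^ Suc n) ^ Suc n"
    and c_ne_0: "c \<noteq> 0" and b_ne_0: "b \<noteq> 0"
    and cb_ne: "s < n \<Longrightarrow> c * b ^ n \<noteq> b ^ s"
begin

definition S :: "nat \<Rightarrow> nat \<Rightarrow> 'm \<Rightarrow> complex" where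
  "S n k A = (\<Sum>B\<in>{B \<in> X n. rk n B = k}. pr n A B)"

definition val :: "nat \<Rightarrow> nat \<Rightarrow> real" where
  "val n k = card {B \<in> X n. rk n B = k}"

sublocale G: self_dual_group "X n" "z n" "pr n" for n by (rule group)

lemma rk_z: "rk n (z n) = 0"
  using rk_zero[OF G.zero_in] by blast

lemma blk_in: "C \<in> X n \<Longrightarrow> v \<in> V n \<Longrightarrow> d \<in> D \<Longrightarrow> blk n C v d \<in> X (Suc n)"
  using bij_betwE[OF blk_bij[of n]] by auto

lemma card_X_Suc: "card (X (Suc n)) = card (X n) * (card (V n) * card D)"
  using bij_betw_same_card[OF blk_bij[of n]] by (simp add: card_cartesian_product)

lemma card_X: "real (card (X n)) = (c * b ^ n) ^ n"
proof (induction n)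
  case (Suc n)
  then show ?case unfolding card_X_Suc card_step[symmetric] by simp
qed (simp add: base)

lemma S_z: "S n k (z n) = of_real (val n k)"
proof -
  have "S n k (z n) = (\<Sum>B\<in>{B \<in> X n. rk n B = k}. 1)"
    unfolding S_def by (rule sum.cong) (auto simp: G.pr_zero)
  then show ?thesis by (simp add: val_def)
qed

lemma S_0: "A \<in> X n \<Longrightarrow> S n 0 A = 1"
proof -
  assume "A \<in> X n"
  moreover have "{B \<in> X n. rk n B = 0} = {z n}" using rk_zero rk_z G.zero_in by auto
  ultimately show ?thesis by (simp add: S_def G.pr_sym[of A] G.pr_zero G.zero_in)
qed

lemma val_0: "val n 0 = 1"
  using S_z[of n 0] S_0[OF G.zero_in, of n] by (metis of_real_eq_1_iff)

lemma sum_val: "(\<Sum>k\<le>n. val n k) = card (X n)"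
proof -
  have "(\<Sum>k\<le>n. card {B \<in> X n. rk n B = k}) = (\<Sum>k\<le>n. \<Sum>B\<in>{B \<in> X n. rk n B = k}. 1)" by simp
  also have "\<dots> = (\<Sum>B\<in>X n. 1)" by (rule sum.group) (use G.finite_X rk_le in auto)
  finally show ?thesis unfolding val_def of_nat_sum[symmetric] by simp
qed

lemma S_symmetry: "(\<Sum>A\<in>{A \<in> X n. rk n A = i}. S n k A) = (\<Sum>B\<in>{B \<in> X n. rk n B = k}. S n i B)"
  unfolding S_def by (subst sum.swap) (auto intro!: sum.cong simp: G.pr_sym)

text \<open>Forms with corner \<open>d0\<close> contribute equally to both character sums, so the
  difference removes them. For any other corner, shifting the block by \<open>T n v d\<close> makes
  the rank \<open>Suc (rk n C)\<close>; the sum over \<open>v\<close> is the Gauss sum divided by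
  \<open>card D\<close>, and \<open>\<psi> a d - 1\<close> sums to \<open>- card D\<close> over
  \<open>d\<close>.\<close>

lemma S_blk_minus:
  assumes A: "A \<in> X n" and a: "a \<in> D" "a \<noteq> d0"
  shows "S (Suc n) (Suc k) (blk n A (v0 n) a) - S (Suc n) (Suc k) (blk n A (v0 n) d0) =
    - of_real (c * b ^ (2 * n + 1 - rk n A)) * S n k A"
proof -
  let ?I = "{B \<in> X (Suc n). rk (Suc n) B = Suc k}"
  let ?f = "\<lambda>B. pr (Suc n) (blk n A (v0 n) a) B - pr (Suc n) (blk n A (v0 n) d0) B"
  let ?G = "of_real (c * b ^ (2 * n + 1 - rk n A)) :: complex"
  let ?ind = "\<lambda>B. if rk (Suc n) B = Suc k then ?f B else 0"
  have fin: "finite (X n)" "finite (X (Suc n))" by (rule G.finite_X)+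
  have D: "card D \<noteq> 0" using finite_D d0_in by auto
  have "S (Suc n) (Suc k) (blk n A (v0 n) a) - S (Suc n) (Suc k) (blk n A (v0 n) d0) = (\<Sum>B\<in>?I. ?f B)"
    unfolding S_def by (rule sum_subtractf[symmetric])
  also have "\<dots> = (\<Sum>B\<in>X (Suc n). ?ind B)" using fin by (simp add: sum.inter_filter)
  also have "\<dots> = (\<Sum>x\<in>X n \<times> V n \<times> D. ?ind (case x of (C, v, d) \<Rightarrow> blk n C v d))"
    by (rule sum.reindex_bij_betw[OF blk_bij[of n], symmetric])
  also have "\<dots> = (\<Sum>(C, v, d)\<in>X n \<times> V n \<times> D. ?ind (blk n C v d))"
    by (rule sum.cong) auto
  also have "\<dots> = (\<Sum>C\<in>X n. \<Sum>v\<in>V n. \<Sum>d\<in>D. ?ind (blk n C v d))"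
    by (simp add: sum.cartesian_product)
  also have "\<dots> = (\<Sum>d\<in>D. \<Sum>v\<in>V n. \<Sum>C\<in>X n. ?ind (blk n C v d))"
    by (subst sum.swap, subst (2) sum.swap, subst sum.swap, rule refl)
  also have "\<dots> = (\<Sum>d\<in>D. \<Sum>v\<in>V n. \<Sum>C\<in>X n. if rk (Suc n) (blk n C v d) = Suc k then pr n A C * (\<psi> a d - 1) else 0)"
    using A a d0_in by (intro sum.cong refl) (auto simp: pr_blk \<psi>_d0 algebra_simps)
  also have "\<dots> = (\<Sum>d\<in>D. \<Sum>v\<in>V n. if d = d0 then 0 else (\<psi> a d - 1) * (pr n A (T n v d) * S n k A))"
  proof (intro sum.cong refl)
    fix d v assume d: "d \<in> D" and v: "v \<in> V n"
    show "(\<Sum>C\<in>X n. if rk (Suc n) (blk n C v d) = Suc k then pr n A C * (\<psi> a d - 1) else 0) =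
       (if d = d0 then 0 else (\<psi> a d - 1) * (pr n A (T n v d) * S n k A))"
    proof (cases "d = d0")
      case True
      then show ?thesis using a \<psi>_d0 by (auto intro!: sum.neutral)
    next
      case False
      have T: "T n v d \<in> X n" by (rule T_in[OF v d False])
      have "(\<Sum>C\<in>X n. if rk (Suc n) (blk n C v d) = Suc k then pr n A C * (\<psi> a d - 1) else 0) =
          (\<Sum>C\<in>X n. if rk (Suc n) (blk n (C + T n v d) v d) = Suc k then pr n A (C + T n v d) * (\<psi> a d - 1) else 0)"
        by (rule G.sum_shift[OF T, symmetric])
      also have "\<dots> = (\<Sum>C\<in>X n. if rk n C = k then (\<psi> a d - 1) * (pr n A (T n v d) * pr n A C) else 0)"
        using v d False A T by (intro sum.cong refl) (auto simp: rk_blk G.pr_sym[of A] G.pr_add G.add_in)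
      also have "\<dots> = (\<psi> a d - 1) * (pr n A (T n v d) * S n k A)"
        unfolding S_def sum_distrib_left by (rule sum.inter_filter[OF fin(1), symmetric])
      finally show ?thesis using False by simp
    qed
  qed
  also have "\<dots> = (\<Sum>d\<in>D. if d = d0 then 0 else (\<psi> a d - 1) * (?G / of_nat (card D) * S n k A))"
  proof (intro sum.cong refl)
    fix d assume d: "d \<in> D"
    show "(\<Sum>v\<in>V n. if d = d0 then 0 else (\<psi> a d - 1) * (pr n A (T n v d) * S n k A)) =
        (if d = d0 then 0 else (\<psi> a d - 1) * (?G / of_nat (card D) * S n k A))"
    proof (cases "d = d0")
      case False
      then have "?G / of_nat (card D) = (\<Sum>v\<in>V n. pr n A (T n v d))"
        using gauss_sum[OF A d False] D by (metis nonzero_mult_div_cancel_left of_nat_eq_0_iff)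
      then show ?thesis using False by (simp add: sum_distrib_left sum_distrib_right mult.assoc)
    qed simp
  qed
  \<comment> \<open>The corner \<open>d0\<close> is included again at no cost, as
    \<open>\<psi> a d0 = 1\<close>.\<close>
  also have "\<dots> = (\<Sum>d\<in>D. (\<psi> a d - 1) * (?G / of_nat (card D) * S n k A))"
    by (intro sum.cong refl) (use a \<psi>_d0 in auto)
  also have "\<dots> = (\<Sum>d\<in>D. \<psi> a d - 1) * (?G / of_nat (card D) * S n k A)"
    by (rule sum_distrib_right[symmetric])
  also have "(\<Sum>d\<in>D. \<psi> a d - 1) = - of_nat (card D)"
    using sum_\<psi>[OF a] by (simp add: sum_subtractf)
  finally show ?thesis using D by simp
qed

text \<open>The recursion starts at the zero form, where the value is the still unknown number of
  forms of rank \<open>k\<close>. The offset between \<open>val\<close> and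
  \<open>rank_count\<close> is carried along until \<open>S_eig\<close> shows that it is
  zero.\<close>

lemma S_eig_offset:
  assumes IH: "\<And>k A. k \<le> n \<Longrightarrow> A \<in> X n \<Longrightarrow> S n k A = of_real (eig b c n k (rk n A))"
    and k: "k \<le> Suc n" and A: "A \<in> X (Suc n)"
  shows "S (Suc n) k A = of_real (val (Suc n) k + (eig b c (Suc n) k (rk (Suc n) A) - rank_count b c (Suc n) k))"
  using A
proof (induction "rk (Suc n) A" arbitrary: A)
  case 0
  then have "A = z (Suc n)" using rk_zero by metis
  then show ?case using 0(1)[symmetric] by (simp add: S_z)
next
  case (Suc i)
  show ?case
  proof (cases k)
    case 0
    then show ?thesis using S_0[OF Suc.prems] val_0 by simp
  next
    case (Suc l)
    have "A \<noteq> z (Suc n)" using Suc.hyps(2) rk_z by auto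
    then obtain A' a where A': "A' \<in> X n" and a: "a \<in> D" "a \<noteq> d0" and rk: "Suc (rk n A') = rk (Suc n) A"
      and eq: "S (Suc n) k A = S (Suc n) k (blk n A' (v0 n) a)"
      using reduction[OF Suc.prems] unfolding S_def by blast
    have i: "rk n A' = i" "rk (Suc n) A = Suc i" using rk Suc.hyps(2) by auto
    have B: "blk n A' (v0 n) d0 \<in> X (Suc n)" "rk (Suc n) (blk n A' (v0 n) d0) = i"
      using blk_in[OF A' v0_in d0_in] rk_blk_0[OF A'] i by auto
    have "S (Suc n) k A = S (Suc n) k (blk n A' (v0 n) d0) - of_real (c * b ^ (2 * n + 1 - i)) * S n l A'"
      using S_blk_minus[OF A' a, of l] unfolding eq unfolding Suc i by (simp add: algebra_simps)
    also have "S (Suc n) k (blk n A' (v0 n) d0) = of_real (val (Suc n) k + (eig b c (Suc n) k i - rank_count b c (Suc n) k))"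
      using Suc.hyps(1)[OF B(2)[symmetric] B(1)] unfolding B(2) .
    also have "S n l A' = of_real (eig b c n l i)" using IH[of l A'] A' k Suc i by simp
    also have "of_real (val (Suc n) k + (eig b c (Suc n) k i - rank_count b c (Suc n) k)) -
        of_real (c * b ^ (2 * n + 1 - i)) * of_real (eig b c n l i) =
        complex_of_real (val (Suc n) k + (eig b c (Suc n) k (Suc i) - rank_count b c (Suc n) k))"
      unfolding Suc by simp
    finally show ?thesis unfolding i .
  qed
qed

theorem S_eig:
  assumes "k \<le> n" "A \<in> X n"
  shows "S n k A = of_real (eig b c n k (rk n A))" and "val n k = rank_count b c n k"
proof -
  have "(\<forall>k\<le>n. \<forall>A\<in>X n. S n k A = of_real (eig b c n k (rk n A))) \<and> (\<forall>k\<le>n. val n k = rank_count b c n k)"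
  proof (induction n)
    case 0
    show ?case using base rk_z[of 0] S_0[of "z 0" 0] val_0 by simp
  next
    case (Suc n)
    let ?w = "rank_count b c (Suc n)" and ?v = "val (Suc n)" and ?e = "eig b c (Suc n)"
    have IH: "S n k A = of_real (eig b c n k (rk n A))" if "k \<le> n" "A \<in> X n" for k A
      using Suc that by blast
    note off = S_eig_offset[OF IH]
    \<comment> \<open>Evaluating both sides of \<open>S_symmetry\<close> by the offset formula, the
      products of the two counts cancel.\<close>
    have sym: "?v i * (?e k i - ?w k) = ?v k * (?e i k - ?w i)" if "i \<le> Suc n" "k \<le> Suc n" for i k
    proof -
      let ?L = "\<lambda>i. {A \<in> X (Suc n). rk (Suc n) A = i}"
      have "(\<Sum>A\<in>?L i. S (Suc n) k A) = of_real (?v i * (?v k + (?e k i - ?w k)))" if "k \<le> Suc n" for i k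
      proof -
        have "(\<Sum>A\<in>?L i. S (Suc n) k A) = (\<Sum>A\<in>?L i. of_real (?v k + (?e k i - ?w k)))"
          by (rule sum.cong) (use off that in auto)
        then show ?thesis by (simp add: val_def)
      qed
      from this[OF that(2), of i] this[OF that(1), of k] S_symmetry[of "Suc n" i k]
      have "complex_of_real (?v i * (?v k + (?e k i - ?w k))) = complex_of_real (?v k * (?v i + (?e i k - ?w i)))"
        by simp
      then have "?v i * (?v k + (?e k i - ?w k)) = ?v k * (?v i + (?e i k - ?w i))"
        by (simp only: of_real_eq_iff)
      then show ?thesis by (simp add: distrib_left mult.commute)
    qed
    have ratio: "?v (Suc k) * ?w 1 = ?v 1 * ?w (Suc k)" if k: "k \<le> n" for k
    proof -
      have ne: "?e 1 (Suc k) - ?w 1 \<noteq> 0"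
        using eig_first_minus[OF k, of c] b_ne_0 c_ne_0 pow_ne_1[of "Suc k"] by auto
      have "?v (Suc k) * ?w 1 * (?e 1 (Suc k) - ?w 1) = ?w 1 * (?v (Suc k) * (?e 1 (Suc k) - ?w 1))" by simp
      also have "\<dots> = ?v 1 * (?w 1 * (?e (Suc k) 1 - ?w (Suc k)))"
      proof -
        have s: "?v (Suc k) * (?e 1 (Suc k) - ?w 1) = ?v 1 * (?e (Suc k) 1 - ?w (Suc k))"
          by (rule sym[symmetric]) (use k in auto)
        show ?thesis unfolding s by (rule mult.left_commute)
      qed
      also have "\<dots> = ?v 1 * ?w (Suc k) * (?e 1 (Suc k) - ?w 1)"
        unfolding rank_count_ratio[OF k] by simp
      finally show ?thesis using ne by simp
    qed
    \<comment> \<open>Two different corners give at least two forms. Hence the total over the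
      positive ranks is nonzero and can be cancelled when the totals of \<open>val\<close> and
      \<open>rank_count\<close> are compared.\<close>
    have big: "real (card (X (Suc n))) - 1 \<noteq> 0"
    proof -
      obtain d where d: "d \<in> D" "d \<noteq> d0" using D_nontrivial by blast
      have "blk n (z n) (v0 n) d \<noteq> blk n (z n) (v0 n) d0"
        using inj_onD[OF bij_betw_imp_inj_on[OF blk_bij[of n]], of "(z n, v0 n, d)" "(z n, v0 n, d0)"]
          d d0_in v0_in G.zero_in by auto
      then have "card {blk n (z n) (v0 n) d, blk n (z n) (v0 n) d0} = 2" by simp
      moreover have "{blk n (z n) (v0 n) d, blk n (z n) (v0 n) d0} \<subseteq> X (Suc n)"
        using d d0_in v0_in G.zero_in blk_in by simp
      ultimately have "2 \<le> card (X (Suc n))" using card_mono[OF G.finite_X] by metis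
      then show ?thesis by simp
    qed
    have sumv: "(\<Sum>k\<le>n. ?v (Suc k)) = real (card (X (Suc n))) - 1"
      using sum_val[of "Suc n"] val_0[of "Suc n"] unfolding sum.atMost_Suc_shift by simp
    have sumw: "(\<Sum>k\<le>n. ?w (Suc k)) = real (card (X (Suc n))) - 1"
      using sum_rank_count[of c "Suc n"] card_X[of "Suc n"] unfolding sum.atMost_Suc_shift by simp
    have "(real (card (X (Suc n))) - 1) * ?w 1 = (\<Sum>k\<le>n. ?v (Suc k) * ?w 1)"
      unfolding sumv[symmetric] by (rule sum_distrib_right)
    also have "\<dots> = (\<Sum>k\<le>n. ?v 1 * ?w (Suc k))" by (rule sum.cong) (use ratio in auto)
    also have "\<dots> = ?v 1 * (real (card (X (Suc n))) - 1)"
      unfolding sumw[symmetric] by (rule sum_distrib_left[symmetric])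
    finally have v1: "?v 1 = ?w 1" using big by simp
    have "c * b ^ Suc n \<noteq> 1" using big card_X[of "Suc n"] by auto
    then have w1: "?w 1 \<noteq> 0" using gbin_ne_0[of 1 "Suc n"] by (simp add: rank_count_def)
    have vw: "?v k = ?w k" if "k \<le> Suc n" for k
    proof (cases k)
      case 0
      then show ?thesis using val_0 by simp
    next
      case (Suc l)
      then show ?thesis using ratio[of l] that v1 w1 by simp
    qed
    then show ?case using off by simp
  qed
  then show "S n k A = of_real (eig b c n k (rk n A))" "val n k = rank_count b c n k"
    using assms by blast+
qed

lemma rank_count_ne_0: "k \<le> n \<Longrightarrow> rank_count b c n k \<noteq> 0"
  using gbin_ne_0 cb_ne by (auto simp: rank_count_def)

sublocale RS: rank_scheme "X n" "z n" "pr n" "rk n" n "eig b c n" for n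
proof unfold_locales
  fix k A assume "k \<le> n" "A \<in> X n"
  then show "(\<Sum>B\<in>{B \<in> X n. rk n B = k}. pr n A B) = of_real (eig b c n k (rk n A))"
    using S_eig(1)[of k n A] unfolding S_def by simp
qed (use rk_le rk_zero rk_minus rank_count_ne_0 in auto)

lemma LP_equals_Rel:
  assumes "lp_optimum n (eig b c n) d v"
  shows "LP_equals (X n) (RS.Rel n) n d v"
proof -
  interpret scheme "X n" "RS.Rel n" n by unfold_locales (rule RS.association_scheme)
  show ?thesis using assms LP_equals_iff[OF RS.PQ] by blast
qed

end

section \<open>Characters of finite fields\<close>

text \<open>Closure under negation follows, since \<open>- x\<close> is the multiple of
  \<open>x\<close> by \<open>CHAR('f) - 1\<close>; see \<open>add_subgroup_uminus\<close>.\<close>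

definition add_subgroup :: "'f::{field,finite} set \<Rightarrow> bool" where
  "add_subgroup H \<longleftrightarrow> 0 \<in> H \<and> (\<forall>x\<in>H. \<forall>y\<in>H. x + y \<in> H)"

text \<open>The subgroup generated by \<open>H\<close> and \<open>x\<close>. The multiples stay
  below the characteristic, so that for \<open>x\<close> outside \<open>H\<close> every element is
  listed once.\<close>

definition add_extend :: "'f::{field,finite} set \<Rightarrow> 'f \<Rightarrow> 'f set" where
  "add_extend H x = (\<lambda>(h, k). h + of_nat k * x) ` (H \<times> {..<CHAR('f)})"

lemma CHAR_prime_finite: "prime CHAR('f::{field,finite})"
  by (rule prime_CHAR_semidom, rule finite_imp_CHAR_pos) simp

lemma of_nat_mod_CHAR: "of_nat (k mod CHAR('f)) = (of_nat k :: 'f::{field,finite})"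
proof -
  have "of_nat k = (of_nat (CHAR('f) * (k div CHAR('f)) + k mod CHAR('f)) :: 'f)" by simp
  then show ?thesis by (simp only: of_nat_add of_nat_mult of_nat_CHAR) simp
qed

lemma add_subgroup_multiple:
  assumes "add_subgroup H" "x \<in> H" shows "of_nat k * x \<in> H"
  using assms by (induction k) (auto simp: add_subgroup_def algebra_simps)

lemma add_subgroup_uminus:
  fixes x :: "'f::{field,finite}"
  assumes "add_subgroup H" "x \<in> H" shows "- x \<in> H"
proof -
  have "1 \<le> CHAR('f)" using CHAR_prime_finite[where 'f = 'f] prime_ge_1_nat by blast
  then have "of_nat (CHAR('f) - 1) * x = - x" by (simp add: of_nat_diff algebra_simps)
  then show ?thesis using add_subgroup_multiple[OF assms] by metis
qed

lemma add_subgroup_diff: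
  fixes x :: "'f::{field,finite}"
  assumes "add_subgroup H" "x \<in> H" "y \<in> H" shows "x - y \<in> H"
  using assms add_subgroup_uminus[of H y] unfolding add_subgroup_def by (metis diff_conv_add_uminus)

text \<open>Multiply by an inverse of \<open>d\<close> modulo the characteristic.\<close>

lemma add_subgroup_divide:
  fixes x :: "'f::{field,finite}"
  assumes H: "add_subgroup H" and d: "of_nat d * x \<in> H" "0 < d" "d < CHAR('f)"
  shows "x \<in> H"
proof -
  have "coprime d CHAR('f)"
    using CHAR_prime_finite[where 'f = 'f] d by (metis coprime_commute nat_dvd_not_less prime_imp_coprime_nat)
  then obtain j where "[d * j = 1] (mod CHAR('f))" using cong_solve_coprime_nat by auto
  then have "(of_nat (d * j) :: 'f) = of_nat 1"
    by (metis of_nat_mod_CHAR cong_def)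
  then have "of_nat d * of_nat j = (1 :: 'f)" by simp
  then have "of_nat j * (of_nat d * x) = x" by (metis mult.assoc mult.commute mult_1)
  then show ?thesis using add_subgroup_multiple[OF H d(1), of j] by metis
qed

lemma add_extend_subgroup:
  fixes x :: "'f::{field,finite}"
  assumes H: "add_subgroup H" shows "add_subgroup (add_extend H x)"
  unfolding add_subgroup_def
proof (intro conjI ballI)
  have p: "0 < CHAR('f)" using CHAR_prime_finite[where 'f = 'f] prime_gt_0_nat by blast
  have "0 = (\<lambda>(h, k). h + of_nat k * x) (0, 0)" by simp
  moreover have "(0, 0) \<in> H \<times> {..<CHAR('f)}" using H p by (simp add: add_subgroup_def)
  ultimately show "0 \<in> add_extend H x" unfolding add_extend_def by (rule image_eqI)
  fix u v assume "u \<in> add_extend H x" "v \<in> add_extend H x"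
  then obtain h k h' k' where "h \<in> H" "h' \<in> H" "u = h + of_nat k * x" "v = h' + of_nat k' * x"
    by (auto simp: add_extend_def)
  moreover from this have "u + v = (\<lambda>(h, k). h + of_nat k * x) (h + h', (k + k') mod CHAR('f))"
    by (simp add: of_nat_mod_CHAR algebra_simps)
  moreover have "(h + h', (k + k') mod CHAR('f)) \<in> H \<times> {..<CHAR('f)}"
    using H calculation p by (simp add: add_subgroup_def)
  ultimately show "u + v \<in> add_extend H x" unfolding add_extend_def by (intro image_eqI)
qed

lemma card_add_extend:
  fixes x :: "'f::{field,finite}"
  assumes H: "add_subgroup H" and x: "x \<notin> H"
  shows "card (add_extend H x) = CHAR('f) * card H"
proof -
  have *: "k = k'" if "h \<in> H" "h' \<in> H" "k' < CHAR('f)" "k \<le> k'" "h + of_nat k * x = h' + of_nat k' * x" for h h' k k'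
  proof (rule ccontr)
    assume "k \<noteq> k'"
    have "of_nat (k' - k) * x = h - h'" using that by (simp add: of_nat_diff algebra_simps)
    then have "of_nat (k' - k) * x \<in> H" using add_subgroup_diff[OF H] that by simp
    then have "x \<in> H" by (rule add_subgroup_divide[OF H]) (use that \<open>k \<noteq> k'\<close> in auto)
    then show False using x by blast
  qed
  have "inj_on (\<lambda>(h, k). h + of_nat k * x) (H \<times> {..<CHAR('f)})"
  proof (rule inj_onI, clarsimp)
    fix h k h' k' assume a: "h \<in> H" "h' \<in> H" "k < CHAR('f)" "k' < CHAR('f)" "h + of_nat k * x = h' + of_nat k' * x"
    have "k = k'"
    proof (cases "k \<le> k'")
      case True
      then show ?thesis using *[of h h' k' k] a by simp
    next
      case False
      then show ?thesis using *[of h' h k k'] a by simp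
    qed
    with a show "h = h' \<and> k = k'" by simp
  qed
  then show ?thesis unfolding add_extend_def by (simp add: card_image card_cartesian_product)
qed

lemma ex_max_card:
  fixes P :: "'a::finite set \<Rightarrow> bool"
  assumes "P H" shows "\<exists>H. P H \<and> (\<forall>H'. P H' \<longrightarrow> card H' \<le> card H)"
  by (rule ex_has_greatest_nat[of P H card "Suc CARD('a)"])
    (use assms in \<open>auto simp: less_Suc_eq_le intro: card_mono\<close>)

text \<open>A largest subgroup whose order is a power of the characteristic is everything, because
  adjoining a missing element multiplies the order by the characteristic.\<close>

lemma CARD_finite_field_power: "\<exists>e. CARD('f::{field,finite}) = CHAR('f) ^ e"
proof -
  let ?P = "\<lambda>H::'f set. add_subgroup H \<and> (\<exists>e. card H = CHAR('f) ^ e)"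
  have "?P {0}" by (auto simp: add_subgroup_def intro: exI[of _ 0])
  then obtain H where H: "?P H" and max: "\<And>H'. ?P H' \<Longrightarrow> card H' \<le> card H"
    using ex_max_card[of ?P "{0}"] by blast
  have "H = UNIV"
  proof (rule ccontr)
    assume "H \<noteq> UNIV"
    then obtain x where x: "x \<notin> H" by blast
    obtain e where e: "card H = CHAR('f) ^ e" using H by blast
    have "card (add_extend H x) = CHAR('f) ^ Suc e" using card_add_extend[of H x] H x e by simp
    then have "?P (add_extend H x)" using add_extend_subgroup H by blast
    from max[OF this] have "CHAR('f) * card H \<le> card H" using card_add_extend[of H x] H x by simp
    moreover have "1 < CHAR('f)" using CHAR_prime_finite[where 'f = 'f] prime_gt_1_nat by blast
    moreover from this have "0 < card H" using e by simp
    ultimately show False using mult_less_mono1[of 1 "CHAR('f)" "card H"] by simp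
  qed
  with H show ?thesis by auto
qed

text \<open>Nontriviality is required at 1 itself. As 1 lies in every subfield, the restriction to a
  subfield is nontrivial too, and \<open>1 / a\<close> is a uniform witness against triviality of
  the character sending \<open>x\<close> to \<open>\<chi> (a * x)\<close>.\<close>

definition additive_character :: "('f::{field,finite} \<Rightarrow> complex) \<Rightarrow> bool" where
  "additive_character \<chi> \<longleftrightarrow> \<chi> 0 = 1 \<and> (\<forall>x y. \<chi> (x + y) = \<chi> x * \<chi> y) \<and> \<chi> 1 \<noteq> 1"

text \<open>A subgroup that is maximal among those not containing \<open>1\<close> has index \<open>CHAR('f)\<close>, and its
  cosets are represented by the multiples of \<open>1\<close>; the character reads off that multiple.\<close>

lemma additive_character_exists: "\<exists>\<chi> :: 'f::{field,finite} \<Rightarrow> complex. additive_character \<chi>"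
proof -
  let ?p = "CHAR('f)"
  have p: "prime ?p" "1 < ?p" using CHAR_prime_finite[where 'f = 'f] prime_gt_1_nat by blast+
  let ?P = "\<lambda>H::'f set. add_subgroup H \<and> 1 \<notin> H"
  have "?P {0}" by (auto simp: add_subgroup_def)
  then obtain H where H: "?P H" and max: "\<And>H'. ?P H' \<Longrightarrow> card H' \<le> card H"
    using ex_max_card[of ?P "{0}"] by blast
  then have sub: "add_subgroup H" and one: "1 \<notin> H" by auto
  have "\<exists>k. x - of_nat k \<in> H" for x
  proof (cases "x \<in> H")
    case True
    then show ?thesis by (intro exI[of _ 0]) simp
  next
    case False
    have "0 < card H" using sub by (auto simp: add_subgroup_def card_gt_0_iff)
    \<comment> \<open>Maximality of \<open>H\<close> puts 1 into the extension by \<open>x\<close>;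
      solving for \<open>x\<close> modulo the characteristic makes it a multiple of 1 up to an
      element of \<open>H\<close>.\<close>
    then have "card H < card (add_extend H x)" using card_add_extend[OF sub False] p by simp
    then have "1 \<in> add_extend H x" using max[of "add_extend H x"] add_extend_subgroup[OF sub] by auto
    then obtain h j where h: "h \<in> H" "1 = h + of_nat j * x" "j < ?p" by (auto simp: add_extend_def)
    then have "0 < j" using one by (cases j) auto
    then have "coprime j ?p" using p h by (metis coprime_commute nat_dvd_not_less prime_imp_coprime_nat)
    then obtain k where "[j * k = 1] (mod ?p)" using cong_solve_coprime_nat by auto
    then have "(of_nat (j * k) :: 'f) = of_nat 1" by (metis of_nat_mod_CHAR cong_def)
    then have kj: "of_nat k * of_nat j = (1 :: 'f)" by (simp add: mult.commute)
    have "of_nat k * 1 = of_nat k * h + of_nat k * of_nat j * x"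
      using h(2) by (metis distrib_left mult.assoc)
    then have "of_nat k = of_nat k * h + x" unfolding kj by simp
    then have "x - of_nat k = - (of_nat k * h)" by (simp add: eq_neg_iff_add_eq_0 algebra_simps)
    then show ?thesis using add_subgroup_uminus[OF sub add_subgroup_multiple[OF sub h(1)]] by metis
  qed
  then obtain \<kappa> where \<kappa>: "\<And>x. x - of_nat (\<kappa> x) \<in> H" by metis
  have uniq: "[k = l] (mod ?p)" if "x - of_nat k \<in> H" "x - of_nat l \<in> H" "l \<le> k" for x k l
  proof (rule ccontr)
    assume "\<not> ?thesis"
    then have "(k - l) mod ?p \<noteq> 0" using that(3) by (simp add: cong_altdef_nat mod_eq_0_iff_dvd)
    moreover have "of_nat ((k - l) mod ?p) * 1 \<in> H"
      using add_subgroup_diff[OF sub that(2,1)] that(3) by (simp add: of_nat_mod_CHAR of_nat_diff)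
    ultimately show False using add_subgroup_divide[OF sub] one p by simp
  qed
  have uniq: "[k = l] (mod ?p)" if "x - of_nat k \<in> H" "x - of_nat l \<in> H" for x k l
    using uniq[of x k l] uniq[of x l k] that by (cases "l \<le> k") (auto simp: cong_sym)
  define e where "e = (\<lambda>k::nat. cis (2 * pi * real k / real ?p))"
  have e_add: "e (k + l) = e k * e l" for k l
    by (simp add: e_def cis_mult add_divide_distrib distrib_left)
  have "e (?p * k) = 1" for k
  proof -
    have "2 * pi * real (?p * k) / real ?p = 2 * pi * real k" using p by simp
    then show ?thesis unfolding e_def using cis_multiple_2pi[of "real k"] by simp
  qed
  then have e_mod: "e k = e (k mod ?p)" for k
    using e_add[of "?p * (k div ?p)" "k mod ?p"] by simp
  have e_cong: "e k = e l" if "[k = l] (mod ?p)" for k l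
    using that e_mod[of k] e_mod[of l] by (simp add: cong_def)
  have e1: "e 1 \<noteq> 1"
  proof
    assume "e 1 = 1"
    then have "cos (2 * pi / real ?p) = 1" by (simp add: e_def cis.ctr complex_eq_iff)
    then obtain m :: int where m: "2 * pi / real ?p = of_int m * 2 * pi" using cos_one_2pi_int by auto
    have "2 * pi * (of_int m * real ?p) = 2 * pi" using m p by (simp add: field_simps)
    then have "of_int m * real ?p = 1" by simp
    then have "real_of_int (m * int ?p) = real_of_int 1" by simp
    then have "m * int ?p = 1" by (simp only: of_int_eq_iff)
    then have "int ?p dvd 1" by (metis dvd_triv_right)
    then show False using p by simp
  qed
  have "additive_character (\<lambda>x. e (\<kappa> x))"
    unfolding additive_character_def
  proof (intro conjI allI)
    have "(0::'f) - of_nat 0 \<in> H" using sub by (simp add: add_subgroup_def)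
    then have "e (\<kappa> 0) = e 0" by (intro e_cong uniq[OF \<kappa>])
    then show "e (\<kappa> 0) = 1" by (simp add: e_def)
    have "(1::'f) - of_nat 1 \<in> H" using sub by (simp add: add_subgroup_def)
    then have "e (\<kappa> 1) = e 1" by (intro e_cong uniq[OF \<kappa>])
    then show "e (\<kappa> 1) \<noteq> 1" using e1 by simp
    fix x y
    have "x - of_nat (\<kappa> x) + (y - of_nat (\<kappa> y)) \<in> H" using sub \<kappa> by (simp add: add_subgroup_def)
    then have "x + y - of_nat (\<kappa> x + \<kappa> y) \<in> H" by (simp add: algebra_simps)
    then have "e (\<kappa> (x + y)) = e (\<kappa> x + \<kappa> y)" by (intro e_cong uniq[OF \<kappa>])
    then show "e (\<kappa> (x + y)) = e (\<kappa> x) * e (\<kappa> y)" by (simp add: e_add)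
  qed
  then show ?thesis by blast
qed

lemma additive_character_ne_0: "additive_character \<chi> \<Longrightarrow> \<chi> x \<noteq> 0"
proof
  assume a: "additive_character \<chi>" and "\<chi> x = 0"
  then have "\<chi> (x + (- x)) = 0" unfolding additive_character_def by (metis mult_zero_left)
  then show False using a by (simp add: additive_character_def)
qed

lemma sum_additive_character:
  fixes \<chi> :: "'f::{field,finite} \<Rightarrow> complex"
  assumes \<chi>: "additive_character \<chi>" and K: "add_subgroup K" and c: "c \<in> K" "\<chi> (a * c) \<noteq> 1"
  shows "(\<Sum>x\<in>K. \<chi> (a * x)) = 0"
proof -
  have "(\<Sum>x\<in>K. \<chi> (a * x)) = (\<Sum>x\<in>K. \<chi> (a * (x + c)))"
    by (rule sum.reindex_bij_witness[where i = "\<lambda>x. x + c" and j = "\<lambda>x. x - c"])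
      (use K c add_subgroup_diff[OF K] in \<open>auto simp: add_subgroup_def\<close>)
  also have "\<dots> = (\<Sum>x\<in>K. \<chi> (a * x)) * \<chi> (a * c)"
    using \<chi> by (simp add: additive_character_def distrib_left sum_distrib_right)
  finally show ?thesis using c by simp
qed

lemma sum_additive_character_UNIV:
  assumes "additive_character \<chi>" "a \<noteq> 0"
  shows "(\<Sum>x\<in>UNIV. \<chi> (a * x)) = 0"
  by (rule sum_additive_character[where c = "1 / a"])
    (use assms in \<open>auto simp: additive_character_def add_subgroup_def\<close>)

section \<open>Fields of square order: Frobenius map, norm and trace\<close>

lemma finite_field_power_CARD: "(x :: 'f::{field,finite}) ^ CARD('f) = x"
proof (cases "x = 0")
  case False
  have "(\<Prod>y\<in>UNIV - {0}. x * y) = (\<Prod>y\<in>UNIV - {0}. y)"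
    by (rule prod.reindex_bij_witness[where i = "\<lambda>y. y / x" and j = "\<lambda>y. x * y"]) (use False in auto)
  moreover have "(\<Prod>y\<in>UNIV - {0}. x * y) = x ^ (CARD('f) - 1) * (\<Prod>y\<in>UNIV - {0}. y)"
    by (simp add: prod.distrib card_Diff_singleton)
  moreover have "(\<Prod>y\<in>UNIV - {0 :: 'f}. y) \<noteq> 0" by simp
  ultimately have "x ^ (CARD('f) - 1) = 1" by simp
  then have "x ^ Suc (CARD('f) - 1) = x" by (simp only: power_Suc mult_1_right)
  moreover have "Suc (CARD('f) - 1) = CARD('f)" using zero_less_card_finite[where 'a = 'f] by simp
  ultimately show ?thesis by metis
qed (simp add: card_gt_0_iff)

locale quadratic_field =
  fixes q :: nat and dummy :: "'f::{field,finite} itself"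
  assumes q: "q ^ 2 = CARD('f)"
begin

text \<open>The fixed field of the Frobenius map, which is the subfield of order \<open>q\<close> by
  \<open>card_K_and_norm\<close>.\<close>

definition K :: "'f set" where "K = {x. x ^ q = x}"

lemma q_ge_2: "2 \<le> q"
proof (rule ccontr)
  assume "\<not> 2 \<le> q"
  then have "q = 0 \<or> q = 1" by auto
  then have "CARD('f) \<le> 1" using q by auto
  moreover have "card {0, 1 :: 'f} \<le> CARD('f)" by (rule card_mono) auto
  ultimately show False by simp
qed

text \<open>All that is known of \<open>q\<close> is that its square is the order of the field;
  dividing a power of the characteristic, it is itself such a power.\<close>

lemma frobenius_add: "(x + y :: 'f) ^ q = x ^ q + y ^ q"
proof -
  obtain e where "CARD('f) = CHAR('f) ^ e" using CARD_finite_field_power by blast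
  then have "q dvd CHAR('f) ^ e" unfolding q[symmetric] by (metis dvd_triv_left power2_eq_square)
  then obtain m where "q = CHAR('f) ^ m"
    using divides_primepow_nat[OF CHAR_prime_finite] by blast
  then show ?thesis using freshmans_dream'[OF CHAR_prime_finite] by blast
qed

lemma frobenius_sum: "finite I \<Longrightarrow> (\<Sum>i\<in>I. f i :: 'f) ^ q = (\<Sum>i\<in>I. f i ^ q)"
  by (induction I rule: finite_induct) (use q_ge_2 in \<open>auto simp: frobenius_add\<close>)

lemma frobenius_frobenius: "((x :: 'f) ^ q) ^ q = x"
  using finite_field_power_CARD[of x] unfolding q[symmetric] power2_eq_square power_mult .

lemma K_subgroup: "add_subgroup K"
  using q_ge_2 by (auto simp: add_subgroup_def K_def frobenius_add)

lemma K_0: "0 \<in> K" and K_1: "1 \<in> K" and K_mult: "x \<in> K \<Longrightarrow> y \<in> K \<Longrightarrow> x * y \<in> K"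
  and K_divide: "x \<in> K \<Longrightarrow> y \<in> K \<Longrightarrow> x / y \<in> K"
  using q_ge_2 by (auto simp: K_def power_mult_distrib power_divide)

lemma norm_in_K: "x ^ q * x \<in> K"
  by (simp add: K_def power_mult_distrib frobenius_frobenius mult.commute)

lemma trace_in_K: "x ^ q + x \<in> K"
  by (simp add: K_def frobenius_add frobenius_frobenius add.commute)

lemma card_roots_le:
  fixes f :: "'f poly" assumes "f \<noteq> 0" shows "card {x. poly f x = 0} \<le> degree f"
  using card_poly_roots_bound[OF assms] .

text \<open>Counting roots gives at most \<open>q\<close> elements of \<open>K\<close> and at most
  \<open>Suc q\<close> in each norm fibre. The fibres over \<open>K - {0}\<close> contain all
  \<open>q ^ 2 - 1 = (q - 1) * Suc q\<close> nonzero elements, so both bounds are attained.\<close>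

lemma card_K_and_norm:
  "card K = q" "t \<in> K \<Longrightarrow> t \<noteq> 0 \<Longrightarrow> card {x. x ^ q * x = t} = Suc q"
proof -
  have deg: "degree (monom (1::'f) m + f) = m" if "degree f < m" for m f
    using that by (simp add: degree_add_eq_left degree_monom_eq)
  have le: "card {x :: 'f. x ^ m = a * x + b} \<le> m" if "1 < m" for m a b
  proof -
    let ?f = "monom 1 m + [:- b, - a:]"
    have d: "degree ?f = m" by (rule deg) (use that in auto)
    then have "?f \<noteq> 0" using that by auto
    then have "card {x. poly ?f x = 0} \<le> m" using card_roots_le d by metis
    moreover have "{x. poly ?f x = 0} = {x. x ^ m = a * x + b}"
      by (auto simp: poly_monom algebra_simps eq_neg_iff_add_eq_0)
    ultimately show ?thesis by simp
  qed
  have K_le: "card K \<le> q" using le[of q 1 0] q_ge_2 by (simp add: K_def)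
  have fib: "card {x :: 'f. x ^ q * x = t} \<le> Suc q" for t
    using le[of "Suc q" 0 t] q_ge_2 by (simp add: mult.commute)
  have "card (UNIV - {0 :: 'f}) = card (\<Union>t\<in>K - {0}. {x :: 'f. x ^ q * x = t})"
  proof (rule arg_cong[where f = card])
    show "UNIV - {0 :: 'f} = (\<Union>t\<in>K - {0}. {x. x ^ q * x = t})"
      using norm_in_K q_ge_2 by auto
  qed
  also have "\<dots> = (\<Sum>t\<in>K - {0}. card {x :: 'f. x ^ q * x = t})"
    by (rule card_UN_disjoint) auto
  finally have total: "(\<Sum>t\<in>K - {0}. card {x :: 'f. x ^ q * x = t}) = q ^ 2 - 1"
    by (simp add: card_Diff_singleton q)
  have sq: "q ^ 2 - 1 = (q - 1) * Suc q" using q_ge_2 by (simp add: power2_eq_square algebra_simps)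
  have cK: "card (K - {0}) = card K - 1" by (simp add: card_Diff_singleton K_0)
  have "q ^ 2 - 1 \<le> (\<Sum>t\<in>K - {0}. Suc q)" unfolding total[symmetric] by (rule sum_mono) (rule fib)
  then have "(q - 1) * Suc q \<le> (card K - 1) * Suc q" by (simp only: sq sum_constant cK of_nat_id)
  then have "q - 1 \<le> card K - 1" by (simp only: mult_le_cancel2)
  then show cardK: "card K = q" using K_le q_ge_2 by simp
  show "card {x. x ^ q * x = t} = Suc q" if t: "t \<in> K" "t \<noteq> 0"
  proof (rule ccontr)
    assume "card {x. x ^ q * x = t} \<noteq> Suc q"
    then have "card {x. x ^ q * x = t} < Suc q" using fib[of t] by simp
    then have "(\<Sum>t\<in>K - {0}. card {x :: 'f. x ^ q * x = t}) < (\<Sum>t\<in>K - {0}. Suc q)"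
      by (intro sum_strict_mono_ex1) (use t fib in auto)
    then show False unfolding total sq by (simp add: cK cardK)
  qed
qed

text \<open>The polynomial \<open>x ^ q + x\<close> has at most \<open>q < q ^ 2\<close> roots, in
  any characteristic.\<close>

lemma trace_nontrivial: "\<exists>x :: 'f. x ^ q + x \<noteq> 0"
proof (rule ccontr)
  assume "\<not> ?thesis"
  then have all: "\<And>x :: 'f. x ^ q + x = 0" by blast
  let ?f = "monom 1 q + [:0, 1:] :: 'f poly"
  have d: "degree ?f = q" using q_ge_2 by (simp add: degree_add_eq_left degree_monom_eq)
  then have "?f \<noteq> 0" using q_ge_2 by auto
  then have "card {x. poly ?f x = 0} \<le> q" using card_roots_le d by metis
  moreover have "{x. poly ?f x = 0} = UNIV" using all by (auto simp: poly_monom)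
  ultimately have "q ^ 2 \<le> q" by (simp add: q)
  then show False using q_ge_2 by (simp add: power2_eq_square)
qed

lemma trace_surj:
  assumes "t \<in> K" shows "\<exists>x :: 'f. x ^ q + x = t"
proof -
  obtain x :: 'f where x: "x ^ q + x \<noteq> 0" using trace_nontrivial by blast
  let ?s = "t / (x ^ q + x)"
  have "?s ^ q = ?s" using K_divide[OF assms trace_in_K] by (simp add: K_def)
  then have "(?s * x) ^ q + ?s * x = ?s * (x ^ q + x)" by (simp only: power_mult_distrib distrib_left)
  then show ?thesis using x by (intro exI[of _ "?s * x"]) simp
qed

lemma sum_character_K:
  assumes "additive_character \<chi>" "a \<in> K" "a \<noteq> 0"
  shows "(\<Sum>x\<in>K. \<chi> (a * x)) = 0"
  by (rule sum_additive_character[where c = "1 / a"])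
    (use assms K_subgroup K_divide K_1 in \<open>auto simp: additive_character_def\<close>)

text \<open>Every nonzero norm is taken \<open>Suc q\<close> times, and the nonzero part of the
  character sum over \<open>K\<close> is \<open>- 1\<close>, which makes \<open>1 - Suc q\<close> in
  total. This sign is the source of the negative base of the Hermitian forms.\<close>

lemma sum_character_norm:
  assumes \<chi>: "additive_character \<chi>" and a: "a \<in> K" "a \<noteq> 0"
  shows "(\<Sum>x\<in>UNIV. \<chi> (a * (x ^ q * x))) = - of_nat q"
proof -
  have "(\<Sum>t\<in>K. \<Sum>x\<in>{x \<in> UNIV. x ^ q * x = t}. \<chi> (a * (x ^ q * x))) = (\<Sum>x\<in>UNIV. \<chi> (a * (x ^ q * x)))"
    by (rule sum.group) (auto simp: norm_in_K)
  moreover have "(\<Sum>x\<in>{x \<in> UNIV. x ^ q * x = t}. \<chi> (a * (x ^ q * x))) =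
      of_nat (card {x. x ^ q * x = t}) * \<chi> (a * t)" for t by simp
  ultimately have "(\<Sum>x\<in>UNIV. \<chi> (a * (x ^ q * x))) = (\<Sum>t\<in>K. of_nat (card {x. x ^ q * x = t}) * \<chi> (a * t))"
    by simp
  also have "\<dots> = of_nat (card {x :: 'f. x ^ q * x = 0}) * \<chi> (a * 0) +
      (\<Sum>t\<in>K - {0}. of_nat (card {x. x ^ q * x = t}) * \<chi> (a * t))"
    by (rule sum.remove) (auto simp: K_0)
  also have "{x :: 'f. x ^ q * x = 0} = {0}" using q_ge_2 by auto
  also have "(\<Sum>t\<in>K - {0}. of_nat (card {x. x ^ q * x = t}) * \<chi> (a * t)) = (\<Sum>t\<in>K - {0}. of_nat (Suc q) * \<chi> (a * t))"
    by (rule sum.cong) (auto simp: card_K_and_norm(2) simp del: of_nat_Suc)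
  also have "\<dots> = of_nat (Suc q) * (\<Sum>t\<in>K - {0}. \<chi> (a * t))" by (rule sum_distrib_left[symmetric])
  also have "(\<Sum>t\<in>K - {0}. \<chi> (a * t)) = - 1"
    using sum_character_K[OF assms] sum.remove[of K 0 "\<lambda>t. \<chi> (a * t)"] \<chi> K_0
    by (simp add: additive_character_def eq_neg_iff_add_eq_0 add.commute)
  finally show ?thesis using \<chi> by (simp add: additive_character_def)
qed

end

section \<open>Matrices over finite fields\<close>

lemma (in vectorspace) card_carrier:
  assumes "fin_dim" and "finite (carrier K)"
  shows "card (carrier V) = card (carrier K) ^ dim"
proof -
  obtain B where B: "finite B" "basis B" using finite_basis_exists assms(1) by blast
  then have sub: "B \<subseteq> carrier V" by (simp add: basis_def)
  have crit: "\<And>v. v \<in> carrier V \<Longrightarrow> \<exists>!a. a \<in> B \<rightarrow>\<^sub>E carrier K \<and> lincomb a B = v"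
    using basis_criterion[OF B(1) sub] B(2) by blast
  have closed: "lincomb a B \<in> carrier V" if "a \<in> B \<rightarrow>\<^sub>E carrier K" for a
    using that sub by (intro lincomb_closed) (auto simp: PiE_def)
  have "bij_betw (\<lambda>a. lincomb a B) (B \<rightarrow>\<^sub>E carrier K) (carrier V)"
    unfolding bij_betw_def
  proof
    show "inj_on (\<lambda>a. lincomb a B) (B \<rightarrow>\<^sub>E carrier K)"
    proof (rule inj_onI)
      fix a a' assume a: "a \<in> B \<rightarrow>\<^sub>E carrier K" "a' \<in> B \<rightarrow>\<^sub>E carrier K" "lincomb a B = lincomb a' B"
      have "\<exists>\<^sub>\<le>\<^sub>1c. c \<in> B \<rightarrow>\<^sub>E carrier K \<and> lincomb c B = lincomb a B"
        using crit[OF closed[OF a(1)]] unfolding ex1_iff_ex_Uniq by (rule conjunct2)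
      then show "a = a'" by (rule Uniq_D) (use a in auto)
    qed
    show "(\<lambda>a. lincomb a B) ` (B \<rightarrow>\<^sub>E carrier K) = carrier V"
    proof (intro subset_antisym image_subsetI subsetI)
      fix v assume "v \<in> carrier V"
      from ex1_implies_ex[OF crit[OF this]] show "v \<in> (\<lambda>a. lincomb a B) ` (B \<rightarrow>\<^sub>E carrier K)" by blast
    qed (rule closed)
  qed
  then have "card (carrier V) = card (B \<rightarrow>\<^sub>E carrier K)" by (simp add: bij_betw_same_card)
  then show ?thesis using B by (simp add: card_PiE dim_basis)
qed

text \<open>Ranks are compared by counting: the size of this column space determines the rank
  (\<open>card_img\<close>), so bijections between images suffice.\<close>

definition img :: "'f::{field,finite} mat \<Rightarrow> 'f vec set" where
  "img A = (\<lambda>v. A *\<^sub>v v) ` carrier_vec (dim_col A)"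

lemma card_img:
  fixes A :: "'f::{field,finite} mat"
  assumes A: "A \<in> carrier_mat m n"
  shows "card (img A) = CARD('f) ^ vec_space.rank m A"
proof -
  interpret vec_space "TYPE('f)" m .
  have sub: "set (cols A) \<subseteq> carrier_vec m" using A cols_dim by blast
  have vs: "vectorspace class_ring (span_vs (set (cols A)))"
    by (intro subspace_is_vs span_is_subspace) (use sub in \<open>simp add: module_vec_simps\<close>)
  have "card (carrier (span_vs (set (cols A)))) = card (carrier (class_ring :: 'f ring)) ^ rank A"
    unfolding rank_def
    by (rule vectorspace.card_carrier[OF vs fin_dim_span_cols[OF A]]) (simp add: class_ring_simps)
  moreover have "carrier (span_vs (set (cols A))) = img A"
    using col_space_eq[OF A] A unfolding col_space_def img_def by auto
  ultimately show ?thesis by (simp add: class_ring_simps)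
qed

lemma card_field_gt_1: "1 < CARD('f::{field,finite})"
proof -
  have "card {0, 1 :: 'f} \<le> CARD('f)" by (rule card_mono) auto
  then show ?thesis by simp
qed

lemma rank_eqI:
  fixes A B :: "'f::{field,finite} mat"
  assumes "A \<in> carrier_mat m n" "B \<in> carrier_mat m' n'" "card (img A) = card (img B) * CARD('f) ^ k"
  shows "vec_space.rank m A = vec_space.rank m' B + k"
proof -
  have "CARD('f) ^ vec_space.rank m A = CARD('f) ^ (vec_space.rank m' B + k)"
    using assms card_img by (metis power_add)
  then show ?thesis using card_field_gt_1[where 'f = 'f] power_inject_exp by blast
qed

lemma rank_eq_0_iff:
  fixes A :: "'f::{field,finite} mat"
  assumes A: "A \<in> carrier_mat m n"
  shows "vec_space.rank m A = 0 \<longleftrightarrow> A = 0\<^sub>m m n"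
proof
  assume "vec_space.rank m A = 0"
  then have "card (img A) = 1" using card_img[OF A] by simp
  then obtain y where y: "img A = {y}" by (auto simp: card_1_singleton_iff)
  have "A *\<^sub>v v = 0\<^sub>v m" if "v \<in> carrier_vec n" for v
  proof -
    have "A *\<^sub>v v \<in> img A" "A *\<^sub>v 0\<^sub>v n \<in> img A" using that A by (auto simp: img_def)
    moreover have "A *\<^sub>v 0\<^sub>v n = 0\<^sub>v m" using A by (intro eq_vecI) auto
    ultimately show ?thesis using y by auto
  qed
  then have "A $$ (i, j) = 0" if "i < m" "j < n" for i j
  proof -
    have "(A *\<^sub>v unit_vec n j) $ i = A $$ (i, j)" using that A by (simp add: scalar_prod_right_unit)
    then show ?thesis using \<open>\<And>v. v \<in> carrier_vec n \<Longrightarrow> A *\<^sub>v v = 0\<^sub>v m\<close>[of "unit_vec n j"] that by simp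
  qed
  then show "A = 0\<^sub>m m n" using A by (intro eq_matI) auto
next
  assume "A = 0\<^sub>m m n"
  then show "vec_space.rank m A = 0" by (simp add: vec_space.rank_0I)
qed

lemma rank_mult_invertible:
  fixes A :: "'f::{field,finite} mat"
  assumes A: "A \<in> carrier_mat m n" and P: "P \<in> carrier_mat m m" "P' \<in> carrier_mat m m" "P' * P = 1\<^sub>m m"
    and R: "R \<in> carrier_mat n n" "R' \<in> carrier_mat n n" "R * R' = 1\<^sub>m n"
  shows "vec_space.rank m (P * A * R) = vec_space.rank m A"
proof -
  have pull: "(P * A * R) *\<^sub>v v = P *\<^sub>v (A *\<^sub>v (R *\<^sub>v v))" if "v \<in> carrier_vec n" for v
    using that A P R assoc_mult_mat_vec[of "P * A" m n R n v] assoc_mult_mat_vec[of P m m A n "R *\<^sub>v v"] by simp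
  have "img (P * A * R) = (\<lambda>y. P *\<^sub>v y) ` img A"
  proof (intro subset_antisym subsetI)
    fix y assume "y \<in> img (P * A * R)"
    then obtain v where v: "v \<in> carrier_vec n" "y = (P * A * R) *\<^sub>v v" using R by (auto simp: img_def)
    then have "y = P *\<^sub>v (A *\<^sub>v (R *\<^sub>v v))" using pull by simp
    moreover have "A *\<^sub>v (R *\<^sub>v v) \<in> img A" using v R A by (auto simp: img_def)
    ultimately show "y \<in> (\<lambda>y. P *\<^sub>v y) ` img A" by blast
  next
    fix y assume "y \<in> (\<lambda>y. P *\<^sub>v y) ` img A"
    then obtain v where v: "v \<in> carrier_vec n" "y = P *\<^sub>v (A *\<^sub>v v)" using A by (auto simp: img_def)
    have "(P * A * R) *\<^sub>v (R' *\<^sub>v v) = P *\<^sub>v (A *\<^sub>v ((R * R') *\<^sub>v v))"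
      using pull[of "R' *\<^sub>v v"] assoc_mult_mat_vec[of R n n R' n v] R(1,2) v by simp
    then have "(P * A * R) *\<^sub>v (R' *\<^sub>v v) = y" using v R by simp
    then show "y \<in> img (P * A * R)" using v R A P unfolding img_def by (intro image_eqI[of _ _ "R' *\<^sub>v v"]) auto
  qed
  moreover have "inj_on (\<lambda>y. P *\<^sub>v y) (img A)"
  proof (rule inj_on_inverseI[where g = "\<lambda>y. P' *\<^sub>v y"])
    fix y assume "y \<in> img A"
    then have y: "y \<in> carrier_vec m" using A by (auto simp: img_def)
    then have "P' *\<^sub>v (P *\<^sub>v y) = (P' * P) *\<^sub>v y" using P(1,2) by simp
    then show "P' *\<^sub>v (P *\<^sub>v y) = y" using P y by simp
  qed
  ultimately have "card (img (P * A * R)) = card (img A)" by (simp add: card_image)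
  moreover have "P * A * R \<in> carrier_mat m n" using A P R by simp
  ultimately show ?thesis using rank_eqI[of "P * A * R" m n A m n 0] A by simp
qed

lemma rank_uminus_diff:
  fixes A B :: "'f::{field,finite} mat"
  assumes "A \<in> carrier_mat m n" "B \<in> carrier_mat m n"
  shows "vec_space.rank m (A - B) = vec_space.rank m (B - A)"
proof -
  have "1\<^sub>m m * (B - A) * (- 1\<^sub>m n) = A - B"
  proof -
    have "1\<^sub>m m * (B - A) * (- 1\<^sub>m n) = - (B - A)" using assms by simp
    also have "\<dots> = A - B" using assms by (intro eq_matI) auto
    finally show ?thesis .
  qed
  moreover have "- 1\<^sub>m n * - 1\<^sub>m n = (1\<^sub>m n :: 'f mat)" by simp
  ultimately show ?thesis
    using rank_mult_invertible[of "B - A" m n "1\<^sub>m m" "1\<^sub>m m" "- 1\<^sub>m n" "- 1\<^sub>m n"] assms minus_carrier_mat[of A m n B] by simp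
qed

lemma rank_direct_sum:
  fixes C :: "'f::{field,finite} mat"
  assumes C: "C \<in> carrier_mat r c" and D: "D \<in> carrier_mat s s'"
  shows "vec_space.rank (r + s) (four_block_mat C (0\<^sub>m r s') (0\<^sub>m s c) D) = vec_space.rank r C + vec_space.rank s D"
proof -
  let ?M = "four_block_mat C (0\<^sub>m r s') (0\<^sub>m s c) D"
  have M: "?M \<in> carrier_mat (r + s) (c + s')" using C D by simp
  have mult: "?M *\<^sub>v (x @\<^sub>v y) = (C *\<^sub>v x) @\<^sub>v (D *\<^sub>v y)" if "x \<in> carrier_vec c" "y \<in> carrier_vec s'" for x y
    using that C D by (subst four_block_mat_mult_vec[OF C _ _ D]) auto
  have "img ?M = (\<lambda>(x, y). x @\<^sub>v y) ` (img C \<times> img D)"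
  proof (intro subset_antisym subsetI)
    fix u assume "u \<in> img ?M"
    then obtain v where v: "v \<in> carrier_vec (c + s')" "u = ?M *\<^sub>v v" using M by (auto simp: img_def)
    define x y where "x = vec_first v c" and "y = vec_last v s'"
    have xy: "x \<in> carrier_vec c" "y \<in> carrier_vec s'" "v = x @\<^sub>v y"
      using v by (auto simp: x_def y_def)
    then have "u = (C *\<^sub>v x) @\<^sub>v (D *\<^sub>v y)" using v mult by simp
    then show "u \<in> (\<lambda>(x, y). x @\<^sub>v y) ` (img C \<times> img D)"
      using xy C D unfolding img_def by (intro image_eqI[of _ _ "(C *\<^sub>v x, D *\<^sub>v y)"]) auto
  next
    fix u assume "u \<in> (\<lambda>(x, y). x @\<^sub>v y) ` (img C \<times> img D)"
    then obtain x y where xy: "x \<in> carrier_vec c" "y \<in> carrier_vec s'" "u = (C *\<^sub>v x) @\<^sub>v (D *\<^sub>v y)"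
      using C D by (auto simp: img_def)
    then have "u = ?M *\<^sub>v (x @\<^sub>v y)" using mult by simp
    then show "u \<in> img ?M" using xy M unfolding img_def by (intro image_eqI[of _ _ "x @\<^sub>v y"]) auto
  qed
  moreover have "inj_on (\<lambda>(x, y). x @\<^sub>v y) (img C \<times> img D)"
  proof (rule inj_onI, clarify)
    fix x y x' y' assume "x \<in> img C" "x' \<in> img C" "y \<in> img D" "y' \<in> img D" and eq: "x @\<^sub>v y = x' @\<^sub>v y'"
    then have "x \<in> carrier_vec r" "x' \<in> carrier_vec r" using C by (auto simp: img_def)
    then show "x = x' \<and> y = y'" using eq append_vec_eq by blast
  qed
  ultimately have "card (img ?M) = card (img C) * card (img D)"
    by (simp add: card_image card_cartesian_product)
  then show ?thesis using rank_eqI[OF M C, of "vec_space.rank s D"] card_img[OF D] by simp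
qed

lemma rank_invertible:
  fixes D :: "'f::{field,finite} mat"
  assumes D: "D \<in> carrier_mat s s" "D' \<in> carrier_mat s s" "D * D' = 1\<^sub>m s"
  shows "vec_space.rank s D = s"
proof -
  interpret vec_space "TYPE('f)" s .
  have "card (img D) = card (carrier_vec s :: 'f vec set)"
  proof (rule arg_cong[where f = card], intro subset_antisym subsetI)
    fix y :: "'f vec" assume y: "y \<in> carrier_vec s"
    have "D *\<^sub>v (D' *\<^sub>v y) = (D * D') *\<^sub>v y" using D(1,2) y by simp
    then have "y = D *\<^sub>v (D' *\<^sub>v y)" using D y by simp
    then show "y \<in> img D" using D y unfolding img_def by (intro image_eqI[of _ _ "D' *\<^sub>v y"]) auto
  qed (use D in \<open>auto simp: img_def\<close>)
  also have "card (carrier_vec s :: 'f vec set) = CARD('f) ^ s"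
    using vectorspace.card_carrier[OF vectorspace_axioms] dim_is_n by (simp add: class_ring_simps module_vec_simps)
  finally show ?thesis using card_img[OF D(1)] card_field_gt_1[where 'f = 'f] power_inject_exp by metis
qed

lemma card_carrier_vec: "card (carrier_vec n :: 'f::{field,finite} vec set) = CARD('f) ^ n"
proof -
  interpret vec_space "TYPE('f)" n .
  show ?thesis
    using vectorspace.card_carrier[OF vectorspace_axioms] dim_is_n by (simp add: class_ring_simps module_vec_simps)
qed

lemma finite_carrier_vec: "finite (carrier_vec n :: 'f::{field,finite} vec set)"
  by (rule card_ge_0_finite) (simp add: card_carrier_vec)

lemma finite_carrier_mat: "finite (carrier_mat m n :: 'f::{field,finite} mat set)"
proof (rule finite_subset)
  show "carrier_mat m n \<subseteq> mat_of_cols m ` {cs :: 'f vec list. set cs \<subseteq> carrier_vec m \<and> length cs = n}"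
  proof
    fix A :: "'f mat" assume A: "A \<in> carrier_mat m n"
    then have "A = mat_of_cols m (cols A)" using mat_of_cols_cols by auto
    moreover have "set (cols A) \<subseteq> carrier_vec m" "length (cols A) = n" using A cols_dim[of A] by auto
    ultimately show "A \<in> mat_of_cols m ` {cs. set cs \<subseteq> carrier_vec m \<and> length cs = n}" by blast
  qed
  show "finite (mat_of_cols m ` {cs :: 'f vec list. set cs \<subseteq> carrier_vec m \<and> length cs = n})"
    by (intro finite_imageI finite_lists_length_eq finite_carrier_vec)
qed

text \<open>The corner has size 1 for bilinear and Hermitian forms and size 2 for alternating ones.
  With the Schur complement \<open>C\<close> as the given datum, the same identity serves to border
  a form and to reduce one.\<close>

lemma schur_factorisation:
  fixes C :: "'f::{field,finite} mat"
  assumes C: "C \<in> carrier_mat r c" and V: "V \<in> carrier_mat r s" and W: "W \<in> carrier_mat s c"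
    and D: "D \<in> carrier_mat s s" "D' \<in> carrier_mat s s" "D * D' = 1\<^sub>m s" "D' * D = 1\<^sub>m s"
  shows "four_block_mat (C + V * D' * W) V W D =
    four_block_mat (1\<^sub>m r) (V * D') (0\<^sub>m s r) (1\<^sub>m s) * four_block_mat C (0\<^sub>m r s) (0\<^sub>m s c) D *
    four_block_mat (1\<^sub>m c) (0\<^sub>m c s) (D' * W) (1\<^sub>m s)"
proof -
  have DD: "V * D' * D = V" "D * (D' * W) = W"
    using V W D by (simp_all flip: assoc_mult_mat[of D s s D' s W c])
  have "four_block_mat (1\<^sub>m r) (V * D') (0\<^sub>m s r) (1\<^sub>m s) * four_block_mat C (0\<^sub>m r s) (0\<^sub>m s c) D =
      four_block_mat C V (0\<^sub>m s c) D"
    using assms(1-5) DD by (subst mult_four_block_mat[of _ r r _ s _ s _ _ c _ s]) simp_all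
  also have "\<dots> * four_block_mat (1\<^sub>m c) (0\<^sub>m c s) (D' * W) (1\<^sub>m s) = four_block_mat (C + V * D' * W) V W D"
    using assms(1-5) DD by (subst mult_four_block_mat[of _ r c _ s _ s _ _ c _ s]) simp_all
  finally show ?thesis by simp
qed

lemma uminus_zero_mat [simp]: "- 0\<^sub>m r c = (0\<^sub>m r c :: 'a::group_add mat)"
  by (intro eq_matI) auto

lemma add_uminus_mat: "U \<in> carrier_mat r c \<Longrightarrow> U + - U = (0\<^sub>m r c :: 'a::group_add mat)"
  by (intro eq_matI) auto

lemma unipotent_inverse:
  fixes U :: "'f::{field,finite} mat"
  assumes "U \<in> carrier_mat r s"
  shows "four_block_mat (1\<^sub>m r) U (0\<^sub>m s r) (1\<^sub>m s) * four_block_mat (1\<^sub>m r) (- U) (0\<^sub>m s r) (1\<^sub>m s) = 1\<^sub>m (r + s)"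
    and "four_block_mat (1\<^sub>m r) (- U) (0\<^sub>m s r) (1\<^sub>m s) * four_block_mat (1\<^sub>m r) U (0\<^sub>m s r) (1\<^sub>m s) = 1\<^sub>m (r + s)"
  using assms by (subst mult_four_block_mat[of _ r r _ s _ s _ _ r _ s]; simp add: add_uminus_mat)+

lemma unipotent_inverse':
  fixes U :: "'f::{field,finite} mat"
  assumes "U \<in> carrier_mat s c"
  shows "four_block_mat (1\<^sub>m c) (0\<^sub>m c s) U (1\<^sub>m s) * four_block_mat (1\<^sub>m c) (0\<^sub>m c s) (- U) (1\<^sub>m s) = 1\<^sub>m (c + s)"
    and "four_block_mat (1\<^sub>m c) (0\<^sub>m c s) (- U) (1\<^sub>m s) * four_block_mat (1\<^sub>m c) (0\<^sub>m c s) U (1\<^sub>m s) = 1\<^sub>m (c + s)"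
  using assms by (subst mult_four_block_mat[of _ c c _ s _ s _ _ c _ s]; simp add: add_uminus_mat)+

lemma rank_schur:
  fixes C :: "'f::{field,finite} mat"
  assumes C: "C \<in> carrier_mat r c" and V: "V \<in> carrier_mat r s" and W: "W \<in> carrier_mat s c"
    and D: "D \<in> carrier_mat s s" "D' \<in> carrier_mat s s" "D * D' = 1\<^sub>m s" "D' * D = 1\<^sub>m s"
  shows "vec_space.rank (r + s) (four_block_mat (C + V * D' * W) V W D) = vec_space.rank r C + s"
proof -
  have U: "V * D' \<in> carrier_mat r s" "D' * W \<in> carrier_mat s c" using V W D by auto
  have "vec_space.rank (r + s) (four_block_mat (C + V * D' * W) V W D) =
      vec_space.rank (r + s) (four_block_mat C (0\<^sub>m r s) (0\<^sub>m s c) D)"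
    unfolding schur_factorisation[OF assms]
    by (rule rank_mult_invertible[where P' = "four_block_mat (1\<^sub>m r) (- (V * D')) (0\<^sub>m s r) (1\<^sub>m s)"
          and R' = "four_block_mat (1\<^sub>m c) (0\<^sub>m c s) (- (D' * W)) (1\<^sub>m s)"])
      (use C D U unipotent_inverse[OF U(1)] unipotent_inverse'[OF U(2)] in auto)
  then show ?thesis using rank_direct_sum[OF C D(1)] rank_invertible[OF D(1-3)] by simp
qed

lemma nonzero_entryE:
  assumes "A \<in> carrier_mat m n" "A \<noteq> 0\<^sub>m m n"
  obtains s t where "s < m" "t < n" "A $$ (s, t) \<noteq> 0"
proof (rule ccontr)
  assume "\<not> thesis"
  then have "A = 0\<^sub>m m n" using assms(1) that by (intro eq_matI) auto
  with assms(2) show False by blast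
qed

section \<open>Pairings, permutation matrices, borders and Gauss sums\<close>

definition pair :: "'f::comm_ring_1 mat \<Rightarrow> 'f mat \<Rightarrow> 'f" where
  "pair A B = (\<Sum>i<dim_row A. \<Sum>j<dim_col A. A $$ (i, j) * B $$ (i, j))"

lemma pair_sym:
  assumes "A \<in> carrier_mat m n" "B \<in> carrier_mat m n" shows "pair A B = pair B A"
  using assms by (simp add: pair_def mult.commute)

lemma pair_add:
  assumes "A \<in> carrier_mat m n" "B \<in> carrier_mat m n" shows "pair (A + B) C = pair A C + pair B C"
  using assms by (simp add: pair_def sum.distrib distrib_right)

lemma mult3_entry:
  fixes A :: "'f::comm_ring_1 mat"
  assumes "P \<in> carrier_mat m m'" "A \<in> carrier_mat m' n'" "R \<in> carrier_mat n' n" "i < m" "j < n"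
  shows "(P * A * R) $$ (i, j) = (\<Sum>s<m'. \<Sum>t<n'. P $$ (i, s) * A $$ (s, t) * R $$ (t, j))"
  using assms by (simp add: scalar_prod_def lessThan_atLeast0 sum_distrib_left mult.assoc)

text \<open>\<open>pair A B\<close> is the trace of \<open>A\<^sup>T * B\<close>, so outer factors
  pass to the other argument as transposes. This moves a change of basis from the fixed form to the
  summation variable.\<close>

lemma pair_mult:
  fixes A :: "'f::comm_ring_1 mat"
  assumes P: "P \<in> carrier_mat m m" and A: "A \<in> carrier_mat m n" and R: "R \<in> carrier_mat n n" and B: "B \<in> carrier_mat m n"
  shows "pair (P * A * R) B = pair A (P\<^sup>T * B * R\<^sup>T)"
proof -
  let ?f = "\<lambda>i j s t. P $$ (i, s) * A $$ (s, t) * R $$ (t, j) * B $$ (i, j)"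
  have "pair (P * A * R) B = (\<Sum>i<m. \<Sum>j<n. \<Sum>s<m. \<Sum>t<n. ?f i j s t)"
    using assms mult3_entry[OF P A R] by (simp add: pair_def sum_distrib_right)
  also have "\<dots> = (\<Sum>s<m. \<Sum>t<n. \<Sum>i<m. \<Sum>j<n. ?f i j s t)"
    by (simp only: sum.cartesian_product)
      (rule sum.reindex_bij_witness[where i = "\<lambda>(s, t, i, j). (i, j, s, t)" and j = "\<lambda>(s, t, i, j). (i, j, s, t)"], auto)
  also have "\<dots> = pair A (P\<^sup>T * B * R\<^sup>T)"
  proof -
    have e: "(P\<^sup>T * B * R\<^sup>T) $$ (s, t) = (\<Sum>i<m. \<Sum>j<n. P $$ (i, s) * B $$ (i, j) * R $$ (t, j))" if "s < m" "t < n" for s t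
      using mult3_entry[of "P\<^sup>T" m m B n "R\<^sup>T" n s t] assms that by simp
    have "pair A (P\<^sup>T * B * R\<^sup>T) = (\<Sum>s<m. \<Sum>t<n. A $$ (s, t) * (P\<^sup>T * B * R\<^sup>T) $$ (s, t))"
      by (simp only: pair_def carrier_matD[OF A])
    also have "\<dots> = (\<Sum>s<m. \<Sum>t<n. A $$ (s, t) * (\<Sum>i<m. \<Sum>j<n. P $$ (i, s) * B $$ (i, j) * R $$ (t, j)))"
      by (intro sum.cong refl) (simp only: e lessThan_iff)
    finally show ?thesis by (simp add: sum_distrib_left mult_ac)
  qed
  finally show ?thesis .
qed

lemma sum_lessThan_add: "(\<Sum>i<r + s. f i) = (\<Sum>i<r. f i) + (\<Sum>i<s. f (r + i :: nat) :: 'a::comm_monoid_add)"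
  by (induction s) (simp_all add: add.assoc)

lemma pair_four_block:
  fixes C :: "'f::comm_ring_1 mat"
  assumes "C \<in> carrier_mat r c" "V \<in> carrier_mat r s'" "W \<in> carrier_mat s c" "D \<in> carrier_mat s s'"
    and "C' \<in> carrier_mat r c" "V' \<in> carrier_mat r s'" "W' \<in> carrier_mat s c" "D' \<in> carrier_mat s s'"
  shows "pair (four_block_mat C V W D) (four_block_mat C' V' W' D') = pair C C' + pair V V' + pair W W' + pair D D'"
  using assms by (simp add: pair_def sum_lessThan_add sum.distrib algebra_simps)

lemma pair_zero: "pair (0\<^sub>m m n) B = 0"
  by (simp add: pair_def)

text \<open>Nondegeneracy is requested as the value 1 because \<open>additive_character\<close>
  guarantees \<open>\<chi> 1 \<noteq> 1\<close>.\<close>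

lemma mat_self_dual_group:
  fixes f :: "'f::{field,finite} mat \<Rightarrow> 'f mat \<Rightarrow> 'f"
  assumes X: "X \<subseteq> carrier_mat r c" "0\<^sub>m r c \<in> X" "\<And>A B. A \<in> X \<Longrightarrow> B \<in> X \<Longrightarrow> A + B \<in> X"
      "\<And>A B. A \<in> X \<Longrightarrow> B \<in> X \<Longrightarrow> A - B \<in> X"
    and f: "\<And>A B. A \<in> X \<Longrightarrow> B \<in> X \<Longrightarrow> f A B = f B A"
      "\<And>A B C. A \<in> X \<Longrightarrow> B \<in> X \<Longrightarrow> C \<in> X \<Longrightarrow> f (A + B) C = f A C + f B C"
    and nd: "\<And>A. A \<in> X \<Longrightarrow> A \<noteq> 0\<^sub>m r c \<Longrightarrow> \<exists>B\<in>X. f A B = 1"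
    and \<chi>: "additive_character \<chi>"
  shows "self_dual_group X (0\<^sub>m r c) (\<lambda>A B. \<chi> (f A B))"
proof
  show "finite X" using X(1) finite_carrier_mat by (rule finite_subset)
  fix A B assume AB: "A \<in> X" "B \<in> X"
  then have c: "A \<in> carrier_mat r c" "B \<in> carrier_mat r c" using X(1) by auto
  show "A - B + B = A" "A + B - B = A" using c by (auto intro!: eq_matI)
  show "A - B = 0\<^sub>m r c \<longleftrightarrow> A = B"
  proof
    assume e: "A - B = 0\<^sub>m r c"
    have "A $$ (i, j) = B $$ (i, j)" if "i < r" "j < c" for i j
      using arg_cong[OF e, of "\<lambda>M. M $$ (i, j)"] that c by simp
    then show "A = B" using c by (intro eq_matI) auto
  qed (use c in \<open>auto intro!: eq_matI\<close>)
next
  fix A assume "A \<in> X"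
  then have "A \<in> carrier_mat r c" using X(1) by auto
  then show "A - 0\<^sub>m r c = A" by (auto intro!: eq_matI)
next
  fix A assume "A \<in> X" "A \<noteq> 0\<^sub>m r c"
  then show "\<exists>B\<in>X. \<chi> (f A B) \<noteq> 1" using nd \<chi> by (metis additive_character_def)
qed (use X f additive_character_ne_0[OF \<chi>] \<chi>[unfolded additive_character_def] in auto)

lemma sum_rank_invariant:
  assumes f: "\<And>B. B \<in> X \<Longrightarrow> f B \<in> X \<and> f' B \<in> X \<and> f (f' B) = B \<and> f' (f B) = B \<and> rk (f B) = rk B"
    and pr: "\<And>B. B \<in> X \<Longrightarrow> p B = p' (f B)"
  shows "(\<Sum>B\<in>{B \<in> X. rk B = k}. p B) = (\<Sum>B\<in>{B \<in> X. rk B = k}. p' B)"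
proof (rule sum.reindex_bij_witness[where i = f' and j = f])
  fix B assume B: "B \<in> {B \<in> X. rk B = k}"
  then have "rk (f' B) = rk (f (f' B))" using f[of "f' B"] f[of B] by simp
  then show "f' B \<in> {B \<in> X. rk B = k}" using f[of B] B by simp
qed (use f pr in auto)

definition pm :: "nat \<Rightarrow> (nat \<Rightarrow> nat) \<Rightarrow> 'f::field mat" where
  "pm n \<pi> = mat n n (\<lambda>(i, j). if \<pi> i = j then 1 else 0)"

lemma pm_carrier [simp]: "pm n \<pi> \<in> carrier_mat n n"
  by (simp add: pm_def)

lemma pm_dim [simp]: "dim_row (pm n \<pi>) = n" "dim_col (pm n \<pi>) = n"
  by (simp_all add: pm_def)

lemma pm_entry: "i < n \<Longrightarrow> j < n \<Longrightarrow> pm n \<pi> $$ (i, j) = (if \<pi> i = j then 1 else 0)"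
  by (simp add: pm_def)

lemma pm_inverse:
  assumes "\<pi> permutes {..<n}"
  shows "pm n \<pi> * (pm n \<pi>)\<^sup>T = 1\<^sub>m n" "(pm n \<pi>)\<^sup>T * pm n \<pi> = 1\<^sub>m n"
proof -
  have inj: "\<pi> i = \<pi> j \<longleftrightarrow> i = j" for i j using permutes_inj[OF assms] by (auto dest: injD)
  have bound: "\<pi> i < n" if "i < n" for i using permutes_in_image[OF assms, of i] that by simp
  show "pm n \<pi> * (pm n \<pi>)\<^sup>T = 1\<^sub>m n"
  proof (rule eq_matI)
    fix i j assume ij: "i < dim_row (1\<^sub>m n)" "j < dim_col (1\<^sub>m n)"
    have "(pm n \<pi> * (pm n \<pi>)\<^sup>T) $$ (i, j) = (\<Sum>k<n. pm n \<pi> $$ (i, k) * pm n \<pi> $$ (j, k))"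
      using ij by (simp add: scalar_prod_def lessThan_atLeast0)
    also have "\<dots> = (\<Sum>k<n. if k = \<pi> i then (if \<pi> j = k then 1 else 0) else 0)"
      using ij by (intro sum.cong refl) (auto simp: pm_entry)
    also have "\<dots> = 1\<^sub>m n $$ (i, j)" using ij bound inj by (auto simp: sum.delta)
    finally show "(pm n \<pi> * (pm n \<pi>)\<^sup>T) $$ (i, j) = 1\<^sub>m n $$ (i, j)" .
  qed auto
  show "(pm n \<pi>)\<^sup>T * pm n \<pi> = 1\<^sub>m n"
  proof (rule eq_matI)
    fix i j assume ij: "i < dim_row (1\<^sub>m n)" "j < dim_col (1\<^sub>m n)"
    have "((pm n \<pi>)\<^sup>T * pm n \<pi>) $$ (i, j) = (\<Sum>k<n. pm n \<pi> $$ (k, i) * pm n \<pi> $$ (k, j))"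
      using ij by (simp add: scalar_prod_def lessThan_atLeast0)
    also have "\<dots> = (\<Sum>k<n. (\<lambda>k. if k = i then (if i = j then 1 else 0) else 0) (\<pi> k))"
      using ij by (intro sum.cong refl) (auto simp: pm_entry)
    also have "\<dots> = (\<Sum>k<n. if k = i then (if i = j then 1 else 0) else 0)"
      by (rule sum.reindex_bij_betw[OF permutes_imp_bij[OF assms]])
    also have "\<dots> = 1\<^sub>m n $$ (i, j)" using ij by (auto simp: sum.delta)
    finally show "((pm n \<pi>)\<^sup>T * pm n \<pi>) $$ (i, j) = 1\<^sub>m n $$ (i, j)" .
  qed auto
qed

lemma pm_conj_entry:
  fixes A :: "'f::field mat"
  assumes A: "A \<in> carrier_mat m n" and \<pi>: "\<pi> permutes {..<m}" and \<sigma>: "\<sigma> permutes {..<n}" and ij: "i < m" "j < n"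
  shows "(pm m \<pi> * A * (pm n \<sigma>)\<^sup>T) $$ (i, j) = A $$ (\<pi> i, \<sigma> j)"
proof -
  have b: "\<pi> i < m" "\<sigma> j < n" using permutes_in_image[OF \<pi>, of i] permutes_in_image[OF \<sigma>, of j] ij by auto
  have "(pm m \<pi> * A * (pm n \<sigma>)\<^sup>T) $$ (i, j) = (\<Sum>s<m. \<Sum>t<n. pm m \<pi> $$ (i, s) * A $$ (s, t) * (pm n \<sigma>)\<^sup>T $$ (t, j))"
    by (rule mult3_entry[where m = m and n = n]) (use A ij in auto)
  also have "\<dots> = (\<Sum>s<m. \<Sum>t<n. if s = \<pi> i then (if t = \<sigma> j then A $$ (s, t) else 0) else 0)"
    using ij by (intro sum.cong refl) (auto simp: pm_def)
  also have "\<dots> = (\<Sum>s<m. if s = \<pi> i then A $$ (s, \<sigma> j) else 0)"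
    using b by (intro sum.cong refl) (auto simp: sum.delta)
  finally show ?thesis using b by simp
qed

definition colm :: "nat \<Rightarrow> 'f vec \<Rightarrow> 'f mat" where "colm r v = mat r 1 (\<lambda>(i, j). v $ i)"
definition rowm :: "nat \<Rightarrow> 'f vec \<Rightarrow> 'f mat" where "rowm c v = mat 1 c (\<lambda>(i, j). v $ j)"
definition sc :: "'f \<Rightarrow> 'f mat" where "sc d = mat 1 1 (\<lambda>_. d)"

lemma border_carrier [simp]:
  "colm r v \<in> carrier_mat r 1" "rowm c w \<in> carrier_mat 1 c" "sc d \<in> carrier_mat 1 1"
  by (auto simp: colm_def rowm_def sc_def)

lemma border_dim [simp]:
  "dim_row (colm r v) = r" "dim_col (colm r v) = 1" "dim_row (rowm c w) = 1" "dim_col (rowm c w) = c"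
  "dim_row (sc d) = 1" "dim_col (sc d) = 1"
  by (auto simp: colm_def rowm_def sc_def)

lemma sc_inverse: "d \<noteq> 0 \<Longrightarrow> sc d * sc (1 / d) = 1\<^sub>m 1" "d \<noteq> 0 \<Longrightarrow> sc (1 / d) * sc d = 1\<^sub>m 1"
  for d :: "'f::field"
  by (rule eq_matI; simp add: sc_def scalar_prod_def)+

lemma colm_sc_rowm_entry:
  fixes v :: "'f::field vec"
  assumes "i < r" "j < c"
  shows "(colm r v * sc x * rowm c w) $$ (i, j) = x * (v $ i * w $ j)"
proof -
  have "(colm r v * sc x * rowm c w) $$ (i, j) = (\<Sum>s<1. \<Sum>t<1. colm r v $$ (i, s) * sc x $$ (s, t) * rowm c w $$ (t, j))"
    by (rule mult3_entry[where m = r and n = c]) (use assms in auto)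
  then show ?thesis using assms by (simp add: colm_def sc_def rowm_def)
qed

lemma pair_rank_one:
  fixes A :: "'f::field mat"
  assumes A: "A \<in> carrier_mat r c" and v: "v \<in> carrier_vec r" and w: "w \<in> carrier_vec c"
  shows "pair A (colm r v * sc x * rowm c w) = x * (v \<bullet> (A *\<^sub>v w))"
proof -
  have "pair A (colm r v * sc x * rowm c w) = (\<Sum>i<r. \<Sum>j<c. A $$ (i, j) * (x * (v $ i * w $ j)))"
    unfolding pair_def carrier_matD[OF A]
    by (intro sum.cong refl) (simp only: colm_sc_rowm_entry lessThan_iff)
  also have "\<dots> = x * (\<Sum>i<r. v $ i * (\<Sum>j<c. A $$ (i, j) * w $ j))"
    by (simp add: sum_distrib_left mult_ac)
  also have "\<dots> = x * (v \<bullet> (A *\<^sub>v w))"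
    using A v w by (simp add: scalar_prod_def lessThan_atLeast0)
  finally show ?thesis .
qed

lemma vec_cancel:
  fixes v :: "'f::ab_group_add vec"
  assumes "v \<in> carrier_vec r" "u \<in> carrier_vec r" shows "v - u + u = v" "v + u - u = v"
  using assms by (auto intro!: eq_vecI)

lemma sum_character_scalar_prod:
  fixes y :: "'f::{field,finite} vec"
  assumes \<chi>: "additive_character \<chi>" and t: "t \<noteq> 0" and y: "y \<in> carrier_vec r"
  shows "(\<Sum>v\<in>carrier_vec r. \<chi> (t * (v \<bullet> y))) = (if y = 0\<^sub>v r then of_nat (CARD('f) ^ r) else 0)"
proof (cases "y = 0\<^sub>v r")
  case True
  then have "(\<Sum>v\<in>carrier_vec r. \<chi> (t * (v \<bullet> y))) = (\<Sum>v\<in>(carrier_vec r :: 'f vec set). 1)"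
    using \<chi> by (intro sum.cong) (auto simp: additive_character_def)
  then show ?thesis using True by (simp add: card_carrier_vec)
next
  case False
  have "\<exists>i<r. y $ i \<noteq> 0"
  proof (rule ccontr)
    assume "\<not> ?thesis"
    then have "y = 0\<^sub>v r" using y by (intro eq_vecI) auto
    with False show False by blast
  qed
  then obtain i where i: "i < r" "y $ i \<noteq> 0" by blast
  define u where "u = (1 / (t * y $ i)) \<cdot>\<^sub>v unit_vec r i"
  have u: "u \<in> carrier_vec r" by (simp add: u_def)
  have uy: "t * (u \<bullet> y) = 1" using i t y by (simp add: u_def scalar_prod_left_unit)
  have "(\<Sum>v\<in>carrier_vec r. \<chi> (t * (v \<bullet> y))) = (\<Sum>v\<in>carrier_vec r. \<chi> (t * ((v + u) \<bullet> y)))"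
    by (rule sum.reindex_bij_witness[where i = "\<lambda>v. v + u" and j = "\<lambda>v. v - u"])
      (use u vec_cancel[OF _ u] in auto)
  also have "\<dots> = (\<Sum>v\<in>carrier_vec r. \<chi> (t * (v \<bullet> y)) * \<chi> 1)"
    using u y \<chi> uy by (intro sum.cong refl) (simp add: add_scalar_prod_distrib[of _ r] distrib_left additive_character_def)
  also have "\<dots> = (\<Sum>v\<in>carrier_vec r. \<chi> (t * (v \<bullet> y))) * \<chi> 1" by (rule sum_distrib_right[symmetric])
  finally show ?thesis using \<chi> False by (simp add: additive_character_def)
qed

lemma card_kernel_img:
  fixes A :: "'f::{field,finite} mat"
  assumes A: "A \<in> carrier_mat r c"
  shows "card {w \<in> carrier_vec c. A *\<^sub>v w = 0\<^sub>v r} * card (img A) = CARD('f) ^ c"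
proof -
  let ?K = "{w \<in> carrier_vec c. A *\<^sub>v w = 0\<^sub>v r}"
  have fiber: "card {w \<in> carrier_vec c. A *\<^sub>v w = y} = card ?K" if y: "y \<in> img A" for y
  proof -
    obtain u where u: "u \<in> carrier_vec c" "y = A *\<^sub>v u" using y A by (auto simp: img_def)
    have "bij_betw (\<lambda>w. w + u) ?K {w \<in> carrier_vec c. A *\<^sub>v w = y}"
    proof (rule bij_betw_byWitness[where f' = "\<lambda>w. w - u"])
      show "\<forall>w\<in>?K. w + u - u = w" using u by (auto intro!: eq_vecI)
      show "\<forall>w\<in>{w \<in> carrier_vec c. A *\<^sub>v w = y}. w - u + u = w" using u by (auto intro!: eq_vecI)
      show "(\<lambda>w. w + u) ` ?K \<subseteq> {w \<in> carrier_vec c. A *\<^sub>v w = y}"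
        using u A by (auto simp: mult_add_distrib_mat_vec[OF A])
      show "(\<lambda>w. w - u) ` {w \<in> carrier_vec c. A *\<^sub>v w = y} \<subseteq> ?K"
        using u A by (auto simp: mult_minus_distrib_mat_vec[OF A])
    qed
    then show ?thesis by (simp add: bij_betw_same_card)
  qed
  have "CARD('f) ^ c = card (\<Union>y\<in>img A. {w \<in> carrier_vec c. A *\<^sub>v w = y})"
  proof -
    have "(\<Union>y\<in>img A. {w \<in> carrier_vec c. A *\<^sub>v w = y}) = carrier_vec c" using A by (auto simp: img_def)
    then show ?thesis by (simp add: card_carrier_vec)
  qed
  also have "\<dots> = (\<Sum>y\<in>img A. card {w \<in> carrier_vec c. A *\<^sub>v w = y})"
    by (rule card_UN_disjoint) (auto simp: img_def finite_carrier_vec)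
  also have "\<dots> = card ?K * card (img A)" by (simp add: fiber)
  finally show ?thesis by simp
qed

text \<open>Summing over \<open>v\<close> first leaves only those \<open>w\<close> in the kernel of
  \<open>A\<close>, whose number \<open>card_kernel_img\<close> gives.\<close>

lemma bilinear_gauss_sum:
  fixes A :: "'f::{field,finite} mat"
  assumes \<chi>: "additive_character \<chi>" and t: "t \<noteq> 0" and A: "A \<in> carrier_mat r c"
  shows "(\<Sum>(v, w)\<in>carrier_vec r \<times> carrier_vec c. \<chi> (t * (v \<bullet> (A *\<^sub>v w)))) =
    of_nat (CARD('f) ^ (r + c - vec_space.rank r A))"
proof -
  let ?K = "{w \<in> carrier_vec c. A *\<^sub>v w = 0\<^sub>v r}"
  have "(\<Sum>(v, w)\<in>carrier_vec r \<times> carrier_vec c. \<chi> (t * (v \<bullet> (A *\<^sub>v w)))) =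
      (\<Sum>w\<in>carrier_vec c. \<Sum>v\<in>carrier_vec r. \<chi> (t * (v \<bullet> (A *\<^sub>v w))))"
    by (subst sum.cartesian_product[symmetric], rule sum.swap)
  also have "\<dots> = (\<Sum>w\<in>carrier_vec c. if A *\<^sub>v w = 0\<^sub>v r then of_nat (CARD('f) ^ r) else 0)"
    using A by (intro sum.cong refl sum_character_scalar_prod[OF \<chi> t]) auto
  also have "\<dots> = of_nat (card ?K * CARD('f) ^ r)"
    by (simp add: finite_carrier_vec flip: sum.inter_filter)
  also have "card ?K * CARD('f) ^ r = CARD('f) ^ (r + c - vec_space.rank r A)"
  proof -
    have q: "0 < CARD('f)" by simp
    have prod: "card ?K * CARD('f) ^ vec_space.rank r A = CARD('f) ^ c"
      using card_kernel_img[OF A] unfolding card_img[OF A] .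
    have "CARD('f) ^ vec_space.rank r A dvd CARD('f) ^ c" unfolding prod[symmetric] by (rule dvd_triv_right)
    then have "CARD('f) ^ vec_space.rank r A \<le> CARD('f) ^ c" by (rule dvd_imp_le) simp
    then have le: "vec_space.rank r A \<le> c"
      by (rule power_le_imp_le_exp[OF card_field_gt_1])
    have "card ?K * CARD('f) ^ r * CARD('f) ^ vec_space.rank r A = CARD('f) ^ c * CARD('f) ^ r"
      unfolding prod[symmetric] by (simp only: mult_ac)
    also have "\<dots> = CARD('f) ^ (r + c - vec_space.rank r A) * CARD('f) ^ vec_space.rank r A"
      using le by (simp flip: power_add add: add.commute)
    finally show ?thesis using q by simp
  qed
  finally show ?thesis .
qed

section \<open>Bilinear forms\<close>

lemma split_last_block:
  fixes M :: "'f::field mat"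
  assumes M: "M \<in> carrier_mat (r + s) (c + s')"
  obtains M1 M2 M3 M4 where "M1 \<in> carrier_mat r c" "M2 \<in> carrier_mat r s'" "M3 \<in> carrier_mat s c" "M4 \<in> carrier_mat s s'"
    "M = four_block_mat M1 M2 M3 M4"
proof
  show "mat r c (\<lambda>(i, j). M $$ (i, j)) \<in> carrier_mat r c" by simp
  show "mat r s' (\<lambda>(i, j). M $$ (i, c + j)) \<in> carrier_mat r s'" by simp
  show "mat s c (\<lambda>(i, j). M $$ (r + i, j)) \<in> carrier_mat s c" by simp
  show "mat s s' (\<lambda>(i, j). M $$ (r + i, c + j)) \<in> carrier_mat s s'" by simp
  show "M = four_block_mat (mat r c (\<lambda>(i, j). M $$ (i, j))) (mat r s' (\<lambda>(i, j). M $$ (i, c + j)))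
     (mat s c (\<lambda>(i, j). M $$ (r + i, j))) (mat s s' (\<lambda>(i, j). M $$ (r + i, c + j)))"
    using M by (intro eq_matI) auto
qed

lemma four_block_eqD:
  assumes eq: "four_block_mat A B C D = four_block_mat A' B' C' D'"
    and c: "A \<in> carrier_mat r c" "B \<in> carrier_mat r s'" "C \<in> carrier_mat s c" "D \<in> carrier_mat s s'"
    "A' \<in> carrier_mat r c" "B' \<in> carrier_mat r s'" "C' \<in> carrier_mat s c" "D' \<in> carrier_mat s s'"
  shows "A = A'" "B = B'" "C = C'" "D = D'"
proof -
  have e: "four_block_mat A B C D $$ (i, j) = four_block_mat A' B' C' D' $$ (i, j)" for i j
    using eq by simp
  show "A = A'"
  proof (rule eq_matI)
    fix i j assume "i < dim_row A'" "j < dim_col A'"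
    then show "A $$ (i, j) = A' $$ (i, j)" using e[of i j] c by auto
  qed (use c in auto)
  show "B = B'"
  proof (rule eq_matI)
    fix i j assume "i < dim_row B'" "j < dim_col B'"
    then show "B $$ (i, j) = B' $$ (i, j)" using e[of i "c + j"] c by auto
  qed (use c in auto)
  show "C = C'"
  proof (rule eq_matI)
    fix i j assume "i < dim_row C'" "j < dim_col C'"
    then show "C $$ (i, j) = C' $$ (i, j)" using e[of "r + i" j] c by auto
  qed (use c in auto)
  show "D = D'"
  proof (rule eq_matI)
    fix i j assume "i < dim_row D'" "j < dim_col D'"
    then show "D $$ (i, j) = D' $$ (i, j)" using e[of "r + i" "c + j"] c by auto
  qed (use c in auto)
qed

lemma colm_surj: "M \<in> carrier_mat r 1 \<Longrightarrow> M = colm r (vec r (\<lambda>i. M $$ (i, 0)))"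
  by (rule eq_matI) (auto simp: colm_def)

lemma rowm_surj: "M \<in> carrier_mat 1 c \<Longrightarrow> M = rowm c (vec c (\<lambda>j. M $$ (0, j)))"
  by (rule eq_matI) (auto simp: rowm_def)

lemma sc_surj: "M \<in> carrier_mat 1 1 \<Longrightarrow> M = sc (M $$ (0, 0))"
  by (rule eq_matI) (auto simp: sc_def)

lemma border_entry [simp]:
  "i < r \<Longrightarrow> colm r v $$ (i, 0) = v $ i" "j < c \<Longrightarrow> rowm c w $$ (0, j) = w $ j" "sc d $$ (0, 0) = d"
  by (auto simp: colm_def rowm_def sc_def)

lemma colm_inj:
  assumes "v \<in> carrier_vec r" "v' \<in> carrier_vec r" "colm r v = colm r v'" shows "v = v'"
proof (rule eq_vecI)
  fix i assume "i < dim_vec v'"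
  then show "v $ i = v' $ i" using assms border_entry(1)[of i r v] border_entry(1)[of i r v'] by simp
qed (use assms in auto)

lemma rowm_inj:
  assumes "v \<in> carrier_vec r" "v' \<in> carrier_vec r" "rowm r v = rowm r v'" shows "v = v'"
proof (rule eq_vecI)
  fix i assume "i < dim_vec v'"
  then show "v $ i = v' $ i" using assms border_entry(2)[of i r v] border_entry(2)[of i r v'] by simp
qed (use assms in auto)

lemma sc_inj: "sc d = sc d' \<Longrightarrow> d = d'"
  by (metis border_entry(3))

lemma border_zero: "colm r (0\<^sub>v r) = 0\<^sub>m r 1" "rowm r (0\<^sub>v r) = 0\<^sub>m 1 r" "sc 0 = 0\<^sub>m 1 1"
  by (rule eq_matI; simp add: colm_def rowm_def sc_def)+

lemma pair_sc: "pair (sc a) (sc d) = a * d"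
  by (simp add: pair_def sc_def)

lemma transpose_inverse:
  fixes P :: "'f::field mat"
  assumes "P \<in> carrier_mat n n" "P' \<in> carrier_mat n n" "P * P' = 1\<^sub>m n"
  shows "P'\<^sup>T * P\<^sup>T = 1\<^sub>m n"
  using assms transpose_mult[of P n n P' n] by simp

lemma conj_cancel:
  fixes B :: "'f::field mat"
  assumes B: "B \<in> carrier_mat m n" and P: "P \<in> carrier_mat m m" "P' \<in> carrier_mat m m" "P * P' = 1\<^sub>m m"
    and R: "R \<in> carrier_mat n n" "R' \<in> carrier_mat n n" "R' * R = 1\<^sub>m n"
  shows "P * (P' * B * R') * R = B"
proof -
  have Y: "B * R' \<in> carrier_mat m n" by (rule mult_carrier_mat[OF B R(2)])
  have "P * (P' * B * R') = P * (P' * (B * R'))" unfolding assoc_mult_mat[OF P(2) B R(2)] ..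
  also have "\<dots> = P * P' * (B * R')" by (rule assoc_mult_mat[OF P(1,2) Y, symmetric])
  also have "\<dots> = B * R'" unfolding P(3) using Y by (rule left_mult_one_mat)
  finally have "P * (P' * B * R') * R = B * (R' * R)" using assoc_mult_mat[OF B R(2,1)] by simp
  then show ?thesis using B R by simp
qed

lemma mat_minus_add_cancel:
  fixes A :: "'f::ab_group_add mat"
  assumes "A \<in> carrier_mat m n" "B \<in> carrier_mat m n" shows "A - B + B = A"
  using assms by (intro eq_matI) auto

lemma bilinear_sum_invariant:
  fixes A :: "'f::{field,finite} mat"
  assumes A: "A \<in> carrier_mat m n"
    and P: "P \<in> carrier_mat m m" "P' \<in> carrier_mat m m" "P * P' = 1\<^sub>m m" "P' * P = 1\<^sub>m m"
    and R: "R \<in> carrier_mat n n" "R' \<in> carrier_mat n n" "R * R' = 1\<^sub>m n" "R' * R = 1\<^sub>m n"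
  shows "(\<Sum>B\<in>{B \<in> carrier_mat m n. vec_space.rank m B = k}. \<chi> (pair (P * A * R) B) :: complex) =
    (\<Sum>B\<in>{B \<in> carrier_mat m n. vec_space.rank m B = k}. \<chi> (pair A B))"
proof (rule sum_rank_invariant[where f = "\<lambda>B. P\<^sup>T * B * R\<^sup>T" and f' = "\<lambda>B. P'\<^sup>T * B * R'\<^sup>T"])
  note T = transpose_inverse[OF P(1,2,3)] transpose_inverse[OF P(2,1,4)]
    transpose_inverse[OF R(1,2,3)] transpose_inverse[OF R(2,1,4)]
  fix B :: "'f mat" assume B: "B \<in> carrier_mat m n"
  show "\<chi> (pair (P * A * R) B) = \<chi> (pair A (P\<^sup>T * B * R\<^sup>T))"
    using pair_mult[OF P(1) A R(1) B] by simp
  have "P\<^sup>T * (P'\<^sup>T * B * R'\<^sup>T) * R\<^sup>T = B"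
    by (rule conj_cancel[OF B]) (use P R T in auto)
  moreover have "P'\<^sup>T * (P\<^sup>T * B * R\<^sup>T) * R'\<^sup>T = B"
    by (rule conj_cancel[OF B]) (use P R T in auto)
  moreover have "vec_space.rank m (P\<^sup>T * B * R\<^sup>T) = vec_space.rank m B"
    by (rule rank_mult_invertible[where P' = "P'\<^sup>T" and R' = "R'\<^sup>T"]) (use B P R T in auto)
  moreover have "P\<^sup>T * B * R\<^sup>T \<in> carrier_mat m n" "P'\<^sup>T * B * R'\<^sup>T \<in> carrier_mat m n"
    using B P R by (auto intro!: mult_carrier_mat)
  ultimately show "P\<^sup>T * B * R\<^sup>T \<in> carrier_mat m n \<and> P'\<^sup>T * B * R'\<^sup>T \<in> carrier_mat m n \<and>
      P\<^sup>T * (P'\<^sup>T * B * R'\<^sup>T) * R\<^sup>T = B \<and> P'\<^sup>T * (P\<^sup>T * B * R\<^sup>T) * R'\<^sup>T = B \<and>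
      vec_space.rank m (P\<^sup>T * B * R\<^sup>T) = vec_space.rank m B" by blast
qed

lemma transpose_permutes: "a < n \<Longrightarrow> b < n \<Longrightarrow> Transposition.transpose a b permutes {..<n}" for n :: nat
  by (rule permutes_swap_id) auto

text \<open>The surplus \<open>e\<close> of rows over columns stays fixed while \<open>n\<close>
  grows, which makes rectangular matrices a family closed under bordering. A border is a column
  together with an independent row.\<close>

definition bil_blk :: "nat \<Rightarrow> nat \<Rightarrow> 'f::field mat \<Rightarrow> 'f vec \<times> 'f vec \<Rightarrow> 'f \<Rightarrow> 'f mat" where
  "bil_blk e n C vw d = four_block_mat C (colm (n + e) (fst vw)) (rowm n (snd vw)) (sc d)"

definition bil_corr :: "nat \<Rightarrow> nat \<Rightarrow> 'f::field vec \<times> 'f vec \<Rightarrow> 'f \<Rightarrow> 'f mat" where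
  "bil_corr e n vw d = colm (n + e) (fst vw) * sc (1 / d) * rowm n (snd vw)"

text \<open>Row and column permutations bring a nonzero entry to the corner, and the Schur
  factorisation clears the border. Both are multiplications by invertible matrices, which preserve
  ranks and, by \<open>bilinear_sum_invariant\<close>, the character sums.\<close>

lemma bil_reduction:
  fixes A :: "'f::{field,finite} mat"
  assumes A: "A \<in> carrier_mat (r + 1) (c + 1)" "A \<noteq> 0\<^sub>m (r + 1) (c + 1)"
  shows "\<exists>C a. C \<in> carrier_mat r c \<and> a \<noteq> 0 \<and> Suc (vec_space.rank r C) = vec_space.rank (r + 1) A \<and>
    (\<forall>k. (\<Sum>B\<in>{B \<in> carrier_mat (r + 1) (c + 1). vec_space.rank (r + 1) B = k}. \<chi> (pair A B) :: complex) =
      (\<Sum>B\<in>{B \<in> carrier_mat (r + 1) (c + 1). vec_space.rank (r + 1) B = k}.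
        \<chi> (pair (four_block_mat C (0\<^sub>m r 1) (0\<^sub>m 1 c) (sc a)) B)))"
proof -
  obtain s t where st: "s < r + 1" "t < c + 1" "A $$ (s, t) \<noteq> 0"
    using nonzero_entryE[OF A(1) A(2)] .
  define \<pi> where "\<pi> = Transposition.transpose s r"
  define \<sigma> where "\<sigma> = Transposition.transpose t c"
  have \<pi>: "\<pi> permutes {..<r + 1}" and \<sigma>: "\<sigma> permutes {..<c + 1}"
    using st unfolding \<pi>_def \<sigma>_def by (intro transpose_permutes; simp)+
  let ?P = "pm (r + 1) \<pi> :: 'f mat" and ?R = "(pm (c + 1) \<sigma>)\<^sup>T :: 'f mat"
  define M where "M = ?P * A * ?R"
  have M: "M \<in> carrier_mat (r + 1) (c + 1)" unfolding M_def using A by (auto intro!: mult_carrier_mat)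
  have Mrc: "M $$ (r, c) \<noteq> 0"
    using pm_conj_entry[OF A(1) \<pi> \<sigma>, of r c] st unfolding M_def by (simp add: \<pi>_def \<sigma>_def)
  note invP = pm_inverse[OF \<pi>] and invR = pm_inverse[OF \<sigma>]
  have S1: "(\<Sum>B\<in>{B \<in> carrier_mat (r + 1) (c + 1). vec_space.rank (r + 1) B = k}. \<chi> (pair M B)) =
      (\<Sum>B\<in>{B \<in> carrier_mat (r + 1) (c + 1). vec_space.rank (r + 1) B = k}. \<chi> (pair A B))" for k
    unfolding M_def by (rule bilinear_sum_invariant[OF A(1) _ _ invP _ _ invR(2,1)]) auto
  have rank1: "vec_space.rank (r + 1) M = vec_space.rank (r + 1) A"
    unfolding M_def by (rule rank_mult_invertible[OF A(1) _ _ invP(2) _ _ invR(2)]) auto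
  obtain M1 M2 M3 M4 where blocks: "M1 \<in> carrier_mat r c" "M2 \<in> carrier_mat r 1" "M3 \<in> carrier_mat 1 c" "M4 \<in> carrier_mat 1 1"
    and Meq: "M = four_block_mat M1 M2 M3 M4"
    by (rule split_last_block[OF M])
  define a where "a = M4 $$ (0, 0)"
  have M4: "M4 = sc a" unfolding a_def by (rule sc_surj[OF blocks(4)])
  have a: "a \<noteq> 0" using Mrc blocks unfolding Meq a_def by simp
  define D' where "D' = sc (1 / a)"
  have D: "M4 \<in> carrier_mat 1 1" "D' \<in> carrier_mat 1 1" "M4 * D' = 1\<^sub>m 1" "D' * M4 = 1\<^sub>m 1"
    unfolding M4 D'_def using sc_inverse[OF a] by auto
  define C where "C = M1 - M2 * D' * M3"
  have T: "M2 * D' * M3 \<in> carrier_mat r c" using blocks D by (auto intro!: mult_carrier_mat)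
  have C: "C \<in> carrier_mat r c" unfolding C_def using T by (rule minus_carrier_mat)
  have CT: "C + M2 * D' * M3 = M1" unfolding C_def by (rule mat_minus_add_cancel[OF blocks(1) T])
  let ?N = "four_block_mat C (0\<^sub>m r 1) (0\<^sub>m 1 c) M4"
  have U: "M2 * D' \<in> carrier_mat r 1" "D' * M3 \<in> carrier_mat 1 c" using blocks D by auto
  have fact: "M = four_block_mat (1\<^sub>m r) (M2 * D') (0\<^sub>m 1 r) (1\<^sub>m 1) * ?N * four_block_mat (1\<^sub>m c) (0\<^sub>m c 1) (D' * M3) (1\<^sub>m 1)"
    using schur_factorisation[OF C blocks(2,3) D] unfolding CT Meq[symmetric] .
  have N: "?N \<in> carrier_mat (r + 1) (c + 1)" by (rule four_block_carrier_mat[OF C blocks(4)])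
  have S2: "(\<Sum>B\<in>{B \<in> carrier_mat (r + 1) (c + 1). vec_space.rank (r + 1) B = k}. \<chi> (pair M B)) =
      (\<Sum>B\<in>{B \<in> carrier_mat (r + 1) (c + 1). vec_space.rank (r + 1) B = k}. \<chi> (pair ?N B))" for k
    unfolding fact
    by (rule bilinear_sum_invariant[OF N _ _ unipotent_inverse[OF U(1)] _ _ unipotent_inverse'[OF U(2)]]) (use U in auto)
  have "vec_space.rank (r + 1) M = vec_space.rank r C + 1"
    using rank_schur[OF C blocks(2,3) D] unfolding CT Meq .
  then have "Suc (vec_space.rank r C) = vec_space.rank (r + 1) A" using rank1 by simp
  with C a S1 S2 show ?thesis unfolding M4 by (intro exI[of _ C] exI[of _ a]) auto
qed

lemma bil_form_family:
  fixes \<chi> :: "'f::{field,finite} \<Rightarrow> complex"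
  assumes \<chi>: "additive_character \<chi>"
  shows "form_family (real CARD('f)) (real CARD('f) ^ e) (\<lambda>n. carrier_mat (n + e) n) (\<lambda>n. 0\<^sub>m (n + e) n)
    (\<lambda>n A B. \<chi> (pair A B)) (\<lambda>n. vec_space.rank (n + e)) (\<lambda>n. carrier_vec (n + e) \<times> carrier_vec n)
    (\<lambda>n. (0\<^sub>v (n + e), 0\<^sub>v n)) UNIV 0 (bil_blk e) (bil_corr e) (\<lambda>a d. \<chi> (a * d))"
proof -
  let ?q = "real CARD('f)"
  have q: "1 < ?q" using card_field_gt_1[where 'f = 'f] by simp
  have gb: "gauss_base ?q" using q by (rule gauss_base_gt_1)
  have blk_in: "bil_blk e n C vw d \<in> carrier_mat (Suc n + e) (Suc n)" if "C \<in> carrier_mat (n + e) n" for n and C :: "'f mat" and vw d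
    using four_block_carrier_mat[OF that border_carrier(3), of "colm (n + e) (fst vw)" "rowm n (snd vw)" d]
    unfolding bil_blk_def by (simp add: add.commute)
  have zero_blk: "bil_blk e n C (0\<^sub>v (n + e), 0\<^sub>v n) d = four_block_mat C (0\<^sub>m (n + e) 1) (0\<^sub>m 1 n) (sc d)" for n and C :: "'f mat" and d
    by (simp add: bil_blk_def border_zero)
  have corr_in: "bil_corr e n vw d \<in> carrier_mat (n + e) n" for n vw and d :: 'f
    unfolding bil_corr_def by (auto intro!: mult_carrier_mat)
  show ?thesis
  proof (intro form_family.intro gb form_family_axioms.intro)
    fix n
    show "self_dual_group (carrier_mat (n + e) n) (0\<^sub>m (n + e) n) (\<lambda>A B. \<chi> (pair A B))"
    proof (rule mat_self_dual_group[OF _ _ _ _ _ _ _ \<chi>])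
      fix A :: "'f mat" assume A: "A \<in> carrier_mat (n + e) n" "A \<noteq> 0\<^sub>m (n + e) n"
      obtain s t where st: "s < n + e" "t < n" "A $$ (s, t) \<noteq> 0"
        using nonzero_entryE[OF A(1) A(2)] .
      let ?B = "mat (n + e) n (\<lambda>(i, j). if i = s \<and> j = t then 1 / A $$ (s, t) else 0)"
      have "pair A ?B = (\<Sum>i<n + e. \<Sum>j<n. if i = s then (if j = t then 1 else 0) else 0)"
        using A(1) st by (auto simp: pair_def intro!: sum.cong)
      also have "\<dots> = (\<Sum>i<n + e. if i = s then 1 else 0)" using st by (intro sum.cong) auto
      also have "\<dots> = 1" using st by simp
      finally show "\<exists>B\<in>carrier_mat (n + e) n. pair A B = 1" by (intro bexI[of _ ?B]) auto
    qed (auto simp: pair_sym pair_add intro: minus_carrier_mat)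
    show "vec_space.rank (n + e) A \<le> n" if "A \<in> carrier_mat (n + e) n" for A :: "'f mat"
      using vec_space.rank_le_nc[OF that] .
    show "vec_space.rank (n + e) A = 0 \<longleftrightarrow> A = 0\<^sub>m (n + e) n" if "A \<in> carrier_mat (n + e) n" for A :: "'f mat"
      by (rule rank_eq_0_iff[OF that])
    show "vec_space.rank (n + e) (A - B) = vec_space.rank (n + e) (B - A)"
      if "A \<in> carrier_mat (n + e) n" "B \<in> carrier_mat (n + e) n" for A B :: "'f mat"
      by (rule rank_uminus_diff[OF that])
    show "bij_betw (\<lambda>(C, vw, d). bil_blk e n C vw d)
       (carrier_mat (n + e) n \<times> (carrier_vec (n + e) \<times> carrier_vec n) \<times> (UNIV :: 'f set)) (carrier_mat (Suc n + e) (Suc n))"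
      unfolding bij_betw_def
    proof
      show "inj_on (\<lambda>(C, vw, d). bil_blk e n C vw d)
         (carrier_mat (n + e) n \<times> (carrier_vec (n + e) \<times> carrier_vec n) \<times> (UNIV :: 'f set))"
      proof (rule inj_onI)
        fix x y
        assume "x \<in> carrier_mat (n + e) n \<times> (carrier_vec (n + e) \<times> carrier_vec n) \<times> (UNIV :: 'f set)"
          "y \<in> carrier_mat (n + e) n \<times> (carrier_vec (n + e) \<times> carrier_vec n) \<times> (UNIV :: 'f set)"
          and eq: "(case x of (C, vw, d) \<Rightarrow> bil_blk e n C vw d) = (case y of (C, vw, d) \<Rightarrow> bil_blk e n C vw d)"
        then obtain C C' v v' w w' d d' where xy: "x = (C, (v, w), d)" "y = (C', (v', w'), d')"
          and c: "C \<in> carrier_mat (n + e) n" "C' \<in> carrier_mat (n + e) n" "v \<in> carrier_vec (n + e)" "v' \<in> carrier_vec (n + e)"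
          "w \<in> carrier_vec n" "w' \<in> carrier_vec n" by auto
        have "bil_blk e n C (v, w) d = bil_blk e n C' (v', w') d'" using eq unfolding xy by simp
        note D = four_block_eqD[OF this[unfolded bil_blk_def] c(1) border_carrier c(2) border_carrier]
        show "x = y" unfolding xy
          using D colm_inj[OF c(3,4)] rowm_inj[OF c(5,6)] sc_inj by auto
      qed
      show "(\<lambda>(C, vw, d). bil_blk e n C vw d) ` (carrier_mat (n + e) n \<times> (carrier_vec (n + e) \<times> carrier_vec n) \<times> (UNIV :: 'f set)) =
          carrier_mat (Suc n + e) (Suc n)"
      proof (intro subset_antisym subsetI)
        fix M :: "'f mat" assume "M \<in> carrier_mat (Suc n + e) (Suc n)"
        then have "M \<in> carrier_mat (n + e + 1) (n + 1)" by simp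
        then obtain M1 M2 M3 M4 where b: "M1 \<in> carrier_mat (n + e) n" "M2 \<in> carrier_mat (n + e) 1" "M3 \<in> carrier_mat 1 n" "M4 \<in> carrier_mat 1 1"
          and M: "M = four_block_mat M1 M2 M3 M4" by (rule split_last_block)
        have "M = bil_blk e n M1 (vec (n + e) (\<lambda>i. M2 $$ (i, 0)), vec n (\<lambda>j. M3 $$ (0, j))) (M4 $$ (0, 0))"
          unfolding M bil_blk_def fst_conv snd_conv
          using colm_surj[OF b(2)] rowm_surj[OF b(3)] sc_surj[OF b(4)] by metis
        then show "M \<in> (\<lambda>(C, vw, d). bil_blk e n C vw d) ` (carrier_mat (n + e) n \<times> (carrier_vec (n + e) \<times> carrier_vec n) \<times> UNIV)"
          using b by (intro image_eqI[of _ _ "(M1, (vec (n + e) (\<lambda>i. M2 $$ (i, 0)), vec n (\<lambda>j. M3 $$ (0, j))), M4 $$ (0, 0))"]) auto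
      qed (use blk_in in auto)
    qed
    show "vec_space.rank (Suc n + e) (bil_blk e n (C + bil_corr e n vw d) vw d) = Suc (vec_space.rank (n + e) C)"
      if "C \<in> carrier_mat (n + e) n" "d \<noteq> 0" for C vw and d :: 'f
      using rank_schur[OF that(1) border_carrier(1,2,3,3) sc_inverse[OF that(2)], of "fst vw" "snd vw"]
      unfolding bil_blk_def bil_corr_def by simp
    show "vec_space.rank (Suc n + e) (bil_blk e n C (0\<^sub>v (n + e), 0\<^sub>v n) 0) = vec_space.rank (n + e) C"
      if "C \<in> carrier_mat (n + e) n" for C :: "'f mat"
      using rank_direct_sum[OF that zero_carrier_mat[of 1 1]] unfolding zero_blk border_zero
      by (simp add: vec_space.rank_0I)
    show "\<chi> (pair (bil_blk e n A (0\<^sub>v (n + e), 0\<^sub>v n) a) (bil_blk e n C vw d)) = \<chi> (pair A C) * \<chi> (a * d)"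
      if "A \<in> carrier_mat (n + e) n" "C \<in> carrier_mat (n + e) n" for A C :: "'f mat" and vw a d
      unfolding zero_blk unfolding bil_blk_def
      using pair_four_block[OF that(1) zero_carrier_mat zero_carrier_mat border_carrier(3) that(2) border_carrier] \<chi>
      by (simp add: pair_zero pair_sc additive_character_def)
    show "\<exists>A'\<in>carrier_mat (n + e) n. \<exists>a\<in>UNIV - {0}. Suc (vec_space.rank (n + e) A') = vec_space.rank (Suc n + e) A \<and>
        (\<forall>k. (\<Sum>B\<in>{B \<in> carrier_mat (Suc n + e) (Suc n). vec_space.rank (Suc n + e) B = k}. \<chi> (pair A B)) =
          (\<Sum>B\<in>{B \<in> carrier_mat (Suc n + e) (Suc n). vec_space.rank (Suc n + e) B = k}.
             \<chi> (pair (bil_blk e n A' (0\<^sub>v (n + e), 0\<^sub>v n) a) B)))"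
      if "A \<in> carrier_mat (Suc n + e) (Suc n)" "A \<noteq> 0\<^sub>m (Suc n + e) (Suc n)" for A :: "'f mat"
    proof -
      have e1: "n + e + 1 = Suc n + e" and e2: "n + 1 = Suc n" by auto
      show ?thesis
        using bil_reduction[of A "n + e" n \<chi>, unfolded e1, unfolded e2, OF that] unfolding zero_blk by blast
    qed
    show "of_nat (card (UNIV :: 'f set)) * (\<Sum>vw\<in>carrier_vec (n + e) \<times> carrier_vec n. \<chi> (pair A (bil_corr e n vw d))) =
        complex_of_real (?q ^ e * ?q ^ (2 * n + 1 - vec_space.rank (n + e) A))"
      if A: "A \<in> carrier_mat (n + e) n" and d: "d \<noteq> 0" for A and d :: 'f
    proof -
      have "(\<Sum>vw\<in>carrier_vec (n + e) \<times> carrier_vec n. \<chi> (pair A (bil_corr e n vw d))) =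
          (\<Sum>(v, w)\<in>carrier_vec (n + e) \<times> carrier_vec n. \<chi> ((1 / d) * (v \<bullet> (A *\<^sub>v w))))"
        by (rule sum.cong) (auto simp: bil_corr_def pair_rank_one[OF A] simp del: assoc_mult_mat)
      also have "\<dots> = of_nat (CARD('f) ^ (n + e + n - vec_space.rank (n + e) A))"
        by (rule bilinear_gauss_sum[OF \<chi> _ A]) (use d in simp)
      finally have "of_nat CARD('f) * (\<Sum>vw\<in>carrier_vec (n + e) \<times> carrier_vec n. \<chi> (pair A (bil_corr e n vw d))) =
          of_nat (CARD('f) ^ Suc (n + e + n - vec_space.rank (n + e) A))" by simp
      \<comment> \<open>No truncation occurs, as the rank is at most \<open>n\<close>. The successor
        comes from \<open>card D\<close>, and \<open>c = q ^ e\<close> from the surplus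
        rows.\<close>
      also have "Suc (n + e + n - vec_space.rank (n + e) A) = e + (2 * n + 1 - vec_space.rank (n + e) A)"
        using vec_space.rank_le_nc[OF A] by simp
      finally show ?thesis by (simp add: power_add)
    qed
    show "real (card (carrier_vec (n + e) \<times> carrier_vec n :: ('f vec \<times> 'f vec) set)) * real (card (UNIV :: 'f set)) *
        (?q ^ e * ?q ^ n) ^ n = (?q ^ e * ?q ^ Suc n) ^ Suc n"
    proof -
      have "n + e + n + 1 + (e + n) * n = (e + Suc n) * Suc n" by simp
      then have "?q ^ (n + e + n + 1 + (e + n) * n) = ?q ^ ((e + Suc n) * Suc n)" by (simp only:)
      then have "?q ^ (n + e) * ?q ^ n * ?q ^ 1 * (?q ^ (e + n)) ^ n = (?q ^ (e + Suc n)) ^ Suc n"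
        by (simp only: power_add power_mult)
      then show ?thesis by (simp only: card_cartesian_product card_carrier_vec of_nat_mult of_nat_power power_add power_one_right)
    qed
    show "?q ^ e * ?q ^ n \<noteq> ?q ^ s" if "s < n" for s
    proof -
      have "?q ^ s < ?q ^ (e + n)" using q that by (intro power_strict_increasing) auto
      then show ?thesis by (simp add: power_add)
    qed
    show "(\<Sum>d\<in>UNIV. \<chi> (a * d)) = 0" if "a \<noteq> 0" for a :: 'f
      by (rule sum_additive_character_UNIV[OF \<chi> that])
  qed (use \<chi> q in \<open>auto simp: additive_character_def corr_in finite_carrier_vec intro: exI[of _ 1]\<close>)
qed

section \<open>Hermitian forms\<close>

lemma sum_carrier_vec_append:
  fixes f :: "'f::{field,finite} vec \<Rightarrow> complex"
  shows "(\<Sum>v\<in>carrier_vec (n + 1). f v) = (\<Sum>u\<in>carrier_vec n. \<Sum>x\<in>UNIV. f (u @\<^sub>v vec 1 (\<lambda>_. x)))"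
proof -
  have "(\<Sum>u\<in>carrier_vec n. \<Sum>x\<in>UNIV. f (u @\<^sub>v vec 1 (\<lambda>_. x))) =
      (\<Sum>(u, x)\<in>carrier_vec n \<times> UNIV. f (u @\<^sub>v vec 1 (\<lambda>_. x)))"
    by (rule sum.cartesian_product)
  also have "\<dots> = (\<Sum>v\<in>carrier_vec (n + 1). f v)"
  proof (rule sum.reindex_bij_witness[where i = "\<lambda>v. (vec n (\<lambda>i. v $ i), v $ n)" and j = "\<lambda>(u, x). u @\<^sub>v vec 1 (\<lambda>_. x)"])
    fix v :: "'f vec" assume v: "v \<in> carrier_vec (n + 1)"
    have "vec n (\<lambda>i. v $ i) @\<^sub>v vec 1 (\<lambda>_. v $ n) = v"
      using v by (intro eq_vecI) (auto simp: less_Suc_eq)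
    then show "(case (vec n (\<lambda>i. v $ i), v $ n) of (u, x) \<Rightarrow> u @\<^sub>v vec 1 (\<lambda>_. x)) = v" by simp
  next
    fix p :: "'f vec \<times> 'f" assume "p \<in> carrier_vec n \<times> UNIV"
    then obtain u x where p: "p = (u, x)" "u \<in> carrier_vec n" by auto
    show "(case p of (u, x) \<Rightarrow> u @\<^sub>v vec 1 (\<lambda>_. x)) \<in> carrier_vec (n + 1)"
      using p by (intro carrier_vecI) simp
    show "(vec n (\<lambda>i. (case p of (u, x) \<Rightarrow> u @\<^sub>v vec 1 (\<lambda>_. x)) $ i), (case p of (u, x) \<Rightarrow> u @\<^sub>v vec 1 (\<lambda>_. x)) $ n) = p"
      using p by (auto intro!: eq_vecI)
  qed auto
  finally show ?thesis by simp
qed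

context quadratic_field
begin

definition ct :: "'f mat \<Rightarrow> 'f mat" where "ct A = (map_mat (\<lambda>x. x ^ q) A)\<^sup>T"
definition cv :: "'f vec \<Rightarrow> 'f vec" where "cv v = map_vec (\<lambda>x. x ^ q) v"
definition H :: "nat \<Rightarrow> 'f mat set" where "H n = {A \<in> carrier_mat n n. ct A = A}"

lemma ct_carrier [simp]: "ct A \<in> carrier_mat n m \<longleftrightarrow> A \<in> carrier_mat m n"
  by (auto simp: ct_def)

lemma ct_dim [simp]: "dim_row (ct A) = dim_col A" "dim_col (ct A) = dim_row A"
  by (auto simp: ct_def)

lemma ct_entry: "A \<in> carrier_mat m n \<Longrightarrow> i < n \<Longrightarrow> j < m \<Longrightarrow> ct A $$ (i, j) = A $$ (j, i) ^ q"
  by (auto simp: ct_def)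

lemma cv_carrier [simp]: "cv v \<in> carrier_vec n \<longleftrightarrow> v \<in> carrier_vec n"
  by (auto simp: cv_def)

lemma ct_mult:
  assumes A: "A \<in> carrier_mat m n" and B: "B \<in> carrier_mat n k"
  shows "ct (A * B) = ct B * ct A"
proof (rule eq_matI)
  fix i j assume "i < dim_row (ct B * ct A)" "j < dim_col (ct B * ct A)"
  then have ij: "i < k" "j < m" using A B by auto
  have "ct (A * B) $$ (i, j) = (\<Sum>s<n. A $$ (j, s) * B $$ (s, i)) ^ q"
    using ij A B by (simp add: ct_entry[of _ m k] scalar_prod_def lessThan_atLeast0)
  also have "\<dots> = (\<Sum>s<n. B $$ (s, i) ^ q * A $$ (j, s) ^ q)"
    by (simp add: frobenius_sum power_mult_distrib mult.commute)
  also have "\<dots> = (ct B * ct A) $$ (i, j)"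
    using ij A B by (simp add: ct_entry[OF A] ct_entry[OF B] scalar_prod_def lessThan_atLeast0)
  finally show "ct (A * B) $$ (i, j) = (ct B * ct A) $$ (i, j)" .
qed (use A B in auto)

lemma ct_ct: "A \<in> carrier_mat m n \<Longrightarrow> ct (ct A) = A"
  by (intro eq_matI) (auto simp: ct_def frobenius_frobenius)

lemma ct_add: "A \<in> carrier_mat m n \<Longrightarrow> B \<in> carrier_mat m n \<Longrightarrow> ct (A + B) = ct A + ct B"
  by (intro eq_matI) (auto simp: ct_def frobenius_add)

lemma frobenius_diff: "(x - y :: 'f) ^ q = x ^ q - y ^ q"
  using frobenius_add[of "x - y" y] by (simp add: eq_diff_eq)

lemma ct_minus: "A \<in> carrier_mat m n \<Longrightarrow> B \<in> carrier_mat m n \<Longrightarrow> ct (A - B) = ct A - ct B"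
  by (intro eq_matI) (auto simp: ct_def frobenius_diff)

lemma ct_zero [simp]: "ct (0\<^sub>m m n) = 0\<^sub>m n m"
  using q_ge_2 by (intro eq_matI) (auto simp: ct_def)

lemma ct_one [simp]: "ct (1\<^sub>m n) = 1\<^sub>m n"
  using q_ge_2 by (intro eq_matI) (auto simp: ct_def)

lemma ct_border [simp]:
  "v \<in> carrier_vec n \<Longrightarrow> ct (colm n v) = rowm n (cv v)" "v \<in> carrier_vec n \<Longrightarrow> ct (rowm n (cv v)) = colm n v"
  "ct (sc d) = sc (d ^ q)"
  by (intro eq_matI; simp add: ct_def colm_def rowm_def sc_def cv_def frobenius_frobenius)+

lemma ct_four_block:
  assumes "A \<in> carrier_mat r c" "B \<in> carrier_mat r s'" "C \<in> carrier_mat s c" "D \<in> carrier_mat s s'"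
  shows "ct (four_block_mat A B C D) = four_block_mat (ct A) (ct C) (ct B) (ct D)"
  unfolding ct_def using assms
  by (subst map_four_block_mat[of _ r c _ s' _ s]) (auto intro!: transpose_four_block_mat[of _ r c _ s' _ s])

lemma ct_inverse:
  assumes "P \<in> carrier_mat n n" "P' \<in> carrier_mat n n" "P * P' = 1\<^sub>m n"
  shows "ct P' * ct P = 1\<^sub>m n"
  using assms ct_mult[of P n n P' n] by simp

lemma ct_transpose: "A \<in> carrier_mat m n \<Longrightarrow> (ct A)\<^sup>T = ct (A\<^sup>T)"
  by (intro eq_matI) (auto simp: ct_def)

lemma conj_in_H:
  assumes "P \<in> carrier_mat n n" "B \<in> H n" shows "P * B * ct P \<in> H n"
proof -
  have B: "B \<in> carrier_mat n n" "ct B = B" using assms by (auto simp: H_def)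
  have PB: "P * B \<in> carrier_mat n n" by (rule mult_carrier_mat[OF assms(1) B(1)])
  have cP: "ct P \<in> carrier_mat n n" using assms by simp
  have "ct (P * B * ct P) = ct (ct P) * (ct B * ct P)"
    using ct_mult[OF PB cP] ct_mult[OF assms(1) B(1)] by simp
  also have "\<dots> = P * B * ct P"
    unfolding ct_ct[OF assms(1)] B(2) by (rule assoc_mult_mat[OF assms(1) B(1) cP, symmetric])
  finally show ?thesis using mult_carrier_mat[OF PB cP] by (simp add: H_def)
qed

text \<open>A change of basis for Hermitian forms. The inverse is kept as a witness because the rank
  and summation lemmas take it explicitly.\<close>

definition hcong :: "nat \<Rightarrow> 'f mat \<Rightarrow> 'f mat \<Rightarrow> bool" where
  "hcong n A B \<longleftrightarrow> (\<exists>P P'. P \<in> carrier_mat n n \<and> P' \<in> carrier_mat n n \<and> P * P' = 1\<^sub>m n \<and> P' * P = 1\<^sub>m n \<and> A = P * B * ct P)"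

lemma hcongE:
  assumes "hcong n A B"
  obtains P P' where "P \<in> carrier_mat n n" "P' \<in> carrier_mat n n" "P * P' = 1\<^sub>m n" "P' * P = 1\<^sub>m n" "A = P * B * ct P"
  using assms unfolding hcong_def by blast

lemma hcong_sym:
  assumes "B \<in> carrier_mat n n" "hcong n A B" shows "hcong n B A"
proof -
  obtain P P' where P: "P \<in> carrier_mat n n" "P' \<in> carrier_mat n n" "P * P' = 1\<^sub>m n" "P' * P = 1\<^sub>m n" and A: "A = P * B * ct P"
    using assms(2) by (rule hcongE)
  have "P' * (P * B * ct P) * ct P' = B"
    by (rule conj_cancel[OF assms(1) P(2,1,4)]) (use P ct_inverse[OF P(2,1,4)] in auto)
  then show ?thesis unfolding hcong_def A using P by (intro exI[of _ P'] exI[of _ P]) auto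
qed

lemma hcong_trans:
  assumes C: "C \<in> carrier_mat n n" and "hcong n A B" "hcong n B C" shows "hcong n A C"
proof -
  obtain P P' where P: "P \<in> carrier_mat n n" "P' \<in> carrier_mat n n" "P * P' = 1\<^sub>m n" "P' * P = 1\<^sub>m n" and A: "A = P * B * ct P"
    using assms(2) by (rule hcongE)
  obtain Q Q' where Q: "Q \<in> carrier_mat n n" "Q' \<in> carrier_mat n n" "Q * Q' = 1\<^sub>m n" "Q' * Q = 1\<^sub>m n" and B: "B = Q * C * ct Q"
    using assms(3) by (rule hcongE)
  have cc: "ct P \<in> carrier_mat n n" "ct Q \<in> carrier_mat n n" using P Q by auto
  have QC: "Q * C \<in> carrier_mat n n" by (rule mult_carrier_mat[OF Q(1) C])
  have PQ: "P * Q \<in> carrier_mat n n" "Q' * P' \<in> carrier_mat n n" using P Q by (auto intro: mult_carrier_mat)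
  have "P * (Q * C * ct Q) * ct P = P * (Q * C) * ct Q * ct P"
    using assoc_mult_mat[OF P(1) QC cc(2)] by simp
  also have "\<dots> = P * (Q * C) * (ct Q * ct P)"
    by (rule assoc_mult_mat[OF mult_carrier_mat[OF P(1) QC] cc(2,1)])
  also have "\<dots> = P * Q * C * ct (P * Q)"
    using assoc_mult_mat[OF P(1) Q(1) C] ct_mult[OF P(1) Q(1)] by simp
  finally have "A = P * Q * C * ct (P * Q)" unfolding A B .
  moreover have inv: "X * Y * (Y' * X') = 1\<^sub>m n"
    if "X \<in> carrier_mat n n" "Y \<in> carrier_mat n n" "Y' \<in> carrier_mat n n" "X' \<in> carrier_mat n n" "X * X' = 1\<^sub>m n" "Y * Y' = 1\<^sub>m n"
    for X Y X' Y' :: "'f mat"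
  proof -
    have "X * Y * (Y' * X') = X * (Y * (Y' * X'))" by (rule assoc_mult_mat[OF that(1,2) mult_carrier_mat[OF that(3,4)]])
    also have "Y * (Y' * X') = Y * Y' * X'" by (rule assoc_mult_mat[OF that(2-4), symmetric])
    finally show ?thesis using that by simp
  qed
  ultimately show ?thesis unfolding hcong_def
    using PQ inv[OF P(1) Q(1) Q(2) P(2) P(3) Q(3)] inv[OF Q(2) P(2) P(1) Q(1) Q(4) P(4)] by blast
qed

lemma hcong_H: "B \<in> H n \<Longrightarrow> hcong n A B \<Longrightarrow> A \<in> H n"
  unfolding hcong_def using conj_in_H by blast

lemma hcong_rank:
  assumes "B \<in> carrier_mat n n" "hcong n A B" shows "vec_space.rank n A = vec_space.rank n B"
proof -
  obtain P P' where P: "P \<in> carrier_mat n n" "P' \<in> carrier_mat n n" "P * P' = 1\<^sub>m n" "P' * P = 1\<^sub>m n" and A: "A = P * B * ct P"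
    using assms(2) by (rule hcongE)
  show ?thesis unfolding A
    by (rule rank_mult_invertible[OF assms(1) P(1,2,4), where R' = "ct P'"]) (use P ct_inverse[OF P(2,1,4)] in auto)
qed

text \<open>Moved across the pairing, \<open>P\<close> acts on the summation variable as a
  congruence by \<open>P\<^sup>T\<close>, which permutes the Hermitian matrices of each
  rank.\<close>

lemma hcong_sum:
  assumes B: "B \<in> H n" and cong: "hcong n A B"
  shows "(\<Sum>C\<in>{C \<in> H n. vec_space.rank n C = k}. \<chi> (pair A C) :: complex) =
    (\<Sum>C\<in>{C \<in> H n. vec_space.rank n C = k}. \<chi> (pair B C))"
proof -
  obtain P P' where P: "P \<in> carrier_mat n n" "P' \<in> carrier_mat n n" "P * P' = 1\<^sub>m n" "P' * P = 1\<^sub>m n" and A: "A = P * B * ct P"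
    using cong by (rule hcongE)
  have Bc: "B \<in> carrier_mat n n" using B by (simp add: H_def)
  note T = transpose_inverse[OF P(1,2,3)] transpose_inverse[OF P(2,1,4)]
  have PT: "P\<^sup>T \<in> carrier_mat n n" "P'\<^sup>T \<in> carrier_mat n n" using P by auto
  show ?thesis
  proof (rule sum_rank_invariant[where f = "\<lambda>C. P\<^sup>T * C * ct (P\<^sup>T)" and f' = "\<lambda>C. P'\<^sup>T * C * ct (P'\<^sup>T)"])
    fix C assume C: "C \<in> H n"
    then have Cc: "C \<in> carrier_mat n n" by (simp add: H_def)
    show "\<chi> (pair A C) = \<chi> (pair B (P\<^sup>T * C * ct (P\<^sup>T)))"
      unfolding A using pair_mult[OF P(1) Bc _ Cc, of "ct P"] P by (simp add: ct_transpose)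
    have "P\<^sup>T * (P'\<^sup>T * C * ct (P'\<^sup>T)) * ct (P\<^sup>T) = C"
      by (rule conj_cancel[OF Cc PT T(2)]) (use PT ct_inverse[OF PT T(2)] in auto)
    moreover have "P'\<^sup>T * (P\<^sup>T * C * ct (P\<^sup>T)) * ct (P'\<^sup>T) = C"
      by (rule conj_cancel[OF Cc PT(2,1) T(1)]) (use PT ct_inverse[OF PT(2,1) T(1)] in auto)
    moreover have "vec_space.rank n (P\<^sup>T * C * ct (P\<^sup>T)) = vec_space.rank n C"
      by (rule rank_mult_invertible[OF Cc PT T(1), where R' = "ct (P'\<^sup>T)"]) (use PT ct_inverse[OF PT(2,1) T(1)] in auto)
    ultimately show "P\<^sup>T * C * ct (P\<^sup>T) \<in> H n \<and> P'\<^sup>T * C * ct (P'\<^sup>T) \<in> H n \<and>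
        P\<^sup>T * (P'\<^sup>T * C * ct (P'\<^sup>T)) * ct (P\<^sup>T) = C \<and> P'\<^sup>T * (P\<^sup>T * C * ct (P\<^sup>T)) * ct (P'\<^sup>T) = C \<and>
        vec_space.rank n (P\<^sup>T * C * ct (P\<^sup>T)) = vec_space.rank n C"
      using conj_in_H[OF PT(1) C] conj_in_H[OF PT(2) C] by blast
  qed
qed

lemma H_entry: "A \<in> H n \<Longrightarrow> i < n \<Longrightarrow> j < n \<Longrightarrow> A $$ (i, j) = A $$ (j, i) ^ q"
  using ct_entry[of A n n i j] by (simp add: H_def)

text \<open>A Hermitian matrix with zero diagonal acquires a nonzero diagonal entry when a suitable
  multiple of one row is added to another, because the trace of the field extension is nonzero.\<close>

lemma hcong_diagonal_entry:
  assumes A: "A \<in> H n" "A \<noteq> 0\<^sub>m n n"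
  obtains M s where "hcong n M A" "s < n" "M $$ (s, s) \<noteq> 0"
proof -
  have Ac: "A \<in> carrier_mat n n" using A by (simp add: H_def)
  show ?thesis
  proof (cases "\<exists>s<n. A $$ (s, s) \<noteq> 0")
    case True
    then obtain s where s: "s < n" "A $$ (s, s) \<noteq> 0" by blast
    have "A = 1\<^sub>m n * A * ct (1\<^sub>m n)" using Ac by simp
    then have "hcong n A A" unfolding hcong_def by (intro exI[of _ "1\<^sub>m n"]) auto
    then show ?thesis using that s by blast
  next
    case False
    obtain s t where st: "s < n" "t < n" "A $$ (s, t) \<noteq> 0"
      using nonzero_entryE[OF Ac A(2)] .
    then have ne: "s \<noteq> t" using False by auto
    obtain x :: 'f where x: "x ^ q + x = 1" using trace_surj[OF K_1] by blast
    have Ats: "A $$ (t, s) \<noteq> 0" "A $$ (s, t) = A $$ (t, s) ^ q" using st H_entry[OF A(1), of s t] q_ge_2 by auto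
    \<comment> \<open>With this choice the new diagonal entry is the trace of
      \<open>l * A $$ (t, s) = x\<close>, that is 1, since the old diagonal vanishes.\<close>
    define l where "l = x / A $$ (t, s)"
    let ?P = "addrow_mat n l s t"
    define M where "M = ?P * A * ct ?P"
    have Pe: "?P $$ (s, i) = (if i = s then 1 else if i = t then l else 0)" if "i < n" for i
      using that st ne by auto
    have two: "(\<Sum>i<n. (if i = s then 1 else if i = t then y else 0) * f i) = f s + y * f t" for y and f :: "nat \<Rightarrow> 'f"
    proof -
      have "(\<Sum>i<n. (if i = s then 1 else if i = t then y else 0) * f i) =
          (\<Sum>i<n. (if i = s then f s else 0) + (if i = t then y * f t else 0))"
        using ne by (intro sum.cong) auto
      then show ?thesis using st by (simp add: sum.distrib)
    qed
    have "M $$ (s, s) = (\<Sum>i<n. \<Sum>j<n. ?P $$ (s, i) * A $$ (i, j) * ct ?P $$ (j, s))"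
      unfolding M_def by (rule mult3_entry[where m = n and n = n]) (use Ac st in auto)
    also have "\<dots> = (\<Sum>i<n. (if i = s then 1 else if i = t then l else 0) *
        (\<Sum>j<n. (if j = s then 1 else if j = t then l ^ q else 0) * A $$ (i, j)))"
      unfolding sum_distrib_left
    proof (intro sum.cong refl)
      fix i j assume ij: "i \<in> {..<n}" "j \<in> {..<n}"
      have "ct ?P $$ (j, s) = (if j = s then 1 else if j = t then l ^ q else 0)"
        using ct_entry[of ?P n n j s] Pe[of j] ij st q_ge_2 by auto
      then show "?P $$ (s, i) * A $$ (i, j) * ct ?P $$ (j, s) = (if i = s then 1 else if i = t then l else 0) *
          ((if j = s then 1 else if j = t then l ^ q else 0) * A $$ (i, j))"
        using Pe[of i] ij by (simp only: lessThan_iff mult_ac)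
    qed
    also have "\<dots> = A $$ (s, s) + l ^ q * A $$ (s, t) + l * (A $$ (t, s) + l ^ q * A $$ (t, t))"
      unfolding two ..
    also have "\<dots> = (l * A $$ (t, s)) ^ q + l * A $$ (t, s)"
      using False st Ats(2) by (simp add: power_mult_distrib)
    also have "\<dots> = 1" using Ats(1) x by (simp add: l_def)
    finally have "M $$ (s, s) \<noteq> 0" by simp
    moreover have "hcong n M A" unfolding hcong_def M_def
      using addrow_mat_inv[OF st(1,2) ne, of l] addrow_mat_inv[OF st(1,2) ne, of "- l"]
      by (intro exI[of _ ?P] exI[of _ "addrow_mat n (- l) s t"]) auto
    ultimately show ?thesis using that st by blast
  qed
qed

text \<open>Pivoting on a diagonal entry keeps the reduction a congruence. The pivot is fixed by the
  Frobenius map and thus lies in \<open>K\<close>.\<close>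

lemma her_reduction:
  assumes A: "A \<in> H (n + 1)" "A \<noteq> 0\<^sub>m (n + 1) (n + 1)"
  obtains C a where "C \<in> H n" "a \<in> K" "a \<noteq> 0" "hcong (n + 1) A (four_block_mat C (0\<^sub>m n 1) (0\<^sub>m 1 n) (sc a))"
proof -
  obtain M0 s where M0: "hcong (n + 1) M0 A" "s < n + 1" "M0 $$ (s, s) \<noteq> 0"
    using hcong_diagonal_entry[OF A] .
  have M0H: "M0 \<in> H (n + 1)" by (rule hcong_H[OF A(1) M0(1)])
  have Ac: "A \<in> carrier_mat (n + 1) (n + 1)" and M0c: "M0 \<in> carrier_mat (n + 1) (n + 1)" using A M0H by (auto simp: H_def)
  define \<pi> where "\<pi> = Transposition.transpose s n"
  have \<pi>: "\<pi> permutes {..<n + 1}" unfolding \<pi>_def using M0 by (intro transpose_permutes) auto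
  let ?P = "pm (n + 1) \<pi> :: 'f mat"
  define M where "M = ?P * M0 * ct ?P"
  have ctP: "ct ?P = ?P\<^sup>T"
    using q_ge_2 by (intro eq_matI) (auto simp: ct_def pm_def)
  have MM0: "hcong (n + 1) M M0" unfolding hcong_def M_def
    using pm_inverse[OF \<pi>] by (intro exI[of _ ?P] exI[of _ "?P\<^sup>T"]) auto
  have MH: "M \<in> H (n + 1)" by (rule hcong_H[OF M0H MM0])
  then have Mc: "M \<in> carrier_mat (n + 1) (n + 1)" by (simp add: H_def)
  have Mnn: "M $$ (n, n) \<noteq> 0"
    using pm_conj_entry[OF M0c \<pi> \<pi>, of n n] M0(3) unfolding M_def ctP by (simp add: \<pi>_def)
  obtain M1 M2 M3 M4 where b: "M1 \<in> carrier_mat n n" "M2 \<in> carrier_mat n 1" "M3 \<in> carrier_mat 1 n" "M4 \<in> carrier_mat 1 1"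
    and Meq: "M = four_block_mat M1 M2 M3 M4" by (rule split_last_block[OF Mc])
  have herm: "four_block_mat (ct M1) (ct M3) (ct M2) (ct M4) = four_block_mat M1 M2 M3 M4"
    using MH ct_four_block[OF b] unfolding H_def Meq by simp
  have e: "ct M1 = M1" "ct M3 = M2" "ct M2 = M3" "ct M4 = M4"
    using four_block_eqD[OF herm, of n n 1 1] b by auto
  define a where "a = M4 $$ (0, 0)"
  have M4: "M4 = sc a" unfolding a_def by (rule sc_surj[OF b(4)])
  have a0: "a \<noteq> 0" using Mnn b unfolding Meq a_def by simp
  have aK: "a \<in> K" using e(4) sc_inj[of "a ^ q" a] unfolding M4 by (simp add: K_def)
  define D' where "D' = sc (1 / a)"
  have D: "M4 \<in> carrier_mat 1 1" "D' \<in> carrier_mat 1 1" "M4 * D' = 1\<^sub>m 1" "D' * M4 = 1\<^sub>m 1"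
    unfolding M4 D'_def using sc_inverse[OF a0] by auto
  have ctD: "ct D' = D'" using K_divide[OF K_1 aK] by (simp add: D'_def K_def)
  have U: "M2 * D' \<in> carrier_mat n 1" "D' * M3 \<in> carrier_mat 1 n" using b D by auto
  have ctU: "ct (M2 * D') = D' * M3" using ct_mult[OF b(2) D(2)] ctD e by simp
  have T: "M2 * D' * M3 \<in> carrier_mat n n" by (rule mult_carrier_mat[OF U(1) b(3)])
  have ctT: "ct (M2 * D' * M3) = M2 * D' * M3"
    using ct_mult[OF U(1) b(3)] ctU e assoc_mult_mat[OF b(2) D(2) b(3)] by simp
  define C where "C = M1 - M2 * D' * M3"
  have C: "C \<in> carrier_mat n n" unfolding C_def using T by (rule minus_carrier_mat)
  have CH: "C \<in> H n" using C ct_minus[OF b(1) T] ctT e unfolding H_def C_def by simp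
  have CT: "C + M2 * D' * M3 = M1" unfolding C_def by (rule mat_minus_add_cancel[OF b(1) T])
  let ?N = "four_block_mat C (0\<^sub>m n 1) (0\<^sub>m 1 n) (sc a)"
  let ?L = "four_block_mat (1\<^sub>m n) (M2 * D') (0\<^sub>m 1 n) (1\<^sub>m 1)"
  have ctL: "ct ?L = four_block_mat (1\<^sub>m n) (0\<^sub>m n 1) (D' * M3) (1\<^sub>m 1)"
    using ct_four_block[of "1\<^sub>m n" n n "M2 * D'" 1 "0\<^sub>m 1 n" 1 "1\<^sub>m 1"] U ctU by simp
  have "M = ?L * four_block_mat C (0\<^sub>m n 1) (0\<^sub>m 1 n) M4 * ct ?L"
    using schur_factorisation[OF C b(2,3) D] unfolding CT Meq[symmetric] ctL .
  then have "M = ?L * ?N * ct ?L" by (simp only: M4)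
  then have MN: "hcong (n + 1) M ?N" unfolding hcong_def
    using unipotent_inverse[OF U(1)] U
    by (intro exI[of _ ?L] exI[of _ "four_block_mat (1\<^sub>m n) (- (M2 * D')) (0\<^sub>m 1 n) (1\<^sub>m 1)"]) auto
  have N: "?N \<in> carrier_mat (n + 1) (n + 1)" by (rule four_block_carrier_mat[OF C border_carrier(3)])
  have "hcong (n + 1) A ?N"
    by (rule hcong_trans[OF N hcong_trans[OF Mc hcong_sym[OF Ac M0(1)] hcong_sym[OF M0c MM0]] MN])
  then show ?thesis using that CH aK a0 by blast
qed

definition hform :: "'f mat \<Rightarrow> 'f vec \<Rightarrow> 'f" where "hform A v = v \<bullet> (A *\<^sub>v cv v)"

lemma cv_mult:
  assumes "A \<in> carrier_mat m n" "v \<in> carrier_vec n"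
  shows "cv (A\<^sup>T\<^sup>T *\<^sub>v v) = ct (A\<^sup>T) *\<^sub>v cv v"
proof (rule eq_vecI)
  fix i assume "i < dim_vec (ct (A\<^sup>T) *\<^sub>v cv v)"
  then have i: "i < m" using assms by auto
  have "cv (A\<^sup>T\<^sup>T *\<^sub>v v) $ i = (\<Sum>j<n. A $$ (i, j) * v $ j) ^ q"
    using i assms by (simp add: cv_def scalar_prod_def lessThan_atLeast0)
  also have "\<dots> = (\<Sum>j<n. A $$ (i, j) ^ q * v $ j ^ q)" by (simp add: frobenius_sum power_mult_distrib)
  also have "\<dots> = (ct (A\<^sup>T) *\<^sub>v cv v) $ i"
    using i assms by (simp add: ct_def cv_def scalar_prod_def lessThan_atLeast0)
  finally show "cv (A\<^sup>T\<^sup>T *\<^sub>v v) $ i = (ct (A\<^sup>T) *\<^sub>v cv v) $ i" .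
qed (use assms in \<open>auto simp: cv_def\<close>)

lemma hform_hcong:
  assumes B: "B \<in> carrier_mat n n" and P: "P \<in> carrier_mat n n" and v: "v \<in> carrier_vec n"
  shows "hform (P * B * ct P) v = hform B (P\<^sup>T *\<^sub>v v)"
proof -
  have c: "ct P \<in> carrier_mat n n" "cv v \<in> carrier_vec n" using P v by auto
  have "(P * B * ct P) *\<^sub>v cv v = P *\<^sub>v (B *\<^sub>v (ct P *\<^sub>v cv v))"
    using assoc_mult_mat_vec[OF mult_carrier_mat[OF P B] c] assoc_mult_mat_vec[OF P B mult_mat_vec_carrier[OF c]] by simp
  also have "ct P *\<^sub>v cv v = cv (P\<^sup>T *\<^sub>v v)" using cv_mult[of "P\<^sup>T" n n v] P v by simp
  finally have "hform (P * B * ct P) v = v \<bullet> (P *\<^sub>v (B *\<^sub>v cv (P\<^sup>T *\<^sub>v v)))" by (simp add: hform_def)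
  also have "\<dots> = (P\<^sup>T *\<^sub>v v) \<bullet> (B *\<^sub>v cv (P\<^sup>T *\<^sub>v v))"
    using transpose_vec_mult_scalar[of P n n "B *\<^sub>v cv (P\<^sup>T *\<^sub>v v)" v] P B v by simp
  finally show ?thesis by (simp add: hform_def)
qed

lemma hform_four_block:
  assumes C: "C \<in> carrier_mat n n" and u: "u \<in> carrier_vec n"
  shows "hform (four_block_mat C (0\<^sub>m n 1) (0\<^sub>m 1 n) (sc a)) (u @\<^sub>v vec 1 (\<lambda>_. x)) = hform C u + a * (x ^ q * x)"
proof -
  have cva: "cv (u @\<^sub>v vec 1 (\<lambda>_. x)) = cv u @\<^sub>v vec 1 (\<lambda>_. x ^ q)"
    using u by (intro eq_vecI) (auto simp: cv_def)
  have "four_block_mat C (0\<^sub>m n 1) (0\<^sub>m 1 n) (sc a) *\<^sub>v (cv u @\<^sub>v vec 1 (\<lambda>_. x ^ q)) =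
      (C *\<^sub>v cv u) @\<^sub>v (sc a *\<^sub>v vec 1 (\<lambda>_. x ^ q))"
    using C u by (subst four_block_mat_mult_vec[OF C _ _ border_carrier(3)]) auto
  moreover have "sc a *\<^sub>v vec 1 (\<lambda>_. x ^ q) = vec 1 (\<lambda>_. a * x ^ q)"
    by (intro eq_vecI) (auto simp: sc_def scalar_prod_def)
  moreover have "(u @\<^sub>v vec 1 (\<lambda>_. x)) \<bullet> ((C *\<^sub>v cv u) @\<^sub>v vec 1 (\<lambda>_. a * x ^ q)) =
      u \<bullet> (C *\<^sub>v cv u) + vec 1 (\<lambda>_. x) \<bullet> vec 1 (\<lambda>_. a * x ^ q)"
    by (rule scalar_prod_append[of _ n _ 1]) (use C u in auto)
  ultimately show ?thesis unfolding hform_def cva by (simp add: scalar_prod_def mult_ac)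
qed

text \<open>Each nonzero diagonal entry split off contributes \<open>- q\<close> by
  \<open>sum_character_norm\<close>, whereas the zero form contributes \<open>q ^ 2\<close> per
  coordinate. The power of \<open>q\<close> on the left avoids a subtraction in the
  exponent.\<close>

lemma hermitian_gauss_sum:
  assumes \<chi>: "additive_character \<chi>" and t: "t \<in> K" "t \<noteq> 0" and A: "A \<in> H n"
  shows "(\<Sum>v\<in>carrier_vec n. \<chi> (t * hform A v)) * of_nat q ^ vec_space.rank n A =
    (- 1) ^ vec_space.rank n A * of_nat q ^ (2 * n)"
  using A
proof (induction n arbitrary: A)
  case 0
  then have A0: "A = 0\<^sub>m 0 0" by (auto simp: H_def intro!: eq_matI)
  have "(carrier_vec 0 :: 'f vec set) = {0\<^sub>v 0}" by (auto intro!: eq_vecI)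
  then show ?case using \<chi> unfolding A0
    by (simp add: hform_def vec_space.rank_0I additive_character_def scalar_prod_def)
next
  case (Suc n)
  have A: "A \<in> H (n + 1)" using Suc.prems by simp
  show ?case
  proof (cases "A = 0\<^sub>m (n + 1) (n + 1)")
    case True
    have "hform A v = 0" if "v \<in> carrier_vec (Suc n)" for v
    proof -
      have "0\<^sub>m (n + 1) (n + 1) *\<^sub>v cv v = 0\<^sub>v (n + 1)" using that by (intro eq_vecI) (auto simp: scalar_prod_def)
      then show ?thesis using that by (simp add: hform_def True)
    qed
    then have "(\<Sum>v\<in>carrier_vec (Suc n). \<chi> (t * hform A v)) = (\<Sum>v\<in>(carrier_vec (Suc n) :: 'f vec set). 1)"
      using \<chi> by (intro sum.cong refl) (simp add: additive_character_def)
    also have "\<dots> = of_nat q ^ (2 * Suc n)"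
      by (simp only: sum_constant card_carrier_vec q[symmetric] power_mult) simp
    finally show ?thesis using True by (simp add: vec_space.rank_0I)
  next
    case False
    obtain C a where C: "C \<in> H n" and a: "a \<in> K" "a \<noteq> 0"
      and cong: "hcong (n + 1) A (four_block_mat C (0\<^sub>m n 1) (0\<^sub>m 1 n) (sc a))"
      using her_reduction[OF A False] .
    let ?N = "four_block_mat C (0\<^sub>m n 1) (0\<^sub>m 1 n) (sc a)"
    have Cc: "C \<in> carrier_mat n n" using C by (simp add: H_def)
    have N: "?N \<in> carrier_mat (n + 1) (n + 1)" by (rule four_block_carrier_mat[OF Cc border_carrier(3)])
    have "vec_space.rank 1 (sc a) = 1"
      by (rule rank_invertible[OF border_carrier(3,3) sc_inverse(1)[OF a(2)]])
    then have rank: "vec_space.rank (n + 1) A = Suc (vec_space.rank n C)"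
      using hcong_rank[OF N cong] rank_direct_sum[OF Cc border_carrier(3), of a] by simp
    obtain P P' where P: "P \<in> carrier_mat (n + 1) (n + 1)" "P' \<in> carrier_mat (n + 1) (n + 1)" "P * P' = 1\<^sub>m (n + 1)" "P' * P = 1\<^sub>m (n + 1)"
      and Aeq: "A = P * ?N * ct P" using cong by (rule hcongE)
    have PT: "P\<^sup>T \<in> carrier_mat (n + 1) (n + 1)" "P'\<^sup>T \<in> carrier_mat (n + 1) (n + 1)" using P by auto
    have pinv: "P'\<^sup>T *\<^sub>v (P\<^sup>T *\<^sub>v v) = v" "P\<^sup>T *\<^sub>v (P'\<^sup>T *\<^sub>v v) = v" if "v \<in> carrier_vec (n + 1)" for v
      using assoc_mult_mat_vec[OF PT(2,1) that] assoc_mult_mat_vec[OF PT that] that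
        transpose_inverse[OF P(1,2,3)] transpose_inverse[OF P(2,1,4)] by simp_all
    have "(\<Sum>v\<in>carrier_vec (n + 1). \<chi> (t * hform A v)) = (\<Sum>v\<in>carrier_vec (n + 1). \<chi> (t * hform ?N v))"
      by (rule sum.reindex_bij_witness[where i = "\<lambda>v. P'\<^sup>T *\<^sub>v v" and j = "\<lambda>v. P\<^sup>T *\<^sub>v v"])
        (use PT pinv hform_hcong[OF N P(1)] in \<open>auto simp: Aeq\<close>)
    also have "\<dots> = (\<Sum>u\<in>carrier_vec n. \<Sum>x\<in>UNIV. \<chi> (t * hform ?N (u @\<^sub>v vec 1 (\<lambda>_. x))))"
      by (rule sum_carrier_vec_append)
    also have "\<dots> = (\<Sum>u\<in>carrier_vec n. \<Sum>x\<in>UNIV. \<chi> (t * hform C u) * \<chi> (t * a * (x ^ q * x)))"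
    proof (intro sum.cong refl)
      fix u :: "'f vec" and x :: 'f assume u: "u \<in> carrier_vec n"
      have "t * hform ?N (u @\<^sub>v vec 1 (\<lambda>_. x)) = t * hform C u + t * a * (x ^ q * x)"
        unfolding hform_four_block[OF Cc u] by (simp only: distrib_left mult.assoc)
      then show "\<chi> (t * hform ?N (u @\<^sub>v vec 1 (\<lambda>_. x))) = \<chi> (t * hform C u) * \<chi> (t * a * (x ^ q * x))"
        using \<chi> by (simp only: additive_character_def)
    qed
    also have "\<dots> = (\<Sum>u\<in>carrier_vec n. \<chi> (t * hform C u)) * (- of_nat q)"
      using sum_character_norm[OF \<chi> K_mult[OF t(1) a(1)]] t(2) a(2)
      by (simp only: sum_distrib_left[symmetric] sum_distrib_right[symmetric] mult_eq_0_iff) simp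
    finally have step: "(\<Sum>v\<in>carrier_vec (n + 1). \<chi> (t * hform A v)) = (\<Sum>u\<in>carrier_vec n. \<chi> (t * hform C u)) * (- of_nat q)" .
    let ?S = "\<Sum>u\<in>carrier_vec n. \<chi> (t * hform C u)" and ?r = "vec_space.rank n C"
    have "(\<Sum>v\<in>carrier_vec (n + 1). \<chi> (t * hform A v)) * of_nat q ^ vec_space.rank (n + 1) A = (?S * of_nat q ^ ?r) * (- (of_nat q ^ 2))"
      unfolding step rank by (simp add: power2_eq_square)
    also have "\<dots> = (- 1) ^ vec_space.rank (n + 1) A * of_nat q ^ (2 * (n + 1))"
      unfolding Suc.IH[OF C] rank by (simp add: power2_eq_square)
    finally show ?thesis by simp
  qed
qed

definition her_blk :: "nat \<Rightarrow> 'f mat \<Rightarrow> 'f vec \<Rightarrow> 'f \<Rightarrow> 'f mat" where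
  "her_blk n C v d = four_block_mat C (colm n v) (rowm n (cv v)) (sc d)"

definition her_corr :: "nat \<Rightarrow> 'f vec \<Rightarrow> 'f \<Rightarrow> 'f mat" where
  "her_corr n v d = colm n v * sc (1 / d) * rowm n (cv v)"

lemma her_corr_H:
  assumes "v \<in> carrier_vec n" "d \<in> K" shows "her_corr n v d \<in> H n"
proof -
  have c: "colm n v * sc (1 / d) \<in> carrier_mat n 1" by (rule mult_carrier_mat) auto
  have "ct (her_corr n v d) = colm n v * (sc ((1 / d) ^ q) * rowm n (cv v))"
    unfolding her_corr_def using ct_mult[OF c border_carrier(2)] ct_mult[OF border_carrier(1,3), of n v "1 / d"] assms by simp
  also have "(1 / d) ^ q = 1 / d" using K_divide[OF K_1 assms(2)] by (simp add: K_def)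
  also have "colm n v * (sc (1 / d) * rowm n (cv v)) = her_corr n v d"
    unfolding her_corr_def by (rule assoc_mult_mat[OF border_carrier(1,3,2), symmetric])
  finally show ?thesis unfolding H_def using mult_carrier_mat[OF c border_carrier(2)] by (simp add: her_corr_def)
qed

lemma her_blk_H:
  assumes "C \<in> H n" "v \<in> carrier_vec n" "d \<in> K" shows "her_blk n C v d \<in> H (Suc n)"
proof -
  have C: "C \<in> carrier_mat n n" "ct C = C" using assms by (auto simp: H_def)
  have "her_blk n C v d \<in> carrier_mat (n + 1) (n + 1)"
    unfolding her_blk_def by (rule four_block_carrier_mat[OF C(1) border_carrier(3)])
  moreover have "ct (her_blk n C v d) = her_blk n C v d"
    unfolding her_blk_def using ct_four_block[OF C(1) border_carrier] C assms by (simp add: K_def)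
  ultimately show ?thesis by (simp add: H_def)
qed

lemma her_nondegenerate:
  assumes A: "A \<in> H n" "A \<noteq> 0\<^sub>m n n"
  shows "\<exists>B\<in>H n. pair A B = 1"
proof -
  have Ac: "A \<in> carrier_mat n n" using A by (simp add: H_def)
  obtain s t where st: "s < n" "t < n" "A $$ (s, t) \<noteq> 0"
    using nonzero_entryE[OF Ac A(2)] .
  have delta: "(\<Sum>i<n. \<Sum>j<n. A $$ (i, j) * (if i = s' \<and> j = t' then y else 0)) = A $$ (s', t') * y"
    if "s' < n" "t' < n" for s' t' and y :: 'f
  proof -
    have "(\<Sum>i<n. \<Sum>j<n. A $$ (i, j) * (if i = s' \<and> j = t' then y else 0)) =
        (\<Sum>i<n. \<Sum>j<n. if j = t' then (if i = s' then A $$ (s', t') * y else 0) else 0)"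
      by (intro sum.cong refl) auto
    also have "\<dots> = (\<Sum>i<n. if i = s' then A $$ (s', t') * y else 0)" using that by simp
    finally show ?thesis using that by simp
  qed
  show ?thesis
  proof (cases "s = t")
    case True
    let ?y = "1 / A $$ (s, t)"
    let ?B = "mat n n (\<lambda>(i, j). if i = s \<and> j = t then ?y else 0)"
    have "A $$ (s, t) ^ q = A $$ (s, t)" using H_entry[OF A(1), of s s] st True by simp
    then have "?y ^ q = ?y" by (simp add: power_divide)
    then have "?B \<in> H n" using True q_ge_2 by (auto simp: H_def ct_def intro!: eq_matI)
    moreover have "pair A ?B = (\<Sum>i<n. \<Sum>j<n. A $$ (i, j) * (if i = s \<and> j = t then ?y else 0))"
      using Ac by (simp add: pair_def)
    ultimately show ?thesis using delta[of s t ?y] st by (intro bexI[of _ ?B]) auto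
  next
    case False
    obtain x :: 'f where x: "x ^ q + x = 1" using trace_surj[OF K_1] by blast
    \<comment> \<open>Placing \<open>y\<close> and \<open>y ^ q\<close> at the two transposed
      positions makes the pairing the trace of \<open>A $$ (s, t) * y = x\<close>, that is
      1.\<close>
    define y where "y = x / A $$ (s, t)"
    let ?B = "mat n n (\<lambda>(i, j). (if i = s \<and> j = t then y else 0) + (if i = t \<and> j = s then y ^ q else 0))"
    have BH: "?B \<in> H n" using False q_ge_2 by (auto simp: H_def ct_def frobenius_frobenius intro!: eq_matI)
    have "pair A ?B = (\<Sum>i<n. \<Sum>j<n. A $$ (i, j) * (if i = s \<and> j = t then y else 0)) +
        (\<Sum>i<n. \<Sum>j<n. A $$ (i, j) * (if i = t \<and> j = s then y ^ q else 0))"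
      using Ac by (simp add: pair_def distrib_left sum.distrib)
    then have "pair A ?B = A $$ (s, t) * y + A $$ (t, s) * y ^ q" using delta st by simp
    also have "A $$ (t, s) * y ^ q = (A $$ (s, t) * y) ^ q"
      using H_entry[OF A(1), of t s] st by (simp add: power_mult_distrib)
    also have "A $$ (s, t) * y = x" using st by (simp add: y_def)
    finally have "pair A ?B = 1" using x by (simp add: add.commute)
    then show ?thesis using BH by (intro bexI[of _ ?B])
  qed
qed

lemma her_form_family:
  assumes \<chi>: "additive_character \<chi>"
  shows "form_family (- real q) (- 1) H (\<lambda>n. 0\<^sub>m n n) (\<lambda>n A B. \<chi> (pair A B)) vec_space.rank carrier_vec
    (\<lambda>n. 0\<^sub>v n) K 0 her_blk her_corr (\<lambda>a d. \<chi> (a * d))"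
proof -
  have q2: "2 \<le> real q" using q_ge_2 by simp
  have gb: "gauss_base (- real q)" using q2 by (rule gauss_base_neg)
  have Hc: "A \<in> carrier_mat n n" if "A \<in> H n" for A n using that by (simp add: H_def)
  have cv0: "cv (0\<^sub>v n) = 0\<^sub>v n" for n using q_ge_2 by (intro eq_vecI) (auto simp: cv_def)
  have zero_blk: "her_blk n C (0\<^sub>v n) d = four_block_mat C (0\<^sub>m n 1) (0\<^sub>m 1 n) (sc d)" for n C d
    by (simp add: her_blk_def border_zero cv0)
  have cvinj: "cv v = cv v' \<Longrightarrow> v = v'" for v v' :: "'f vec"
  proof -
    assume e: "cv v = cv v'"
    have "cv (cv u) = u" for u by (intro eq_vecI) (auto simp: cv_def frobenius_frobenius)
    then show "v = v'" using e by metis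
  qed
  show ?thesis
  proof (intro form_family.intro gb form_family_axioms.intro)
    fix n
    show "self_dual_group (H n) (0\<^sub>m n n) (\<lambda>A B. \<chi> (pair A B))"
    proof (rule mat_self_dual_group[OF _ _ _ _ _ _ _ \<chi>])
      fix A B assume AB: "A \<in> H n" "B \<in> H n"
      show "A + B \<in> H n" "A - B \<in> H n" using AB ct_add[OF Hc Hc] ct_minus[OF Hc Hc] by (auto simp: H_def minus_carrier_mat)
      show "pair A B = pair B A" by (rule pair_sym[OF Hc Hc]) (use AB in auto)
      show "pair (A + B) C = pair A C + pair B C" for C by (rule pair_add[OF Hc Hc]) (use AB in auto)
    next
      fix A assume "A \<in> H n" "A \<noteq> 0\<^sub>m n n"
      then show "\<exists>B\<in>H n. pair A B = 1" by (rule her_nondegenerate)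
    qed (auto simp: H_def)
    show "H 0 = {0\<^sub>m 0 0}" by (auto simp: H_def intro!: eq_matI)
    show "vec_space.rank n A \<le> n" if "A \<in> H n" for A using vec_space.rank_le_nc[OF Hc[OF that]] .
    show "vec_space.rank n A = 0 \<longleftrightarrow> A = 0\<^sub>m n n" if "A \<in> H n" for A by (rule rank_eq_0_iff[OF Hc[OF that]])
    show "vec_space.rank n (A - B) = vec_space.rank n (B - A)" if "A \<in> H n" "B \<in> H n" for A B
      by (rule rank_uminus_diff[OF Hc[OF that(1)] Hc[OF that(2)]])
    show "bij_betw (\<lambda>(C, v, d). her_blk n C v d) (H n \<times> carrier_vec n \<times> K) (H (Suc n))"
      unfolding bij_betw_def
    proof
      show "inj_on (\<lambda>(C, v, d). her_blk n C v d) (H n \<times> carrier_vec n \<times> K)"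
      proof (rule inj_onI)
        fix x y assume "x \<in> H n \<times> carrier_vec n \<times> K" "y \<in> H n \<times> carrier_vec n \<times> K"
          and eq: "(case x of (C, v, d) \<Rightarrow> her_blk n C v d) = (case y of (C, v, d) \<Rightarrow> her_blk n C v d)"
        then obtain C C' v v' d d' where xy: "x = (C, v, d)" "y = (C', v', d')"
          and c: "C \<in> H n" "C' \<in> H n" "v \<in> carrier_vec n" "v' \<in> carrier_vec n" by auto
        have "her_blk n C v d = her_blk n C' v' d'" using eq unfolding xy by simp
        note D = four_block_eqD[OF this[unfolded her_blk_def] Hc[OF c(1)] border_carrier Hc[OF c(2)] border_carrier]
        show "x = y" unfolding xy using D colm_inj[OF c(3,4)] sc_inj by auto
      qed
      show "(\<lambda>(C, v, d). her_blk n C v d) ` (H n \<times> carrier_vec n \<times> K) = H (Suc n)"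
      proof (intro subset_antisym subsetI)
        fix M assume M: "M \<in> H (Suc n)"
        then have "M \<in> carrier_mat (n + 1) (n + 1)" by (simp add: H_def)
        then obtain M1 M2 M3 M4 where b: "M1 \<in> carrier_mat n n" "M2 \<in> carrier_mat n 1" "M3 \<in> carrier_mat 1 n" "M4 \<in> carrier_mat 1 1"
          and Meq: "M = four_block_mat M1 M2 M3 M4" by (rule split_last_block)
        have herm: "four_block_mat (ct M1) (ct M3) (ct M2) (ct M4) = four_block_mat M1 M2 M3 M4"
          using M ct_four_block[OF b] unfolding H_def Meq by simp
        have e: "ct M1 = M1" "ct M2 = M3" "ct M4 = M4"
          using four_block_eqD[OF herm, of n n 1 1] b by auto
        define v where "v = vec n (\<lambda>i. M2 $$ (i, 0))"
        define d where "d = M4 $$ (0, 0)"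
        have v: "v \<in> carrier_vec n" by (simp add: v_def)
        have M2: "M2 = colm n v" unfolding v_def by (rule colm_surj[OF b(2)])
        have M4: "M4 = sc d" unfolding d_def by (rule sc_surj[OF b(4)])
        have M3: "M3 = rowm n (cv v)" using e(2) v unfolding M2 by simp
        have "d \<in> K" using e(3) sc_inj[of "d ^ q" d] unfolding M4 by (simp add: K_def)
        moreover have "M1 \<in> H n" using b e by (simp add: H_def)
        moreover have "M = her_blk n M1 v d" unfolding Meq her_blk_def M2 M3 M4 ..
        ultimately show "M \<in> (\<lambda>(C, v, d). her_blk n C v d) ` (H n \<times> carrier_vec n \<times> K)"
          using v by (intro image_eqI[of _ _ "(M1, v, d)"]) auto
      qed (use her_blk_H in auto)
    qed
    show "her_corr n v d \<in> H n" if "v \<in> carrier_vec n" "d \<in> K" for v d by (rule her_corr_H[OF that])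
    show "vec_space.rank (Suc n) (her_blk n (C + her_corr n v d) v d) = Suc (vec_space.rank n C)"
      if "C \<in> H n" "d \<noteq> 0" for C v d
      using rank_schur[OF Hc[OF that(1)] border_carrier(1,2,3,3) sc_inverse[OF that(2)], of v "cv v"]
      unfolding her_blk_def her_corr_def by simp
    show "vec_space.rank (Suc n) (her_blk n C (0\<^sub>v n) 0) = vec_space.rank n C" if "C \<in> H n" for C
      using rank_direct_sum[OF Hc[OF that] zero_carrier_mat[of 1 1]] unfolding zero_blk border_zero
      by (simp add: vec_space.rank_0I)
    show "\<chi> (pair (her_blk n A (0\<^sub>v n) a) (her_blk n C v d)) = \<chi> (pair A C) * \<chi> (a * d)"
      if "A \<in> H n" "C \<in> H n" for A C v a d
      unfolding zero_blk unfolding her_blk_def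
      using pair_four_block[OF Hc[OF that(1)] zero_carrier_mat zero_carrier_mat border_carrier(3) Hc[OF that(2)] border_carrier] \<chi>
      by (simp add: pair_zero pair_sc additive_character_def)
    show "\<exists>A'\<in>H n. \<exists>a\<in>K - {0}. Suc (vec_space.rank n A') = vec_space.rank (Suc n) A \<and>
        (\<forall>k. (\<Sum>B\<in>{B \<in> H (Suc n). vec_space.rank (Suc n) B = k}. \<chi> (pair A B)) =
          (\<Sum>B\<in>{B \<in> H (Suc n). vec_space.rank (Suc n) B = k}. \<chi> (pair (her_blk n A' (0\<^sub>v n) a) B)))"
      if A: "A \<in> H (Suc n)" "A \<noteq> 0\<^sub>m (Suc n) (Suc n)" for A
    proof -
      have e: "Suc n = n + 1" by simp
      obtain C a where C: "C \<in> H n" and a: "a \<in> K" "a \<noteq> 0"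
        and cong: "hcong (n + 1) A (four_block_mat C (0\<^sub>m n 1) (0\<^sub>m 1 n) (sc a))"
        using her_reduction[OF A[unfolded e]] .
      have NH: "four_block_mat C (0\<^sub>m n 1) (0\<^sub>m 1 n) (sc a) \<in> H (n + 1)"
        using her_blk_H[OF C _ a(1), of "0\<^sub>v n"] unfolding zero_blk e by simp
      have "vec_space.rank 1 (sc a) = 1"
        by (rule rank_invertible[OF border_carrier(3,3) sc_inverse(1)[OF a(2)]])
      then have "vec_space.rank (n + 1) A = Suc (vec_space.rank n C)"
        using hcong_rank[OF Hc[OF NH] cong] rank_direct_sum[OF Hc[OF C] border_carrier(3), of a] by simp
      then show ?thesis unfolding zero_blk e using C a hcong_sum[OF NH cong] by (intro bexI[of _ C] bexI[of _ a]) auto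
    qed
    show "of_nat (card K) * (\<Sum>v\<in>carrier_vec n. \<chi> (pair A (her_corr n v d))) =
        complex_of_real (- 1 * (- real q) ^ (2 * n + 1 - vec_space.rank n A))"
      if A: "A \<in> H n" and d: "d \<in> K" "d \<noteq> 0" for A d
    proof -
      let ?r = "vec_space.rank n A" and ?S = "\<Sum>v\<in>carrier_vec n. \<chi> (pair A (her_corr n v d))"
      have S: "?S = (\<Sum>v\<in>carrier_vec n. \<chi> ((1 / d) * hform A v))"
        by (rule sum.cong) (auto simp: her_corr_def pair_rank_one[OF Hc[OF A]] hform_def simp del: assoc_mult_mat)
      have gs: "?S * of_nat q ^ ?r = (- 1) ^ ?r * of_nat q ^ (2 * n)"
        unfolding S by (rule hermitian_gauss_sum[OF \<chi> K_divide[OF K_1 d(1)] _ A]) (use d in simp)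
      have r: "?r \<le> n" using vec_space.rank_le_nc[OF Hc[OF A]] .
      have "(of_nat q * ?S) * of_nat q ^ ?r = of_nat q * ((- 1) ^ ?r * of_nat q ^ (2 * n))"
        using gs by (simp only: mult.assoc)
      \<comment> \<open>The exponent \<open>2 * n + 1 - ?r\<close> has the parity opposite to
        \<open>?r\<close>; the resulting minus sign is \<open>c = - 1\<close>.\<close>
      also have "\<dots> = - ((- of_nat q) ^ (2 * n + 1 - ?r)) * of_nat q ^ ?r"
      proof -
        have m: "2 * n + 1 = 2 * n + 1 - ?r + ?r" using r by simp
        have "(- 1 :: complex) ^ (2 * n + 1 - ?r) = - ((- 1) ^ ?r)"
          using r by (simp add: uminus_power_if)
        then have "- ((- of_nat q) ^ (2 * n + 1 - ?r)) = (- 1) ^ ?r * (of_nat q :: complex) ^ (2 * n + 1 - ?r)"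
          by (subst power_minus) simp
        then have "- ((- of_nat q) ^ (2 * n + 1 - ?r)) * of_nat q ^ ?r =
            (- 1) ^ ?r * ((of_nat q :: complex) ^ (2 * n + 1 - ?r) * of_nat q ^ ?r)" by (simp only: mult.assoc)
        also have "(of_nat q :: complex) ^ (2 * n + 1 - ?r) * of_nat q ^ ?r = of_nat q ^ (2 * n + 1)"
          unfolding power_add[symmetric] m[symmetric] ..
        finally show ?thesis by simp
      qed
      finally have "(of_nat q * ?S) * of_nat q ^ ?r = - ((- of_nat q) ^ (2 * n + 1 - ?r)) * of_nat q ^ ?r" .
      moreover have "(of_nat q :: complex) ^ ?r \<noteq> 0" using q_ge_2 by simp
      ultimately have "of_nat q * ?S = - ((- of_nat q) ^ (2 * n + 1 - ?r))" by (rule mult_right_cancel[THEN iffD1, rotated])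
      then show ?thesis by (simp add: card_K_and_norm(1))
    qed
    show "real (card (carrier_vec n :: 'f vec set)) * real (card K) * (- 1 * (- real q) ^ n) ^ n =
        (- 1 * (- real q) ^ Suc n) ^ Suc n"
    proof -
      \<comment> \<open>The product \<open>Suc m * m\<close> is even, so the negative parameters
        yield the positive count \<open>q ^ (m * m)\<close>.\<close>
      have sq: "(- 1 * (- real q) ^ m) ^ m = real q ^ (m * m)" for m
      proof -
        have "(- 1 * (- real q) ^ m) = (- 1) ^ Suc m * real q ^ m"
          using power_mult_distrib[of "- 1" "real q" m] by simp
        then have "(- 1 * (- real q) ^ m) ^ m = (- 1) ^ (Suc m * m) * real q ^ (m * m)"
          by (simp only: power_mult_distrib power_mult)
        then show ?thesis by simp
      qed
      have "real (card (carrier_vec n :: 'f vec set)) = real q ^ (2 * n)"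
        by (simp only: card_carrier_vec q[symmetric] power_mult of_nat_power)
      moreover have "real q ^ (2 * n) * real q * real q ^ (n * n) = real q ^ (Suc n * Suc n)"
      proof -
        have "2 * n + 1 + n * n = Suc n * Suc n" by simp
        then have "real q ^ (2 * n + 1 + n * n) = real q ^ (Suc n * Suc n)" by (simp only:)
        then show ?thesis by (simp only: power_add power_one_right)
      qed
      ultimately show ?thesis unfolding sq card_K_and_norm(1) by simp
    qed
    show "- 1 * (- real q) ^ n \<noteq> (- real q) ^ s" if "s < n" for s
    proof
      assume e: "- 1 * (- real q) ^ n = (- real q) ^ s"
      have "\<bar>- 1 * (- real q) ^ n\<bar> = real q ^ n" "\<bar>(- real q) ^ s\<bar> = real q ^ s" by (simp_all add: power_abs)
      then have "real q ^ n = real q ^ s" using arg_cong[OF e, of abs] by (simp only:)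
      moreover have "real q ^ s < real q ^ n" using q2 that by (intro power_strict_increasing) auto
      ultimately show False by simp
    qed
    show "(\<Sum>d\<in>K. \<chi> (a * d)) = 0" if "a \<in> K" "a \<noteq> 0" for a by (rule sum_character_K[OF \<chi> that])
    show "finite (carrier_vec n :: 'f vec set)" by (rule finite_carrier_vec)
    show "\<exists>d\<in>K. d \<noteq> 0" using K_1 by (intro bexI[of _ 1]) auto
  qed (use \<chi> q_ge_2 K_0 in \<open>auto simp: additive_character_def\<close>)
qed

end

section \<open>Alternating forms\<close>

lemma Alt_entry:
  assumes "A \<in> Alt m" "i < m" "j < m" shows "A $$ (j, i) = - A $$ (i, j)"
proof -
  have c: "A \<in> carrier_mat m m" "A\<^sup>T = - A" using assms by (auto simp: Alt_def)
  have "A\<^sup>T $$ (i, j) = (- A) $$ (i, j)" by (simp only: c(2))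
  then show ?thesis using assms(2,3) c(1) by simp
qed

lemma Alt_carrier: "A \<in> Alt m \<Longrightarrow> A \<in> carrier_mat m m"
  by (simp add: Alt_def)

lemma Alt_diag: "A \<in> Alt m \<Longrightarrow> i < m \<Longrightarrow> A $$ (i, i) = 0"
  by (simp add: Alt_def)

lemma AltI:
  assumes "A \<in> carrier_mat m m" "\<And>i j. i < m \<Longrightarrow> j < m \<Longrightarrow> A $$ (j, i) = - A $$ (i, j)" "\<And>i. i < m \<Longrightarrow> A $$ (i, i) = 0"
  shows "A \<in> Alt m"
proof -
  have "A\<^sup>T = - A"
  proof (rule eq_matI)
    fix i j assume "i < dim_row (- A)" "j < dim_col (- A)"
    then show "A\<^sup>T $$ (i, j) = (- A) $$ (i, j)" using assms(1) assms(2)[of i j] by simp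
  qed (use assms(1) in auto)
  then show ?thesis using assms(1,3) by (simp add: Alt_def)
qed

lemma Alt_minus_transpose: "M \<in> carrier_mat m m \<Longrightarrow> M - M\<^sup>T \<in> Alt m"
  by (rule AltI) auto

lemma Alt_add:
  assumes A: "A \<in> Alt m" and B: "B \<in> Alt m" shows "A + B \<in> Alt m"
proof (rule AltI)
  have c: "A \<in> carrier_mat m m" "B \<in> carrier_mat m m" using A B by (auto dest: Alt_carrier)
  show "A + B \<in> carrier_mat m m" using c by auto
  fix i assume i: "i < m"
  show "(A + B) $$ (i, i) = 0" using c i Alt_diag[OF A i] Alt_diag[OF B i] by simp
  fix j assume j: "j < m"
  show "(A + B) $$ (j, i) = - (A + B) $$ (i, j)"
    unfolding index_add_mat(1)[of j B i, OF _ _, unfolded carrier_matD[OF c(2)], OF j i]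
      index_add_mat(1)[of i B j, OF _ _, unfolded carrier_matD[OF c(2)], OF i j] Alt_entry[OF A i j] Alt_entry[OF B i j] by simp
qed

lemma Alt_minus:
  assumes A: "A \<in> Alt m" and B: "B \<in> Alt m" shows "A - B \<in> Alt m"
proof (rule AltI)
  have c: "A \<in> carrier_mat m m" "B \<in> carrier_mat m m" using A B by (auto dest: Alt_carrier)
  show "A - B \<in> carrier_mat m m" using c by auto
  fix i assume i: "i < m"
  show "(A - B) $$ (i, i) = 0" using c i Alt_diag[OF A i] Alt_diag[OF B i] by simp
  fix j assume j: "j < m"
  show "(A - B) $$ (j, i) = - (A - B) $$ (i, j)"
    unfolding index_minus_mat(1)[of j B i, OF _ _, unfolded carrier_matD[OF c(2)], OF j i]
      index_minus_mat(1)[of i B j, OF _ _, unfolded carrier_matD[OF c(2)], OF i j] Alt_entry[OF A i j] Alt_entry[OF B i j] by simp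
qed

lemma Alt_zero: "0\<^sub>m m m \<in> Alt m"
  by (rule AltI) auto

text \<open>Alternating matrices are exactly the differences \<open>U - U\<^sup>T\<close>. Here such
  a \<open>U\<close> is chosen without division by 2, so that characteristic 2 is included.\<close>

definition up :: "'f::zero mat \<Rightarrow> 'f mat" where
  "up B = mat (dim_row B) (dim_col B) (\<lambda>(i, j). if i < j then B $$ (i, j) else 0)"

lemma up_carrier [simp]: "up B \<in> carrier_mat m n \<longleftrightarrow> B \<in> carrier_mat m n"
  unfolding carrier_mat_def up_def by simp

lemma up_minus_transpose: "B \<in> Alt m \<Longrightarrow> up B - (up B)\<^sup>T = B"
proof (rule eq_matI)
  fix i j assume B: "B \<in> Alt m" and ij: "i < dim_row B" "j < dim_col B"
  then have c: "B \<in> carrier_mat m m" "i < m" "j < m" using Alt_carrier[OF B] by auto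
  show "(up B - (up B)\<^sup>T) $$ (i, j) = B $$ (i, j)"
    using c Alt_entry[OF B c(3,2)] Alt_diag[OF B c(2)] by (cases i j rule: linorder_cases) (auto simp: up_def)
qed (auto simp: up_def dest!: Alt_carrier)

lemma conj_skew:
  fixes P :: "'f::field mat"
  assumes P: "P \<in> carrier_mat m m" and U: "U \<in> carrier_mat m m"
  shows "P * (U - U\<^sup>T) * P\<^sup>T = P * U * P\<^sup>T - (P * U * P\<^sup>T)\<^sup>T"
proof -
  have c: "P\<^sup>T \<in> carrier_mat m m" "U\<^sup>T \<in> carrier_mat m m" using P U by auto
  have PU: "P * U \<in> carrier_mat m m" "P * U\<^sup>T \<in> carrier_mat m m" using P U by auto
  have "(P * U * P\<^sup>T)\<^sup>T = P\<^sup>T\<^sup>T * (P * U)\<^sup>T" by (rule transpose_mult[OF PU(1) c(1)])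
  also have "(P * U)\<^sup>T = U\<^sup>T * P\<^sup>T" by (rule transpose_mult[OF P U])
  also have "P\<^sup>T\<^sup>T * (U\<^sup>T * P\<^sup>T) = P * U\<^sup>T * P\<^sup>T" using assoc_mult_mat[OF P c(2,1)] by simp
  finally have T: "(P * U * P\<^sup>T)\<^sup>T = P * U\<^sup>T * P\<^sup>T" .
  show ?thesis unfolding T mult_minus_distrib_mat[OF P U c(2)] by (rule minus_mult_distrib_mat[OF PU c(1)])
qed

text \<open>In characteristic 2 skew-symmetry would not give the zero diagonal, so the
  representation through \<open>up B\<close> is transported instead.\<close>

lemma conj_Alt:
  assumes P: "P \<in> carrier_mat m m" and B: "B \<in> Alt m" shows "P * B * P\<^sup>T \<in> Alt m"
proof -
  have "P * up B * P\<^sup>T \<in> carrier_mat m m" using P Alt_carrier[OF B] by (auto intro!: mult_carrier_mat)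
  from Alt_minus_transpose[OF this] show ?thesis
    using conj_skew[OF P, of "up B"] Alt_carrier[OF B] up_minus_transpose[OF B] by simp
qed

text \<open>Induction is used because showing the sum equal to its own negative is inconclusive in
  characteristic 2.\<close>

lemma sum_skew_eq_0:
  fixes f :: "nat \<Rightarrow> nat \<Rightarrow> 'f::comm_ring_1"
  assumes "\<And>i j. i < n \<Longrightarrow> j < n \<Longrightarrow> f j i = - f i j" "\<And>i. i < n \<Longrightarrow> f i i = 0"
  shows "(\<Sum>i<n. \<Sum>j<n. f i j) = 0"
  using assms
proof (induction n)
  case (Suc n)
  have "(\<Sum>i<n. f i n) = (\<Sum>i<n. - f n i)" by (intro sum.cong refl Suc.prems(1)) auto
  moreover have "(\<Sum>i<n. \<Sum>j<n. f i j) = 0" by (rule Suc.IH) (rule Suc.prems; simp)+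
  moreover have "f n n = 0" by (rule Suc.prems(2)) simp
  ultimately show ?case by (simp add: sum.distrib sum_negf)
qed simp

text \<open>The hypothesis says that \<open>M - M'\<close> is symmetric, and an alternating matrix
  pairs to zero with every symmetric one.\<close>

lemma pair_Alt_cong:
  assumes A: "A \<in> Alt m" and c: "M \<in> carrier_mat m m" "M' \<in> carrier_mat m m" and e: "M - M\<^sup>T = M' - M'\<^sup>T"
  shows "pair A M = pair A M'"
proof -
  have "(\<Sum>i<m. \<Sum>j<m. A $$ (i, j) * (M $$ (i, j) - M' $$ (i, j))) = 0"
  proof (rule sum_skew_eq_0)
    fix i j assume ij: "i < m" "j < m"
    have "(M - M\<^sup>T) $$ (i, j) = (M' - M'\<^sup>T) $$ (i, j)" using e by simp
    then have "M $$ (i, j) - M $$ (j, i) = M' $$ (i, j) - M' $$ (j, i)" using c ij by simp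
    then have "M $$ (j, i) - M' $$ (j, i) = M $$ (i, j) - M' $$ (i, j)" by (simp add: algebra_simps)
    then show "A $$ (j, i) * (M $$ (j, i) - M' $$ (j, i)) = - (A $$ (i, j) * (M $$ (i, j) - M' $$ (i, j)))"
      using Alt_entry[OF A ij] by simp
  qed (use Alt_diag[OF A] in auto)
  then have "(\<Sum>i<m. \<Sum>j<m. A $$ (i, j) * M $$ (i, j)) = (\<Sum>i<m. \<Sum>j<m. A $$ (i, j) * M' $$ (i, j))"
    by (simp add: right_diff_distrib sum_subtractf)
  then show ?thesis using carrier_matD[OF Alt_carrier[OF A]] by (simp add: pair_def)
qed

text \<open>Only the entries above the diagonal are paired: for alternating matrices
  \<open>pair A B\<close> is twice this sum and would vanish in characteristic 2.\<close>

definition altp :: "'f::comm_ring_1 mat \<Rightarrow> 'f mat \<Rightarrow> 'f" where "altp A B = pair A (up B)"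

lemma altp_sym:
  assumes "A \<in> carrier_mat m m" "B \<in> carrier_mat m m" shows "altp A B = altp B A"
  using assms by (auto simp: altp_def pair_def up_def intro!: sum.cong)

text \<open>The transform of \<open>up B\<close> is no longer triangular, but minus its transpose it
  still gives the transform of \<open>B\<close>, which is all that \<open>pair_Alt_cong\<close> asks
  for.\<close>

lemma altp_conj:
  assumes P: "P \<in> carrier_mat m m" and A: "A \<in> Alt m" and B: "B \<in> Alt m"
  shows "altp (P * A * P\<^sup>T) B = altp A (P\<^sup>T * B * P)"
proof -
  have c: "A \<in> carrier_mat m m" "up B \<in> carrier_mat m m" "P\<^sup>T \<in> carrier_mat m m"
    using A B P Alt_carrier by auto
  have Q: "P\<^sup>T * B * P \<in> Alt m" using conj_Alt[OF c(3) B] by simp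
  have "altp (P * A * P\<^sup>T) B = pair A (P\<^sup>T * up B * P)"
    unfolding altp_def using pair_mult[OF P c(1,3,2)] by simp
  also have "\<dots> = pair A (up (P\<^sup>T * B * P))"
  proof (rule pair_Alt_cong[OF A])
    show "P\<^sup>T * up B * P \<in> carrier_mat m m" using c P by (auto intro!: mult_carrier_mat)
    show "up (P\<^sup>T * B * P) \<in> carrier_mat m m" using Alt_carrier[OF Q] by simp
    show "P\<^sup>T * up B * P - (P\<^sup>T * up B * P)\<^sup>T = up (P\<^sup>T * B * P) - (up (P\<^sup>T * B * P))\<^sup>T"
      using conj_skew[OF c(3,2)] unfolding up_minus_transpose[OF Q] up_minus_transpose[OF B] by simp
  qed
  finally show ?thesis by (simp add: altp_def)
qed

lemma alt_sum_invariant: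
  fixes A :: "'f::{field,finite} mat"
  assumes A: "A \<in> Alt m" and P: "P \<in> carrier_mat m m" "P' \<in> carrier_mat m m" "P * P' = 1\<^sub>m m" "P' * P = 1\<^sub>m m"
  shows "(\<Sum>B\<in>{B \<in> Alt m. vec_space.rank m B div 2 = k}. \<chi> (altp (P * A * P\<^sup>T) B) :: complex) =
    (\<Sum>B\<in>{B \<in> Alt m. vec_space.rank m B div 2 = k}. \<chi> (altp A B))"
proof (rule sum_rank_invariant[where f = "\<lambda>B. P\<^sup>T * B * P" and f' = "\<lambda>B. P'\<^sup>T * B * P'" and rk = "\<lambda>B. vec_space.rank m B div 2"])
  fix B :: "'f mat" assume B: "B \<in> Alt m"
  then have Bc: "B \<in> carrier_mat m m" by (rule Alt_carrier)
  note T = transpose_inverse[OF P(1,2,3)] transpose_inverse[OF P(2,1,4)]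
  have PT: "P\<^sup>T \<in> carrier_mat m m" "P'\<^sup>T \<in> carrier_mat m m" using P by auto
  show "\<chi> (altp (P * A * P\<^sup>T) B) = \<chi> (altp A (P\<^sup>T * B * P))" by (simp only: altp_conj[OF P(1) A B])
  have "P\<^sup>T * (P'\<^sup>T * B * P') * P = B" by (rule conj_cancel[OF Bc PT T(2)]) (use P in auto)
  moreover have "P'\<^sup>T * (P\<^sup>T * B * P) * P' = B" by (rule conj_cancel[OF Bc PT(2,1) T(1)]) (use P in auto)
  moreover have "vec_space.rank m (P\<^sup>T * B * P) = vec_space.rank m B"
    by (rule rank_mult_invertible[OF Bc PT T(1) P(1,2,3)])
  ultimately show "P\<^sup>T * B * P \<in> Alt m \<and> P'\<^sup>T * B * P' \<in> Alt m \<and> P\<^sup>T * (P'\<^sup>T * B * P') * P = B \<and>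
      P'\<^sup>T * (P\<^sup>T * B * P) * P' = B \<and> vec_space.rank m (P\<^sup>T * B * P) div 2 = vec_space.rank m B div 2"
    using conj_Alt[OF PT(1) B] conj_Alt[OF PT(2) B] by simp
qed

definition skew2 :: "'f::ring_1 \<Rightarrow> 'f mat" where
  "skew2 d = mat 2 2 (\<lambda>(i, j). if i = j then 0 else if i = 0 then d else - d)"

lemma skew2_carrier [simp]: "skew2 d \<in> carrier_mat 2 2"
  by (simp add: skew2_def)

lemma skew2_entry: "skew2 d $$ (0, 1) = d" "skew2 d $$ (0, Suc 0) = d"
  by (simp_all add: skew2_def)

lemma less_2_cases: "i < 2 \<Longrightarrow> i = 0 \<or> i = (1 :: nat)"
  by auto

lemma skew2_inverse:
  fixes d :: "'f::field"
  assumes "d \<noteq> 0" shows "skew2 d * skew2 (- 1 / d) = 1\<^sub>m 2" "skew2 (- 1 / d) * skew2 d = 1\<^sub>m 2"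
  using assms by (auto intro!: eq_matI dest!: less_2_cases simp: skew2_def scalar_prod_def numeral_2_eq_2)

lemma skew2_Alt: "skew2 d \<in> Alt 2"
  by (rule AltI) (auto simp: skew2_def dest!: less_2_cases)

lemma Alt_2: "M \<in> Alt 2 \<Longrightarrow> M = skew2 (M $$ (0, 1))"
  using Alt_entry[of M 2 0 1] Alt_diag[of M 2 0] Alt_diag[of M 2 1] Alt_carrier[of M 2]
  by (intro eq_matI) (auto simp: skew2_def dest!: less_2_cases)

lemma altp_skew2: "altp (skew2 a) (skew2 d) = a * d"
  by (simp add: altp_def pair_def up_def skew2_def numeral_2_eq_2)

lemma four_block_Alt:
  "C \<in> carrier_mat r r \<Longrightarrow> V \<in> carrier_mat r s \<Longrightarrow> W \<in> carrier_mat s r \<Longrightarrow> D \<in> carrier_mat s s \<Longrightarrow>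
    four_block_mat C V W D \<in> Alt (r + s) \<longleftrightarrow> C \<in> Alt r \<and> W = - V\<^sup>T \<and> D \<in> Alt s"
proof
  assume c: "C \<in> carrier_mat r r" "V \<in> carrier_mat r s" "W \<in> carrier_mat s r" "D \<in> carrier_mat s s"
  let ?M = "four_block_mat C V W D"
  assume M: "?M \<in> Alt (r + s)"
  have "C \<in> Alt r"
  proof (rule AltI[OF c(1)])
    fix i j assume "i < r" "j < r"
    then show "C $$ (j, i) = - C $$ (i, j)" using Alt_entry[OF M, of i j] c by simp
  next
    fix i assume "i < r"
    then show "C $$ (i, i) = 0" using Alt_diag[OF M, of i] c by simp
  qed
  moreover have "D \<in> Alt s"
  proof (rule AltI[OF c(4)])
    fix i j assume "i < s" "j < s"
    then show "D $$ (j, i) = - D $$ (i, j)" using Alt_entry[OF M, of "r + i" "r + j"] c by simp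
  next
    fix i assume "i < s"
    then show "D $$ (i, i) = 0" using Alt_diag[OF M, of "r + i"] c by simp
  qed
  moreover have "W = - V\<^sup>T"
  proof (rule eq_matI)
    fix i j assume "i < dim_row (- V\<^sup>T)" "j < dim_col (- V\<^sup>T)"
    then show "W $$ (i, j) = (- V\<^sup>T) $$ (i, j)" using Alt_entry[OF M, of j "r + i"] c by simp
  qed (use c in auto)
  ultimately show "C \<in> Alt r \<and> W = - V\<^sup>T \<and> D \<in> Alt s" by blast
next
  assume c: "C \<in> carrier_mat r r" "V \<in> carrier_mat r s" "W \<in> carrier_mat s r" "D \<in> carrier_mat s s"
    and a: "C \<in> Alt r \<and> W = - V\<^sup>T \<and> D \<in> Alt s"
  have C: "C $$ (j, i) = - C $$ (i, j)" if "i < r" "j < r" for i j using a Alt_entry[of C r] that by blast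
  have D: "D $$ (j, i) = - D $$ (i, j)" if "i < s" "j < s" for i j using a Alt_entry[of D s] that by blast
  have W: "W $$ (i, j) = - V $$ (j, i)" if "i < s" "j < r" for i j using a c that by simp
  show "four_block_mat C V W D \<in> Alt (r + s)"
  proof (rule AltI)
    show "four_block_mat C V W D \<in> carrier_mat (r + s) (r + s)" by (rule four_block_carrier_mat[OF c(1,4)])
    fix i assume i: "i < r + s"
    show "four_block_mat C V W D $$ (i, i) = 0"
      using i c a Alt_diag[of C r i] Alt_diag[of D s "i - r"] by auto
    fix j assume j: "j < r + s"
    show "four_block_mat C V W D $$ (j, i) = - four_block_mat C V W D $$ (i, j)"
      using i j c C[of i j] D[of "i - r" "j - r"] W[of "i - r" j] W[of "j - r" i]
      by (cases "i < r"; cases "j < r") auto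
  qed
qed

lemma up_four_block:
  assumes "C \<in> carrier_mat r r" "V \<in> carrier_mat r s" "W \<in> carrier_mat s r" "D \<in> carrier_mat s s"
  shows "up (four_block_mat C V W D) = four_block_mat (up C) V (0\<^sub>m s r) (up D)"
proof (rule eq_matI)
  fix i j assume "i < dim_row (four_block_mat (up C) V (0\<^sub>m s r) (up D))" "j < dim_col (four_block_mat (up C) V (0\<^sub>m s r) (up D))"
  then show "up (four_block_mat C V W D) $$ (i, j) = four_block_mat (up C) V (0\<^sub>m s r) (up D) $$ (i, j)"
    using assms by (cases "i < r"; cases "j < r") (auto simp: up_def)
qed (use assms in \<open>auto simp: up_def\<close>)

lemma alt_reduction:
  fixes A :: "'f::{field,finite} mat"
  assumes A: "A \<in> Alt (r + 2)" "A \<noteq> 0\<^sub>m (r + 2) (r + 2)"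
  shows "\<exists>C a. C \<in> Alt r \<and> a \<noteq> 0 \<and> vec_space.rank (r + 2) A = vec_space.rank r C + 2 \<and>
    (\<forall>k. (\<Sum>B\<in>{B \<in> Alt (r + 2). vec_space.rank (r + 2) B div 2 = k}. \<chi> (altp A B) :: complex) =
      (\<Sum>B\<in>{B \<in> Alt (r + 2). vec_space.rank (r + 2) B div 2 = k}.
        \<chi> (altp (four_block_mat C (0\<^sub>m r 2) (0\<^sub>m 2 r) (skew2 a)) B)))"
proof -
  have Ac: "A \<in> carrier_mat (r + 2) (r + 2)" by (rule Alt_carrier[OF A(1)])
  obtain s t where st: "s < r + 2" "t < r + 2" "A $$ (s, t) \<noteq> 0"
    using nonzero_entryE[OF Ac A(2)] .
  then have ne: "s \<noteq> t" using Alt_diag[OF A(1)] by auto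
  \<comment> \<open>Exchanging \<open>s\<close> and \<open>r\<close> may displace \<open>t\<close>;
    \<open>t'\<close> is its position afterwards. Hence \<open>\<pi>\<close> sends \<open>r\<close>
    to \<open>s\<close> and \<open>r + 1\<close> to \<open>t\<close>.\<close>
  define t' where "t' = Transposition.transpose s r t"
  define \<pi> where "\<pi> = Transposition.transpose s r \<circ> Transposition.transpose (r + 1) t'"
  have t': "t' < r + 2" "t' \<noteq> r" using st ne unfolding t'_def by (auto simp: Transposition.transpose_def)
  have \<pi>: "\<pi> permutes {..<r + 2}" unfolding \<pi>_def
    by (rule permutes_compose; rule transpose_permutes) (use st t' in auto)
  have \<pi>r: "\<pi> r = s" using t'(2) by (simp add: \<pi>_def transpose_apply_other)
  have \<pi>r1: "\<pi> (r + 1) = t" by (simp add: \<pi>_def t'_def)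
  let ?P = "pm (r + 2) \<pi> :: 'f mat"
  define M where "M = ?P * A * ?P\<^sup>T"
  note invP = pm_inverse[OF \<pi>]
  have M: "M \<in> Alt (r + 2)" unfolding M_def by (rule conj_Alt[OF _ A(1)]) simp
  have Mc: "M \<in> carrier_mat (r + 2) (r + 2)" by (rule Alt_carrier[OF M])
  have Mrr: "M $$ (r, r + 1) \<noteq> 0"
    using pm_conj_entry[OF Ac \<pi> \<pi>, of r "r + 1"] st(3) unfolding M_def \<pi>r \<pi>r1 by simp
  have S1: "(\<Sum>B\<in>{B \<in> Alt (r + 2). vec_space.rank (r + 2) B div 2 = k}. \<chi> (altp M B)) =
      (\<Sum>B\<in>{B \<in> Alt (r + 2). vec_space.rank (r + 2) B div 2 = k}. \<chi> (altp A B))" for k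
    unfolding M_def by (rule alt_sum_invariant[OF A(1) _ _ invP]) auto
  have rank1: "vec_space.rank (r + 2) M = vec_space.rank (r + 2) A"
    unfolding M_def by (rule rank_mult_invertible[OF Ac _ _ invP(2) _ _ invP(2)]) auto
  obtain M1 M2 M3 M4 where b: "M1 \<in> carrier_mat r r" "M2 \<in> carrier_mat r 2" "M3 \<in> carrier_mat 2 r" "M4 \<in> carrier_mat 2 2"
    and Meq: "M = four_block_mat M1 M2 M3 M4"
    by (rule split_last_block[OF Mc])
  have blocks: "M1 \<in> Alt r" "M3 = - M2\<^sup>T" "M4 \<in> Alt 2"
    using M four_block_Alt[OF b] unfolding Meq by auto
  define a where "a = M4 $$ (0, 1)"
  have M4: "M4 = skew2 a" unfolding a_def by (rule Alt_2[OF blocks(3)])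
  have a: "a \<noteq> 0" using Mrr b unfolding Meq a_def by simp
  define D' where "D' = skew2 (- 1 / a)"
  have D: "M4 \<in> carrier_mat 2 2" "D' \<in> carrier_mat 2 2" "M4 * D' = 1\<^sub>m 2" "D' * M4 = 1\<^sub>m 2"
    unfolding M4 D'_def using skew2_inverse[OF a] by auto
  have U: "M2 * D' \<in> carrier_mat r 2" "D' * M3 \<in> carrier_mat 2 r" using b D by auto
  have D'T: "D'\<^sup>T = - D'" using skew2_Alt[of "- 1 / a"] by (simp add: Alt_def D'_def)
  have UT: "(M2 * D')\<^sup>T = D' * M3"
    using transpose_mult[OF b(2) D(2)] b D unfolding D'T blocks(2) by simp
  have T: "M2 * D' * M3 \<in> carrier_mat r r" using U b by auto
  define C where "C = M1 - M2 * D' * M3"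
  have Cc: "C \<in> carrier_mat r r" unfolding C_def using T by (rule minus_carrier_mat)
  have CT: "C + M2 * D' * M3 = M1" unfolding C_def by (rule mat_minus_add_cancel[OF b(1) T])
  let ?N = "four_block_mat C (0\<^sub>m r 2) (0\<^sub>m 2 r) M4"
  let ?L = "four_block_mat (1\<^sub>m r) (M2 * D') (0\<^sub>m 2 r) (1\<^sub>m 2)"
  let ?L' = "four_block_mat (1\<^sub>m r) (- (M2 * D')) (0\<^sub>m 2 r) (1\<^sub>m 2)"
  have LT: "?L\<^sup>T = four_block_mat (1\<^sub>m r) (0\<^sub>m r 2) (D' * M3) (1\<^sub>m 2)"
    using transpose_four_block_mat[of "1\<^sub>m r" r r "M2 * D'" 2 "0\<^sub>m 2 r" 2 "1\<^sub>m 2"] U(1) UT by simp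
  have L: "?L \<in> carrier_mat (r + 2) (r + 2)" "?L' \<in> carrier_mat (r + 2) (r + 2)"
    by (rule four_block_carrier_mat; simp)+
  note invL = unipotent_inverse[OF U(1)]
  have N: "?N \<in> carrier_mat (r + 2) (r + 2)" by (rule four_block_carrier_mat[OF Cc b(4)])
  have fact: "M = ?L * ?N * ?L\<^sup>T"
    using schur_factorisation[OF Cc b(2,3) D] unfolding CT Meq[symmetric] LT .
  \<comment> \<open>That \<open>C\<close> is alternating is inherited from \<open>M\<close> by
    undoing the congruence.\<close>
  have "?L' * M * ?L'\<^sup>T = ?N" unfolding fact
    by (rule conj_cancel[OF N L(2,1) invL(2)]) (use L transpose_inverse[OF L(2,1) invL(2)] in auto)
  then have NA: "?N \<in> Alt (r + 2)" using conj_Alt[OF L(2) M] by simp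
  then have CA: "C \<in> Alt r" using four_block_Alt[OF Cc _ _ b(4)] by simp
  have S2: "(\<Sum>B\<in>{B \<in> Alt (r + 2). vec_space.rank (r + 2) B div 2 = k}. \<chi> (altp M B)) =
      (\<Sum>B\<in>{B \<in> Alt (r + 2). vec_space.rank (r + 2) B div 2 = k}. \<chi> (altp ?N B))" for k
    unfolding fact by (rule alt_sum_invariant[OF NA L invL])
  have "vec_space.rank (r + 2) M = vec_space.rank r C + 2"
    using rank_schur[OF Cc b(2,3) D] unfolding CT Meq .
  then show ?thesis using CA a S1 S2 rank1 unfolding M4 by (intro exI[of _ C] exI[of _ a]) auto
qed

lemma Alt_small: "m < 2 \<Longrightarrow> A \<in> Alt m \<Longrightarrow> A = 0\<^sub>m m m"
  using Alt_diag[of A m 0] Alt_carrier[of A m] by (intro eq_matI) (auto dest!: less_2_cases)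

text \<open>Each use of \<open>alt_reduction\<close> lowers the size and the rank by 2, and the
  process ends at a zero matrix.\<close>

lemma even_rank_Alt:
  fixes A :: "'f::{field,finite} mat"
  assumes "A \<in> Alt m" shows "even (vec_space.rank m A)"
  using assms
proof (induction m arbitrary: A rule: less_induct)
  case (less m)
  show ?case
  proof (cases "A = 0\<^sub>m m m")
    case True
    then show ?thesis by (simp add: vec_space.rank_0I)
  next
    case False
    then have "\<not> m < 2" using Alt_small less.prems by blast
    then obtain r where m: "m = r + 2" by (metis add.commute le_Suc_ex not_less)
    obtain C :: "'f mat" where "C \<in> Alt r" "vec_space.rank (r + 2) A = vec_space.rank r C + 2"
      using alt_reduction[OF less.prems[unfolded m] False[unfolded m], of "\<lambda>_. 0"] by blast
    then show ?thesis using less.IH[of r C] unfolding m by simp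
  qed
qed

definition cols2 :: "nat \<Rightarrow> 'f vec \<times> 'f vec \<Rightarrow> 'f mat" where
  "cols2 r vw = mat r 2 (\<lambda>(i, j). if j = 0 then fst vw $ i else snd vw $ i)"

lemma cols2_carrier [simp]: "cols2 r vw \<in> carrier_mat r 2"
  by (simp add: cols2_def)

definition alt_blk :: "nat \<Rightarrow> nat \<Rightarrow> 'f::field mat \<Rightarrow> 'f vec \<times> 'f vec \<Rightarrow> 'f \<Rightarrow> 'f mat" where
  "alt_blk e n C vw d = four_block_mat C (cols2 (2 * n + e) vw) (- (cols2 (2 * n + e) vw)\<^sup>T) (skew2 d)"

definition alt_corr :: "nat \<Rightarrow> nat \<Rightarrow> 'f::field vec \<times> 'f vec \<Rightarrow> 'f \<Rightarrow> 'f mat" where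
  "alt_corr e n vw d = cols2 (2 * n + e) vw * skew2 (- 1 / d) * (- (cols2 (2 * n + e) vw)\<^sup>T)"

text \<open>With the correction written as \<open>M - M\<^sup>T\<close> for a rank-one
  \<open>M\<close>, \<open>pair_Alt_cong\<close> reduces the pairing with it to a single bilinear
  value, and \<open>bilinear_gauss_sum\<close> can be reused.\<close>

lemma alt_corr_eq:
  fixes v w :: "'f::field vec"
  shows "alt_corr e n (v, w) d = colm (2 * n + e) v * sc (1 / d) * rowm (2 * n + e) w -
    (colm (2 * n + e) v * sc (1 / d) * rowm (2 * n + e) w)\<^sup>T"
proof (rule eq_matI)
  let ?r = "2 * n + e"
  let ?M = "colm ?r v * sc (1 / d) * rowm ?r w"
  have M: "?M \<in> carrier_mat ?r ?r" by (auto intro!: mult_carrier_mat)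
  fix i j assume "i < dim_row (?M - ?M\<^sup>T)" "j < dim_col (?M - ?M\<^sup>T)"
  then have ij: "i < ?r" "j < ?r" by auto
  have "alt_corr e n (v, w) d $$ (i, j) =
      (\<Sum>s<2. \<Sum>t<2. cols2 ?r (v, w) $$ (i, s) * skew2 (- 1 / d) $$ (s, t) * (- (cols2 ?r (v, w))\<^sup>T) $$ (t, j))"
    unfolding alt_corr_def by (rule mult3_entry[where m = ?r and n = ?r]) (use ij in auto)
  also have "\<dots> = (1 / d) * (v $ i * w $ j) - (1 / d) * (v $ j * w $ i)"
    using ij by (simp add: cols2_def skew2_def numeral_2_eq_2)
  also have "\<dots> = ?M $$ (i, j) - ?M $$ (j, i)" unfolding colm_sc_rowm_entry[OF ij] colm_sc_rowm_entry[OF ij(2,1)] ..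
  also have "\<dots> = (?M - ?M\<^sup>T) $$ (i, j)" using ij M by simp
  finally show "alt_corr e n (v, w) d $$ (i, j) = (?M - ?M\<^sup>T) $$ (i, j)" .
qed (auto simp: alt_corr_def cols2_def)

lemma alt_corr_Alt: "alt_corr e n vw d \<in> Alt (2 * n + e)"
proof -
  have "colm (2 * n + e) (fst vw) * sc (1 / d) * rowm (2 * n + e) (snd vw) \<in> carrier_mat (2 * n + e) (2 * n + e)"
    by (auto intro!: mult_carrier_mat)
  from Alt_minus_transpose[OF this] show ?thesis using alt_corr_eq[of e n "fst vw" "snd vw" d] by simp
qed

lemma altp_alt_corr:
  assumes A: "A \<in> Alt (2 * n + e)" and v: "v \<in> carrier_vec (2 * n + e)" "w \<in> carrier_vec (2 * n + e)"
  shows "altp A (alt_corr e n (v, w) d) = (1 / d) * (v \<bullet> (A *\<^sub>v w))"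
proof -
  let ?M = "colm (2 * n + e) v * sc (1 / d) * rowm (2 * n + e) w"
  have M: "?M \<in> carrier_mat (2 * n + e) (2 * n + e)" by (auto intro!: mult_carrier_mat)
  have "altp A (alt_corr e n (v, w) d) = pair A ?M" unfolding altp_def
    by (rule pair_Alt_cong[OF A _ M])
      (use Alt_carrier[OF alt_corr_Alt] up_minus_transpose[OF alt_corr_Alt[of e n "(v, w)" d]] alt_corr_eq[of e n v w d] in auto)
  then show ?thesis using pair_rank_one[OF Alt_carrier[OF A] v] by simp
qed

lemma alt_blk_Alt: "C \<in> Alt (2 * n + e) \<Longrightarrow> alt_blk e n C vw d \<in> Alt (2 * n + e + 2)"
  unfolding alt_blk_def by (subst four_block_Alt) (auto simp: Alt_carrier skew2_Alt)

lemma cols2_inj: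
  assumes "v \<in> carrier_vec r" "v' \<in> carrier_vec r" "w \<in> carrier_vec r" "w' \<in> carrier_vec r"
    and e: "cols2 r (v, w) = cols2 r (v', w')"
  shows "v = v'" "w = w'"
proof -
  have E: "cols2 r vw $$ (i, 0) = fst vw $ i" "cols2 r vw $$ (i, 1) = snd vw $ i" if "i < r" for i and vw :: "'a vec \<times> 'a vec"
    using that by (auto simp: cols2_def)
  have "v $ i = v' $ i" "w $ i = w' $ i" if "i < r" for i
    using E[OF that, of "(v, w)"] E[OF that, of "(v', w')"] unfolding e by simp_all
  then show "v = v'" "w = w'" using assms by (auto intro!: eq_vecI)
qed

lemma cols2_surj: "M \<in> carrier_mat r 2 \<Longrightarrow> M = cols2 r (vec r (\<lambda>i. M $$ (i, 0)), vec r (\<lambda>i. M $$ (i, 1)))"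
  by (rule eq_matI) (auto simp: cols2_def dest!: less_2_cases)

text \<open>The hypothesis on \<open>c\<close> unites the parities of the matrix size:
  \<open>c = 1 / q\<close> for \<open>e = 0\<close> and \<open>c = q\<close> for
  \<open>e = 1\<close>. Identities between powers of \<open>q\<close> are first multiplied by powers
  of \<open>q\<close>, which removes the fraction.\<close>

lemma alt_form_family:
  fixes \<chi> :: "'f::{field,finite} \<Rightarrow> complex"
  assumes \<chi>: "additive_character \<chi>" and e: "e \<le> 1" and c: "c * real CARD('f) = real CARD('f) ^ (2 * e)"
  shows "form_family (real CARD('f) ^ 2) c (\<lambda>n. Alt (2 * n + e)) (\<lambda>n. 0\<^sub>m (2 * n + e) (2 * n + e))
    (\<lambda>n A B. \<chi> (altp A B)) (\<lambda>n A. vec_space.rank (2 * n + e) A div 2)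
    (\<lambda>n. carrier_vec (2 * n + e) \<times> carrier_vec (2 * n + e))
    (\<lambda>n. (0\<^sub>v (2 * n + e), 0\<^sub>v (2 * n + e))) UNIV 0 (alt_blk e) (alt_corr e) (\<lambda>a d. \<chi> (a * d))"
proof -
  let ?q = "real CARD('f)"
  have q: "1 < ?q" using card_field_gt_1[where 'f = 'f] by simp
  have c0: "c \<noteq> 0" using c q by auto
  have gb: "gauss_base (?q ^ 2)" by (rule gauss_base_gt_1, rule one_less_power[OF q]) simp
  have N: "2 * Suc n + e = 2 * n + e + 2" for n by simp
  have zero_blk: "alt_blk e n C (0\<^sub>v (2 * n + e), 0\<^sub>v (2 * n + e)) d =
      four_block_mat C (0\<^sub>m (2 * n + e) 2) (0\<^sub>m 2 (2 * n + e)) (skew2 d)" for n and C :: "'f mat" and d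
  proof -
    have "cols2 (2 * n + e) (0\<^sub>v (2 * n + e), 0\<^sub>v (2 * n + e)) = (0\<^sub>m (2 * n + e) 2 :: 'f mat)"
      by (rule eq_matI) (auto simp: cols2_def)
    then show ?thesis by (simp add: alt_blk_def)
  qed
  have cq: "c * (?q ^ 2) ^ m * ?q = ?q ^ (2 * m + 2 * e)" for m
    using c by (simp add: power_add flip: power_mult)
  show ?thesis
  proof (intro form_family.intro gb form_family_axioms.intro)
    fix n
    let ?r = "2 * n + e"
    have Ac: "A \<in> carrier_mat ?r ?r" if "A \<in> Alt ?r" for A :: "'f mat" using Alt_carrier[OF that] .
    show "self_dual_group (Alt ?r) (0\<^sub>m ?r ?r) (\<lambda>A B. \<chi> (altp A B))"
    proof (rule mat_self_dual_group[OF _ _ _ _ _ _ _ \<chi>])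
      fix A B :: "'f mat" assume AB: "A \<in> Alt ?r" "B \<in> Alt ?r"
      show "A + B \<in> Alt ?r" "A - B \<in> Alt ?r" using AB by (auto intro: Alt_add Alt_minus)
      show "altp A B = altp B A" by (rule altp_sym[OF Ac[OF AB(1)] Ac[OF AB(2)]])
      show "altp (A + B) C = altp A C + altp B C" for C
        unfolding altp_def by (rule pair_add[OF Ac[OF AB(1)] Ac[OF AB(2)]])
    next
      fix A :: "'f mat" assume A: "A \<in> Alt ?r" "A \<noteq> 0\<^sub>m ?r ?r"
      obtain s' t' where st': "s' < ?r" "t' < ?r" "A $$ (s', t') \<noteq> 0"
        using nonzero_entryE[OF Ac[OF A(1)] A(2)] .
      then have "s' \<noteq> t'" using Alt_diag[OF A(1)] by auto
      moreover have "A $$ (t', s') \<noteq> 0" using Alt_entry[OF A(1) st'(1,2)] st'(3) by simp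
      ultimately obtain s t where st: "s < t" "t < ?r" "A $$ (s, t) \<noteq> 0"
        using st' by (cases s' t' rule: linorder_cases) auto
      let ?B = "mat ?r ?r (\<lambda>(i, j). if i = s \<and> j = t then 1 / A $$ (s, t) else if i = t \<and> j = s then - 1 / A $$ (s, t) else 0)"
      have "altp A ?B = (\<Sum>i<?r. \<Sum>j<?r. if i = s then (if j = t then 1 else 0) else 0)"
        using carrier_matD[OF Ac[OF A(1)]] st by (auto simp: altp_def pair_def up_def intro!: sum.cong)
      also have "\<dots> = (\<Sum>i<?r. if i = s then 1 else 0)" using st by (intro sum.cong) auto
      also have "\<dots> = 1" using st by simp
      finally show "\<exists>B\<in>Alt ?r. altp A B = 1" using st by (intro bexI[of _ ?B] AltI) auto
    qed (use Ac Alt_zero in auto)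
    show "vec_space.rank ?r A div 2 \<le> n" if "A \<in> Alt ?r" for A :: "'f mat"
      using vec_space.rank_le_nc[OF Ac[OF that]] e by simp
    show "vec_space.rank ?r A div 2 = 0 \<longleftrightarrow> A = 0\<^sub>m ?r ?r" if "A \<in> Alt ?r" for A :: "'f mat"
    proof -
      have "vec_space.rank ?r A div 2 = 0 \<longleftrightarrow> vec_space.rank ?r A = 0"
        using even_rank_Alt[OF that] by (auto elim!: evenE)
      then show ?thesis unfolding rank_eq_0_iff[OF Ac[OF that]] .
    qed
    show "vec_space.rank ?r (A - B) div 2 = vec_space.rank ?r (B - A) div 2" if "A \<in> Alt ?r" "B \<in> Alt ?r" for A B :: "'f mat"
      using rank_uminus_diff[OF Ac[OF that(1)] Ac[OF that(2)]] by simp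
    show "bij_betw (\<lambda>(C, vw, d). alt_blk e n C vw d)
       (Alt ?r \<times> (carrier_vec ?r \<times> carrier_vec ?r) \<times> (UNIV :: 'f set)) (Alt (2 * Suc n + e))"
      unfolding bij_betw_def N
    proof
      show "inj_on (\<lambda>(C, vw, d). alt_blk e n C vw d) (Alt ?r \<times> (carrier_vec ?r \<times> carrier_vec ?r) \<times> (UNIV :: 'f set))"
      proof (rule inj_onI)
        fix x y
        assume "x \<in> Alt ?r \<times> (carrier_vec ?r \<times> carrier_vec ?r) \<times> (UNIV :: 'f set)"
          "y \<in> Alt ?r \<times> (carrier_vec ?r \<times> carrier_vec ?r) \<times> (UNIV :: 'f set)"
          and eq: "(case x of (C, vw, d) \<Rightarrow> alt_blk e n C vw d) = (case y of (C, vw, d) \<Rightarrow> alt_blk e n C vw d)"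
        then obtain C C' v v' w w' d d' where xy: "x = (C, (v, w), d)" "y = (C', (v', w'), d')"
          and c: "C \<in> Alt ?r" "C' \<in> Alt ?r" "v \<in> carrier_vec ?r" "v' \<in> carrier_vec ?r"
          "w \<in> carrier_vec ?r" "w' \<in> carrier_vec ?r" by auto
        have "alt_blk e n C (v, w) d = alt_blk e n C' (v', w') d'" using eq unfolding xy by simp
        note D = four_block_eqD[OF this[unfolded alt_blk_def] Ac[OF c(1)] cols2_carrier _ skew2_carrier Ac[OF c(2)] cols2_carrier _ skew2_carrier]
        have "C = C'" "cols2 ?r (v, w) = cols2 ?r (v', w')" "skew2 d = skew2 d'" by (rule D; simp)+
        then show "x = y" unfolding xy
          using cols2_inj[OF c(3-6)] skew2_entry(1)[of d] skew2_entry(1)[of d'] by simp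
      qed
      show "(\<lambda>(C, vw, d). alt_blk e n C vw d) ` (Alt ?r \<times> (carrier_vec ?r \<times> carrier_vec ?r) \<times> (UNIV :: 'f set)) = Alt (?r + 2)"
      proof (intro subset_antisym subsetI)
        fix M :: "'f mat" assume M: "M \<in> Alt (?r + 2)"
        obtain M1 M2 M3 M4 where b: "M1 \<in> carrier_mat ?r ?r" "M2 \<in> carrier_mat ?r 2" "M3 \<in> carrier_mat 2 ?r" "M4 \<in> carrier_mat 2 2"
          and Meq: "M = four_block_mat M1 M2 M3 M4" by (rule split_last_block[OF Alt_carrier[OF M]])
        have m: "M1 \<in> Alt ?r" "M3 = - M2\<^sup>T" "M4 \<in> Alt 2" using M four_block_Alt[OF b] unfolding Meq by auto
        define vw where "vw = (vec ?r (\<lambda>i. M2 $$ (i, 0)), vec ?r (\<lambda>i. M2 $$ (i, 1)))"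
        have "cols2 ?r vw = M2" "skew2 (M4 $$ (0, 1)) = M4"
          using cols2_surj[OF b(2)] Alt_2[OF m(3)] unfolding vw_def by auto
        then have "M = alt_blk e n M1 vw (M4 $$ (0, 1))" unfolding Meq alt_blk_def m(2) by simp
        then show "M \<in> (\<lambda>(C, vw, d). alt_blk e n C vw d) ` (Alt ?r \<times> (carrier_vec ?r \<times> carrier_vec ?r) \<times> UNIV)"
          using m(1) by (intro image_eqI[of _ _ "(M1, vw, M4 $$ (0, 1))"]) (auto simp: vw_def)
      qed (use alt_blk_Alt in auto)
    qed
    show "vec_space.rank (2 * Suc n + e) (alt_blk e n (C + alt_corr e n vw d) vw d) div 2 = Suc (vec_space.rank ?r C div 2)"
      if "C \<in> Alt ?r" "d \<noteq> 0" for C vw and d :: 'f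
    proof -
      have "- (cols2 ?r vw)\<^sup>T \<in> carrier_mat 2 ?r" by simp
      from rank_schur[OF Ac[OF that(1)] cols2_carrier this skew2_carrier skew2_carrier skew2_inverse[OF that(2)]]
      show ?thesis unfolding alt_blk_def alt_corr_def N by simp
    qed
    show "vec_space.rank (2 * Suc n + e) (alt_blk e n C (0\<^sub>v ?r, 0\<^sub>v ?r) 0) div 2 = vec_space.rank ?r C div 2"
      if "C \<in> Alt ?r" for C :: "'f mat"
    proof -
      have "skew2 (0 :: 'f) = 0\<^sub>m 2 2" by (rule eq_matI) (auto simp: skew2_def)
      then show ?thesis using rank_direct_sum[OF Ac[OF that] zero_carrier_mat[of 2 2]] unfolding zero_blk N
        by (simp add: vec_space.rank_0I)
    qed
    show "\<chi> (altp (alt_blk e n A (0\<^sub>v ?r, 0\<^sub>v ?r) a) (alt_blk e n C vw d)) = \<chi> (altp A C) * \<chi> (a * d)"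
      if "A \<in> Alt ?r" "C \<in> Alt ?r" for A C :: "'f mat" and vw a d
    proof -
      have "altp (alt_blk e n A (0\<^sub>v ?r, 0\<^sub>v ?r) a) (alt_blk e n C vw d) =
          pair (four_block_mat A (0\<^sub>m ?r 2) (0\<^sub>m 2 ?r) (skew2 a))
            (four_block_mat (up C) (cols2 ?r vw) (0\<^sub>m 2 ?r) (up (skew2 d)))"
        unfolding zero_blk altp_def unfolding alt_blk_def
        by (subst up_four_block[OF Ac[OF that(2)] cols2_carrier _ skew2_carrier]) simp_all
      also have "\<dots> = altp A C + a * d"
        by (subst pair_four_block[of _ ?r ?r _ 2 _ 2]) (use Ac that in \<open>auto simp: pair_zero altp_skew2 simp flip: altp_def\<close>)
      finally show ?thesis using \<chi> by (simp add: additive_character_def)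
    qed
    show "\<exists>A'\<in>Alt ?r. \<exists>a\<in>UNIV - {0}. Suc (vec_space.rank ?r A' div 2) = vec_space.rank (2 * Suc n + e) A div 2 \<and>
        (\<forall>k. (\<Sum>B\<in>{B \<in> Alt (2 * Suc n + e). vec_space.rank (2 * Suc n + e) B div 2 = k}. \<chi> (altp A B)) =
          (\<Sum>B\<in>{B \<in> Alt (2 * Suc n + e). vec_space.rank (2 * Suc n + e) B div 2 = k}.
             \<chi> (altp (alt_blk e n A' (0\<^sub>v ?r, 0\<^sub>v ?r) a) B)))"
      if A: "A \<in> Alt (2 * Suc n + e)" "A \<noteq> 0\<^sub>m (2 * Suc n + e) (2 * Suc n + e)" for A :: "'f mat"
    proof -
      obtain C a where C: "C \<in> Alt ?r" "a \<noteq> 0" "vec_space.rank (?r + 2) A = vec_space.rank ?r C + 2"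
        and S: "\<forall>k. (\<Sum>B\<in>{B \<in> Alt (?r + 2). vec_space.rank (?r + 2) B div 2 = k}. \<chi> (altp A B)) =
          (\<Sum>B\<in>{B \<in> Alt (?r + 2). vec_space.rank (?r + 2) B div 2 = k}.
            \<chi> (altp (four_block_mat C (0\<^sub>m ?r 2) (0\<^sub>m 2 ?r) (skew2 a)) B))"
        using alt_reduction[OF A[unfolded N], of \<chi>] by blast
      have "Suc (vec_space.rank ?r C div 2) = vec_space.rank (?r + 2) A div 2" using C(3) by simp
      then show ?thesis unfolding zero_blk N using C(1,2) S by blast
    qed
    show "of_nat (card (UNIV :: 'f set)) * (\<Sum>vw\<in>carrier_vec ?r \<times> carrier_vec ?r. \<chi> (altp A (alt_corr e n vw d))) =
        complex_of_real (c * (?q ^ 2) ^ (2 * n + 1 - vec_space.rank ?r A div 2))"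
      if A: "A \<in> Alt ?r" and d: "d \<noteq> 0" for A and d :: 'f
    proof -
      have "(\<Sum>vw\<in>carrier_vec ?r \<times> carrier_vec ?r. \<chi> (altp A (alt_corr e n vw d))) =
          (\<Sum>(v, w)\<in>carrier_vec ?r \<times> carrier_vec ?r. \<chi> ((1 / d) * (v \<bullet> (A *\<^sub>v w))))"
      proof (rule sum.cong[OF refl])
        fix vw :: "'f vec \<times> 'f vec" assume "vw \<in> carrier_vec ?r \<times> carrier_vec ?r"
        then obtain v w where vw: "vw = (v, w)" "v \<in> carrier_vec ?r" "w \<in> carrier_vec ?r" by auto
        show "\<chi> (altp A (alt_corr e n vw d)) = (case vw of (v, w) \<Rightarrow> \<chi> ((1 / d) * (v \<bullet> (A *\<^sub>v w))))"
          unfolding vw(1) prod.case altp_alt_corr[OF A vw(2,3)] ..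
      qed
      also have "\<dots> = of_nat (CARD('f) ^ (?r + ?r - vec_space.rank ?r A))"
        by (rule bilinear_gauss_sum[OF \<chi> _ Ac[OF A]]) (use d in simp)
      finally have S: "of_nat CARD('f) * (\<Sum>vw\<in>carrier_vec ?r \<times> carrier_vec ?r. \<chi> (altp A (alt_corr e n vw d))) =
          complex_of_real (?q ^ Suc (?r + ?r - vec_space.rank ?r A))" by simp
      obtain k where k: "vec_space.rank ?r A = 2 * k" using even_rank_Alt[OF A] by (elim evenE)
      have le: "2 * k \<le> ?r" using vec_space.rank_le_nc[OF Ac[OF A]] k by simp
      have "?q ^ Suc (?r + ?r - 2 * k) * ?q = ?q ^ (2 * (2 * n + 1 - k) + 2 * e)"
      proof -
        have "Suc (?r + ?r - 2 * k) + 1 = 2 * (2 * n + 1 - k) + 2 * e" using le e by simp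
        then show ?thesis by (metis power_add power_one_right)
      qed
      also have "\<dots> = c * (?q ^ 2) ^ (2 * n + 1 - k) * ?q" by (rule cq[symmetric])
      finally have "?q ^ Suc (?r + ?r - 2 * k) = c * (?q ^ 2) ^ (2 * n + 1 - k)" using q by simp
      then show ?thesis unfolding S k by simp
    qed
    show "real (card (carrier_vec ?r \<times> carrier_vec ?r :: ('f vec \<times> 'f vec) set)) * real (card (UNIV :: 'f set)) *
        (c * (?q ^ 2) ^ n) ^ n = (c * (?q ^ 2) ^ Suc n) ^ Suc n"
    proof -
      have p: "(c * (?q ^ 2) ^ m) ^ k * ?q ^ k = ?q ^ ((2 * m + 2 * e) * k)" for m k
        by (simp only: power_mult_distrib[symmetric] cq power_mult)
      have "?r + ?r + 1 + (2 * n + 2 * e) * n + 1 = (2 * Suc n + 2 * e) * Suc n" by simp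
      then have "?q ^ (?r + ?r + 1 + (2 * n + 2 * e) * n + 1) = ?q ^ ((2 * Suc n + 2 * e) * Suc n)" by (simp only:)
      then have "?q ^ ?r * ?q ^ ?r * ?q * ?q ^ ((2 * n + 2 * e) * n) * ?q = ?q ^ ((2 * Suc n + 2 * e) * Suc n)"
        by (simp only: power_add power_one_right)
      then have "(?q ^ ?r * ?q ^ ?r * ?q * (c * (?q ^ 2) ^ n) ^ n) * ?q ^ Suc n = (c * (?q ^ 2) ^ Suc n) ^ Suc n * ?q ^ Suc n"
        unfolding p[symmetric] by (simp only: power_Suc mult_ac)
      moreover have "?q ^ Suc n \<noteq> 0" using q by simp
      ultimately have "?q ^ ?r * ?q ^ ?r * ?q * (c * (?q ^ 2) ^ n) ^ n = (c * (?q ^ 2) ^ Suc n) ^ Suc n"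
        by (rule mult_right_cancel[THEN iffD1, rotated])
      then show ?thesis by (simp only: card_cartesian_product card_carrier_vec of_nat_mult of_nat_power)
    qed
    show "c * (?q ^ 2) ^ n \<noteq> (?q ^ 2) ^ s" if "s < n" for s
    proof
      assume "c * (?q ^ 2) ^ n = (?q ^ 2) ^ s"
      \<comment> \<open>After multiplication by \<open>q\<close> the two sides have exponents
        \<open>2 * n + 2 * e\<close> and \<open>2 * s + 1\<close>, and the second is
        smaller.\<close>
      then have "?q ^ (2 * n + 2 * e) = (?q ^ 2) ^ s * ?q" using cq[of n] by simp
      also have "\<dots> = ?q ^ (2 * s + 1)" by (simp flip: power_mult)
      also have "\<dots> < ?q ^ (2 * n + 2 * e)" using q that by (intro power_strict_increasing) auto
      finally show False by simp
    qed
    show "(\<Sum>d\<in>UNIV. \<chi> (a * d)) = 0" if "a \<noteq> 0" for a :: 'f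
      by (rule sum_additive_character_UNIV[OF \<chi> that])
    show "\<exists>d\<in>UNIV. d \<noteq> (0 :: 'f)" by (intro bexI[of _ 1]) auto
  next
    show "Alt (2 * 0 + e) = {0\<^sub>m (2 * 0 + e) (2 * 0 + e) :: 'f mat}"
    proof -
      have "2 * 0 + e < 2" using e by simp
      then show ?thesis using Alt_small Alt_zero by blast
    qed
  qed (use \<chi> q c0 alt_corr_Alt in \<open>auto simp: additive_character_def finite_carrier_vec\<close>)
qed

section \<open>The three schemes as instances of the families of forms\<close>

lemma bil_scheme:
  assumes "1 \<le> n" "n \<le> m"
  shows "association_scheme (Bil n m :: 'f::{field,finite} mat set) (Bil_rel n m) n"
    and "1 \<le> d \<Longrightarrow> d \<le> n \<Longrightarrow>
      LP_equals (Bil n m :: 'f mat set) (Bil_rel n m) n d (lp_val (real CARD('f)) (real CARD('f) ^ (m - n)) n d)"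
proof -
  obtain \<chi> :: "'f \<Rightarrow> complex" where \<chi>: "additive_character \<chi>" using additive_character_exists by blast
  define e where "e = m - n"
  have m: "m = n + e" using assms by (simp add: e_def)
  interpret F: form_family "real CARD('f)" "real CARD('f) ^ e" "\<lambda>n. carrier_mat (n + e) n" "\<lambda>n. 0\<^sub>m (n + e) n"
    "\<lambda>n A B. \<chi> (pair A B)" "\<lambda>n. vec_space.rank (n + e)" "\<lambda>n. carrier_vec (n + e) \<times> carrier_vec n"
    "\<lambda>n. (0\<^sub>v (n + e), 0\<^sub>v n)" UNIV 0 "bil_blk e" "bil_corr e" "\<lambda>a d. \<chi> (a * d)"
    by (rule bil_form_family[OF \<chi>])
  have q: "2 \<le> real CARD('f)" using card_field_gt_1[where 'f = 'f] by simp
  have X: "carrier_mat (n + e) n = (Bil n m :: 'f mat set)" by (simp add: Bil_def m)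
  have R: "F.RS.Rel n = Bil_rel n m" by (intro ext) (auto simp: F.RS.Rel_def Bil_rel_def Bil_def m)
  show "association_scheme (Bil n m :: 'f mat set) (Bil_rel n m) n"
    using F.RS.association_scheme[of n] unfolding R unfolding X .
  assume d: "1 \<le> d" "d \<le> n"
  have "code_lp (real CARD('f)) (real CARD('f) ^ e) n (eig (real CARD('f)) (real CARD('f) ^ e) n)"
    by (rule F.code_lp_eig[OF assms(1)]) (use q in simp)
  moreover have "1 \<le> (real CARD('f) - 1) * real CARD('f) ^ e"
    using q mult_mono[of 1 "real CARD('f) - 1" 1 "real CARD('f) ^ e"] by simp
  ultimately have "lp_optimum n (eig (real CARD('f)) (real CARD('f) ^ e) n) d (lp_val (real CARD('f)) (real CARD('f) ^ e) n d)"
    by (intro lp_optimum_pos_base d) (use q in auto)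
  from F.LP_equals_Rel[OF this]
  show "LP_equals (Bil n m :: 'f mat set) (Bil_rel n m) n d (lp_val (real CARD('f)) (real CARD('f) ^ (m - n)) n d)"
    unfolding R unfolding X unfolding e_def .
qed

lemma her_scheme:
  assumes q: "q ^ 2 = CARD('f::{field,finite})" and n: "1 \<le> n"
  shows "association_scheme (Her q n :: 'f mat set) (Her_rel q n) n"
    and "1 \<le> d \<Longrightarrow> d \<le> n \<Longrightarrow> odd d \<Longrightarrow> LP_equals (Her q n :: 'f mat set) (Her_rel q n) n d (lp_val (- real q) (- 1) n d)"
    and "2 \<le> d \<Longrightarrow> d \<le> n \<Longrightarrow> even d \<Longrightarrow> LP_equals (Her q n :: 'f mat set) (Her_rel q n) n d (lp_val_even (- real q) (- 1) n d)"
proof -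
  interpret quadratic_field q "TYPE('f)" by unfold_locales (rule q)
  obtain \<chi> :: "'f \<Rightarrow> complex" where \<chi>: "additive_character \<chi>" using additive_character_exists by blast
  interpret F: form_family "- real q" "- 1" H "\<lambda>n. 0\<^sub>m n n" "\<lambda>n A B. \<chi> (pair A B)" vec_space.rank carrier_vec
    "\<lambda>n. 0\<^sub>v n" K 0 her_blk her_corr "\<lambda>a d. \<chi> (a * d)"
    by (rule her_form_family[OF \<chi>])
  have q2: "2 \<le> real q" using q_ge_2 by simp
  have X: "H n = Her q n" by (simp add: H_def Her_def ct_def conj_transpose_def)
  have R: "F.RS.Rel n = Her_rel q n" by (intro ext) (unfold F.RS.Rel_def, simp add: Her_rel_def X)
  show "association_scheme (Her q n :: 'f mat set) (Her_rel q n) n"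
    using F.RS.association_scheme[of n] unfolding R unfolding X .
  have lp: "code_lp (- real q) (- 1) n (eig (- real q) (- 1) n)"
    by (rule F.code_lp_eig[OF n]) (use q2 in simp)
  show "LP_equals (Her q n :: 'f mat set) (Her_rel q n) n d (lp_val (- real q) (- 1) n d)" if "1 \<le> d" "d \<le> n" "odd d"
    using F.LP_equals_Rel[OF lp_optimum_hermitian_odd[OF q2 lp that]] unfolding R unfolding X .
  show "LP_equals (Her q n :: 'f mat set) (Her_rel q n) n d (lp_val_even (- real q) (- 1) n d)" if "2 \<le> d" "d \<le> n" "even d"
    using F.LP_equals_Rel[OF lp_optimum_hermitian_even[OF q2 lp that]] unfolding R unfolding X .
qed

lemma alt_scheme:
  assumes m: "2 \<le> m"
  shows "association_scheme (Alt m :: 'f::{field,finite} mat set) (Alt_rel m) (m div 2)"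
    and "1 \<le> d \<Longrightarrow> d \<le> m div 2 \<Longrightarrow> LP_equals (Alt m :: 'f mat set) (Alt_rel m) (m div 2) d
      (lp_val (real CARD('f) ^ 2) (if even m then 1 / real CARD('f) else real CARD('f)) (m div 2) d)"
proof -
  obtain \<chi> :: "'f \<Rightarrow> complex" where \<chi>: "additive_character \<chi>" using additive_character_exists by blast
  define n e where "n = m div 2" and "e = m mod 2"
  define q c where "q = real CARD('f)" and "c = (if even m then 1 / real CARD('f) else real CARD('f))"
  have me: "2 * n + e = m" by (simp add: n_def e_def)
  have e: "e \<le> 1" by (simp add: e_def)
  have q2: "2 \<le> q" using card_field_gt_1[where 'f = 'f] by (simp add: q_def)
  have cq: "c * q = q ^ (2 * e)"
    using q2 by (cases "even m") (auto simp: c_def e_def q_def odd_iff_mod_2_eq_one power2_eq_square)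
  interpret F: form_family "q ^ 2" c "\<lambda>n. Alt (2 * n + e)" "\<lambda>n. 0\<^sub>m (2 * n + e) (2 * n + e)"
    "\<lambda>n A B. \<chi> (altp A B)" "\<lambda>n A. vec_space.rank (2 * n + e) A div 2"
    "\<lambda>n. carrier_vec (2 * n + e) \<times> carrier_vec (2 * n + e)"
    "\<lambda>n. (0\<^sub>v (2 * n + e), 0\<^sub>v (2 * n + e))" UNIV 0 "alt_blk e" "alt_corr e" "\<lambda>a d. \<chi> (a * d)"
    unfolding q_def by (rule alt_form_family[OF \<chi> e]) (use cq in \<open>simp add: q_def\<close>)
  have X: "Alt (2 * n + e) = (Alt m :: 'f mat set)" unfolding me ..
  have R: "F.RS.Rel n = Alt_rel m"
  proof
    fix i
    \<comment> \<open>Halving the rank loses nothing, because alternating matrices have even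
      rank.\<close>
    have "vec_space.rank m (A - B) div 2 = i \<longleftrightarrow> vec_space.rank m (A - B) = 2 * i" if "A \<in> Alt m" "B \<in> Alt m" for A B :: "'f mat"
      using even_rank_Alt[OF Alt_minus[OF that]] by (auto elim!: evenE)
    then show "F.RS.Rel n i = Alt_rel m i" unfolding F.RS.Rel_def unfolding Alt_rel_def me by blast
  qed
  show "association_scheme (Alt m :: 'f mat set) (Alt_rel m) (m div 2)"
    using F.RS.association_scheme[of n] unfolding R unfolding X unfolding n_def .
  have n: "1 \<le> n" using m by (simp add: n_def)
  have "code_lp (q ^ 2) c n (eig (q ^ 2) c n)"
    by (rule F.code_lp_eig[OF n]) (use q2 cq in auto)
  \<comment> \<open>The critical case is \<open>c = 1 / q\<close>, where the claim amounts to
    \<open>q \<le> q ^ 2 - 1\<close>.\<close>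
  moreover have "1 \<le> (q ^ 2 - 1) * c"
  proof -
    have "2 * q \<le> q * q" using q2 by (intro mult_right_mono) auto
    then have "q \<le> q * q - 1" using q2 by linarith
    moreover have "1 \<le> q * c" using cq q2 one_le_power[of q "2 * e"] by (simp add: mult.commute)
    moreover have "0 \<le> c" by (simp add: c_def)
    ultimately show ?thesis using mult_right_mono[of q "q * q - 1" c] by (simp add: power2_eq_square)
  qed
  moreover have "1 < q ^ 2" using q2 by (intro one_less_power) auto
  ultimately have lp: "lp_optimum n (eig (q ^ 2) c n) d (lp_val (q ^ 2) c n d)" if "1 \<le> d" "d \<le> n"
    using lp_optimum_pos_base that by blast
  assume "1 \<le> d" "d \<le> m div 2"
  then show "LP_equals (Alt m :: 'f mat set) (Alt_rel m) (m div 2) d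
      (lp_val (real CARD('f) ^ 2) (if even m then 1 / real CARD('f) else real CARD('f)) (m div 2) d)"
    using F.LP_equals_Rel[OF lp] unfolding R unfolding X unfolding n_def q_def c_def by blast
qed

theorem theorem3p1:
  shows
   "(\<forall>q n m b c.
       q = CARD('f::{field,finite}) \<and> 1 \<le> n \<and> n \<le> m \<and> b = real q \<and> c = real q ^ (m - n) \<longrightarrow>
       association_scheme (Bil n m :: 'f mat set) (Bil_rel n m) n \<and>
       (\<forall>d. 1 \<le> d \<and> d \<le> n \<longrightarrow>
          LP_equals (Bil n m :: 'f mat set) (Bil_rel n m) n d (lp_val b c n d) \<and>
          (\<forall>(Y :: 'y set) S.
             association_scheme Y S n \<and>
             same_PQ_numbers (Bil n m :: 'f mat set) (Bil_rel n m) Y S n \<longrightarrow>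
             LP_equals Y S n d (lp_val b c n d)))) \<and>
    (\<forall>q n b c.
       q ^ 2 = CARD('h::{field,finite}) \<and> 1 \<le> n \<and> b = - real q \<and> c = - 1 \<longrightarrow>
       association_scheme (Her q n :: 'h mat set) (Her_rel q n) n \<and>
       (\<forall>d. 1 \<le> d \<and> d \<le> n \<and> odd d \<longrightarrow>
          LP_equals (Her q n :: 'h mat set) (Her_rel q n) n d (lp_val b c n d) \<and>
          (\<forall>(Y :: 'y set) S.
             association_scheme Y S n \<and>
             same_PQ_numbers (Her q n :: 'h mat set) (Her_rel q n) Y S n \<longrightarrow>
             LP_equals Y S n d (lp_val b c n d))) \<and>
       (\<forall>d. 2 \<le> d \<and> d \<le> n \<and> even d \<longrightarrow>
          LP_equals (Her q n :: 'h mat set) (Her_rel q n) n d (lp_val_even b c n d) \<and>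
          (\<forall>(Y :: 'y set) S.
             association_scheme Y S n \<and>
             same_PQ_numbers (Her q n :: 'h mat set) (Her_rel q n) Y S n \<longrightarrow>
             LP_equals Y S n d (lp_val_even b c n d)))) \<and>
    (\<forall>q m n b c.
       q = CARD('f) \<and> 2 \<le> m \<and> n = m div 2 \<and>
       b = real q ^ 2 \<and> c = (if even m then 1 / real q else real q) \<longrightarrow>
       association_scheme (Alt m :: 'f mat set) (Alt_rel m) n \<and>
       (\<forall>d. 1 \<le> d \<and> d \<le> n \<longrightarrow>
          LP_equals (Alt m :: 'f mat set) (Alt_rel m) n d (lp_val b c n d) \<and>
          (\<forall>(Y :: 'y set) S.
             association_scheme Y S n \<and>
             same_PQ_numbers (Alt m :: 'f mat set) (Alt_rel m) Y S n \<longrightarrow>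
             LP_equals Y S n d (lp_val b c n d))))"
  by (intro conjI allI impI; (elim conjE)?; hypsubst?;
      (rule bil_scheme her_scheme alt_scheme | rule LP_equals_same_PQ[OF bil_scheme(1) _ _ bil_scheme(2)]
        LP_equals_same_PQ[OF her_scheme(1) _ _ her_scheme(2)] LP_equals_same_PQ[OF her_scheme(1) _ _ her_scheme(3)]
        LP_equals_same_PQ[OF alt_scheme(1) _ _ alt_scheme(2)]); assumption)

end
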